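(* Let $y\in|\mathbb{P}^1|$ be of degree $d$ and let $\lambda\in\mathbb{C}^{\times}$. The map $$\mathcal{A}^{K}(\Phi_y,\lambda)\longrightarrow\bigoplus_{\mathfrak{N}_d}\mathbb{C},\qquad f\longmapsto (f(g))_{g\in\mathfrak{N}_d}$$ is an isomorphism of $\mathbb{C}$-vector spaces, where $\mathfrak{N}_d=\{c_0,c_x,c_{2x},\dots,c_{(d-1)x}\}$. In particular, $\dim\mathcal{A}^{K}(\Phi_y,\lambda)=d$.
   Context: Let $q$ be a prime power and $F=\mathbb{F}_q(t)$ the function field of $\mathbb{P}^1$ over $\mathbb{F}_q$; $|\mathbb{P}^1|$ is the set of closed points (equivalently, places of $F$). For $y\in|\mathbb{P}^1|$: $F_y$ is the completion of $F$ at $y$, $\mathcal{O}_y$ its ring of integers, $\pi_y\in F$ a uniformizer, $\kappa(y)=\mathcal{O}_y/(\pi_y)$, the degree of $y$ is $|y|=[\kappa(y):\mathbb{F}_q]$, and $|\cdot|_y$ is the absolute value with $|\pi_y|_y=q^{-|y|}$. $\mathbb{A}$ is the adele ring of $F$, $\mathcal{O}_{\mathbb{A}}=\prod_y\mathcal{O}_y$, $G=\mathrm{GL}_2$, $Z$ is the center of $G(\mathbb{A})$, $K=\mathrm{GL}_2(\mathcal{O}_{\mathbb{A}})$. A matrix in $\mathrm{GL}_2(F_y)$ is viewed in $G(\mathbb{A})$ by putting the identity at all other places. $G(\mathbb{A})$ carries the Haar measure with $\mathrm{vol}(K)=1$. Fix the place $x$ of degree one with uniformizer $\pi_x=t$.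 For an integer $n\ge 0$ let $p_{nx}=\begin{pmatrix}\pi_x^{-n}&0\\0&1\end{pmatrix}\in\mathrm{GL}_2(F_x)$ and let $c_{nx}$ be its class in $G(F)\backslash G(\mathbb{A})/ZK$, with $c_0=c_{0x}$; the classes $c_{nx}$, $n\ge0$, are exactly the distinct elements of $G(F)\backslash G(\mathbb{A})/ZK$. $\Phi_y$ is the characteristic function of $K\begin{pmatrix}\pi_y&0\\0&1\end{pmatrix}K$; it acts on functions by $\Phi_y(f)(g)=\int_{G(\mathbb{A})}\Phi_y(h)f(gh)\,dh$. $\mathcal{A}^{K}$ is the complex vector space of functions $f:G(\mathbb{A})\to\mathbb{C}$ that are left $G(F)$-invariant, $Z$-invariant, right $K$-invariant (so functions on $G(F)\backslash G(\mathbb{A})/ZK$), and of moderate growth, i.e. there are constants $C,N$ with $|f(g)|\le C|g|^N$ for all $g\in G(\mathbb{A})$. Here $|g|=\prod_y |g_y|_y$, with $|g_y|_y$ the maximum of the $y$-adic absolute values of the entries of $g_y$ and of $\det(g_y)^{-1}$. $\mathcal{A}^{K}(\Phi_y,\lambda)=\{f\in\mathcal{A}^{K}\mid\Phi_y(f)=\lambda f\}$. *)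

theory Defs
  imports
    "HOL-Analysis.Analysis"
    "HOL-Algebra.Algebra"
    "HOL-Algebra.Embedded_Algebras"
    "HOL-Algebra.Algebraic_Closure_Type"
    "HOL-Library.Function_Algebras"
    "HOL-Library.Groups_Big_Fun"
begin

section \<open>The rational function field and its places\<close>

text \<open>The constant field $\mathbb{F}_q$ is a type \<open>'k\<close> of class \<open>{field, finite}\<close>, so that
  $q$ is \<open>CARD('k)\<close> and $F = \mathbb{F}_q(t)$ is the type \<open>'k ratfun\<close>.\<close>

type_synonym 'k ratfun = "'k poly fract"

definition const_rf :: "'k::field \<Rightarrow> 'k ratfun" where
  "const_rf c = Fraction_Field.Fract [:c:] 1"

definition t_rf :: "'k::field ratfun" where
  "t_rf = Fraction_Field.Fract [:0, 1:] 1"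

abbreviation F_ring :: "'k::field ratfun ring" where
  "F_ring \<equiv> ring_of_type_algebra"

text \<open>A place is identified with its valuation ring in $F$, i.e. with the local ring of
  $\mathbb{P}^1$ at the corresponding closed point.\<close>

definition valuation_ring :: "'k::field ratfun set \<Rightarrow> bool" where
  "valuation_ring V \<longleftrightarrow>
     subring V F_ring \<and> range const_rf \<subseteq> V \<and> V \<noteq> UNIV \<and> (\<forall>z. z \<in> V \<or> inverse z \<in> V)"

lemma valuation_ring_at_0:
  "valuation_ring {Fraction_Field.Fract a b | a b :: 'k::field poly. poly b 0 \<noteq> 0}"
  (is "valuation_ring ?V")
proof -
  define V where "V = ?V"
  have mem: "Fraction_Field.Fract a b \<in> V" if "poly b 0 \<noteq> 0" for a b :: "'k poly"
    unfolding V_def using that by blast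
  have memE: "\<exists>a b :: 'k poly. h = Fraction_Field.Fract a b \<and> poly b 0 \<noteq> 0" if "h \<in> V" for h
    using that unfolding V_def by blast
  have nz: "b \<noteq> 0" if "poly b 0 \<noteq> 0" for b :: "'k poly"
    using that by auto
  have minus: "a_inv F_ring z = - z" for z :: "'k ratfun"
  proof -
    interpret Rf: ring "F_ring :: 'k ratfun ring"
      by (rule ring_from_type_algebra)
    have "z \<oplus>\<^bsub>F_ring\<^esub> (- z) = \<zero>\<^bsub>F_ring\<^esub>"
      by (simp add: ring_of_type_algebra_def)
    then show ?thesis
      by (metis Rf.add.inv_equality Rf.add.m_comm UNIV_I ring_of_type_algebra_def
          partial_object.select_convs(1))
  qed
  have "subring V F_ring"
  proof (rule ring.subringI[OF ring_from_type_algebra])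
    show "V \<subseteq> carrier F_ring"
      by (simp add: ring_of_type_algebra_def)
    show "\<one>\<^bsub>F_ring\<^esub> \<in> V"
      using mem[of 1 1] by (simp add: ring_of_type_algebra_def One_fract_def)
    show "\<ominus>\<^bsub>F_ring\<^esub> h \<in> V" if h: "h \<in> V" for h
    proof -
      obtain a b :: "'k poly" where "h = Fraction_Field.Fract a b" "poly b 0 \<noteq> 0"
        using h memE by blast
      then show ?thesis
        using mem[of b "- a"] by (simp add: minus)
    qed
    show "h1 \<otimes>\<^bsub>F_ring\<^esub> h2 \<in> V" if h: "h1 \<in> V" "h2 \<in> V" for h1 h2
    proof -
      obtain a b c d :: "'k poly" where *: "h1 = Fraction_Field.Fract a b" "poly b 0 \<noteq> 0"
        "h2 = Fraction_Field.Fract c d" "poly d 0 \<noteq> 0"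
        using h memE by blast
      then have "h1 * h2 = Fraction_Field.Fract (a * c) (b * d)"
        by simp
      moreover have "poly (b * d) 0 \<noteq> 0"
        using * by simp
      ultimately show ?thesis
        using mem by (simp add: ring_of_type_algebra_def)
    qed
    show "h1 \<oplus>\<^bsub>F_ring\<^esub> h2 \<in> V" if h: "h1 \<in> V" "h2 \<in> V" for h1 h2
    proof -
      obtain a b c d :: "'k poly" where *: "h1 = Fraction_Field.Fract a b" "poly b 0 \<noteq> 0"
        "h2 = Fraction_Field.Fract c d" "poly d 0 \<noteq> 0"
        using h memE by blast
      then have "h1 + h2 = Fraction_Field.Fract (a * d + c * b) (b * d)"
        by (simp add: nz)
      moreover have "poly (b * d) 0 \<noteq> 0"
        using * by simp
      ultimately show ?thesis
        using mem by (simp add: ring_of_type_algebra_def)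
    qed
  qed
  moreover have "range const_rf \<subseteq> V"
    by (auto simp: const_rf_def intro!: mem)
  moreover have "Fraction_Field.Fract 1 [:0, 1 :: 'k:] \<notin> V"
  proof
    assume "Fraction_Field.Fract 1 [:0, 1 :: 'k:] \<in> V"
    then obtain a b :: "'k poly" where
      ab: "Fraction_Field.Fract 1 [:0, 1:] = Fraction_Field.Fract a b" "poly b 0 \<noteq> 0"
      using memE by blast
    then have "1 * b = a * [:0, 1:]"
      by (subst (asm) eq_fract) (auto simp: nz)
    then have "poly b 0 = 0"
      by simp
    with ab show False by simp
  qed
  moreover have "z \<in> V \<or> inverse z \<in> V" for z
  proof (cases z)
    case (Fract a b)
    show ?thesis
    proof (cases "a = 0")
      case True
      then show ?thesis
        using Fract mem[of 1 0] by (simp add: fract_collapse)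
    next
      case False
      obtain a' where a': "a = [:0, 1:] ^ Polynomial.order 0 a * a'" "\<not> [:0, 1:] dvd a'"
        using order_decomp[OF False, of 0] unfolding minus_zero by blast
      obtain b' where b': "b = [:0, 1:] ^ Polynomial.order 0 b * b'" "\<not> [:0, 1:] dvd b'"
        using order_decomp[OF Fract(2), of 0] unfolding minus_zero by blast
      have p: "poly a' 0 \<noteq> 0" "poly b' 0 \<noteq> 0"
        using a'(2) b'(2) by (auto simp: poly_eq_0_iff_dvd)
      define m n where "m = Polynomial.order 0 a" and "n = Polynomial.order 0 b"
      have a: "a = [:0, 1:] ^ m * a'" and b: "b = [:0, 1:] ^ n * b'"
        unfolding m_def n_def by (fact a'(1), fact b'(1))
      show ?thesis
      proof (cases "n \<le> m")
        case True
        then have "[:0, 1 :: 'k:] ^ m = [:0, 1:] ^ n * [:0, 1:] ^ (m - n)"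
          by (simp flip: power_add)
        then have "a = [:0, 1:] ^ n * ([:0, 1:] ^ (m - n) * a')"
          using a by (simp only: mult.assoc)
        then have "z = Fraction_Field.Fract ([:0, 1:] ^ (m - n) * a') b'"
          using Fract(1) b by (metis mult_fract_cancel power_not_zero pCons_eq_0_iff one_neq_zero)
        then show ?thesis
          using mem p by metis
      next
        case False
        then have "[:0, 1 :: 'k:] ^ n = [:0, 1:] ^ m * [:0, 1:] ^ (n - m)"
          by (simp flip: power_add)
        then have "b = [:0, 1:] ^ m * ([:0, 1:] ^ (n - m) * b')"
          using b by (simp only: mult.assoc)
        then have "inverse z = Fraction_Field.Fract ([:0, 1:] ^ (n - m) * b') a'"
          using Fract(1) a
          by (metis inverse_fract mult_fract_cancel power_not_zero pCons_eq_0_iff one_neq_zero)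
        then show ?thesis
          using mem p by metis
      qed
    qed
  qed
  ultimately show ?thesis
    unfolding valuation_ring_def V_def by blast
qed

typedef (overloaded) 'k place = "{V :: 'k::field ratfun set. valuation_ring V}"
  morphisms val_ring Abs_place
  using valuation_ring_at_0 by blast

definition uniformizer :: "'k::field place \<Rightarrow> 'k ratfun \<Rightarrow> bool" where
  "uniformizer y p \<longleftrightarrow>
     {z \<in> val_ring y. z = 0 \<or> inverse z \<notin> val_ring y} = {p * z | z. z \<in> val_ring y}"

text \<open>The normalised valuation of a nonzero element of $F$; its value at 0 is irrelevant.\<close>

definition ord_at :: "'k::field place \<Rightarrow> 'k ratfun \<Rightarrow> int" where
  "ord_at y z = (THE n. \<exists>p u. uniformizer y p \<and> u \<in> val_ring y \<and> inverse u \<in> val_ring y \<and>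
                   u \<noteq> 0 \<and> z = u * p powi n)"

definition near_zero :: "'k::field place \<Rightarrow> int \<Rightarrow> 'k ratfun \<Rightarrow> bool" where
  "near_zero y N z \<longleftrightarrow> z = 0 \<or> ord_at y z \<ge> N"


section \<open>Completions\<close>

text \<open>$F_y$ is the ring of Cauchy sequences in $F$ modulo the ideal of null sequences. The
  $y$-adic uniformity only involves the valuation, so it is available before the degree
  of $y$, which normalises the absolute value.\<close>

definition cauchy_ring :: "'k::field place \<Rightarrow> (nat \<Rightarrow> 'k ratfun) ring" where
  "cauchy_ring y = \<lparr>
     carrier = {s. \<forall>N. \<exists>M. \<forall>m\<ge>M. \<forall>n\<ge>M. near_zero y N (s m - s n)},
     monoid.mult = (\<lambda>s r n. s n * r n),
     one = (\<lambda>n. 1),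
     ring.zero = (\<lambda>n. 0),
     add = (\<lambda>s r n. s n + r n) \<rparr>"

definition null_ideal :: "'k::field place \<Rightarrow> (nat \<Rightarrow> 'k ratfun) set" where
  "null_ideal y = {s. \<forall>N. \<exists>M. \<forall>n\<ge>M. near_zero y N (s n)}"

type_synonym 'k local = "(nat \<Rightarrow> 'k ratfun) set"

definition completion :: "'k::field place \<Rightarrow> 'k local ring" where
  "completion y = cauchy_ring y Quot null_ideal y"

definition emb_local :: "'k::field place \<Rightarrow> 'k ratfun \<Rightarrow> 'k local" where
  "emb_local y z = null_ideal y +>\<^bsub>cauchy_ring y\<^esub> (\<lambda>n. z)"

text \<open>The valuation of a nonzero element of $F_y$: along any representing Cauchy sequence the
  valuation is eventually constant.\<close>

definition ord_local :: "'k::field place \<Rightarrow> 'k local \<Rightarrow> int" where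
  "ord_local y a = (THE n. \<exists>s\<in>a. \<exists>M. \<forall>i\<ge>M. s i \<noteq> 0 \<and> ord_at y (s i) = n)"

definition local_integers :: "'k::field place \<Rightarrow> 'k local ring" where
  "local_integers y = (completion y)
     \<lparr>carrier := {a \<in> carrier (completion y). a = \<zero>\<^bsub>completion y\<^esub> \<or> ord_local y a \<ge> 0}\<rparr>"

text \<open>The ideal $(\pi_y)$ does not depend on the uniformizer chosen.\<close>

definition max_ideal :: "'k::field place \<Rightarrow> 'k local set" where
  "max_ideal y = PIdl\<^bsub>local_integers y\<^esub> (emb_local y (SOME p. uniformizer y p))"

definition residue_field :: "'k::field place \<Rightarrow> 'k local set ring" where
  "residue_field y = local_integers y Quot max_ideal y"

definition residue_constants :: "'k::field place \<Rightarrow> 'k local set set" where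
  "residue_constants y =
     range (\<lambda>c. max_ideal y +>\<^bsub>local_integers y\<^esub> emb_local y (const_rf c))"

definition place_degree :: "'k::field place \<Rightarrow> nat" where
  "place_degree y = (THE n. ring.dimension (residue_field y) n (residue_constants y)
                              (carrier (residue_field y)))"

definition abs_local :: "'k::{field,finite} place \<Rightarrow> 'k local \<Rightarrow> real" where
  "abs_local y a = (if a = \<zero>\<^bsub>completion y\<^esub> then 0
     else (real CARD('k) ^ place_degree y) powi (- ord_local y a))"

definition local_topology :: "'k::{field,finite} place \<Rightarrow> 'k local topology" where
  "local_topology y = Metric_space.mtopology (carrier (completion y))
     (\<lambda>a b. abs_local y (a \<ominus>\<^bsub>completion y\<^esub> b))"


section \<open>Adeles\<close>

type_synonym 'k adele = "'k place \<Rightarrow> 'k local"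

definition adele_ring :: "'k::field adele ring" where
  "adele_ring = \<lparr>
     carrier = {a. (\<forall>y. a y \<in> carrier (completion y)) \<and>
                   finite {y. a y \<notin> carrier (local_integers y)}},
     monoid.mult = (\<lambda>a b y. a y \<otimes>\<^bsub>completion y\<^esub> b y),
     one = (\<lambda>y. \<one>\<^bsub>completion y\<^esub>),
     ring.zero = (\<lambda>y. \<zero>\<^bsub>completion y\<^esub>),
     add = (\<lambda>a b y. a y \<oplus>\<^bsub>completion y\<^esub> b y) \<rparr>"

definition integral_adeles :: "'k::field adele ring" where
  "integral_adeles = adele_ring\<lparr>carrier := {a. \<forall>y. a y \<in> carrier (local_integers y)}\<rparr>"

definition emb_adele :: "'k::field ratfun \<Rightarrow> 'k adele" where
  "emb_adele z = (\<lambda>y. emb_local y z)"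

definition adele_topology :: "'k::{field,finite} adele topology" where
  "adele_topology = topology_generated_by
     {{a \<in> carrier adele_ring. \<forall>y. a y \<in> U y} | U.
        (\<forall>y. openin (local_topology y) (U y)) \<and>
        finite {y. U y \<noteq> carrier (local_integers y)}}"


section \<open>The group GL2\<close>

datatype 'a mat2 = Mat2 (e11: 'a) (e12: 'a) (e21: 'a) (e22: 'a)

definition det2 :: "('a, 'b) ring_scheme \<Rightarrow> 'a mat2 \<Rightarrow> 'a" where
  "det2 R g = (e11 g \<otimes>\<^bsub>R\<^esub> e22 g) \<ominus>\<^bsub>R\<^esub> (e12 g \<otimes>\<^bsub>R\<^esub> e21 g)"

definition GL2 :: "('a, 'b) ring_scheme \<Rightarrow> 'a mat2 monoid" where
  "GL2 R = \<lparr>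
     carrier = {g. set_mat2 g \<subseteq> carrier R \<and> det2 R g \<in> Units R},
     monoid.mult = (\<lambda>g h. Mat2
        ((e11 g \<otimes>\<^bsub>R\<^esub> e11 h) \<oplus>\<^bsub>R\<^esub> (e12 g \<otimes>\<^bsub>R\<^esub> e21 h))
        ((e11 g \<otimes>\<^bsub>R\<^esub> e12 h) \<oplus>\<^bsub>R\<^esub> (e12 g \<otimes>\<^bsub>R\<^esub> e22 h))
        ((e21 g \<otimes>\<^bsub>R\<^esub> e11 h) \<oplus>\<^bsub>R\<^esub> (e22 g \<otimes>\<^bsub>R\<^esub> e21 h))
        ((e21 g \<otimes>\<^bsub>R\<^esub> e12 h) \<oplus>\<^bsub>R\<^esub> (e22 g \<otimes>\<^bsub>R\<^esub> e22 h))),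
     one = Mat2 \<one>\<^bsub>R\<^esub> \<zero>\<^bsub>R\<^esub> \<zero>\<^bsub>R\<^esub> \<one>\<^bsub>R\<^esub> \<rparr>"

text \<open>The topology on the units of the matrix algebra over a topological ring: the one induced
  by $g \mapsto (g, \det(g)^{-1})$.\<close>

definition GL2_topology :: "('a, 'b) ring_scheme \<Rightarrow> 'a topology \<Rightarrow> 'a mat2 topology" where
  "GL2_topology R T = pullback_topology (carrier (GL2 R))
     (\<lambda>g. (e11 g, e12 g, e21 g, e22 g, inv\<^bsub>R\<^esub> (det2 R g)))
     (prod_topology T (prod_topology T (prod_topology T (prod_topology T T))))"

type_synonym 'k GA = "'k adele mat2"

abbreviation G_A :: "'k::field GA monoid" where
  "G_A \<equiv> GL2 adele_ring"

definition G_F :: "'k::field GA set" where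
  "G_F = map_mat2 emb_adele ` carrier (GL2 F_ring)"

definition Z_A :: "'k::field GA set" where
  "Z_A = {z \<in> carrier G_A. \<forall>g\<in>carrier G_A. z \<otimes>\<^bsub>G_A\<^esub> g = g \<otimes>\<^bsub>G_A\<^esub> z}"

definition K_A :: "'k::field GA set" where
  "K_A = carrier (GL2 integral_adeles)"

text \<open>The matrix \<open>m\<close> over $F_y$, with the identity at all other places.\<close>

definition at_place :: "'k::field place \<Rightarrow> 'k local mat2 \<Rightarrow> 'k GA" where
  "at_place y m =
     (let one = \<one>\<^bsub>adele_ring\<^esub>; zero = \<zero>\<^bsub>adele_ring\<^esub> in
      Mat2 (one(y := e11 m)) (zero(y := e12 m)) (zero(y := e21 m)) (one(y := e22 m)))"

definition diag_at :: "'k::field place \<Rightarrow> 'k ratfun \<Rightarrow> 'k GA" where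
  "diag_at y z = at_place y (map_mat2 (emb_local y) (Mat2 z 0 0 1))"

text \<open>The double coset $G(F)\, g\, Z K$.\<close>

definition dclass :: "'k::field GA \<Rightarrow> 'k GA set" where
  "dclass g = (G_F #>\<^bsub>G_A\<^esub> g) <#>\<^bsub>G_A\<^esub> (Z_A <#>\<^bsub>G_A\<^esub> K_A)"

text \<open>The class $c_{nx}$ of the matrix with entries $\pi_x^{-n}$ and 1, where \<open>p\<close> is $\pi_x$.\<close>

definition c_class :: "'k::field place \<Rightarrow> 'k ratfun \<Rightarrow> nat \<Rightarrow> 'k GA set" where
  "c_class x p n = dclass (diag_at x (p powi (- int n)))"


text \<open>The set $\mathfrak{N}_d = \{c_0, c_x, \dots, c_{(d-1)x}\}$.\<close>

definition N_classes :: "'k::field place \<Rightarrow> 'k ratfun \<Rightarrow> nat \<Rightarrow> 'k GA set set" where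
  "N_classes x p d = c_class x p ` {..<d}"


section \<open>Haar measure, automorphic functions and Hecke operators\<close>

text \<open>A nonzero left invariant Borel measure that is finite on compact sets. Regularity is
  automatic for second countable groups such as $G(\mathbb{A})$, which is moreover unimodular,
  so that left and right Haar measures coincide.\<close>

definition haar_measure ::
  "('a, 'b) monoid_scheme \<Rightarrow> 'a topology \<Rightarrow> 'a measure \<Rightarrow> bool" where
  "haar_measure G T \<mu> \<longleftrightarrow>
     space \<mu> = topspace T \<and>
     sets \<mu> = sigma_sets (topspace T) {U. openin T U} \<and>
     (\<forall>g\<in>carrier G. \<forall>A\<in>sets \<mu>. emeasure \<mu> (g <#\<^bsub>G\<^esub> A) = emeasure \<mu> A) \<and>
     (\<forall>C. compactin T C \<longrightarrow> emeasure \<mu> C < \<infinity>) \<and>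
     emeasure \<mu> (space \<mu>) \<noteq> 0"

definition local_height :: "'k::{field,finite} place \<Rightarrow> 'k local mat2 \<Rightarrow> real" where
  "local_height y m = Max (abs_local y `
     {e11 m, e12 m, e21 m, e22 m, inv\<^bsub>completion y\<^esub> (det2 (completion y) m)})"

text \<open>Almost all factors equal 1, so this product over all places is finite.\<close>

definition height :: "'k::{field,finite} GA \<Rightarrow> real" where
  "height g = Prod_any (\<lambda>y. local_height y (map_mat2 (\<lambda>a. a y) g))"

text \<open>A function on $G(\mathbb{A})$ is represented by its extension by zero to the whole type, so
  that $\mathcal{A}^K$ is a linear subspace of the space of all functions on the type.\<close>

definition automorphic_functions :: "('k::{field,finite} GA \<Rightarrow> complex) set" where
  "automorphic_functions = {f.
     (\<forall>g. g \<notin> carrier G_A \<longrightarrow> f g = 0) \<and>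
     (\<forall>\<gamma>\<in>G_F. \<forall>g\<in>carrier G_A. f (\<gamma> \<otimes>\<^bsub>G_A\<^esub> g) = f g) \<and>
     (\<forall>z\<in>Z_A. \<forall>g\<in>carrier G_A. f (z \<otimes>\<^bsub>G_A\<^esub> g) = f g) \<and>
     (\<forall>k\<in>K_A. \<forall>g\<in>carrier G_A. f (g \<otimes>\<^bsub>G_A\<^esub> k) = f g) \<and>
     (\<exists>C N :: real. \<forall>g\<in>carrier G_A. cmod (f g) \<le> C * height g powr N)}"

definition hecke_operator ::
  "'k::{field,finite} GA measure \<Rightarrow> 'k place \<Rightarrow> 'k ratfun \<Rightarrow> ('k GA \<Rightarrow> complex) \<Rightarrow> 'k GA \<Rightarrow> complex"
  where
  "hecke_operator \<mu> y p f g =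
     (if g \<in> carrier G_A
      then LINT h|\<mu>. indicator (K_A <#>\<^bsub>G_A\<^esub> (diag_at y p <#\<^bsub>G_A\<^esub> K_A)) h * f (g \<otimes>\<^bsub>G_A\<^esub> h)
      else 0)"

definition fun_scale :: "complex \<Rightarrow> ('a \<Rightarrow> complex) \<Rightarrow> 'a \<Rightarrow> complex" where
  "fun_scale c f = (\<lambda>x. c * f x)"

definition hecke_eigenspace ::
  "'k::{field,finite} GA measure \<Rightarrow> 'k place \<Rightarrow> 'k ratfun \<Rightarrow> complex \<Rightarrow> ('k GA \<Rightarrow> complex) set" where
  "hecke_eigenspace \<mu> y p l =
     {f \<in> automorphic_functions. hecke_operator \<mu> y p f = fun_scale l f}"

text \<open>The direct sum of copies of $\mathbb{C}$ indexed by a finite set \<open>S\<close>.\<close>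

definition coord_space :: "'a set \<Rightarrow> ('a \<Rightarrow> complex) set" where
  "coord_space S = {v. \<forall>c. c \<notin> S \<longrightarrow> v c = 0}"

text \<open>The values of \<open>f\<close> on the classes in \<open>S\<close>. A function in $\mathcal{A}^K$ is constant
  on each class, so any representative computes its value there.\<close>

definition eval_classes :: "'k GA set set \<Rightarrow> ('k GA \<Rightarrow> complex) \<Rightarrow> 'k GA set \<Rightarrow> complex" where
  "eval_classes S f = (\<lambda>c. if c \<in> S then f (SOME g. g \<in> c) else 0)"

end

theory Submission
  imports Defs "HOL-Computational_Algebra.Polynomial_Factorial"
begin

text \<open>The class of $g$ in $G(F)\backslash G(\mathbb{A})/ZK$ is a vector bundle of rank two on
$\mathbb{P}^1$ up to twist by line bundles. Such a bundle splits as a sum of two line bundles, so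
the difference $n \ge 0$ of their degrees is a complete invariant, and $n$ belongs to the class
$c_{nx}$. A Hecke neighbour at a place $y$ of degree $d$ is an elementary modification of the
bundle along $y$. A modification raises the degree of a line subbundle by 0 or $d$ and the degree
of the whole bundle by $d$, so it raises $n$ by at most $d$; and the modification of $c_{nx}$ that
enlarges a line subbundle of maximal degree raises $n$ by exactly $d$. If $\varphi(n)$ is the
value of an eigenfunction at $c_{nx}$, the eigenvalue equation at $c_{nx}$ therefore reads
$m\,\varphi(n+d) + \sum_{k<n+d} m_k\,\varphi(k) = \lambda\,\varphi(n)$ with a positive integer
$m$. This is a recursion: the values $\varphi(0),\dots,\varphi(d-1)$ can be prescribed, and they
determine all others.

Moderate growth is automatic. The recursion lets $|\varphi(n)|$ grow at most like $V B^n$, and the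
height of any representative of $c_{nx}$ is at least $q^{n/3}$, because a matrix of small height
cannot distort the degrees of line subbundles by much.

The invariant $n$ is read off without bundles. A matrix with components in $\mathrm{GL}_2(F)$
assigns to every nonzero row vector $v \in F^2$ the number \<open>vdeg\<close>, the sum over all places of
the valuations of $v g_y$ weighted by degrees. It is the degree of the line subbundle spanned by
$v$, and \<open>slope\<close> compares its maximum over $v$ with the degree of the determinant. The product
formula (\<open>product_formula\<close>) makes this invariant under $G(F)$; the two inequalities about
modifications are \<open>slope_hecke_le\<close> and \<open>slope_hecke_ge\<close>; the bound by the height is
\<open>slope_le_height\<close>. That every bundle splits is \<open>family_standard_form\<close>, a reduction based on
the class number one of $\mathbb{P}^1$ and on strong approximation away from $x$.

These statements concern matrices over $F$, one for each place. They carry over to the adeles since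
$F$ is dense in $F_y$ and integral matrices are open: every element of $G(\mathbb{A})$ is such a
family times an element of $K$ (\<open>adelic_approximation\<close>). The double coset of $\Phi_y$ is a finite
disjoint union of cosets $hK$, each of volume one, so that $\Phi_y$ acts by the finite sum in
\<open>hecke_operator_sum\<close>.\<close>


section \<open>Rational functions as quotients of polynomials in a generator\<close>

lemma const_rf_0 [simp]: "const_rf 0 = 0"
  by (simp add: const_rf_def fract_collapse)

lemma const_rf_1 [simp]: "const_rf 1 = 1"
  by (simp add: const_rf_def One_fract_def one_pCons)

lemma const_rf_add: "const_rf (a + b) = const_rf a + const_rf b"
  by (simp add: const_rf_def mult.commute)

lemma const_rf_minus: "const_rf (- a) = - const_rf a"
  by (simp add: const_rf_def mult.commute)

lemma const_rf_mult: "const_rf (a * b) = const_rf a * const_rf b"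
  by (simp add: const_rf_def mult.commute)

lemma const_rf_eq_0 [simp]: "const_rf a = 0 \<longleftrightarrow> a = 0"
  by (simp add: const_rf_def Zero_fract_def eq_fract)

text \<open>Evaluation of a polynomial with constant coefficients at an element of $F$. It is applied at $t$ and at
$1/t$: each place is integral at one of the two, and the place $x$, where $t$ vanishes, acts as the
point at infinity of the affine line with coordinate $1/t$.\<close>

definition ev :: "'k::field ratfun \<Rightarrow> 'k poly \<Rightarrow> 'k ratfun" where
  "ev \<tau> A = poly (map_poly const_rf A) \<tau>"

lemma ev_0 [simp]: "ev \<tau> 0 = 0"
  by (simp add: ev_def)

lemma ev_pCons [simp]: "ev \<tau> (pCons a A) = const_rf a + \<tau> * ev \<tau> A"
  by (simp add: ev_def map_poly_pCons)

lemma ev_1 [simp]: "ev \<tau> 1 = 1"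
  by (simp add: one_pCons)

lemma ev_add: "ev \<tau> (A + B) = ev \<tau> A + ev \<tau> B"
  by (induction A B rule: poly_induct2) (simp_all add: const_rf_add algebra_simps)

lemma ev_minus: "ev \<tau> (- A) = - ev \<tau> A"
  using ev_add[of \<tau> A "- A"] by (simp add: eq_neg_iff_add_eq_0 add.commute)

lemma ev_diff: "ev \<tau> (A - B) = ev \<tau> A - ev \<tau> B"
  using ev_add[of \<tau> A "- B"] by (simp add: ev_minus)

lemma ev_smult: "ev \<tau> (Polynomial.smult c A) = const_rf c * ev \<tau> A"
  by (induction A) (auto simp: const_rf_mult algebra_simps)

lemma ev_mult: "ev \<tau> (A * B) = ev \<tau> A * ev \<tau> B"
  by (induction A) (auto simp: ev_add ev_smult algebra_simps)

lemma ev_power: "ev \<tau> (A ^ n) = ev \<tau> A ^ n"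
  by (induction n) (auto simp: ev_mult)

definition generator :: "'k::field ratfun \<Rightarrow> bool" where
  "generator \<tau> \<longleftrightarrow> (\<forall>A. ev \<tau> A = 0 \<longrightarrow> A = 0) \<and>
     (\<forall>z. \<exists>A B. B \<noteq> 0 \<and> z = ev \<tau> A / ev \<tau> B)"

lemma generator_ev_eq_0 [simp]: "generator \<tau> \<Longrightarrow> ev \<tau> A = 0 \<longleftrightarrow> A = 0"
  by (auto simp: generator_def)

lemma generator_cases:
  assumes "generator \<tau>"
  obtains A B where "B \<noteq> 0" "z = ev \<tau> A / ev \<tau> B"
  using assms unfolding generator_def by blast

lemma ev_t: "ev t_rf A = Fraction_Field.Fract A 1"
proof (induction A)
  case 0
  show ?case by (simp add: fract_collapse)
next
  case (pCons a A)
  have "[:a:] + [:0, 1:] * A = pCons a A" by simp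
  then show ?case
    unfolding ev_pCons pCons.IH unfolding const_rf_def t_rf_def mult_fract
    by (subst add_fract) simp_all
qed

lemma t_rf_nonzero [simp]: "t_rf \<noteq> 0"
  by (simp add: t_rf_def Zero_fract_def eq_fract)

lemma generator_t: "generator (t_rf :: 'k::field ratfun)"
  unfolding generator_def
proof (intro conjI allI impI)
  fix A :: "'k poly" assume "ev t_rf A = 0"
  then show "A = 0" by (simp add: ev_t Zero_fract_def eq_fract)
next
  fix z :: "'k ratfun"
  obtain a b where "z = Fraction_Field.Fract a b" "b \<noteq> 0"
    by (cases z) auto
  then have "z = ev t_rf a / ev t_rf b" by (simp add: ev_t)
  then show "\<exists>A B. B \<noteq> 0 \<and> z = ev t_rf A / ev t_rf B"
    using \<open>b \<noteq> 0\<close> by blast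
qed

lemma ev_inverse:
  fixes \<tau> :: "'k::field ratfun"
  assumes "\<tau> \<noteq> 0"
  shows "ev (inverse \<tau>) A = ev \<tau> (reflect_poly A) / \<tau> ^ Polynomial.degree A"
proof -
  have inj: "const_rf a = 0 \<longleftrightarrow> a = 0" for a :: 'k by simp
  have deg: "Polynomial.degree (map_poly const_rf A) = Polynomial.degree A"
    by (simp add: degree_map_poly)
  have "map_poly const_rf (reflect_poly A) = reflect_poly (map_poly const_rf A)"
    by (rule poly_eqI) (simp add: coeff_map_poly coeff_reflect_poly deg)
  then have "ev \<tau> (reflect_poly A) = \<tau> ^ Polynomial.degree A * ev (inverse \<tau>) A"
    unfolding ev_def using poly_reflect_poly_nz[OF assms, of "map_poly const_rf A"] deg by simp
  then show ?thesis using assms by simp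
qed

text \<open>Reversing coefficients turns a polynomial in $t$ into one in $1/t$ up to a power of $t$.\<close>

lemma generator_inverse_t: "generator (inverse t_rf :: 'k::field ratfun)"
  unfolding generator_def
proof (intro conjI allI impI)
  fix A :: "'k poly" assume "ev (inverse t_rf) A = 0"
  then have "ev t_rf (reflect_poly A) = 0" by (simp add: ev_inverse)
  then have "reflect_poly A = 0" using generator_ev_eq_0[OF generator_t] by blast
  then show "A = 0" by simp
next
  fix z :: "'k ratfun"
  have s: "inverse t_rf \<noteq> (0 :: 'k ratfun)" by simp
  have t: "ev t_rf A = ev (inverse t_rf) (reflect_poly A) * t_rf ^ Polynomial.degree A" for A :: "'k poly"
    using ev_inverse[OF s, of A] by (simp add: field_simps)
  have tp: "t_rf ^ n = (1 :: 'k ratfun) / ev (inverse t_rf) ([:0,1:] ^ n)" for n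
    by (simp add: ev_power field_simps)
  obtain A B where AB: "B \<noteq> 0" "z = ev t_rf A / ev t_rf B"
    using generator_cases[OF generator_t, of z] by metis
  let ?A = "reflect_poly A * [:0,1:] ^ Polynomial.degree B"
  let ?B = "reflect_poly B * [:0,1:] ^ Polynomial.degree A"
  have "z = ev (inverse t_rf) ?A / ev (inverse t_rf) ?B"
    unfolding AB(2) t[of A] t[of B] tp by (simp add: ev_mult)
  moreover have "?B \<noteq> 0" using AB(1) by simp
  ultimately show "\<exists>A B. B \<noteq> 0 \<and> z = ev (inverse t_rf) A / ev (inverse t_rf) B"
    by blast
qed


section \<open>Places are discrete valuations\<close>

lemma val_ring_valuation: "valuation_ring (val_ring y)"
  using val_ring[of y] by simp

lemma a_inv_F_ring: "a_inv F_ring z = - (z :: 'k::field ratfun)"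
proof -
  interpret Rf: ring "F_ring :: 'k ratfun ring" by (rule ring_from_type_algebra)
  have "z \<oplus>\<^bsub>F_ring\<^esub> (- z) = \<zero>\<^bsub>F_ring\<^esub>" by (simp add: ring_of_type_algebra_def)
  then show ?thesis
    by (metis Rf.add.inv_equality Rf.add.m_comm UNIV_I ring_of_type_algebra_def
        partial_object.select_convs(1))
qed

lemma
  fixes y :: "'k::field place"
  shows val_ring_0 [simp]: "0 \<in> val_ring y"
    and val_ring_1 [simp]: "1 \<in> val_ring y"
    and val_ring_add: "z \<in> val_ring y \<Longrightarrow> w \<in> val_ring y \<Longrightarrow> z + w \<in> val_ring y"
    and val_ring_mult: "z \<in> val_ring y \<Longrightarrow> w \<in> val_ring y \<Longrightarrow> z * w \<in> val_ring y"
    and val_ring_minus: "z \<in> val_ring y \<Longrightarrow> - z \<in> val_ring y"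
    and val_ring_const [simp]: "const_rf c \<in> val_ring y"
    and val_ring_total: "v \<in> val_ring y \<or> inverse v \<in> val_ring y"
    and val_ring_proper: "val_ring y \<noteq> UNIV"
proof -
  have v: "subring (val_ring y) F_ring" "range const_rf \<subseteq> val_ring y" "val_ring y \<noteq> UNIV"
    "\<forall>z. z \<in> val_ring y \<or> inverse z \<in> val_ring y"
    using val_ring_valuation[of y] unfolding valuation_ring_def by auto
  note sr = subringE(3,5-7)[OF v(1)]
  show "1 \<in> val_ring y" using sr(1) by (simp add: ring_of_type_algebra_def)
  show "0 \<in> val_ring y" using v(2) const_rf_0 by (metis rangeI subsetD)
  show "z \<in> val_ring y \<Longrightarrow> w \<in> val_ring y \<Longrightarrow> z + w \<in> val_ring y"
    using sr(4)[of z w] by (simp add: ring_of_type_algebra_def)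
  show "z \<in> val_ring y \<Longrightarrow> w \<in> val_ring y \<Longrightarrow> z * w \<in> val_ring y"
    using sr(3)[of z w] by (simp add: ring_of_type_algebra_def)
  show "z \<in> val_ring y \<Longrightarrow> - z \<in> val_ring y"
    using sr(2)[of z] by (simp add: a_inv_F_ring)
  show "const_rf c \<in> val_ring y" using v(2) by auto
  show "v \<in> val_ring y \<or> inverse v \<in> val_ring y" using v(4) by auto
  show "val_ring y \<noteq> UNIV" by (fact v(3))
qed

lemma val_ring_power: "z \<in> val_ring y \<Longrightarrow> z ^ n \<in> val_ring y"
  by (induction n) (auto intro: val_ring_mult)

definition max_at :: "'k::field place \<Rightarrow> 'k ratfun set" where
  "max_at y = {z \<in> val_ring y. z = 0 \<or> inverse z \<notin> val_ring y}"

lemma uniformizer_iff_max: "uniformizer y p \<longleftrightarrow> max_at y = {p * z | z. z \<in> val_ring y}"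
  by (simp add: uniformizer_def max_at_def)

lemma uniformizer_in_max:
  assumes "uniformizer y p"
  shows "p \<in> max_at y"
proof -
  have "\<exists>z. p = p * z \<and> z \<in> val_ring y"
    by (rule exI[of _ 1]) (simp add: val_ring_1)
  then show ?thesis using assms unfolding uniformizer_iff_max by blast
qed

lemma max_at_mult:
  assumes "z \<in> max_at y" "w \<in> val_ring y"
  shows "z * w \<in> max_at y"
proof -
  have "z * w = 0 \<or> inverse (z * w) \<notin> val_ring y"
  proof (rule ccontr)
    assume a: "\<not> ?thesis"
    then have "w * inverse (z * w) \<in> val_ring y" using assms val_ring_mult by blast
    moreover have "w * inverse (z * w) = inverse z" using a by (simp add: field_simps)
    ultimately have "inverse z \<in> val_ring y" by metis
    then show False using assms a by (auto simp: max_at_def)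
  qed
  then show ?thesis using assms val_ring_mult by (auto simp: max_at_def)
qed

text \<open>Of two elements of a valuation ring one divides the other, so a sum of two nonunits is a
multiple of a nonunit.\<close>

lemma max_at_add:
  assumes "z \<in> max_at y" "w \<in> max_at y"
  shows "z + w \<in> max_at y"
proof -
  have *: "z + w \<in> max_at y" if zw: "z \<in> max_at y" "w \<in> max_at y" "z * inverse w \<in> val_ring y" for z w
  proof (cases "w = 0")
    case False
    then have "z + w = w * (1 + z * inverse w)" by (simp add: field_simps)
    then show ?thesis
      using max_at_mult[OF zw(2) val_ring_add[OF val_ring_1 zw(3)]] by simp
  qed (use zw in auto)
  have "z * inverse w \<in> val_ring y \<or> w * inverse z \<in> val_ring y"
    using val_ring_total[of "z * inverse w" y] by (simp add: mult.commute)
  then show ?thesis using *[OF assms] *[OF assms(2,1)] by (auto simp: add.commute)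
qed

lemma one_notin_max [simp]: "1 \<notin> max_at y"
  by (simp add: max_at_def)

lemma const_in_max_iff: "const_rf c \<in> max_at y \<longleftrightarrow> c = 0"
proof
  assume a: "const_rf c \<in> max_at y"
  show "c = 0"
  proof (rule ccontr)
    assume "c \<noteq> 0"
    then have "const_rf c * const_rf (inverse c) = 1" by (simp flip: const_rf_mult)
    then show False using max_at_mult[OF a val_ring_const[of "inverse c"]] by simp
  qed
qed (simp add: max_at_def)

lemma val_ring_ev:
  assumes "\<tau> \<in> val_ring y"
  shows "ev \<tau> A \<in> val_ring y"
  by (induction A) (auto intro!: val_ring_add val_ring_mult assms)

text \<open>The polynomials in $\<tau>$ lying in the maximal ideal of a place form a nonzero prime ideal of a
principal ideal domain. Its generator controls the whole place: the valuation of a rational function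
counts how often the generator divides numerator and denominator.\<close>

definition place_poly :: "'k::field place \<Rightarrow> 'k ratfun \<Rightarrow> 'k poly \<Rightarrow> bool" where
  "place_poly y \<tau> P \<longleftrightarrow> generator \<tau> \<and> \<tau> \<in> val_ring y \<and> prime_elem P \<and> (\<forall>A. ev \<tau> A \<in> max_at y \<longleftrightarrow> P dvd A)"

lemma place_poly_exists:
  assumes g: "generator \<tau>" and \<tau>: "\<tau> \<in> val_ring y"
  shows "\<exists>P. place_poly y \<tau> P"
proof -
  have ex: "\<exists>A. A \<noteq> 0 \<and> ev \<tau> A \<in> max_at y"
  proof (rule ccontr)
    assume a: "\<not> ?thesis"
    have "z \<in> val_ring y" for z
    proof -
      obtain A B where AB: "B \<noteq> 0" "z = ev \<tau> A / ev \<tau> B" using generator_cases[OF g, of z] by metis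
      then have "inverse (ev \<tau> B) \<in> val_ring y"
        using a val_ring_ev[OF \<tau>, of B] by (auto simp: max_at_def)
      then show ?thesis using val_ring_ev[OF \<tau>, of A] AB(2) val_ring_mult by (simp add: divide_inverse)
    qed
    then show False using val_ring_proper[of y] by auto
  qed
  \<comment> \<open>a nonzero element of minimal degree generates the ideal, by division with remainder\<close>
  define n where "n = (LEAST n. \<exists>A. A \<noteq> 0 \<and> ev \<tau> A \<in> max_at y \<and> Polynomial.degree A = n)"
  obtain P where P: "P \<noteq> 0" "ev \<tau> P \<in> max_at y" "Polynomial.degree P = n"
    using LeastI_ex[of "\<lambda>n. \<exists>A. A \<noteq> 0 \<and> ev \<tau> A \<in> max_at y \<and> Polynomial.degree A = n"] ex
    unfolding n_def by blast
  have least: "n \<le> Polynomial.degree A" if "A \<noteq> 0" "ev \<tau> A \<in> max_at y" for A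
    unfolding n_def by (rule Least_le) (use that in blast)
  have dvd: "ev \<tau> A \<in> max_at y \<longleftrightarrow> P dvd A" for A
  proof
    assume a: "ev \<tau> A \<in> max_at y"
    have "ev \<tau> (A mod P) = ev \<tau> A + ev \<tau> P * ev \<tau> (- (A div P))"
    proof -
      have "A mod P = A + P * (- (A div P))"
        by (metis add_uminus_conv_diff minus_mult_div_eq_mod mult_minus_right)
      then show ?thesis using ev_add ev_mult by metis
    qed
    then have "ev \<tau> (A mod P) \<in> max_at y"
      using a max_at_add max_at_mult[OF P(2) val_ring_ev[OF \<tau>]] by metis
    then have "A mod P = 0"
      using least[of "A mod P"] degree_mod_less[OF P(1), of A] P(3) by fastforce
    then show "P dvd A" by (simp add: dvd_eq_mod_eq_0)
  next
    assume "P dvd A"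
    then show "ev \<tau> A \<in> max_at y"
      using max_at_mult[OF P(2) val_ring_ev[OF \<tau>]] by (auto simp: ev_mult elim!: dvdE)
  qed
  have "prime_elem P"
  proof (rule prime_elemI)
    show "P \<noteq> 0" by fact
    show "\<not> is_unit P" using dvd[of 1] by simp
    fix A B assume "P dvd A * B"
    then have AB: "ev \<tau> A * ev \<tau> B \<in> max_at y" using dvd ev_mult by metis
    show "P dvd A \<or> P dvd B"
    proof (rule ccontr)
      assume "\<not> ?thesis"
      then have "ev \<tau> A \<notin> max_at y" "ev \<tau> B \<notin> max_at y" using dvd by auto
      then have u: "ev \<tau> A \<noteq> 0" "inverse (ev \<tau> A) \<in> val_ring y" "ev \<tau> B \<noteq> 0" "inverse (ev \<tau> B) \<in> val_ring y"
        using val_ring_ev[OF \<tau>] by (auto simp: max_at_def)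
      then have "1 \<in> max_at y"
        using max_at_mult[OF AB val_ring_mult[OF u(2,4)]] by (simp add: field_simps)
      then show False by simp
    qed
  qed
  then show ?thesis using dvd g \<tau> unfolding place_poly_def by blast
qed

lemma generator_in_val_ring: "\<exists>\<tau>. generator \<tau> \<and> \<tau> \<in> val_ring y"
  using val_ring_total[of t_rf y] generator_t generator_inverse_t by blast

lemma place_poly_nonzero: "place_poly y \<tau> P \<Longrightarrow> P \<noteq> 0"
  by (auto simp: place_poly_def)

definition unit_at :: "'k::field place \<Rightarrow> 'k ratfun \<Rightarrow> bool" where
  "unit_at y u \<longleftrightarrow> u \<noteq> 0 \<and> u \<in> val_ring y \<and> inverse u \<in> val_ring y"

lemma unit_at_mult: "unit_at y u \<Longrightarrow> unit_at y v \<Longrightarrow> unit_at y (u * v)"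
  by (auto simp: unit_at_def intro: val_ring_mult)

lemma unit_at_inverse: "unit_at y u \<Longrightarrow> unit_at y (inverse u)"
  by (auto simp: unit_at_def)

lemma unit_at_1 [simp]: "unit_at y 1"
  by (simp add: unit_at_def)

lemma unit_at_const: "c \<noteq> 0 \<Longrightarrow> unit_at y (const_rf c)"
  using const_in_max_iff[of c y] by (auto simp: unit_at_def max_at_def)

lemma place_poly_unit:
  assumes "place_poly y \<tau> P" "\<not> P dvd A"
  shows "unit_at y (ev \<tau> A)"
  using assms val_ring_ev[of \<tau> y A] by (auto simp: place_poly_def unit_at_def max_at_def)

lemma split_prime_power:
  fixes A P :: "'k::field poly"
  assumes "A \<noteq> 0" "prime_elem P"
  shows "\<exists>k B. A = P ^ k * B \<and> \<not> P dvd B"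
  using assms(1)
proof (induction "Polynomial.degree A" arbitrary: A rule: less_induct)
  case less
  show ?case
  proof (cases "P dvd A")
    case True
    then obtain B where B: "A = P * B" by blast
    have P0: "P \<noteq> 0" "\<not> is_unit P" using assms by (auto simp: prime_elem_def)
    then have "Polynomial.degree P > 0" by (auto simp: is_unit_iff_degree)
    then have "Polynomial.degree B < Polynomial.degree A"
      using B less P0 by (auto simp: degree_mult_eq)
    then obtain k C where "B = P ^ k * C" "\<not> P dvd C" 
      using less.hyps[of B] B less.prems by auto
    then have "A = P ^ Suc k * C" "\<not> P dvd C" using B by (auto simp: mult.assoc)
    then show ?thesis by blast
  next
    case False
    then have "A = P ^ 0 * A \<and> \<not> P dvd A" by simp
    then show ?thesis by blast
  qed
qed

lemma place_poly_decomp: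
  assumes P: "place_poly y \<tau> P" and z: "z \<noteq> 0"
  shows "\<exists>n u. unit_at y u \<and> z = u * ev \<tau> P powi n"
proof -
  have pr: "prime_elem P" and g: "generator \<tau>" using P by (auto simp: place_poly_def)
  have e0: "ev \<tau> P \<noteq> 0" using g place_poly_nonzero[OF P] by simp
  have *: "\<exists>k u. unit_at y u \<and> ev \<tau> A = u * ev \<tau> P ^ k" if A0: "A \<noteq> 0" for A
  proof -
    obtain k B where "A = P ^ k * B" "\<not> P dvd B" using split_prime_power[OF A0 pr] by blast
    then have "unit_at y (ev \<tau> B) \<and> ev \<tau> A = ev \<tau> B * ev \<tau> P ^ k"
      using place_poly_unit[OF P] by (simp add: ev_mult ev_power)
    then show ?thesis by blast
  qed
  obtain A B where AB: "B \<noteq> 0" "z = ev \<tau> A / ev \<tau> B" using generator_cases[OF g, of z] by metis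
  then have "A \<noteq> 0" using z by auto
  obtain k u where k: "unit_at y u" "ev \<tau> A = u * ev \<tau> P ^ k" using *[OF \<open>A \<noteq> 0\<close>] by blast
  obtain l v where l: "unit_at y v" "ev \<tau> B = v * ev \<tau> P ^ l" using *[OF AB(1)] by blast
  have "z = (u * inverse v) * ev \<tau> P powi (int k - int l)"
    using AB(2) k l e0 by (simp add: power_int_diff field_simps)
  then show ?thesis using unit_at_mult[OF k(1) unit_at_inverse[OF l(1)]] by blast
qed

lemma place_poly_uniformizer:
  assumes P: "place_poly y \<tau> P"
  shows "uniformizer y (ev \<tau> P)"
proof -
  let ?p = "ev \<tau> P"
  have e0: "?p \<noteq> 0" using P place_poly_nonzero[OF P] by (simp add: place_poly_def)
  have pm: "?p \<in> max_at y" using P by (auto simp: place_poly_def)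
  then have pv: "?p \<in> val_ring y" by (simp add: max_at_def)
  have "\<exists>w. z = ?p * w \<and> w \<in> val_ring y" if z: "z \<in> max_at y" for z
  proof (cases "z = 0")
    case False
    then obtain n u where nu: "unit_at y u" "z = u * ?p powi n"
      using place_poly_decomp[OF P] by blast
    have "n > 0"
    proof (rule ccontr)
      assume n: "\<not> n > 0"
      then have "inverse z = inverse u * ?p ^ nat (- n)"
        using nu(2) by (simp add: power_int_def power_inverse)
      then have "inverse z \<in> val_ring y"
        using nu(1) val_ring_power[OF pv] by (auto simp: unit_at_def intro: val_ring_mult)
      then show False using z False by (simp add: max_at_def)
    qed
    then have "z = ?p * (u * ?p ^ nat (n - 1))"
    proof -
      have "nat n = Suc (nat (n - 1))" using \<open>n > 0\<close> by simp
      then have "?p powi n = ?p * ?p ^ nat (n - 1)" using \<open>n > 0\<close> by (simp add: power_int_def)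
      then show ?thesis using nu(2) by (simp add: mult.left_commute)
    qed
    moreover have "u * ?p ^ nat (n - 1) \<in> val_ring y"
      using nu(1) val_ring_power[OF pv] by (auto simp: unit_at_def intro: val_ring_mult)
    ultimately show ?thesis by blast
  qed (auto intro: exI[of _ 0])
  then show ?thesis using max_at_mult[OF pm] unfolding uniformizer_iff_max by blast
qed

lemma uniformizer_exists: "\<exists>p. uniformizer y p"
  using generator_in_val_ring place_poly_exists place_poly_uniformizer by blast

text \<open>Two generators of the maximal ideal divide each other, hence differ by a unit. Together with
discreteness this makes the valuation independent of the uniformizer.\<close>

lemma uniformizer_related:
  assumes p: "uniformizer y p" and r: "uniformizer y r"
  shows "p \<noteq> 0 \<and> (\<exists>u. unit_at y u \<and> r = u * p)"
proof -
  obtain \<tau> P where P: "place_poly y \<tau> P" using generator_in_val_ring place_poly_exists by blast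
  let ?e = "ev \<tau> P"
  have e0: "?e \<noteq> 0" using P place_poly_nonzero[OF P] by (simp add: place_poly_def)
  have em: "?e \<in> max_at y" using P by (auto simp: place_poly_def)
  have p0: "p \<noteq> 0" if "uniformizer y p" for p
    using em that e0 unfolding uniformizer_iff_max by auto
  obtain w where w: "w \<in> val_ring y" "r = p * w" using uniformizer_in_max[OF r] p unfolding uniformizer_iff_max by blast
  obtain v where v: "v \<in> val_ring y" "p = r * v" using uniformizer_in_max[OF p] r unfolding uniformizer_iff_max by blast
  have "p * (w * v) = p * 1" using w(2) v(2) by (metis mult.assoc mult.right_neutral)
  then have wv: "w * v = 1" using p0[OF p] by (metis mult_left_cancel)
  then have "w \<noteq> 0" "inverse w = v" by (auto intro: inverse_unique)
  then have "unit_at y w" using w v by (simp add: unit_at_def)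
  then show ?thesis using w p0[OF p] by (auto simp: mult.commute)
qed

lemma unit_at_power_int: "unit_at y u \<Longrightarrow> unit_at y (u powi n)"
  unfolding unit_at_def power_int_def using val_ring_power[of u y] val_ring_power[of "inverse u" y]
  by (simp add: power_inverse)

lemma uniformizer_decomp:
  assumes p: "uniformizer y p" and z: "z \<noteq> 0"
  shows "\<exists>n u. unit_at y u \<and> z = u * p powi n"
proof -
  obtain \<tau> P where P: "place_poly y \<tau> P" using generator_in_val_ring place_poly_exists by blast
  obtain n u where nu: "unit_at y u" "z = u * ev \<tau> P powi n" using place_poly_decomp[OF P z] by blast
  obtain v where v: "unit_at y v" "ev \<tau> P = v * p"
    using uniformizer_related[OF p place_poly_uniformizer[OF P]] by blast
  have "z = (u * v powi n) * p powi n" using nu v by (simp add: power_int_mult_distrib mult.assoc)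
  then show ?thesis using unit_at_mult[OF nu(1) unit_at_power_int[OF v(1)]] by blast
qed

lemma uniformizer_power_unit:
  assumes p: "uniformizer y p" and u: "unit_at y (p powi n)"
  shows "n = 0"
proof (rule ccontr)
  assume n: "n \<noteq> 0"
  have pm: "p \<in> max_at y"
    by (rule uniformizer_in_max[OF p])
  then have pv: "p \<in> val_ring y" by (simp add: max_at_def)
  have p0: "p \<noteq> 0" using uniformizer_related[OF p p] by simp
  have k: False if "k > 0" "unit_at y (p ^ k)" for k
  proof -
    have "p ^ k = p * p ^ (k - 1)" using that(1) by (simp flip: power_Suc)
    then have "p ^ k \<in> max_at y" using max_at_mult[OF pm val_ring_power[OF pv]] by metis
    then show False using that(2) by (simp add: unit_at_def max_at_def)
  qed
  show False
  proof (cases "n > 0")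
    case True
    then show False using k[of "nat n"] u by (simp add: power_int_def)
  next
    case False
    then have "unit_at y (p ^ nat (- n))"
      using unit_at_inverse[OF u] by (auto simp: power_int_def power_inverse split: if_splits)
    then show False using k[of "nat (- n)"] False n by simp
  qed
qed

lemma ord_at_eqI:
  assumes p: "uniformizer y p" and u: "unit_at y u"
  shows "ord_at y (u * p powi n) = n"
proof -
  define z where "z = u * p powi n"
  have p0: "p \<noteq> 0" using uniformizer_related[OF p p] by simp
  have "m = n" if r: "uniformizer y r" and v: "unit_at y v" and zz: "z = v * r powi m" for r v m
  proof -
    obtain w where w: "unit_at y w" "r = w * p" using uniformizer_related[OF p r] by blast
    have "u * p powi n = v * w powi m * p powi m"
      using zz w z_def by (simp add: power_int_mult_distrib mult.assoc)
    then have "p powi (n - m) = inverse u * (v * w powi m)"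
      using p0 u by (simp add: power_int_diff field_simps unit_at_def)
    then have "unit_at y (p powi (n - m))"
      using u v w by (metis unit_at_inverse unit_at_mult unit_at_power_int)
    then show ?thesis using uniformizer_power_unit[OF p] by fastforce
  qed
  moreover have "\<exists>p u. uniformizer y p \<and> u \<in> val_ring y \<and> inverse u \<in> val_ring y \<and>
                   u \<noteq> 0 \<and> z = u * p powi n"
    using p u z_def by (auto simp: unit_at_def)
  ultimately show ?thesis unfolding ord_at_def z_def[symmetric]
    by (intro the_equality) (auto simp: unit_at_def)
qed

lemma ord_at_unique:
  assumes z: "z \<noteq> 0" and p: "uniformizer y p"
  shows "\<exists>u. unit_at y u \<and> z = u * p powi ord_at y z"
  using uniformizer_decomp[OF p z] ord_at_eqI[OF p] by metis

lemma ord_at_mult: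
  assumes "z \<noteq> 0" "w \<noteq> 0"
  shows "ord_at y (z * w) = ord_at y z + ord_at y w"
proof -
  obtain p where p: "uniformizer y p" using uniformizer_exists by blast
  then have p0: "p \<noteq> 0" using uniformizer_related by blast
  obtain u v where u: "unit_at y u" "z = u * p powi ord_at y z" "unit_at y v" "w = v * p powi ord_at y w"
    using ord_at_unique[OF _ p] assms by metis
  have "z * w = (u * v) * p powi (ord_at y z + ord_at y w)"
    using p0 by (subst u(2), subst u(4)) (simp add: power_int_add ac_simps)
  then show ?thesis using ord_at_eqI[OF p unit_at_mult[OF u(1,3)]] by metis
qed

lemma ord_at_unit: "unit_at y u \<Longrightarrow> ord_at y u = 0"
  using uniformizer_exists[of y] ord_at_eqI[of y _ u 0] by auto

lemma ord_at_1 [simp]: "ord_at y 1 = 0"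
  by (simp add: ord_at_unit)

lemma ord_at_inverse: "ord_at y (inverse z) = - ord_at y z" if "z \<noteq> 0"
  using ord_at_mult[of z "inverse z" y] that by simp

lemma ord_at_divide: "ord_at y (z / w) = ord_at y z - ord_at y w" if "z \<noteq> 0" "w \<noteq> 0"
  using that by (simp add: divide_inverse ord_at_mult ord_at_inverse)

lemma ord_at_power: "ord_at y (z ^ n) = int n * ord_at y z" if "z \<noteq> 0"
  using that by (induction n) (auto simp: ord_at_mult algebra_simps)

lemma ord_at_power_int: "ord_at y (z powi n) = n * ord_at y z" if "z \<noteq> 0"
  using that by (auto simp: power_int_def ord_at_power ord_at_inverse)

lemma ord_at_uniformizer: "uniformizer y p \<Longrightarrow> p \<noteq> 0 \<and> ord_at y p = 1"
  using ord_at_eqI[of y p 1 1] uniformizer_related by auto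

lemma val_ring_iff_ord:
  assumes z: "z \<noteq> 0"
  shows "z \<in> val_ring y \<longleftrightarrow> ord_at y z \<ge> 0"
proof -
  have nn: "ord_at y z \<ge> 0 \<Longrightarrow> z \<in> val_ring y" if z: "z \<noteq> 0" for z
  proof -
    assume o: "ord_at y z \<ge> 0"
    obtain p where p: "uniformizer y p" using uniformizer_exists by blast
    then have pv: "p \<in> val_ring y"
      using uniformizer_in_max[OF p] by (simp add: max_at_def)
    obtain u where "unit_at y u" "z = u * p powi ord_at y z" using ord_at_unique[OF z p] by blast
    then have "z = u * p ^ nat (ord_at y z)" "unit_at y u" using o by (auto simp: power_int_def)
    then show "z \<in> val_ring y" using val_ring_power[OF pv] by (metis unit_at_def val_ring_mult)
  qed
  show ?thesis
  proof
    assume zv: "z \<in> val_ring y"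
    show "ord_at y z \<ge> 0"
    proof (rule ccontr)
      assume a: "\<not> ?thesis"
      then have "inverse z \<in> val_ring y" using nn[of "inverse z"] z by (simp add: ord_at_inverse)
      then have "ord_at y z = 0" using ord_at_unit[of y z] zv z by (simp add: unit_at_def)
      then show False using a by simp
    qed
  qed (use nn z in auto)
qed

lemma unit_at_iff_ord: "unit_at y u \<longleftrightarrow> u \<noteq> 0 \<and> ord_at y u = 0"
  by (auto simp: unit_at_def val_ring_iff_ord ord_at_inverse)

lemma max_at_iff_ord: "z \<in> max_at y \<longleftrightarrow> z = 0 \<or> ord_at y z \<ge> 1"
proof (cases "z = 0")
  case False
  then have "inverse z \<in> val_ring y \<longleftrightarrow> - ord_at y z \<ge> 0"
    using val_ring_iff_ord[of "inverse z" y] ord_at_inverse[of z y] by simp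
  then have "z \<in> max_at y \<longleftrightarrow> ord_at y z \<ge> 0 \<and> \<not> - ord_at y z \<ge> 0"
    unfolding max_at_def mem_Collect_eq val_ring_iff_ord[OF False] using False by metis
  then show ?thesis using False by linarith
qed (simp add: max_at_def)

lemma near_zero_0 [simp]: "near_zero y N 0"
  by (simp add: near_zero_def)

lemma near_zero_val_ring: "near_zero y 0 z \<longleftrightarrow> z \<in> val_ring y"
  by (cases "z = 0") (auto simp: near_zero_def val_ring_iff_ord)

lemma near_zero_mult: "near_zero y N z \<Longrightarrow> near_zero y M w \<Longrightarrow> near_zero y (N + M) (z * w)"
  by (cases "z = 0"; cases "w = 0") (auto simp: near_zero_def ord_at_mult)

lemma near_zero_mono: "near_zero y N z \<Longrightarrow> M \<le> N \<Longrightarrow> near_zero y M z"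
  by (auto simp: near_zero_def)

lemma near_zero_scale:
  assumes "c \<noteq> 0"
  shows "near_zero y N (c * z) \<longleftrightarrow> near_zero y (N - ord_at y c) z"
  using assms by (cases "z = 0") (auto simp: near_zero_def ord_at_mult)

text \<open>Scaling by a power of a uniformizer reduces the ultrametric inequality to the additivity of the
valuation ring.\<close>

lemma near_zero_add:
  assumes "near_zero y N z" "near_zero y N w"
  shows "near_zero y N (z + w)"
proof -
  obtain p where p: "p \<noteq> 0" "ord_at y p = 1" using uniformizer_exists ord_at_uniformizer by metis
  let ?c = "p powi (- N)"
  have c: "?c \<noteq> 0" "ord_at y ?c = - N" using p by (auto simp: ord_at_power_int)
  have *: "near_zero y N v \<longleftrightarrow> ?c * v \<in> val_ring y" for v
    using near_zero_scale[OF c(1), of y 0 v] c(2) by (simp add: near_zero_val_ring)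
  show ?thesis using assms val_ring_add unfolding * by (metis distrib_left)
qed

lemma ord_at_minus [simp]: "ord_at y (- z) = ord_at y z"
proof (cases "z = 0")
  case False
  have "unit_at y (- 1)" using unit_at_const[of "- 1" y] by (simp add: const_rf_minus)
  then show ?thesis using ord_at_mult[of "-1" z y] False ord_at_unit by fastforce
qed simp

lemma near_zero_minus [simp]: "near_zero y N (- z) \<longleftrightarrow> near_zero y N z"
  by (auto simp: near_zero_def)

lemma near_zero_diff: "near_zero y N z \<Longrightarrow> near_zero y N w \<Longrightarrow> near_zero y N (z - w)"
  using near_zero_add[of y N z "- w"] by simp

lemma near_zero_1: "near_zero y N 1 \<longleftrightarrow> N \<le> 0"
  by (auto simp: near_zero_def)

text \<open>The valuation is locally constant away from zero.\<close>

lemma ord_at_eq_of_near: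
  assumes "z \<noteq> 0" "near_zero y (ord_at y z + 1) (w - z)"
  shows "w \<noteq> 0 \<and> ord_at y w = ord_at y z"
proof -
  have "near_zero y (ord_at y z) w"
    using near_zero_add[OF near_zero_mono[OF assms(2)], of "ord_at y z" z] assms(1) by (simp add: near_zero_def)
  moreover have "\<not> near_zero y (ord_at y z + 1) w"
    using near_zero_diff[OF _ assms(2), of w] assms(1) by (auto simp: near_zero_def)
  ultimately show ?thesis by (auto simp: near_zero_def)
qed

section \<open>The places of the projective line and the product formula\<close>

lemma place_poly_ord:
  assumes P: "place_poly y \<tau> P" and A: "\<not> P dvd A"
  shows "ord_at y (ev \<tau> (P ^ k * A)) = int k"
proof -
  have "uniformizer y (ev \<tau> P)" by (rule place_poly_uniformizer[OF P])
  from ord_at_eqI[OF this place_poly_unit[OF P A], of "int k"]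
  show ?thesis by (simp add: ev_mult ev_power mult.commute)
qed

text \<open>The generator determines the valuation, and the valuation determines the valuation ring.\<close>

lemma place_poly_unique:
  assumes P: "place_poly y \<tau> P" and P': "place_poly y' \<tau> P"
  shows "y = y'"
proof -
  have pr: "prime_elem P" and g: "generator \<tau>" using P by (auto simp: place_poly_def)
  have ordA: "ord_at y (ev \<tau> A) = ord_at y' (ev \<tau> A)" if A0: "A \<noteq> 0" for A
  proof -
    obtain k B where B: "A = P ^ k * B" "\<not> P dvd B" using split_prime_power[OF A0 pr] by blast
    show ?thesis unfolding B(1) place_poly_ord[OF P B(2)] place_poly_ord[OF P' B(2)] ..
  qed
  have "z \<in> val_ring y \<longleftrightarrow> z \<in> val_ring y'" for z
  proof (cases "z = 0")
    case False
    obtain A B where AB: "B \<noteq> 0" "z = ev \<tau> A / ev \<tau> B" using generator_cases[OF g, of z] by metis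
    then have A: "A \<noteq> 0" using False by auto
    have "ord_at y z = ord_at y' z"
      using AB A g ordA by (simp add: ord_at_divide)
    then show ?thesis using val_ring_iff_ord[OF False] by metis
  qed simp
  then have "val_ring y = val_ring y'" by blast
  then show ?thesis by (simp add: val_ring_inject)
qed

lemma place_poly_assoc:
  assumes P: "place_poly y \<tau> P" and Q: "prime_elem Q" "P dvd Q"
  shows "place_poly y \<tau> Q"
proof -
  have pr: "prime_elem P" using P by (simp add: place_poly_def)
  obtain R where R: "Q = P * R" using Q(2) by blast
  have "Q dvd P \<or> Q dvd R" using Q(1) R by (metis dvd_refl prime_elem_dvd_mult_iff)
  moreover have "\<not> Q dvd R"
  proof
    assume "Q dvd R"
    then obtain S where "R = Q * S" by blast
    then have "Q * (P * S) = Q * 1" using R by (metis mult.left_commute mult.right_neutral)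
    then have "P * S = 1" using Q(1) by (metis mult_left_cancel prime_elem_not_zeroI)
    then show False using pr by (metis dvd_triv_left prime_elem_not_unit)
  qed
  ultimately have "Q dvd P" by blast
  then have "P dvd A \<longleftrightarrow> Q dvd A" for A using Q(2) dvd_trans by blast
  then show ?thesis using P Q(1) by (auto simp: place_poly_def)
qed

lemma prime_X: "prime_elem [:0, 1 :: 'k::field:]"
proof (rule prime_elemI)
  fix a b :: "'k poly" assume "[:0, 1:] dvd a * b"
  then have "poly (a * b) 0 = 0" by (simp add: dvd_iff_poly_eq_0)
  then show "[:0, 1:] dvd a \<or> [:0, 1:] dvd b" by (simp add: dvd_iff_poly_eq_0)
qed (auto simp: is_unit_iff_degree)

lemma place_poly_X:
  assumes "t_rf \<in> max_at y"
  shows "place_poly y t_rf [:0, 1:]"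
proof -
  have "t_rf \<in> val_ring y" using assms by (simp add: max_at_def)
  then obtain P where P: "place_poly y t_rf P" using place_poly_exists[OF generator_t] by blast
  have "ev t_rf [:0, 1:] \<in> max_at y" using assms by simp
  then have "P dvd [:0, 1:]" using P by (simp only: place_poly_def)
  then show ?thesis by (rule place_poly_assoc[OF P prime_X])
qed

lemma prime_poly_degree: "prime_elem P \<Longrightarrow> Polynomial.degree P > 0" for P :: "'k::field poly"
  using is_unit_iff_degree[of P] by (auto simp: prime_elem_def)

lemma prime_divisor_poly:
  fixes A :: "'k::field poly"
  assumes "Polynomial.degree A > 0"
  shows "\<exists>P. prime_elem P \<and> P dvd A"
proof -
  define S where "S = (\<lambda>P. P dvd A \<and> Polynomial.degree P > 0)"
  have "S A" using assms by (simp add: S_def)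
  from ex_has_least_nat[where P = S and m = Polynomial.degree, OF this]
  obtain P where P: "S P" and "\<forall>Q. S Q \<longrightarrow> Polynomial.degree P \<le> Polynomial.degree Q"
    by (elim exE conjE)
  then have least: "\<And>Q. Q dvd A \<Longrightarrow> Polynomial.degree Q > 0 \<Longrightarrow> Polynomial.degree P \<le> Polynomial.degree Q"
    unfolding S_def by simp
  have P: "P dvd A" "Polynomial.degree P > 0" using P by (simp_all add: S_def)
  have P0: "P \<noteq> 0" using P by auto
  have "Factorial_Ring.irreducible P"
  proof (rule Factorial_Ring.irreducibleI)
    show "\<not> is_unit P" using P P0 by (auto simp: is_unit_iff_degree)
    fix a b assume ab: "P = a * b"
    then have nz: "a \<noteq> 0" "b \<noteq> 0" using P0 by auto
    then have d: "Polynomial.degree P = Polynomial.degree a + Polynomial.degree b"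
      using ab by (simp add: degree_mult_eq)
    have "a dvd A" "b dvd A" using P ab by (auto intro: dvd_trans)
    then show "is_unit a \<or> is_unit b"
      using least[of a] least[of b] d nz by (auto simp: is_unit_iff_degree)
  qed (fact P0)
  then show ?thesis using P field_poly_irreducible_imp_prime by blast
qed

text \<open>Every prime polynomial comes from a place, namely from the localisation at
it. The product formula needs this, since each prime factor of a function has to be accounted for by some
place.\<close>

lemma prime_poly_place:
  fixes Q :: "'k::field poly"
  assumes g: "generator \<tau>" and Q: "prime_elem Q"
  shows "\<exists>y. place_poly y \<tau> Q"
proof -
  define V where "V = {ev \<tau> A / ev \<tau> B | A B. \<not> Q dvd B}"
  have mem: "ev \<tau> A / ev \<tau> B \<in> V" if "\<not> Q dvd B" for A B unfolding V_def using that by blast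
  have mem1: "ev \<tau> A \<in> V" for A
    using mem[of 1 A] Q by (simp add: prime_elem_def)
  have nz: "ev \<tau> B \<noteq> 0" if "\<not> Q dvd B" for B using that g by auto
  have "subring V F_ring"
  proof (rule ring.subringI[OF ring_from_type_algebra])
    show "V \<subseteq> carrier F_ring" by (simp add: ring_of_type_algebra_def)
    show "\<one>\<^bsub>F_ring\<^esub> \<in> V" using mem1[of 1] by (simp add: ring_of_type_algebra_def)
    fix h assume h: "h \<in> V"
    then obtain a b where ab: "h = ev \<tau> a / ev \<tau> b" "\<not> Q dvd b" unfolding V_def by blast
    then show "\<ominus>\<^bsub>F_ring\<^esub> h \<in> V" using mem[OF ab(2), of "- a"] by (simp add: a_inv_F_ring ev_minus)
    fix h' assume "h' \<in> V"
    then obtain c d where cd: "h' = ev \<tau> c / ev \<tau> d" "\<not> Q dvd d" unfolding V_def by blast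
    have bd: "\<not> Q dvd b * d" using ab cd Q by (simp add: prime_elem_dvd_mult_iff)
    show "h \<otimes>\<^bsub>F_ring\<^esub> h' \<in> V"
      using mem[OF bd, of "a * c"] ab(1) cd(1) by (simp add: ev_mult ring_of_type_algebra_def)
    have "h + h' = ev \<tau> (a * d + c * b) / ev \<tau> (b * d)"
      unfolding ab(1) cd(1) ev_mult ev_add by (rule add_frac_eq[OF nz[OF ab(2)] nz[OF cd(2)]])
    then show "h \<oplus>\<^bsub>F_ring\<^esub> h' \<in> V"
      using mem[OF bd, of "a * d + c * b"] by (simp add: ring_of_type_algebra_def)
  qed
  moreover have "range const_rf \<subseteq> V"
  proof
    fix z assume "z \<in> range (const_rf :: 'k \<Rightarrow> _)"
    then obtain c where "z = const_rf c" by blast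
    then show "z \<in> V" using mem1[of "[:c:]"] by simp
  qed
  moreover have inv: "inverse (ev \<tau> A) \<in> V \<longleftrightarrow> \<not> Q dvd A" if A: "A \<noteq> 0" for A
  proof
    assume "inverse (ev \<tau> A) \<in> V"
    then obtain a b where ab: "inverse (ev \<tau> A) = ev \<tau> a / ev \<tau> b" "\<not> Q dvd b" unfolding V_def by blast
    have "ev \<tau> b = ev \<tau> (A * a)" using ab nz[OF ab(2)] A g by (simp add: ev_mult field_simps)
    then have "ev \<tau> (b - A * a) = 0" by (simp add: ev_diff)
    then have "b = A * a" using g by simp
    then show "\<not> Q dvd A" using ab(2) by auto
  next
    assume "\<not> Q dvd A"
    then show "inverse (ev \<tau> A) \<in> V" using mem[of A 1] by (simp add: field_simps)
  qed
  moreover have "V \<noteq> UNIV" using inv[of Q] Q by (auto simp: prime_elem_def)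
  moreover have "z \<in> V \<or> inverse z \<in> V" for z
  proof (cases "z = 0")
    case True
    then show ?thesis using mem1[of 0] by simp
  next
    case False
    obtain A B where AB: "B \<noteq> 0" "z = ev \<tau> A / ev \<tau> B" using generator_cases[OF g, of z] by metis
    then have A0: "A \<noteq> 0" using False by auto
    obtain k a where a: "A = Q ^ k * a" "\<not> Q dvd a" using split_prime_power[OF A0 Q] by blast
    obtain l b where b: "B = Q ^ l * b" "\<not> Q dvd b" using split_prime_power[OF AB(1) Q] by blast
    have Q0: "ev \<tau> Q \<noteq> 0" using g Q by (simp add: prime_elem_def)
    show ?thesis
    proof (cases "l \<le> k")
      case True
      have "ev \<tau> Q ^ k = ev \<tau> Q ^ l * ev \<tau> Q ^ (k - l)" using True by (simp flip: power_add)
      then have "z = ev \<tau> (Q ^ (k - l) * a) / ev \<tau> b"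
        using AB(2) a b Q0 nz[OF b(2)] by (simp add: ev_mult ev_power field_simps)
      then show ?thesis using mem[OF b(2)] by blast
    next
      case False
      have "ev \<tau> Q ^ l = ev \<tau> Q ^ k * ev \<tau> Q ^ (l - k)" using False by (simp flip: power_add)
      then have "inverse z = ev \<tau> (Q ^ (l - k) * b) / ev \<tau> a"
        using AB(2) a b Q0 nz[OF a(2)] by (simp add: ev_mult ev_power field_simps)
      then show ?thesis using mem[OF a(2)] by metis
    qed
  qed
  ultimately have "valuation_ring V" unfolding valuation_ring_def by blast
  then have v: "val_ring (Abs_place V) = V" by (simp add: Abs_place_inverse)
  have "\<tau> \<in> V" using mem1[of "[:0, 1:]"] by simp
  moreover have "ev \<tau> A \<in> max_at (Abs_place V) \<longleftrightarrow> Q dvd A" for A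
    using inv[of A] mem1[of A] g by (cases "A = 0") (auto simp: max_at_def v)
  ultimately show ?thesis using g Q v unfolding place_poly_def by metis
qed

definition s_rf :: "'k::field ratfun" where "s_rf = inverse t_rf"

lemma generator_s [simp]: "generator s_rf"
  unfolding s_rf_def by (rule generator_inverse_t)

lemma finite_polys: "finite {C :: 'k::{field,finite} poly. Polynomial.degree C < n}"
  and card_polys: "n > 0 \<Longrightarrow> card {C :: 'k::{field,finite} poly. Polynomial.degree C < n} = CARD('k) ^ n"
proof -
  let ?L = "{xs :: 'k list. length xs = n}"
  have L: "finite ?L" "card ?L = CARD('k) ^ n"
    using finite_lists_length_eq[of "UNIV :: 'k set" n] card_lists_length_eq[of "UNIV :: 'k set" n] by auto
  let ?f = "\<lambda>C :: 'k poly. map (Polynomial.coeff C) [0..<n]"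
  have inj: "inj_on ?f {C. Polynomial.degree C < n}"
  proof (rule inj_onI)
    fix C D assume a: "C \<in> {C. Polynomial.degree C < n}" "D \<in> {C. Polynomial.degree C < n}" "?f C = ?f D"
    show "C = D"
    proof (rule poly_eqI)
      fix i show "Polynomial.coeff C i = Polynomial.coeff D i"
      proof (cases "i < n")
        case True
        then show ?thesis using arg_cong[OF a(3), of "\<lambda>xs. xs ! i"] by simp
      next
        case False
        then show ?thesis using a(1,2) by (simp add: Polynomial.coeff_eq_0)
      qed
    qed
  qed
  have sub: "?f ` {C. Polynomial.degree C < n} \<subseteq> ?L" by auto
  show "finite {C :: 'k poly. Polynomial.degree C < n}"
    using inj sub L(1) by (meson finite_imageD finite_subset)
  assume n: "n > 0"
  have "?L \<subseteq> ?f ` {C. Polynomial.degree C < n}"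
  proof
    fix xs assume xs: "xs \<in> ?L"
    let ?C = "Poly xs"
    have "Polynomial.degree ?C < n"
      using xs n by (intro degree_lessI) (auto simp: nth_default_def)
    moreover have "?f ?C = xs"
      using xs by (intro nth_equalityI) (auto simp: nth_default_def)
    ultimately show "xs \<in> ?f ` {C. Polynomial.degree C < n}" by (metis (mono_tags, lifting) image_eqI mem_Collect_eq)
  qed
  then have "?f ` {C. Polynomial.degree C < n} = ?L" using sub by blast
  then show "card {C :: 'k poly. Polynomial.degree C < n} = CARD('k) ^ n"
    using card_image[OF inj] L(2) by simp
qed

text \<open>The residue field is represented by the polynomials of degree below that of the generator: as there are
finitely many of them, multiplication by a denominator prime to the generator permutes them, which
allows to divide by it.\<close>

lemma place_poly_residue:
  fixes P :: "'k::{field,finite} poly"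
  assumes P: "place_poly y \<tau> P" and z: "z \<in> val_ring y"
  shows "\<exists>C. Polynomial.degree C < Polynomial.degree P \<and> near_zero y 1 (z - ev \<tau> C)"
proof -
  have pr: "prime_elem P" and g: "generator \<tau>" and \<tau>: "\<tau> \<in> val_ring y"
    and dvd: "\<And>A. ev \<tau> A \<in> max_at y \<longleftrightarrow> P dvd A"
    using P by (auto simp: place_poly_def)
  have P0: "P \<noteq> 0" using pr by auto
  have dP: "Polynomial.degree P > 0" using pr by (rule prime_poly_degree)
  have small: "A = 0" if "P dvd A" "Polynomial.degree A < Polynomial.degree P" for A
    using that dvd_imp_degree_le[of P A] by auto
  have modlt: "Polynomial.degree (A mod P) < Polynomial.degree P" for A
    using degree_mod_less[OF P0, of A] dP by auto
  obtain A B where AB: "z = ev \<tau> A / ev \<tau> B" "\<not> P dvd B"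
  proof -
    obtain A B where AB: "B \<noteq> 0" "z = ev \<tau> A / ev \<tau> B" using generator_cases[OF g, of z] by metis
    show thesis
    proof (cases "z = 0")
      case True
      then show thesis using that[of 0 1] pr by (simp add: prime_elem_def)
    next
      case False
      then have A0: "A \<noteq> 0" using AB by auto
      obtain k a where a: "A = P ^ k * a" "\<not> P dvd a" using split_prime_power[OF A0 pr] by blast
      obtain l b where b: "B = P ^ l * b" "\<not> P dvd b" using split_prime_power[OF AB(1) pr] by blast
      have "ord_at y z = int k - int l"
        using AB A0 g place_poly_ord[OF P a(2), of k] place_poly_ord[OF P b(2), of l] a(1) b(1)
        by (simp add: ord_at_divide)
      then have "l \<le> k" using z False by (simp add: val_ring_iff_ord)
      then have "ev \<tau> P ^ k = ev \<tau> P ^ l * ev \<tau> P ^ (k - l)" by (simp flip: power_add)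
      moreover have "ev \<tau> b \<noteq> 0" "ev \<tau> P \<noteq> 0" using b(2) g P0 by auto
      ultimately have "z = ev \<tau> (P ^ (k - l) * a) / ev \<tau> b"
        using AB(2) a b by (simp add: ev_mult ev_power field_simps)
      then show thesis using that b(2) by blast
    qed
  qed
  let ?S = "{C :: 'k poly. Polynomial.degree C < Polynomial.degree P}"
  have "inj_on (\<lambda>C. (B * C) mod P) ?S"
  proof (rule inj_onI)
    fix C D assume CD: "C \<in> ?S" "D \<in> ?S" "B * C mod P = B * D mod P"
    then have "P dvd B * (C - D)" by (simp add: mod_eq_dvd_iff right_diff_distrib)
    then have "P dvd C - D" using pr AB(2) by (simp add: prime_elem_dvd_mult_iff)
    moreover have "Polynomial.degree (C - D) < Polynomial.degree P"
      using CD degree_diff_less[of C "Polynomial.degree P" D] by simp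
    ultimately show "C = D" using small by fastforce
  qed
  moreover have "(\<lambda>C. (B * C) mod P) ` ?S \<subseteq> ?S" using modlt by auto
  ultimately have "(\<lambda>C. (B * C) mod P) ` ?S = ?S"
    using endo_inj_surj[OF finite_polys] by blast
  then obtain C where C: "C \<in> ?S" "B * C mod P = A mod P" using modlt[of A] by (metis (mono_tags, lifting) image_iff mem_Collect_eq)
  have "P dvd A - B * C" using C(2) mod_eq_dvd_iff[of A P "B * C"] by simp
  then have m: "ev \<tau> (A - B * C) \<in> max_at y" using dvd by blast
  have u: "unit_at y (ev \<tau> B)" by (rule place_poly_unit[OF P AB(2)])
  then have "z - ev \<tau> C = ev \<tau> (A - B * C) * inverse (ev \<tau> B)"
    using AB(1) by (simp add: ev_diff ev_mult unit_at_def field_simps)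
  then have "z - ev \<tau> C \<in> max_at y" using max_at_mult[OF m, of "inverse (ev \<tau> B)"] u by (simp add: unit_at_def)
  then have "near_zero y 1 (z - ev \<tau> C)" by (simp add: max_at_iff_ord near_zero_def)
  then show ?thesis using C by blast
qed

lemma place_poly_residue_unique:
  assumes P: "place_poly y \<tau> P"
    and C: "Polynomial.degree C < Polynomial.degree P" "Polynomial.degree D < Polynomial.degree P"
    and n: "near_zero y 1 (ev \<tau> C - ev \<tau> D)"
  shows "C = D"
proof -
  have "ev \<tau> (C - D) \<in> max_at y" using n by (simp add: ev_diff max_at_iff_ord near_zero_def)
  then have "P dvd C - D" using P by (simp add: place_poly_def)
  moreover have "Polynomial.degree (C - D) < Polynomial.degree P" by (rule degree_diff_less[OF C])
  ultimately show ?thesis using dvd_imp_degree_le[of P "C - D"] by fastforce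
qed

text \<open>Hensel-style expansion: residues are removed one power of the uniformizer at a time, with polynomials as
digits.\<close>

lemma place_poly_residue_power:
  fixes P :: "'k::{field,finite} poly"
  assumes P: "place_poly y \<tau> P" and z: "z \<in> val_ring y"
  shows "\<exists>C. near_zero y (int m) (z - ev \<tau> C)"
proof (induction m)
  case 0
  show ?case using z by (intro exI[of _ 0]) (simp add: near_zero_val_ring)
next
  case (Suc m)
  then obtain C where C: "near_zero y (int m) (z - ev \<tau> C)" by blast
  let ?p = "ev \<tau> P"
  have p: "?p \<noteq> 0" "ord_at y ?p = 1" using ord_at_uniformizer[OF place_poly_uniformizer[OF P]] by auto
  let ?w = "(z - ev \<tau> C) / ?p ^ m"
  have zw: "z - ev \<tau> C = ?p ^ m * ?w" using p by simp
  have pm: "?p ^ m \<noteq> 0" "ord_at y (?p ^ m) = int m" using p by (auto simp: ord_at_power)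
  have "?w \<in> val_ring y" using C near_zero_scale[OF pm(1), of y "int m" ?w] zw pm(2)
    by (simp add: near_zero_val_ring)
  then obtain D where D: "near_zero y 1 (?w - ev \<tau> D)" using place_poly_residue[OF P] by blast
  have "z - ev \<tau> (C + P ^ m * D) = ?p ^ m * (?w - ev \<tau> D)"
    using zw by (simp add: ev_add ev_mult ev_power algebra_simps)
  then have "near_zero y (int (Suc m)) (z - ev \<tau> (C + P ^ m * D))"
    using D near_zero_scale[OF pm(1), of y "int (Suc m)"] pm(2) by simp
  then show ?case by blast
qed

text \<open>The distinguished place is the one where $t$ vanishes. With $s = 1/t$, the functions that are
regular away from $x$ are the polynomials in $s$, and the other places correspond to the prime
polynomials in $s$.\<close>

locale rational_place =
  fixes x :: "'k::{field,finite} place"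
  assumes uniformizer_x: "uniformizer x t_rf"
begin

lemma place_poly_x: "place_poly x t_rf [:0, 1:]"
  by (rule place_poly_X[OF uniformizer_in_max[OF uniformizer_x]])

lemma ord_x_t [simp]: "ord_at x t_rf = 1"
  using ord_at_uniformizer[OF uniformizer_x] by simp

lemma s_in_val_ring_iff: "s_rf \<in> val_ring y \<longleftrightarrow> y \<noteq> x"
proof
  assume "y \<noteq> x"
  show "s_rf \<in> val_ring y"
  proof (rule ccontr)
    assume a: "\<not> ?thesis"
    then have "t_rf \<in> max_at y" using val_ring_total[of t_rf y] by (auto simp: max_at_def s_rf_def)
    then have "place_poly y t_rf [:0, 1:]" by (rule place_poly_X)
    then show False using place_poly_unique[OF _ place_poly_x] \<open>y \<noteq> x\<close> by blast
  qed
next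
  assume "s_rf \<in> val_ring y"
  moreover have "s_rf \<notin> val_ring x" by (simp add: val_ring_iff_ord ord_at_inverse s_rf_def)
  ultimately show "y \<noteq> x" by blast
qed

lemma place_poly_ne: "place_poly y s_rf P \<Longrightarrow> y \<noteq> x"
  using s_in_val_ring_iff by (auto simp: place_poly_def)

lemma place_poly_s: "y \<noteq> x \<Longrightarrow> \<exists>P. place_poly y s_rf P"
  using place_poly_exists[OF generator_s] s_in_val_ring_iff by blast

text \<open>A polynomial of degree $n$ in $s = 1/t$ is $t^{-n}$ times the reversed polynomial in $t$, whose
constant term is the former leading coefficient and thus nonzero.\<close>

lemma ord_x_ev:
  assumes "A \<noteq> 0"
  shows "ord_at x (ev s_rf A) = - int (Polynomial.degree A)"
proof -
  have "\<not> [:0, 1:] dvd reflect_poly A" using assms by (simp add: dvd_iff_poly_eq_0)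
  then have u: "unit_at x (ev t_rf (reflect_poly A))" by (rule place_poly_unit[OF place_poly_x])
  then show ?thesis
    by (simp add: s_rf_def ev_inverse ord_at_divide ord_at_power ord_at_unit[OF u] unit_at_def)
qed

lemma place_poly_other:
  assumes P: "place_poly y s_rf P" and y': "y' \<noteq> x" "y' \<noteq> y"
  shows "ord_at y' (ev s_rf P) = 0"
proof -
  obtain P' where P': "place_poly y' s_rf P'" using place_poly_s y' by blast
  have "\<not> P' dvd P"
  proof
    assume "P' dvd P"
    then have "place_poly y' s_rf P" using place_poly_assoc[OF P'] P by (auto simp: place_poly_def)
    then show False using place_poly_unique[OF P] y' by blast
  qed
  from place_poly_unit[OF P' this] show ?thesis by (rule ord_at_unit)
qed

definition prime_at :: "'k place \<Rightarrow> 'k poly" where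
  "prime_at y = (SOME P. place_poly y s_rf P)"

lemma prime_at: "y \<noteq> x \<Longrightarrow> place_poly y s_rf (prime_at y)"
  unfolding prime_at_def using place_poly_s by (rule someI_ex)

text \<open>The degree of a place in terms of its polynomial. It is shown below to agree with the dimension of
the residue field of the completion.\<close>

definition deg_at :: "'k place \<Rightarrow> nat" where
  "deg_at y = (if y = x then 1 else Polynomial.degree (prime_at y))"

lemma deg_at_pos: "deg_at y > 0"
  using prime_at prime_poly_degree by (auto simp: deg_at_def place_poly_def)

lemma deg_at_poly: "place_poly y s_rf P \<Longrightarrow> deg_at y = Polynomial.degree P"
proof -
  assume P: "place_poly y s_rf P"
  then have y: "y \<noteq> x" by (rule place_poly_ne)
  have Q: "place_poly y s_rf (prime_at y)" by (rule prime_at[OF y])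
  have "prime_at y dvd P" "P dvd prime_at y" using P Q unfolding place_poly_def by (metis dvd_refl)+
  then have "Polynomial.degree P = Polynomial.degree (prime_at y)"
    by (intro antisym dvd_imp_degree_le place_poly_nonzero[OF P] place_poly_nonzero[OF Q])
  then show ?thesis using y by (simp add: deg_at_def)
qed

text \<open>Both sides are additive in $z$, which reduces the claim to a prime polynomial in $s$. It has
valuation 1 at its own place and minus its degree at $x$, where the degree is 1.\<close>

lemma product_formula:
  assumes "z \<noteq> 0"
  shows "finite {y. ord_at y z \<noteq> 0} \<and> (\<Sum>y | ord_at y z \<noteq> 0. int (deg_at y) * ord_at y z) = 0"
proof -
  let ?PF = "\<lambda>z. finite {y. ord_at y z \<noteq> 0} \<and> (\<Sum>y | ord_at y z \<noteq> 0. int (deg_at y) * ord_at y z) = 0"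
  have sup: "(\<Sum>y | ord_at y z \<noteq> 0. int (deg_at y) * ord_at y z) = (\<Sum>y\<in>S. int (deg_at y) * ord_at y z)"
    if "finite S" "{y. ord_at y z \<noteq> 0} \<subseteq> S" for z S
    using that by (intro sum.mono_neutral_left) auto
  have quot: "?PF (z / w)" if "?PF z" "?PF w" "z \<noteq> 0" "w \<noteq> 0" for z w
  proof -
    let ?S = "{y. ord_at y z \<noteq> 0} \<union> {y. ord_at y w \<noteq> 0}"
    have S: "finite ?S" using that by auto
    have sub: "{y. ord_at y (z / w) \<noteq> 0} \<subseteq> ?S" using that by (auto simp: ord_at_divide)
    have "(\<Sum>y | ord_at y (z / w) \<noteq> 0. int (deg_at y) * ord_at y (z / w)) = (\<Sum>y\<in>?S. int (deg_at y) * ord_at y (z / w))"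
      by (rule sup[OF S sub])
    also have "\<dots> = (\<Sum>y\<in>?S. int (deg_at y) * ord_at y z) - (\<Sum>y\<in>?S. int (deg_at y) * ord_at y w)"
      using that by (simp add: ord_at_divide right_diff_distrib sum_subtractf)
    also have "\<dots> = 0" using sup[OF S, of z] sup[OF S, of w] that by auto
    finally show ?thesis using finite_subset[OF sub S] by simp
  qed
  have prime: "?PF (ev s_rf Q)" if Q: "prime_elem Q" for Q
  proof -
    obtain y where y: "place_poly y s_rf Q" using prime_poly_place[OF generator_s Q] by blast
    have yx: "y \<noteq> x" by (rule place_poly_ne[OF y])
    have sub: "{y. ord_at y (ev s_rf Q) \<noteq> 0} \<subseteq> {x, y}" using place_poly_other[OF y] by auto
    have "ord_at y (ev s_rf Q) = 1" using ord_at_uniformizer[OF place_poly_uniformizer[OF y]] by simp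
    moreover have "ord_at x (ev s_rf Q) = - int (Polynomial.degree Q)"
      using Q by (intro ord_x_ev) auto
    moreover have "deg_at x = 1" by (simp add: deg_at_def)
    ultimately have "(\<Sum>y\<in>{x, y}. int (deg_at y) * ord_at y (ev s_rf Q)) = 0"
      using yx deg_at_poly[OF y] by simp
    then show ?thesis using sup[OF _ sub] finite_subset[OF sub] by simp
  qed
  have one: "?PF 1" by simp
  have prod: "?PF (z * w)" if "?PF z" "?PF w" "z \<noteq> 0" "w \<noteq> 0" for z w
    using quot[of z "1 / w"] quot[OF one that(2)] that by simp
  have poly: "?PF (ev s_rf A)" if "A \<noteq> 0" for A
    using that
  proof (induction "Polynomial.degree A" arbitrary: A rule: less_induct)
    case less
    show ?case
    proof (cases "Polynomial.degree A > 0")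
      case True
      then obtain Q where Q: "prime_elem Q" "Q dvd A" using prime_divisor_poly by blast
      then obtain B where B: "A = Q * B" by blast
      have nz: "Q \<noteq> 0" "B \<noteq> 0" using B less.prems by auto
      have "Polynomial.degree B < Polynomial.degree A"
        using B nz prime_poly_degree[OF Q(1)] by (simp add: degree_mult_eq)
      then have "?PF (ev s_rf B)" using less.hyps nz by blast
      from prod[OF prime[OF Q(1)] this] show ?thesis
        using nz by (simp add: B ev_mult)
    next
      case False
      then obtain c where c: "A = [:c:]" using degree_eq_zeroE by blast
      then have "ord_at y (ev s_rf A) = 0" for y
        using less.prems by (simp add: ord_at_unit unit_at_const)
      then show ?thesis by simp
    qed
  qed
  obtain A B where AB: "B \<noteq> 0" "z = ev s_rf A / ev s_rf B" using generator_cases[OF generator_s, of z] by metis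
  then have "A \<noteq> 0" using assms by auto
  then show ?thesis using quot[OF poly poly] AB by simp
qed

lemma finite_ord: "z \<noteq> 0 \<Longrightarrow> finite {y :: 'k place. ord_at y z \<noteq> 0}"
  using product_formula[of z] by simp

text \<open>Each place other than $x$ has a uniformizer that is a unit at all places except itself and $x$, so
valuations away from $x$ can be prescribed independently.\<close>

lemma ideles_class_number_one:
  assumes nz: "\<And>y. a y \<noteq> 0" and fin: "finite {y. ord_at y (a y) \<noteq> 0}"
  shows "\<exists>z. z \<noteq> 0 \<and> (\<forall>y. y \<noteq> x \<longrightarrow> ord_at y z = ord_at y (a y))"
proof -
  let ?S = "{y. ord_at y (a y) \<noteq> 0} - {x}"
  let ?p = "\<lambda>y. ev s_rf (prime_at y)"
  have S: "finite ?S" using fin by simp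
  have p0: "?p y \<noteq> 0" if "y \<noteq> x" for y
    using ord_at_uniformizer[OF place_poly_uniformizer[OF prime_at[OF that]]] by simp
  have p1: "ord_at y' (?p y) = (if y = y' then 1 else 0)" if "y \<noteq> x" "y' \<noteq> x" for y y'
    using ord_at_uniformizer[OF place_poly_uniformizer[OF prime_at[OF that(1)]]]
      place_poly_other[OF prime_at[OF that(1)] that(2)] by auto
  have *: "T \<subseteq> ?S \<Longrightarrow> (\<Prod>y\<in>T. ?p y powi ord_at y (a y)) \<noteq> 0 \<and>
     (\<forall>y'. y' \<noteq> x \<longrightarrow> ord_at y' (\<Prod>y\<in>T. ?p y powi ord_at y (a y)) = (if y' \<in> T then ord_at y' (a y') else 0))"
    if "finite T" for T
    using that
  proof (induction T)
    case (insert y T)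
    have y: "y \<noteq> x" using insert.prems by blast
    have nz': "?p y powi ord_at y (a y) \<noteq> 0" using p0[OF y] by simp
    let ?R = "\<Prod>y\<in>T. ?p y powi ord_at y (a y)"
    have IH: "?R \<noteq> 0" "\<And>y'. y' \<noteq> x \<Longrightarrow> ord_at y' ?R = (if y' \<in> T then ord_at y' (a y') else 0)"
      using insert.IH insert.prems by simp_all
    have e: "(\<Prod>y\<in>insert y T. ?p y powi ord_at y (a y)) = ?p y powi ord_at y (a y) * ?R"
      using insert.hyps by simp
    have "ord_at y' (?p y powi ord_at y (a y) * ?R) = (if y' \<in> insert y T then ord_at y' (a y') else 0)"
      if y': "y' \<noteq> x" for y'
      using insert.hyps(2) p1[OF y y'] IH(2)[OF y']
      by (auto simp: ord_at_mult[OF nz' IH(1)] ord_at_power_int[OF p0[OF y]])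
    then show ?case unfolding e using nz' IH(1) by simp
  qed simp
  from *[OF S] show ?thesis by (intro exI[of _ "\<Prod>y\<in>?S. ?p y powi ord_at y (a y)"]) auto
qed

lemma ev_in_val_ring: "y \<noteq> x \<Longrightarrow> ev s_rf A \<in> val_ring y"
  using s_in_val_ring_iff val_ring_ev by blast

text \<open>The principal part of $b$ at $y$ can be realised by a function whose only poles are at $y$ and $x$:
expand $b\pi^m$ up to order $m$ with polynomials in $s$ as digits.\<close>

lemma strong_approximation_one:
  assumes y: "y \<noteq> x"
  shows "\<exists>\<beta>. b - \<beta> \<in> val_ring y \<and> (\<forall>y'. y' \<noteq> x \<longrightarrow> y' \<noteq> y \<longrightarrow> \<beta> \<in> val_ring y')"
proof (cases "b \<in> val_ring y")
  case False
  then have b0: "b \<noteq> 0" by auto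
  let ?p = "ev s_rf (prime_at y)"
  note P = prime_at[OF y]
  have p: "?p \<noteq> 0" "ord_at y ?p = 1" using ord_at_uniformizer[OF place_poly_uniformizer[OF P]] by auto
  define m where "m = nat (- ord_at y b)"
  have "ord_at y b = - int m" using False b0 by (simp add: m_def val_ring_iff_ord)
  then have "b * ?p ^ m \<in> val_ring y" using b0 p by (simp add: val_ring_iff_ord ord_at_mult ord_at_power)
  then obtain C where C: "near_zero y (int m) (b * ?p ^ m - ev s_rf C)"
    using place_poly_residue_power[OF P] by blast
  let ?\<beta> = "ev s_rf C / ?p ^ m"
  have pm: "?p ^ m \<noteq> 0" "ord_at y (?p ^ m) = int m" using p by (auto simp: ord_at_power)
  have "?p ^ m * (b - ?\<beta>) = b * ?p ^ m - ev s_rf C" using p by (simp add: field_simps)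
  then have "b - ?\<beta> \<in> val_ring y"
    using C near_zero_scale[OF pm(1), of y "int m" "b - ?\<beta>"] pm(2) by (simp add: near_zero_val_ring)
  moreover have "?\<beta> \<in> val_ring y'" if "y' \<noteq> x" "y' \<noteq> y" for y'
  proof -
    have "unit_at y' ?p" using place_poly_other[OF P that] p by (simp add: unit_at_iff_ord)
    then have "inverse ?p \<in> val_ring y'" by (simp add: unit_at_def)
    then show ?thesis
      using val_ring_mult[OF ev_in_val_ring[OF that(1)] val_ring_power[of "inverse ?p" y' m], of C]
      by (simp add: divide_inverse power_inverse)
  qed
  ultimately show ?thesis by blast
qed (auto intro!: exI[of _ 0])

text \<open>Division with remainder: the polar part at $x$, including the constant term, is a polynomial in $s$.
This expresses that $H^1$ of $\mathcal{O}(-1)$ on $\mathbb{P}^1$ vanishes.\<close>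

lemma near_x_poly: "\<exists>A. near_zero x 1 (w - ev s_rf A)"
proof -
  obtain A B where AB: "B \<noteq> 0" "w = ev s_rf A / ev s_rf B" using generator_cases[OF generator_s, of w] by metis
  have "A = B * (A div B) + A mod B" by simp
  then have "ev s_rf A = ev s_rf B * ev s_rf (A div B) + ev s_rf (A mod B)" by (metis ev_add ev_mult)
  then have e: "w - ev s_rf (A div B) = ev s_rf (A mod B) / ev s_rf B"
    using AB by (simp add: field_simps)
  have "near_zero x 1 (ev s_rf (A mod B) / ev s_rf B)"
  proof (cases "A mod B = 0")
    case False
    then have "Polynomial.degree (A mod B) < Polynomial.degree B" using degree_mod_less[OF AB(1), of A] by auto
    then show ?thesis using False AB(1)
      by (simp add: near_zero_def ord_at_divide ord_x_ev)
  qed simp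
  then show ?thesis using e by metis
qed

text \<open>Principal parts away from $x$ are removed one place at a time. What then remains at $x$ is removed by a
polynomial in $s$, which is integral at all other places.\<close>

lemma strong_approximation:
  assumes fin: "finite {y. b y \<notin> val_ring y}"
  shows "\<exists>\<beta>. (\<forall>y. y \<noteq> x \<longrightarrow> b y - \<beta> \<in> val_ring y) \<and> near_zero x 1 (b x - \<beta>)"
proof -
  let ?S = "{y. b y \<notin> val_ring y} - {x}"
  have "\<exists>\<beta>. \<forall>y. y \<noteq> x \<longrightarrow> y \<in> T \<or> b y \<in> val_ring y \<longrightarrow> b y - \<beta> \<in> val_ring y"
    if "finite T" "T \<subseteq> ?S" for T
  proof -
    have "\<exists>\<beta>. \<forall>y. y \<noteq> x \<longrightarrow> (if y \<in> T then b y - \<beta> \<in> val_ring y else \<beta> \<in> val_ring y)"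
      using that
    proof (induction T)
      case empty
      show ?case by (auto intro!: exI[of _ 0])
    next
      case (insert y T)
      then obtain \<beta> where \<beta>: "\<And>y. y \<noteq> x \<Longrightarrow> (if y \<in> T then b y - \<beta> \<in> val_ring y else \<beta> \<in> val_ring y)" by blast
      have y: "y \<noteq> x" using insert.prems by blast
      obtain \<gamma> where \<gamma>: "b y - \<beta> - \<gamma> \<in> val_ring y" "\<And>y'. y' \<noteq> x \<Longrightarrow> y' \<noteq> y \<Longrightarrow> \<gamma> \<in> val_ring y'"
        using strong_approximation_one[OF y, of "b y - \<beta>"] by blast
      have "if y' \<in> insert y T then b y' - (\<beta> + \<gamma>) \<in> val_ring y' else (\<beta> + \<gamma>) \<in> val_ring y'" if y': "y' \<noteq> x" for y'
      proof (cases "y' = y")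
        case True
        then show ?thesis using \<gamma>(1) by (simp add: diff_diff_eq)
      next
        case False
        then have g: "\<gamma> \<in> val_ring y'" using \<gamma>(2) y' by blast
        have "b y' - (\<beta> + \<gamma>) = (b y' - \<beta>) + (- \<gamma>)" by simp
        then show ?thesis using g val_ring_minus[OF g] \<beta>[OF y'] False val_ring_add by (metis insert_iff)
      qed
      then show ?case by blast
    qed
    then obtain \<beta> where \<beta>: "\<And>y. y \<noteq> x \<Longrightarrow> (if y \<in> T then b y - \<beta> \<in> val_ring y else \<beta> \<in> val_ring y)" by blast
    have "b y - \<beta> \<in> val_ring y" if "y \<noteq> x" "y \<in> T \<or> b y \<in> val_ring y" for y
      using \<beta>[OF that(1)] that(2) val_ring_add[OF _ val_ring_minus, of "b y" y \<beta>] by (auto split: if_splits)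
    then show ?thesis by blast
  qed
  from this[of ?S] obtain \<beta> where \<beta>: "\<And>y. y \<noteq> x \<Longrightarrow> b y - \<beta> \<in> val_ring y" using fin by auto
  obtain A where A: "near_zero x 1 (b x - \<beta> - ev s_rf A)" using near_x_poly by blast
  have "b y - (\<beta> + ev s_rf A) \<in> val_ring y" if "y \<noteq> x" for y
    using val_ring_add[OF \<beta>[OF that] val_ring_minus[OF ev_in_val_ring[OF that]]] by (simp add: diff_diff_eq)
  then show ?thesis using A by (intro exI[of _ "\<beta> + ev s_rf A"]) (auto simp: diff_diff_eq)
qed

end

section \<open>Completions\<close>

abbreviation \<F> :: "'k::field place \<Rightarrow> 'k local ring" where "\<F> \<equiv> completion"

lemma near_zero_exists: "\<exists>B. near_zero y B z"
  by (cases "z = 0") (auto simp: near_zero_def)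

text \<open>In the presence of the ultrametric inequality a sequence is Cauchy as soon as it is eventually within any
given distance of some element of $F$. In this form the density of $F$ in its completion is
visible.\<close>

lemma cauchy_carrier:
  "s \<in> carrier (cauchy_ring y) \<longleftrightarrow> (\<forall>N. \<exists>c. \<forall>\<^sub>F n in sequentially. near_zero y N (s n - c))"
proof
  assume s: "s \<in> carrier (cauchy_ring y)"
  show "\<forall>N. \<exists>c. \<forall>\<^sub>F n in sequentially. near_zero y N (s n - c)"
  proof
    fix N
    have "\<forall>N. \<exists>M. \<forall>m\<ge>M. \<forall>n\<ge>M. near_zero y N (s m - s n)" using s by (simp add: cauchy_ring_def)
    then obtain M where "\<forall>m\<ge>M. \<forall>n\<ge>M. near_zero y N (s m - s n)" by blast
    then have "\<forall>n\<ge>M. near_zero y N (s n - s M)" by simp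
    then show "\<exists>c. \<forall>\<^sub>F n in sequentially. near_zero y N (s n - c)"
      unfolding eventually_sequentially by blast
  qed
next
  assume s: "\<forall>N. \<exists>c. \<forall>\<^sub>F n in sequentially. near_zero y N (s n - c)"
  have "\<exists>M. \<forall>m\<ge>M. \<forall>n\<ge>M. near_zero y N (s m - s n)" for N
  proof -
    obtain c M where M: "\<forall>n\<ge>M. near_zero y N (s n - c)" using s unfolding eventually_sequentially by meson
    have "near_zero y N (s m - s n)" if "m \<ge> M" "n \<ge> M" for m n
      using near_zero_diff[of y N "s m - c" "s n - c"] M that by simp
    then show ?thesis by blast
  qed
  then show "s \<in> carrier (cauchy_ring y)" by (simp add: cauchy_ring_def)
qed

lemma null_ideal_iff: "s \<in> null_ideal y \<longleftrightarrow> (\<forall>N. \<forall>\<^sub>F n in sequentially. near_zero y N (s n))"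
  by (simp add: null_ideal_def eventually_sequentially)

lemma cauchy_ops [simp]:
  "s \<otimes>\<^bsub>cauchy_ring y\<^esub> r = (\<lambda>n. s n * r n)" "s \<oplus>\<^bsub>cauchy_ring y\<^esub> r = (\<lambda>n. s n + r n)"
  "\<one>\<^bsub>cauchy_ring y\<^esub> = (\<lambda>n. 1)" "\<zero>\<^bsub>cauchy_ring y\<^esub> = (\<lambda>n. 0)"
  by (simp_all add: cauchy_ring_def)

lemma cauchy_const [simp]: "(\<lambda>n. z) \<in> carrier (cauchy_ring y)"
  unfolding cauchy_carrier by (auto intro!: exI[of _ z])

lemma cauchy_bounded:
  assumes "s \<in> carrier (cauchy_ring y)"
  shows "\<exists>B. \<forall>\<^sub>F n in sequentially. near_zero y B (s n)"
proof -
  obtain c where c: "\<forall>\<^sub>F n in sequentially. near_zero y 0 (s n - c)" using assms cauchy_carrier by blast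
  obtain B where "near_zero y B c" using near_zero_exists by blast
  then have B: "near_zero y (min 0 B) c" by (rule near_zero_mono) simp
  have "\<forall>\<^sub>F n in sequentially. near_zero y (min 0 B) (s n)"
    using c
  proof eventually_elim
    case (elim n)
    show ?case using near_zero_add[OF near_zero_mono[OF elim, of "min 0 B"] B] by simp
  qed
  then show ?thesis by blast
qed

lemma cauchy_add:
  assumes "s \<in> carrier (cauchy_ring y)" "r \<in> carrier (cauchy_ring y)"
  shows "(\<lambda>n. s n + r n) \<in> carrier (cauchy_ring y)"
  unfolding cauchy_carrier
proof
  fix N
  obtain c d where "\<forall>\<^sub>F n in sequentially. near_zero y N (s n - c)" "\<forall>\<^sub>F n in sequentially. near_zero y N (r n - d)"
    using assms unfolding cauchy_carrier by meson
  then have "\<forall>\<^sub>F n in sequentially. near_zero y N (s n + r n - (c + d))"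
  proof eventually_elim
    case (elim n)
    show ?case using near_zero_add[OF elim] by (simp add: algebra_simps)
  qed
  then show "\<exists>c. \<forall>\<^sub>F n in sequentially. near_zero y N (s n + r n - c)" by blast
qed

text \<open>The approximation to the second factor is chosen last, with a precision that depends on the approximation to the
first.\<close>

lemma cauchy_mult:
  assumes "s \<in> carrier (cauchy_ring y)" "r \<in> carrier (cauchy_ring y)"
  shows "(\<lambda>n. s n * r n) \<in> carrier (cauchy_ring y)"
  unfolding cauchy_carrier
proof
  fix N
  obtain Br where Br: "\<forall>\<^sub>F n in sequentially. near_zero y Br (r n)" using cauchy_bounded[OF assms(2)] by blast
  obtain c where c: "\<forall>\<^sub>F n in sequentially. near_zero y (N - Br) (s n - c)"
    using assms unfolding cauchy_carrier by meson
  obtain Bc where Bc: "near_zero y Bc c" using near_zero_exists by blast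
  obtain d where d: "\<forall>\<^sub>F n in sequentially. near_zero y (N - Bc) (r n - d)"
    using assms unfolding cauchy_carrier by meson
  from Br c d have "\<forall>\<^sub>F n in sequentially. near_zero y N (s n * r n - c * d)"
  proof eventually_elim
    case (elim n)
    have "s n * r n - c * d = (s n - c) * r n + c * (r n - d)" by (simp add: algebra_simps)
    then show ?case
      using near_zero_add[of y N] near_zero_mult[OF elim(2,1)] near_zero_mult[OF Bc elim(3)] by simp
  qed
  then show "\<exists>c. \<forall>\<^sub>F n in sequentially. near_zero y N (s n * r n - c)" by blast
qed

lemma cauchy_minus:
  assumes "s \<in> carrier (cauchy_ring y)"
  shows "(\<lambda>n. - s n) \<in> carrier (cauchy_ring y)"
  using cauchy_mult[OF cauchy_const[of "-1"] assms] by simp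

lemma cauchy_cring: "cring (cauchy_ring y)"
proof (rule cringI)
  show "abelian_group (cauchy_ring y)"
  proof (rule abelian_groupI)
    fix s assume "s \<in> carrier (cauchy_ring y)"
    then show "\<exists>r\<in>carrier (cauchy_ring y). r \<oplus>\<^bsub>cauchy_ring y\<^esub> s = \<zero>\<^bsub>cauchy_ring y\<^esub>"
      by (intro bexI[of _ "\<lambda>n. - s n"]) (auto intro: cauchy_minus)
  qed (simp_all add: cauchy_add add.assoc add.commute add.left_commute)
  show "comm_monoid (cauchy_ring y)"
    by (rule comm_monoidI) (simp_all add: cauchy_mult mult.assoc mult.commute mult.left_commute)
qed (simp add: distrib_right)

lemma null_ideal_cauchy: "s \<in> null_ideal y \<Longrightarrow> s \<in> carrier (cauchy_ring y)"
  unfolding null_ideal_iff cauchy_carrier by (intro allI exI[of _ 0]) simp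

lemma a_inv_cauchy:
  assumes "s \<in> carrier (cauchy_ring y)"
  shows "\<ominus>\<^bsub>cauchy_ring y\<^esub> s = (\<lambda>n. - s n)"
proof -
  interpret C: cring "cauchy_ring y" by (rule cauchy_cring)
  show ?thesis using cauchy_minus[OF assms] assms by (intro C.minus_equality) auto
qed

lemma null_ideal_add: "s \<in> null_ideal y \<Longrightarrow> r \<in> null_ideal y \<Longrightarrow> (\<lambda>n. s n + r n) \<in> null_ideal y"
  unfolding null_ideal_iff
proof
  fix N assume "\<forall>N. \<forall>\<^sub>F n in sequentially. near_zero y N (s n)" "\<forall>N. \<forall>\<^sub>F n in sequentially. near_zero y N (r n)"
  then have "\<forall>\<^sub>F n in sequentially. near_zero y N (s n)" "\<forall>\<^sub>F n in sequentially. near_zero y N (r n)" by auto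
  then show "\<forall>\<^sub>F n in sequentially. near_zero y N (s n + r n)" by eventually_elim (rule near_zero_add)
qed

lemma null_ideal_mult:
  assumes "s \<in> null_ideal y" "r \<in> carrier (cauchy_ring y)"
  shows "(\<lambda>n. s n * r n) \<in> null_ideal y"
  unfolding null_ideal_iff
proof
  fix N
  obtain B where B: "\<forall>\<^sub>F n in sequentially. near_zero y B (r n)" using cauchy_bounded[OF assms(2)] by blast
  have "\<forall>\<^sub>F n in sequentially. near_zero y (N - B) (s n)" using assms(1) null_ideal_iff by blast
  with B show "\<forall>\<^sub>F n in sequentially. near_zero y N (s n * r n)"
  proof eventually_elim
    case (elim n)
    show ?case using near_zero_mult[OF elim(2,1)] by simp
  qed
qed

lemma null_ideal_ideal: "ideal (null_ideal y) (cauchy_ring y)"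
proof (rule idealI)
  interpret C: cring "cauchy_ring y" by (rule cauchy_cring)
  show "ring (cauchy_ring y)" by (rule C.ring_axioms)
  show "subgroup (null_ideal y) (add_monoid (cauchy_ring y))"
  proof (rule C.add.subgroupI)
    show "null_ideal y \<subseteq> carrier (cauchy_ring y)" using null_ideal_cauchy by blast
    have "(\<lambda>n. 0) \<in> null_ideal y" by (simp add: null_ideal_iff)
    then show "null_ideal y \<noteq> {}" by blast
    show "\<ominus>\<^bsub>cauchy_ring y\<^esub> s \<in> null_ideal y" if "s \<in> null_ideal y" for s
      using that a_inv_cauchy[OF null_ideal_cauchy[OF that]] by (simp add: null_ideal_iff)
  qed (auto intro: null_ideal_add)
qed (auto intro: null_ideal_mult dest: null_ideal_mult simp: mult.commute)

lemma completion_cring: "cring (\<F> y)"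
  unfolding completion_def using ideal.quotient_is_cring[OF null_ideal_ideal cauchy_cring] .

definition cl :: "'k::field place \<Rightarrow> (nat \<Rightarrow> 'k ratfun) \<Rightarrow> 'k local" where
  "cl y s = null_ideal y +>\<^bsub>cauchy_ring y\<^esub> s"

lemma cl_hom: "cl y \<in> ring_hom (cauchy_ring y) (\<F> y)"
  unfolding completion_def using ideal.rcos_ring_hom[OF null_ideal_ideal, of y]
  by (simp add: cl_def[abs_def])

lemma emb_local_cl: "emb_local y z = cl y (\<lambda>n. z)"
  by (simp add: emb_local_def cl_def)

lemma cl_closed: "s \<in> carrier (cauchy_ring y) \<Longrightarrow> cl y s \<in> carrier (\<F> y)"
  using cl_hom ring_hom_closed by metis

lemma cl_cases:
  assumes "a \<in> carrier (\<F> y)"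
  obtains s where "s \<in> carrier (cauchy_ring y)" "a = cl y s"
  using assms unfolding completion_def FactRing_def A_RCOSETS_def' cl_def by auto

lemma cl_mult: "s \<in> carrier (cauchy_ring y) \<Longrightarrow> r \<in> carrier (cauchy_ring y) \<Longrightarrow>
    cl y s \<otimes>\<^bsub>\<F> y\<^esub> cl y r = cl y (\<lambda>n. s n * r n)"
  using ring_hom_mult[OF cl_hom] by fastforce

lemma cl_add: "s \<in> carrier (cauchy_ring y) \<Longrightarrow> r \<in> carrier (cauchy_ring y) \<Longrightarrow>
    cl y s \<oplus>\<^bsub>\<F> y\<^esub> cl y r = cl y (\<lambda>n. s n + r n)"
  using ring_hom_add[OF cl_hom] by fastforce

lemma cl_one: "\<one>\<^bsub>\<F> y\<^esub> = cl y (\<lambda>n. 1)"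
  using ring_hom_one[OF cl_hom, of y] by simp

lemma cl_zero: "\<zero>\<^bsub>\<F> y\<^esub> = cl y (\<lambda>n. 0)"
  using ring_hom_zero[OF cl_hom cring.axioms(1)[OF cauchy_cring] cring.axioms(1)[OF completion_cring], of y] by simp

lemma cl_mem:
  assumes s: "s \<in> carrier (cauchy_ring y)"
  shows "r \<in> cl y s \<longleftrightarrow> (\<lambda>n. r n - s n) \<in> null_ideal y"
proof
  assume "r \<in> cl y s"
  then obtain i where "i \<in> null_ideal y" "r = (\<lambda>n. i n + s n)" by (auto simp: cl_def a_r_coset_def')
  then show "(\<lambda>n. r n - s n) \<in> null_ideal y" by simp
next
  assume "(\<lambda>n. r n - s n) \<in> null_ideal y"
  then show "r \<in> cl y s" unfolding cl_def a_r_coset_def' by (auto intro!: bexI[of _ "\<lambda>n. r n - s n"])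
qed

lemma cl_self: "s \<in> carrier (cauchy_ring y) \<Longrightarrow> s \<in> cl y s"
  by (simp add: cl_mem null_ideal_iff)

lemma cl_eq_zero_iff:
  assumes s: "s \<in> carrier (cauchy_ring y)"
  shows "cl y s = \<zero>\<^bsub>\<F> y\<^esub> \<longleftrightarrow> s \<in> null_ideal y"
proof
  assume "cl y s = \<zero>\<^bsub>\<F> y\<^esub>"
  then have "s \<in> cl y (\<lambda>n. 0)" using cl_self[OF s] by (simp add: cl_zero)
  then show "s \<in> null_ideal y" by (simp add: cl_mem)
next
  assume "s \<in> null_ideal y"
  then have "null_ideal y +>\<^bsub>cauchy_ring y\<^esub> s = null_ideal y"
    using ideal.rcos_const_imp_mem abelian_subgroup.a_rcos_const
    by (metis abelian_subgroupI3 cauchy_cring cring_def ideal.axioms(1) null_ideal_ideal ring_def)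
  then show "cl y s = \<zero>\<^bsub>\<F> y\<^esub>" by (simp add: cl_def completion_def FactRing_def)
qed

lemma cl_minus:
  assumes s: "s \<in> carrier (cauchy_ring y)"
  shows "\<ominus>\<^bsub>\<F> y\<^esub> cl y s = cl y (\<lambda>n. - s n)"
proof -
  interpret C: cring "\<F> y" by (rule completion_cring)
  show ?thesis using s
    by (intro C.add.inv_equality) (auto intro: cl_closed cauchy_minus simp: cl_add cauchy_minus cl_zero)
qed

text \<open>$a \in \pi_y^N \mathcal{O}_y$. The condition is phrased with representing sequences because it
then makes sense for zero as well, and sums and products are handled termwise.\<close>

definition small :: "'k::field place \<Rightarrow> int \<Rightarrow> 'k local \<Rightarrow> bool" where
  "small y N a \<longleftrightarrow> a \<in> carrier (\<F> y) \<and> (\<forall>s\<in>a. \<forall>\<^sub>F n in sequentially. near_zero y N (s n))"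

lemma small_carrier: "small y N a \<Longrightarrow> a \<in> carrier (\<F> y)"
  by (simp add: small_def)

lemma small_cl:
  assumes s: "s \<in> carrier (cauchy_ring y)"
  shows "small y N (cl y s) \<longleftrightarrow> (\<forall>\<^sub>F n in sequentially. near_zero y N (s n))"
proof
  assume a: "\<forall>\<^sub>F n in sequentially. near_zero y N (s n)"
  have "\<forall>\<^sub>F n in sequentially. near_zero y N (r n)" if "r \<in> cl y s" for r
  proof -
    have "\<forall>\<^sub>F n in sequentially. near_zero y N (r n - s n)" using that s by (simp add: cl_mem null_ideal_iff)
    then show ?thesis using a
    proof eventually_elim
      case (elim n)
      show ?case using near_zero_add[OF elim] by simp
    qed
  qed
  then show "small y N (cl y s)" using cl_closed[OF s] by (simp add: small_def)
qed (use cl_self[OF s] in \<open>auto simp: small_def\<close>)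

lemma small_add: "small y N a \<Longrightarrow> small y N b \<Longrightarrow> small y N (a \<oplus>\<^bsub>\<F> y\<^esub> b)"
proof -
  assume a: "small y N a" and b: "small y N b"
  obtain s where s: "s \<in> carrier (cauchy_ring y)" "a = cl y s" using a small_carrier cl_cases by metis
  obtain r where r: "r \<in> carrier (cauchy_ring y)" "b = cl y r" using b small_carrier cl_cases by metis
  have "\<forall>\<^sub>F n in sequentially. near_zero y N (s n)" "\<forall>\<^sub>F n in sequentially. near_zero y N (r n)"
    using a b s r by (simp_all add: small_cl)
  then have "\<forall>\<^sub>F n in sequentially. near_zero y N (s n + r n)"
    by eventually_elim (rule near_zero_add)
  then show ?thesis using s r by (simp add: cl_add small_cl cauchy_add)
qed

lemma small_mult: "small y N a \<Longrightarrow> small y M b \<Longrightarrow> small y (N + M) (a \<otimes>\<^bsub>\<F> y\<^esub> b)"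
proof -
  assume a: "small y N a" and b: "small y M b"
  obtain s where s: "s \<in> carrier (cauchy_ring y)" "a = cl y s" using a small_carrier cl_cases by metis
  obtain r where r: "r \<in> carrier (cauchy_ring y)" "b = cl y r" using b small_carrier cl_cases by metis
  have "\<forall>\<^sub>F n in sequentially. near_zero y N (s n)" "\<forall>\<^sub>F n in sequentially. near_zero y M (r n)"
    using a b s r by (simp_all add: small_cl)
  then have "\<forall>\<^sub>F n in sequentially. near_zero y (N + M) (s n * r n)"
    by eventually_elim (rule near_zero_mult)
  then show ?thesis using s r by (simp add: cl_mult small_cl cauchy_mult)
qed

lemma small_minus: "small y N a \<Longrightarrow> small y N (\<ominus>\<^bsub>\<F> y\<^esub> a)"
proof -
  assume a: "small y N a"
  obtain s where s: "s \<in> carrier (cauchy_ring y)" "a = cl y s" using a small_carrier cl_cases by metis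
  then show ?thesis using a by (simp add: cl_minus small_cl cauchy_minus)
qed

lemma small_diff: "small y N a \<Longrightarrow> small y N b \<Longrightarrow> small y N (a \<ominus>\<^bsub>\<F> y\<^esub> b)"
  unfolding a_minus_def by (intro small_add small_minus)

lemma small_mono: "small y N a \<Longrightarrow> M \<le> N \<Longrightarrow> small y M a"
  unfolding small_def by (auto elim!: eventually_mono intro: near_zero_mono)

lemma emb_local_closed [simp]: "emb_local y z \<in> carrier (\<F> y)"
  by (simp add: emb_local_cl cl_closed)

lemma emb_local_mult: "emb_local y (z * w) = emb_local y z \<otimes>\<^bsub>\<F> y\<^esub> emb_local y w"
  by (simp add: emb_local_cl cl_mult)

lemma emb_local_add: "emb_local y (z + w) = emb_local y z \<oplus>\<^bsub>\<F> y\<^esub> emb_local y w"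
  by (simp add: emb_local_cl cl_add)

lemma emb_local_1: "emb_local y 1 = \<one>\<^bsub>\<F> y\<^esub>"
  by (simp add: emb_local_cl cl_one)

lemma emb_local_0: "emb_local y 0 = \<zero>\<^bsub>\<F> y\<^esub>"
  by (simp add: emb_local_cl cl_zero)

lemma emb_local_minus: "emb_local y (- z) = \<ominus>\<^bsub>\<F> y\<^esub> emb_local y z"
  by (simp add: emb_local_cl cl_minus)

lemma emb_local_diff: "emb_local y (z - w) = emb_local y z \<ominus>\<^bsub>\<F> y\<^esub> emb_local y w"
  using emb_local_add[of y z "- w"] by (simp add: emb_local_minus a_minus_def)

lemma small_emb: "small y N (emb_local y z) \<longleftrightarrow> near_zero y N z"
  by (simp add: emb_local_cl small_cl)

lemma small_exists: "a \<in> carrier (\<F> y) \<Longrightarrow> \<exists>N. small y N a"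
  using cl_cases cauchy_bounded small_cl by metis

lemma small_approx:
  assumes "a \<in> carrier (\<F> y)"
  shows "\<exists>z. small y N (a \<ominus>\<^bsub>\<F> y\<^esub> emb_local y z)"
proof -
  obtain s where s: "s \<in> carrier (cauchy_ring y)" "a = cl y s" using assms cl_cases by metis
  obtain c where c: "\<forall>\<^sub>F n in sequentially. near_zero y N (s n - c)" using s(1) cauchy_carrier by metis
  have "a \<ominus>\<^bsub>\<F> y\<^esub> emb_local y c = cl y (\<lambda>n. s n + - c)"
    using s cl_add[OF s(1) cauchy_const[of "-c"]] by (simp add: a_minus_def emb_local_cl cl_minus)
  moreover have "(\<lambda>n. s n + - c) \<in> carrier (cauchy_ring y)" using cauchy_add[OF s(1) cauchy_const] by blast
  ultimately have "small y N (a \<ominus>\<^bsub>\<F> y\<^esub> emb_local y c)" using c by (simp add: small_cl)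
  then show ?thesis by blast
qed

text \<open>A Cauchy sequence that does not tend to zero eventually stays closer to some nonzero $c \in F$ than
to zero, and then all its terms have the valuation of $c$.\<close>

lemma small_ord_local:
  assumes a: "a \<in> carrier (\<F> y)" "a \<noteq> \<zero>\<^bsub>\<F> y\<^esub>"
  shows "small y N a \<longleftrightarrow> N \<le> ord_local y a"
proof -
  obtain s where s: "s \<in> carrier (cauchy_ring y)" "a = cl y s" using a cl_cases by metis
  then have "s \<notin> null_ideal y" using a(2) cl_eq_zero_iff by blast
  then obtain K where K: "\<not> (\<forall>\<^sub>F n in sequentially. near_zero y K (s n))" unfolding null_ideal_iff by blast
  obtain c where c: "\<forall>\<^sub>F n in sequentially. near_zero y K (s n - c)" using s(1) cauchy_carrier by metis
  have "\<not> near_zero y K c"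
  proof
    assume "near_zero y K c"
    have "\<forall>\<^sub>F n in sequentially. near_zero y K (s n)"
      using c
    proof eventually_elim
      case (elim n)
      show ?case using near_zero_add[OF elim \<open>near_zero y K c\<close>] by simp
    qed
    then show False using K by blast
  qed
  then have c0: "c \<noteq> 0" "ord_at y c + 1 \<le> K" by (auto simp: near_zero_def)
  define k where "k = ord_at y c"
  have ev: "\<forall>\<^sub>F n in sequentially. r n \<noteq> 0 \<and> ord_at y (r n) = k" if r: "r \<in> a" for r
  proof -
    have "\<forall>\<^sub>F n in sequentially. near_zero y K (r n - s n)" using r s by (simp add: cl_mem null_ideal_iff)
    then show ?thesis using c
    proof eventually_elim
      case (elim n)
      have "near_zero y K (r n - c)" using near_zero_add[OF elim] by simp
      from ord_at_eq_of_near[OF c0(1) near_zero_mono[OF this c0(2)]] show ?case by (simp add: k_def)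
    qed
  qed
  have sa: "s \<in> a" using s cl_self by metis
  have "ord_local y a = k"
    unfolding ord_local_def
  proof (rule the_equality)
    show "\<exists>s\<in>a. \<exists>M. \<forall>i\<ge>M. s i \<noteq> 0 \<and> ord_at y (s i) = k"
      using ev[OF sa] sa unfolding eventually_sequentially by blast
    fix n assume "\<exists>s\<in>a. \<exists>M. \<forall>i\<ge>M. s i \<noteq> 0 \<and> ord_at y (s i) = n"
    then obtain r where r: "r \<in> a" "\<forall>\<^sub>F i in sequentially. r i \<noteq> 0 \<and> ord_at y (r i) = n"
      unfolding eventually_sequentially by blast
    have "\<forall>\<^sub>F i in sequentially. n = k" using r(2) ev[OF r(1)] by eventually_elim simp
    then show "n = k" by simp
  qed
  moreover have "small y N a \<longleftrightarrow> N \<le> k"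
  proof
    assume "small y N a"
    then have "\<forall>\<^sub>F i in sequentially. near_zero y N (s i)" using sa by (simp add: small_def)
    then have "\<forall>\<^sub>F i in sequentially. N \<le> k" using ev[OF sa] by eventually_elim (auto simp: near_zero_def)
    then show "N \<le> k" by simp
  next
    assume "N \<le> k"
    then have "\<forall>\<^sub>F i in sequentially. near_zero y N (s i)"
      using ev[OF sa] by (auto elim!: eventually_mono simp: near_zero_def)
    then show "small y N a" using s by (simp add: small_cl)
  qed
  ultimately show ?thesis by simp
qed

lemma small_zero [simp]: "small y N \<zero>\<^bsub>\<F> y\<^esub>"
  using small_emb[of y N 0] by (simp add: emb_local_0)

lemma small_one: "small y N \<one>\<^bsub>\<F> y\<^esub> \<longleftrightarrow> N \<le> 0"
  using small_emb[of y N 1] by (simp add: emb_local_1 near_zero_1)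

lemma emb_local_eq_iff: "emb_local y z = emb_local y w \<longleftrightarrow> z = w"
proof
  assume e: "emb_local y z = emb_local y w"
  interpret C: cring "\<F> y" by (rule completion_cring)
  have z: "emb_local y (z - w) = \<zero>\<^bsub>\<F> y\<^esub>" using e by (simp add: emb_local_diff)
  show "z = w"
  proof (rule ccontr)
    assume "z \<noteq> w"
    then show False using small_emb[of y "ord_at y (z - w) + 1" "z - w"] z by (simp add: near_zero_def)
  qed
qed simp

lemma local_integers_carrier: "a \<in> carrier (local_integers y) \<longleftrightarrow> small y 0 a"
  by (cases "a \<in> carrier (\<F> y)"; cases "a = \<zero>\<^bsub>\<F> y\<^esub>")
    (auto simp: local_integers_def small_ord_local small_carrier)

lemma local_integers_ops [simp]:
  "monoid.mult (local_integers y) = monoid.mult (\<F> y)" "add (local_integers y) = add (\<F> y)"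
  "\<one>\<^bsub>local_integers y\<^esub> = \<one>\<^bsub>\<F> y\<^esub>" "\<zero>\<^bsub>local_integers y\<^esub> = \<zero>\<^bsub>\<F> y\<^esub>"
  by (simp_all add: local_integers_def)

lemma local_integers_cring: "cring (local_integers y)"
proof -
  interpret C: cring "\<F> y" by (rule completion_cring)
  let ?H = "{a. small y 0 a}"
  have "subring ?H (\<F> y)"
    using small_mult[of y 0 _ 0] by (intro C.subringI) (auto simp: small_one small_carrier intro: small_add small_minus)
  then have "subcring ?H (\<F> y)" by (rule C.subcringI')
  moreover have "?H \<subseteq> carrier (\<F> y)" using small_carrier by blast
  ultimately have "cring (\<F> y \<lparr>carrier := ?H\<rparr>)" using C.subcring_iff by blast
  moreover have "local_integers y = \<F> y \<lparr>carrier := ?H\<rparr>"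
  proof -
    have "{a \<in> carrier (\<F> y). a = \<zero>\<^bsub>\<F> y\<^esub> \<or> 0 \<le> ord_local y a} = ?H"
      using local_integers_carrier[of _ y] by (auto simp: local_integers_def)
    then show ?thesis by (simp add: local_integers_def)
  qed
  ultimately show ?thesis by simp
qed

lemma a_inv_local_integers:
  assumes "small y 0 a"
  shows "\<ominus>\<^bsub>local_integers y\<^esub> a = \<ominus>\<^bsub>\<F> y\<^esub> a"
proof -
  interpret C: cring "\<F> y" by (rule completion_cring)
  interpret O: cring "local_integers y" by (rule local_integers_cring)
  show ?thesis
    using assms small_minus[OF assms] small_carrier[OF assms]
    by (intro O.add.inv_equality) (auto simp: local_integers_carrier C.l_neg)
qed

lemma max_ideal_iff: "a \<in> max_ideal y \<longleftrightarrow> small y 1 a"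
proof -
  interpret C: cring "\<F> y" by (rule completion_cring)
  define p where "p = (SOME p. uniformizer y p)"
  have "uniformizer y p" unfolding p_def using uniformizer_exists by (rule someI_ex)
  then have p: "p \<noteq> 0" "ord_at y p = 1" using ord_at_uniformizer by auto
  have m: "max_ideal y = {b \<otimes>\<^bsub>\<F> y\<^esub> emb_local y p | b. small y 0 b}"
    unfolding max_ideal_def cgenideal_def p_def[symmetric] by (auto simp: local_integers_carrier)
  show ?thesis
  proof
    assume "a \<in> max_ideal y"
    then obtain b where "a = b \<otimes>\<^bsub>\<F> y\<^esub> emb_local y p" "small y 0 b" using m by blast
    then show "small y 1 a" using small_mult[of y 0 b 1 "emb_local y p"] p by (simp add: small_emb near_zero_def)
  next
    assume a: "small y 1 a"
    let ?b = "a \<otimes>\<^bsub>\<F> y\<^esub> emb_local y (inverse p)"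
    have "small y (-1) (emb_local y (inverse p))" using p by (simp add: small_emb near_zero_def ord_at_inverse)
    then have b: "small y 0 ?b" using small_mult[OF a, of "-1"] by simp
    have "a = ?b \<otimes>\<^bsub>\<F> y\<^esub> emb_local y p"
      using small_carrier[OF a] p by (simp add: C.m_assoc emb_local_mult[symmetric] emb_local_1)
    then show "a \<in> max_ideal y" using b m by blast
  qed
qed

lemma max_ideal_ideal: "ideal (max_ideal y) (local_integers y)"
proof -
  interpret O: cring "local_integers y" by (rule local_integers_cring)
  have "uniformizer y (SOME p. uniformizer y p)" using uniformizer_exists by (rule someI_ex)
  from ord_at_uniformizer[OF this] show ?thesis unfolding max_ideal_def
    by (intro O.cgenideal_ideal) (simp add: local_integers_carrier small_emb near_zero_def)
qed

definition res :: "'k::field place \<Rightarrow> 'k local \<Rightarrow> 'k local set" where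
  "res y a = max_ideal y +>\<^bsub>local_integers y\<^esub> a"

lemma res_hom: "res y \<in> ring_hom (local_integers y) (residue_field y)"
  unfolding residue_field_def using ideal.rcos_ring_hom[OF max_ideal_ideal, of y]
  by (simp add: res_def[abs_def])

lemma res_eq_iff:
  assumes "small y 0 a" "small y 0 b"
  shows "res y a = res y b \<longleftrightarrow> small y 1 (a \<ominus>\<^bsub>\<F> y\<^esub> b)"
proof -
  interpret O: cring "local_integers y" by (rule local_integers_cring)
  have "a \<ominus>\<^bsub>local_integers y\<^esub> b = a \<ominus>\<^bsub>\<F> y\<^esub> b"
    using assms by (simp add: a_minus_def a_inv_local_integers)
  then show ?thesis
    using O.quotient_eq_iff_same_a_r_cos[OF max_ideal_ideal, of a b] assms
    by (simp add: local_integers_carrier res_def max_ideal_iff)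
qed

lemma residue_field_carrier: "carrier (residue_field y) = res y ` {a. small y 0 a}"
  unfolding residue_field_def FactRing_def A_RCOSETS_def' res_def by (auto simp: local_integers_carrier)

text \<open>By density every residue class contains an element of $F$, hence one of the chosen polynomials.\<close>

lemma card_residue_field:
  fixes P :: "'k::{field,finite} poly"
  assumes P: "place_poly y \<tau> P"
  shows "card (carrier (residue_field y)) = CARD('k) ^ Polynomial.degree P"
proof -
  let ?S = "{C :: 'k poly. Polynomial.degree C < Polynomial.degree P}"
  let ?f = "\<lambda>C. res y (emb_local y (ev \<tau> C))"
  have \<tau>: "\<tau> \<in> val_ring y" using P by (simp add: place_poly_def)
  have int: "small y 0 (emb_local y (ev \<tau> C))" for C
    using val_ring_ev[OF \<tau>] by (simp add: small_emb near_zero_val_ring)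
  have "bij_betw ?f ?S (carrier (residue_field y))"
    unfolding bij_betw_def
  proof
    show "inj_on ?f ?S"
      using place_poly_residue_unique[OF P]
      by (intro inj_onI) (auto simp: res_eq_iff[OF int int] emb_local_diff[symmetric] small_emb)
    show "?f ` ?S = carrier (residue_field y)"
    proof
      show "?f ` ?S \<subseteq> carrier (residue_field y)" using int by (auto simp: residue_field_carrier)
      show "carrier (residue_field y) \<subseteq> ?f ` ?S"
      proof
        fix u assume "u \<in> carrier (residue_field y)"
        then obtain a where a: "small y 0 a" "u = res y a" by (auto simp: residue_field_carrier)
        interpret C: cring "\<F> y" by (rule completion_cring)
        obtain z where z: "small y 1 (a \<ominus>\<^bsub>\<F> y\<^esub> emb_local y z)" using small_approx small_carrier[OF a(1)] by metis
        have "a \<ominus>\<^bsub>\<F> y\<^esub> (a \<ominus>\<^bsub>\<F> y\<^esub> emb_local y z) = emb_local y z"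
          using small_carrier[OF a(1)] by (simp add: C.minus_add C.a_assoc[symmetric] C.r_neg a_minus_def)
        then have zi: "small y 0 (emb_local y z)"
          using small_diff[OF a(1) small_mono[OF z]] by simp
        then have "z \<in> val_ring y" by (simp add: small_emb near_zero_val_ring)
        then obtain C where C: "Polynomial.degree C < Polynomial.degree P" "near_zero y 1 (z - ev \<tau> C)"
          using place_poly_residue[OF P] by blast
        have "res y (emb_local y z) = ?f C"
          using C(2) by (simp add: res_eq_iff[OF zi int] emb_local_diff[symmetric] small_emb)
        moreover have "u = res y (emb_local y z)" using z by (simp add: a(2) res_eq_iff[OF a(1) zi])
        ultimately show "u \<in> ?f ` ?S" using C(1) by blast
      qed
    qed
  qed
  from bij_betw_same_card[OF this] show ?thesis
    using card_polys[where ?'k = 'k, of "Polynomial.degree P"] P prime_poly_degree[of P] by (simp add: place_poly_def)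
qed

text \<open>Over a finite field the dimension can be recovered by counting.\<close>

lemma card_dimension:
  fixes R (structure)
  assumes R: "ring R" and K: "subfield K R" and fin: "finite (carrier R)"
    and d: "ring.dimension R n K E"
  shows "card E = card K ^ n"
proof -
  interpret ring R by fact
  from d K show ?thesis
  proof (induction n K E rule: dimension.induct)
    case (zero_dim K)
    show ?case by simp
  next
    case (Suc_dim v E n K)
    note E = space_subgroup_props[OF Suc_dim.prems Suc_dim.hyps(3)]
    have Kc: "K \<subseteq> carrier R" and Km: "\<And>k l. k \<in> K \<Longrightarrow> l \<in> K \<Longrightarrow> k \<ominus> l \<in> K"
      using subringE(1,5,7)[OF subfieldE(1)[OF Suc_dim.prems]] by (auto simp: a_minus_def)
    let ?f = "\<lambda>(k, u). k \<otimes> v \<oplus> u"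
    have "inj_on ?f (K \<times> E)"
    proof (rule inj_onI, clarify)
      fix k u l w assume a: "k \<in> K" "u \<in> E" "l \<in> K" "w \<in> E" "k \<otimes> v \<oplus> u = l \<otimes> v \<oplus> w"
      have c: "k \<in> carrier R" "l \<in> carrier R" "u \<in> carrier R" "w \<in> carrier R" using a Kc E(1) by auto
      have "(k \<ominus> l) \<otimes> v = (k \<otimes> v \<oplus> u) \<ominus> (l \<otimes> v \<oplus> u)" using c Suc_dim.hyps(1) by algebra
      also have "\<dots> = (l \<otimes> v \<oplus> w) \<ominus> (l \<otimes> v \<oplus> u)" using a(5) by simp
      also have "\<dots> = w \<oplus> (\<ominus> u)" using c Suc_dim.hyps(1) by algebra
      finally have "(k \<ominus> l) \<otimes> v \<in> E" using E(3,4) a by simp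
      then have "k \<ominus> l = \<zero>" using E(6)[of "k \<ominus> l" v] Km[OF a(1,3)] Suc_dim.hyps(1,2) by blast
      then have "k = l" using c r_right_minus_eq by blast
      then have "u = w" using a(5) c Suc_dim.hyps(1) by simp
      then show "k = l \<and> u = w" using \<open>k = l\<close> by simp
    qed
    moreover have "?f ` (K \<times> E) = line_extension K v E"
      by (auto simp: line_extension_mem_iff image_iff) blast+
    ultimately have "card (line_extension K v E) = card (K \<times> E)" using card_image by metis
    then show ?case using Suc_dim.IH[OF Suc_dim.prems] by (simp add: card_cartesian_product)
  qed
qed

lemma residue_field_dimension:
  "\<exists>n. ring.dimension (residue_field y) n (residue_constants y) (carrier (residue_field y))"
  and card_residue_constants: "card (residue_constants y) = CARD('k)"
  and residue_constants_subfield: "subfield (residue_constants y) (residue_field y)"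
  and residue_field_ring: "ring (residue_field y)" for y :: "'k::{field,finite} place"
proof -
  interpret O: cring "local_integers y" by (rule local_integers_cring)
  show R: "ring (residue_field y)" unfolding residue_field_def
    by (rule ideal.quotient_is_ring[OF max_ideal_ideal])
  interpret R: ring "residue_field y" by (rule R)
  let ?k = "ring_of_type_algebra :: 'k ring"
  let ?h = "\<lambda>c. res y (emb_local y (const_rf c))"
  have int: "small y 0 (emb_local y (const_rf c))" for c
    by (simp add: small_emb near_zero_val_ring)
  have const: "residue_constants y = range ?h" by (simp add: residue_constants_def res_def)
  have inj: "inj ?h"
  proof (rule injI)
    fix c d assume "?h c = ?h d"
    then have "near_zero y 1 (const_rf c - const_rf d)"
      by (simp add: res_eq_iff[OF int int] emb_local_diff[symmetric] small_emb)
    then have "const_rf (c - d) \<in> max_at y"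
      using const_rf_add[of c "- d"] by (simp add: const_rf_minus near_zero_def max_at_iff_ord)
    then show "c = d" by (simp add: const_in_max_iff)
  qed
  then show "card (residue_constants y) = CARD('k)" unfolding const by (rule card_image)
  have hom: "?h \<in> ring_hom ?k (residue_field y)"
  proof (rule ring_hom_memI)
    fix c d :: 'k
    show "?h c \<in> carrier (residue_field y)" using int by (auto simp: residue_field_carrier)
    show "?h (c \<otimes>\<^bsub>?k\<^esub> d) = ?h c \<otimes>\<^bsub>residue_field y\<^esub> ?h d"
      using ring_hom_mult[OF res_hom, of "emb_local y (const_rf c)" y "emb_local y (const_rf d)"] int
      by (simp add: local_integers_carrier ring_of_type_algebra_def const_rf_mult emb_local_mult)
    show "?h (c \<oplus>\<^bsub>?k\<^esub> d) = ?h c \<oplus>\<^bsub>residue_field y\<^esub> ?h d"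
      using ring_hom_add[OF res_hom, of "emb_local y (const_rf c)" y "emb_local y (const_rf d)"] int
      by (simp add: local_integers_carrier ring_of_type_algebra_def const_rf_add emb_local_add)
  next
    show "?h \<one>\<^bsub>?k\<^esub> = \<one>\<^bsub>residue_field y\<^esub>"
      using ring_hom_one[OF res_hom, of y] by (simp add: ring_of_type_algebra_def emb_local_1)
  qed
  interpret H: ring_hom_ring ?k "residue_field y" ?h
    by (rule ring_hom_ringI2[OF ring_from_type_algebra R hom])
  have k: "field ?k" by (rule field_from_type_algebra)
  have one: "\<one>\<^bsub>residue_field y\<^esub> \<noteq> \<zero>\<^bsub>residue_field y\<^esub>"
  proof
    assume "\<one>\<^bsub>residue_field y\<^esub> = \<zero>\<^bsub>residue_field y\<^esub>"
    then have "?h 1 = ?h 0"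
      using H.hom_one H.hom_zero by (simp add: ring_of_type_algebra_def)
    then show False using injD[OF inj, of 1 0] by simp
  qed
  have "subfield (?h ` carrier ?k) (residue_field y)"
    using H.img_is_subfield(2)[OF field.carrier_is_subfield[OF k] one] .
  then show sf: "subfield (residue_constants y) (residue_field y)"
    by (simp add: const ring_of_type_algebra_def)
  obtain \<tau> P where P: "place_poly y \<tau> P" using generator_in_val_ring place_poly_exists by blast
  have fin: "finite (carrier (residue_field y))"
    using card_residue_field[OF P] by (auto intro: card_ge_0_finite)
  then obtain Us where Us: "set Us = carrier (residue_field y)" using finite_list by blast
  have "R.Span (residue_constants y) Us = carrier (residue_field y)"
  proof
    show "R.Span (residue_constants y) Us \<subseteq> carrier (residue_field y)"
      using R.Span_in_carrier[OF subringE(1)[OF subfieldE(1)[OF sf]]] Us by simp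
    show "carrier (residue_field y) \<subseteq> R.Span (residue_constants y) Us"
      using R.Span_base_incl[OF sf, of Us] Us by simp
  qed
  then show "\<exists>n. R.dimension n (residue_constants y) (carrier (residue_field y))"
    using R.Span_finite_dimension[OF sf, of Us] Us unfolding R.finite_dimension_def by auto
qed

text \<open>Both numbers are the exponent of $q$ in the order of the residue field.\<close>

lemma place_degree_eq:
  fixes P :: "'k::{field,finite} poly"
  assumes P: "place_poly y \<tau> P"
  shows "place_degree y = Polynomial.degree P"
proof -
  have fin: "finite (carrier (residue_field y))"
    using card_residue_field[OF P] by (auto intro: card_ge_0_finite)
  have q: "CARD('k) > 1"
    using card_mono[of "UNIV :: 'k set" "{0, 1}"] by simp
  have u: "n = Polynomial.degree P"
    if d: "ring.dimension (residue_field y) n (residue_constants y) (carrier (residue_field y))" for n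
  proof -
    have "CARD('k) ^ Polynomial.degree P = CARD('k) ^ n"
      using card_dimension[OF residue_field_ring residue_constants_subfield fin d]
      unfolding card_residue_constants card_residue_field[OF P] .
    then show ?thesis using q by simp
  qed
  obtain n where n: "ring.dimension (residue_field y) n (residue_constants y) (carrier (residue_field y))"
    using residue_field_dimension by blast
  show ?thesis unfolding place_degree_def using n u by (intro the_equality) auto
qed

context rational_place
begin

lemma deg_at_eq: "deg_at y = place_degree y"
proof (cases "y = x")
  case True
  then show ?thesis using place_degree_eq[OF place_poly_x] by (simp add: deg_at_def)
next
  case False
  then show ?thesis using place_degree_eq[OF prime_at[OF False]] by (simp add: deg_at_def)
qed

end

section \<open>The group GL2 over a commutative ring\<close>

lemma set_mat2_eq: "set_mat2 g = {e11 g, e12 g, e21 g, e22 g}"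
  by (cases g) simp

lemma GL2_carrier:
  "g \<in> carrier (GL2 R) \<longleftrightarrow> e11 g \<in> carrier R \<and> e12 g \<in> carrier R \<and> e21 g \<in> carrier R \<and> e22 g \<in> carrier R
     \<and> det2 R g \<in> Units R"
  by (auto simp: GL2_def set_mat2_eq)

lemma GL2_mult: "Mat2 a b c d \<otimes>\<^bsub>GL2 R\<^esub> Mat2 a' b' c' d' =
   Mat2 ((a \<otimes>\<^bsub>R\<^esub> a') \<oplus>\<^bsub>R\<^esub> (b \<otimes>\<^bsub>R\<^esub> c')) ((a \<otimes>\<^bsub>R\<^esub> b') \<oplus>\<^bsub>R\<^esub> (b \<otimes>\<^bsub>R\<^esub> d'))
        ((c \<otimes>\<^bsub>R\<^esub> a') \<oplus>\<^bsub>R\<^esub> (d \<otimes>\<^bsub>R\<^esub> c')) ((c \<otimes>\<^bsub>R\<^esub> b') \<oplus>\<^bsub>R\<^esub> (d \<otimes>\<^bsub>R\<^esub> d'))"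
  by (simp add: GL2_def)

lemma GL2_one: "\<one>\<^bsub>GL2 R\<^esub> = Mat2 \<one>\<^bsub>R\<^esub> \<zero>\<^bsub>R\<^esub> \<zero>\<^bsub>R\<^esub> \<one>\<^bsub>R\<^esub>"
  by (simp add: GL2_def)

lemma det2_Mat2: "det2 R (Mat2 a b c d) = (a \<otimes>\<^bsub>R\<^esub> d) \<ominus>\<^bsub>R\<^esub> (b \<otimes>\<^bsub>R\<^esub> c)"
  by (simp add: det2_def)

lemma (in cring) Units_iff: "u \<in> Units R \<longleftrightarrow> u \<in> carrier R \<and> (\<exists>w\<in>carrier R. u \<otimes> w = \<one>)"
  unfolding Units_def using m_comm by auto

lemma (in cring) det2_mult:
  assumes "e11 g \<in> carrier R" "e12 g \<in> carrier R" "e21 g \<in> carrier R" "e22 g \<in> carrier R"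
    "e11 h \<in> carrier R" "e12 h \<in> carrier R" "e21 h \<in> carrier R" "e22 h \<in> carrier R"
  shows "det2 R (g \<otimes>\<^bsub>GL2 R\<^esub> h) = det2 R g \<otimes> det2 R h"
proof -
  have *: "(a \<otimes> a' \<oplus> b \<otimes> c') \<otimes> (c \<otimes> b' \<oplus> d \<otimes> d') \<ominus> (a \<otimes> b' \<oplus> b \<otimes> d') \<otimes> (c \<otimes> a' \<oplus> d \<otimes> c')
    = (a \<otimes> d \<ominus> b \<otimes> c) \<otimes> (a' \<otimes> d' \<ominus> b' \<otimes> c')"
    if "a \<in> carrier R" "b \<in> carrier R" "c \<in> carrier R" "d \<in> carrier R"
      "a' \<in> carrier R" "b' \<in> carrier R" "c' \<in> carrier R" "d' \<in> carrier R" for a b c d a' b' c' d'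
    using that by algebra
  show ?thesis using *[OF assms] by (simp add: GL2_def det2_def)
qed

lemma (in cring) det2_closed:
  assumes "e11 g \<in> carrier R" "e12 g \<in> carrier R" "e21 g \<in> carrier R" "e22 g \<in> carrier R"
  shows "det2 R g \<in> carrier R"
  using assms by (simp add: det2_def)

definition GL2_adj :: "('a, 'b) ring_scheme \<Rightarrow> 'a \<Rightarrow> 'a mat2 \<Rightarrow> 'a mat2" where
  "GL2_adj R w g = Mat2 (w \<otimes>\<^bsub>R\<^esub> e22 g) (\<ominus>\<^bsub>R\<^esub> (w \<otimes>\<^bsub>R\<^esub> e12 g)) (\<ominus>\<^bsub>R\<^esub> (w \<otimes>\<^bsub>R\<^esub> e21 g)) (w \<otimes>\<^bsub>R\<^esub> e11 g)"

lemma (in cring) GL2_adj: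
  assumes g: "g \<in> carrier (GL2 R)" and w: "w \<in> carrier R" "det2 R g \<otimes> w = \<one>"
  shows "GL2_adj R w g \<in> carrier (GL2 R)" "GL2_adj R w g \<otimes>\<^bsub>GL2 R\<^esub> g = \<one>\<^bsub>GL2 R\<^esub>"
proof -
  obtain a b c d where gg: "g = Mat2 a b c d" by (cases g) auto
  have c: "a \<in> carrier R" "b \<in> carrier R" "c \<in> carrier R" "d \<in> carrier R"
    using g by (auto simp: GL2_carrier gg)
  have dw: "(a \<otimes> d \<ominus> b \<otimes> c) \<otimes> w = \<one>" using w by (simp add: gg det2_def)
  have "(w \<otimes> d) \<otimes> a \<oplus> (\<ominus> (w \<otimes> b)) \<otimes> c = (a \<otimes> d \<ominus> b \<otimes> c) \<otimes> w" using c w(1) by algebra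
  moreover have "(\<ominus> (w \<otimes> c)) \<otimes> b \<oplus> (w \<otimes> a) \<otimes> d = (a \<otimes> d \<ominus> b \<otimes> c) \<otimes> w" using c w(1) by algebra
  moreover have "(w \<otimes> d) \<otimes> b \<oplus> (\<ominus> (w \<otimes> b)) \<otimes> d = \<zero>" using c w(1) by algebra
  moreover have "(\<ominus> (w \<otimes> c)) \<otimes> a \<oplus> (w \<otimes> a) \<otimes> c = \<zero>" using c w(1) by algebra
  ultimately show "GL2_adj R w g \<otimes>\<^bsub>GL2 R\<^esub> g = \<one>\<^bsub>GL2 R\<^esub>"
    using dw by (simp add: GL2_adj_def gg GL2_mult GL2_one)
  have "(w \<otimes> d) \<otimes> (w \<otimes> a) \<ominus> (\<ominus> (w \<otimes> b)) \<otimes> (\<ominus> (w \<otimes> c)) = w \<otimes> ((a \<otimes> d \<ominus> b \<otimes> c) \<otimes> w)"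
    using c w(1) by algebra
  then have "det2 R (GL2_adj R w g) = w" using dw w(1) by (simp add: GL2_adj_def gg det2_def)
  moreover have "w \<in> Units R" using w c dw by (auto simp: Units_iff m_comm intro!: bexI[of _ "a \<otimes> d \<ominus> b \<otimes> c"])
  ultimately show "GL2_adj R w g \<in> carrier (GL2 R)" using c w(1) by (simp add: GL2_carrier) (simp add: GL2_adj_def gg)
qed

lemma (in cring) GL2_group: "Group.group (GL2 R)"
proof (rule groupI)
  fix g h k assume g: "g \<in> carrier (GL2 R)" and h: "h \<in> carrier (GL2 R)" and k: "k \<in> carrier (GL2 R)"
  obtain a b c d where gg: "g = Mat2 a b c d" by (cases g) auto
  obtain a' b' c' d' where hh: "h = Mat2 a' b' c' d'" by (cases h) auto
  obtain a'' b'' c'' d'' where kk: "k = Mat2 a'' b'' c'' d''" by (cases k) auto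
  have cs: "a \<in> carrier R" "b \<in> carrier R" "c \<in> carrier R" "d \<in> carrier R"
    "a' \<in> carrier R" "b' \<in> carrier R" "c' \<in> carrier R" "d' \<in> carrier R"
    "a'' \<in> carrier R" "b'' \<in> carrier R" "c'' \<in> carrier R" "d'' \<in> carrier R"
    using g h k by (auto simp: GL2_carrier gg hh kk)
  have as: "(p \<otimes> p' \<oplus> q \<otimes> r') \<otimes> p'' \<oplus> (p \<otimes> q' \<oplus> q \<otimes> s') \<otimes> r'' = p \<otimes> (p' \<otimes> p'' \<oplus> q' \<otimes> r'') \<oplus> q \<otimes> (r' \<otimes> p'' \<oplus> s' \<otimes> r'')"
    if "p \<in> carrier R" "q \<in> carrier R" "p' \<in> carrier R" "q' \<in> carrier R" "r' \<in> carrier R" "s' \<in> carrier R"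
      "p'' \<in> carrier R" "r'' \<in> carrier R" for p q p' q' r' s' p'' r''
    using that by algebra
  show "g \<otimes>\<^bsub>GL2 R\<^esub> h \<otimes>\<^bsub>GL2 R\<^esub> k = g \<otimes>\<^bsub>GL2 R\<^esub> (h \<otimes>\<^bsub>GL2 R\<^esub> k)"
    unfolding gg hh kk GL2_mult using cs by (simp add: as)
next
  fix g h assume g: "g \<in> carrier (GL2 R)" and h: "h \<in> carrier (GL2 R)"
  then have "det2 R (g \<otimes>\<^bsub>GL2 R\<^esub> h) = det2 R g \<otimes> det2 R h" by (intro det2_mult) (auto simp: GL2_carrier)
  then have "det2 R (g \<otimes>\<^bsub>GL2 R\<^esub> h) \<in> Units R" using g h by (simp add: GL2_carrier)
  then show "g \<otimes>\<^bsub>GL2 R\<^esub> h \<in> carrier (GL2 R)" using g h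
    by (cases g; cases h) (simp add: GL2_carrier GL2_mult)
next
  have "\<one> \<otimes> \<one> \<ominus> \<zero> \<otimes> \<zero> = \<one>" by algebra
  then show "\<one>\<^bsub>GL2 R\<^esub> \<in> carrier (GL2 R)" by (simp add: GL2_carrier GL2_one det2_def)
next
  fix g assume g: "g \<in> carrier (GL2 R)"
  then show "\<one>\<^bsub>GL2 R\<^esub> \<otimes>\<^bsub>GL2 R\<^esub> g = g" by (cases g) (simp add: GL2_carrier GL2_one GL2_mult)
  obtain w where "w \<in> carrier R" "det2 R g \<otimes> w = \<one>" using g Units_iff by (auto simp: GL2_carrier)
  then show "\<exists>h\<in>carrier (GL2 R). h \<otimes>\<^bsub>GL2 R\<^esub> g = \<one>\<^bsub>GL2 R\<^esub>" using GL2_adj[OF g] by blast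
qed


section \<open>Adeles and adelic matrices place by place\<close>

lemma adele_ops [simp]:
  "a \<otimes>\<^bsub>adele_ring\<^esub> b = (\<lambda>y. a y \<otimes>\<^bsub>\<F> y\<^esub> b y)"
  "a \<oplus>\<^bsub>adele_ring\<^esub> b = (\<lambda>y. a y \<oplus>\<^bsub>\<F> y\<^esub> b y)"
  "\<one>\<^bsub>adele_ring\<^esub> = (\<lambda>y. \<one>\<^bsub>\<F> y\<^esub>)" "\<zero>\<^bsub>adele_ring\<^esub> = (\<lambda>y. \<zero>\<^bsub>\<F> y\<^esub>)"
  "monoid.mult integral_adeles = monoid.mult adele_ring" "add integral_adeles = add adele_ring"
  "\<one>\<^bsub>integral_adeles\<^esub> = \<one>\<^bsub>adele_ring\<^esub>" "\<zero>\<^bsub>integral_adeles\<^esub> = \<zero>\<^bsub>adele_ring\<^esub>"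
  by (simp_all add: adele_ring_def integral_adeles_def)

lemma adele_carrier: "a \<in> carrier adele_ring \<longleftrightarrow> (\<forall>y. a y \<in> carrier (\<F> y)) \<and> finite {y. \<not> small y 0 (a y)}"
  by (simp add: adele_ring_def local_integers_carrier)

lemma integral_adele_carrier: "a \<in> carrier integral_adeles \<longleftrightarrow> (\<forall>y. small y 0 (a y))"
  by (simp add: integral_adeles_def local_integers_carrier)

lemma integral_adele: "a \<in> carrier integral_adeles \<Longrightarrow> a \<in> carrier adele_ring"
  using small_carrier by (auto simp: adele_carrier integral_adele_carrier)

lemma small0_mult: "small y 0 a \<Longrightarrow> small y 0 b \<Longrightarrow> small y 0 (a \<otimes>\<^bsub>\<F> y\<^esub> b)"
  using small_mult[of y 0 a 0 b] by simp

lemma adele_finite2: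
  assumes "finite {y. \<not> small y 0 (a y)}" "finite {y. \<not> small y 0 (b y)}"
    "\<And>y. small y 0 (a y) \<Longrightarrow> small y 0 (b y) \<Longrightarrow> small y 0 (c y)"
  shows "finite {y. \<not> small y 0 (c y)}"
  by (rule finite_subset[of _ "{y. \<not> small y 0 (a y)} \<union> {y. \<not> small y 0 (b y)}"]) (use assms in auto)

lemma adele_add: "a \<in> carrier adele_ring \<Longrightarrow> b \<in> carrier adele_ring \<Longrightarrow> (\<lambda>y. a y \<oplus>\<^bsub>\<F> y\<^esub> b y) \<in> carrier adele_ring"
proof -
  interpret C: cring "\<F> y" for y by (rule completion_cring)
  assume a: "a \<in> carrier adele_ring" "b \<in> carrier adele_ring"
  have "finite {y. \<not> small y 0 (a y \<oplus>\<^bsub>\<F> y\<^esub> b y)}"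
    by (rule adele_finite2[where a = a and b = b]) (use a small_add in \<open>simp_all add: adele_carrier\<close>)
  then show ?thesis using a by (simp add: adele_carrier)
qed

lemma adele_mult: "a \<in> carrier adele_ring \<Longrightarrow> b \<in> carrier adele_ring \<Longrightarrow> (\<lambda>y. a y \<otimes>\<^bsub>\<F> y\<^esub> b y) \<in> carrier adele_ring"
proof -
  interpret C: cring "\<F> y" for y by (rule completion_cring)
  assume a: "a \<in> carrier adele_ring" "b \<in> carrier adele_ring"
  have "finite {y. \<not> small y 0 (a y \<otimes>\<^bsub>\<F> y\<^esub> b y)}"
    by (rule adele_finite2[where a = a and b = b]) (use a small0_mult in \<open>simp_all add: adele_carrier\<close>)
  then show ?thesis using a by (simp add: adele_carrier)
qed

lemma adele_neg: "a \<in> carrier adele_ring \<Longrightarrow> (\<lambda>y. \<ominus>\<^bsub>\<F> y\<^esub> a y) \<in> carrier adele_ring"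
proof -
  interpret C: cring "\<F> y" for y by (rule completion_cring)
  assume a: "a \<in> carrier adele_ring"
  have "finite {y. \<not> small y 0 (\<ominus>\<^bsub>\<F> y\<^esub> a y)}"
    by (rule adele_finite2[where a = a and b = a]) (use a small_minus in \<open>simp_all add: adele_carrier\<close>)
  then show ?thesis using a by (simp add: adele_carrier)
qed

lemma adele_cring: "cring (adele_ring :: 'k::field adele ring)"
proof -
  interpret C: cring "\<F> y" for y :: "'k place" by (rule completion_cring)
  show ?thesis
  proof (rule cringI)
    show "abelian_group (adele_ring :: 'k adele ring)"
    proof (rule abelian_groupI)
      fix a b c :: "'k adele"
      assume a: "a \<in> carrier adele_ring" and b: "b \<in> carrier adele_ring" and c: "c \<in> carrier adele_ring"
      then have m: "a y \<in> carrier (\<F> y)" "b y \<in> carrier (\<F> y)" "c y \<in> carrier (\<F> y)" for y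
        by (auto simp: adele_carrier)
      show "a \<oplus>\<^bsub>adele_ring\<^esub> b \<oplus>\<^bsub>adele_ring\<^esub> c = a \<oplus>\<^bsub>adele_ring\<^esub> (b \<oplus>\<^bsub>adele_ring\<^esub> c)"
        using m by (simp add: C.a_assoc)
    next
      fix a b :: "'k adele"
      assume a: "a \<in> carrier adele_ring" and b: "b \<in> carrier adele_ring"
      then have m: "a y \<in> carrier (\<F> y)" "b y \<in> carrier (\<F> y)" for y
        by (auto simp: adele_carrier)
      show "a \<oplus>\<^bsub>adele_ring\<^esub> b = b \<oplus>\<^bsub>adele_ring\<^esub> a" using m by (simp add: C.a_comm)
      show "a \<oplus>\<^bsub>adele_ring\<^esub> b \<in> carrier adele_ring" using adele_add[OF a b] by simp
    next
      fix a :: "'k adele"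
      assume a: "a \<in> carrier adele_ring"
      then have m: "a y \<in> carrier (\<F> y)" for y by (auto simp: adele_carrier)
      show "\<zero>\<^bsub>adele_ring\<^esub> \<oplus>\<^bsub>adele_ring\<^esub> a = a" using m by simp
      show "\<exists>b\<in>carrier adele_ring. b \<oplus>\<^bsub>adele_ring\<^esub> a = \<zero>\<^bsub>adele_ring\<^esub>"
        by (rule bexI[OF _ adele_neg[OF a]]) (simp add: m C.l_neg)
    qed (simp add: adele_carrier)
    show "comm_monoid (adele_ring :: 'k adele ring)"
    proof (rule comm_monoidI)
      fix a b c :: "'k adele"
      assume a: "a \<in> carrier adele_ring" and b: "b \<in> carrier adele_ring" and c: "c \<in> carrier adele_ring"
      then have m: "a y \<in> carrier (\<F> y)" "b y \<in> carrier (\<F> y)" "c y \<in> carrier (\<F> y)" for y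
        by (auto simp: adele_carrier)
      show "a \<otimes>\<^bsub>adele_ring\<^esub> b \<otimes>\<^bsub>adele_ring\<^esub> c = a \<otimes>\<^bsub>adele_ring\<^esub> (b \<otimes>\<^bsub>adele_ring\<^esub> c)"
        using m by (simp add: C.m_assoc)
    next
      fix a b :: "'k adele"
      assume a: "a \<in> carrier adele_ring" and b: "b \<in> carrier adele_ring"
      then have m: "a y \<in> carrier (\<F> y)" "b y \<in> carrier (\<F> y)" for y
        by (auto simp: adele_carrier)
      show "a \<otimes>\<^bsub>adele_ring\<^esub> b = b \<otimes>\<^bsub>adele_ring\<^esub> a" using m by (simp add: C.m_comm)
      show "a \<otimes>\<^bsub>adele_ring\<^esub> b \<in> carrier adele_ring" using adele_mult[OF a b] by simp
    next
      fix a :: "'k adele"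
      assume a: "a \<in> carrier adele_ring"
      then have m: "a y \<in> carrier (\<F> y)" for y by (auto simp: adele_carrier)
      show "\<one>\<^bsub>adele_ring\<^esub> \<otimes>\<^bsub>adele_ring\<^esub> a = a" using m by simp
    qed (simp add: adele_carrier small_one)
    fix a b c :: "'k adele"
    assume a: "a \<in> carrier adele_ring" and b: "b \<in> carrier adele_ring" and c: "c \<in> carrier adele_ring"
    then have m: "a y \<in> carrier (\<F> y)" "b y \<in> carrier (\<F> y)" "c y \<in> carrier (\<F> y)" for y
      by (auto simp: adele_carrier)
    show "(a \<oplus>\<^bsub>adele_ring\<^esub> b) \<otimes>\<^bsub>adele_ring\<^esub> c = a \<otimes>\<^bsub>adele_ring\<^esub> c \<oplus>\<^bsub>adele_ring\<^esub> b \<otimes>\<^bsub>adele_ring\<^esub> c"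
      using m by (simp add: C.l_distr)
  qed
qed

lemma adele_minus:
  assumes "a \<in> carrier adele_ring"
  shows "\<ominus>\<^bsub>adele_ring\<^esub> a = (\<lambda>y. \<ominus>\<^bsub>\<F> y\<^esub> a y)"
proof -
  interpret A: cring adele_ring by (rule adele_cring)
  interpret C: cring "\<F> y" for y by (rule completion_cring)
  show ?thesis using adele_neg[OF assms] assms
    by (intro A.minus_equality) (auto simp: adele_carrier C.l_neg)
qed

lemma integral_adeles_cring: "cring integral_adeles"
proof -
  interpret A: cring adele_ring by (rule adele_cring)
  let ?H = "{a. \<forall>y. small y 0 (a y)}"
  have sub: "?H \<subseteq> carrier adele_ring" using integral_adele by (auto simp: integral_adele_carrier)
  have "\<ominus>\<^bsub>adele_ring\<^esub> h \<in> ?H" if "h \<in> ?H" for h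
    using adele_minus[OF subsetD[OF sub that]] that by (simp add: small_minus)
  then have "subring ?H adele_ring"
    using sub by (intro A.subringI) (auto simp: small_one intro: small_add small0_mult)
  then have "subcring ?H adele_ring" by (rule A.subcringI')
  then have "cring (adele_ring \<lparr>carrier := ?H\<rparr>)" using A.subcring_iff[OF sub] by blast
  then show ?thesis by (simp add: integral_adeles_def local_integers_carrier)
qed

lemma integral_adele_minus:
  assumes "a \<in> carrier integral_adeles"
  shows "\<ominus>\<^bsub>integral_adeles\<^esub> a = (\<lambda>y. \<ominus>\<^bsub>\<F> y\<^esub> a y)"
proof -
  interpret A: cring integral_adeles by (rule integral_adeles_cring)
  interpret C: cring "\<F> y" for y by (rule completion_cring)
  show ?thesis using assms
    by (intro A.minus_equality) (auto simp: integral_adele_carrier small_minus small_carrier[of _ 0] C.l_neg)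
qed

definition comp_at :: "'k::field place \<Rightarrow> 'k GA \<Rightarrow> 'k local mat2" where
  "comp_at y g = map_mat2 (\<lambda>a. a y) g"

text \<open>Assembles an adelic matrix from its components; adelic matrices are records of functions of the place,
whereas computations take place at one place at a time.\<close>

definition adelic_mat :: "('k::field place \<Rightarrow> 'k local mat2) \<Rightarrow> 'k GA" where
  "adelic_mat m = Mat2 (\<lambda>y. e11 (m y)) (\<lambda>y. e12 (m y)) (\<lambda>y. e21 (m y)) (\<lambda>y. e22 (m y))"

lemma comp_at_Mat2: "comp_at y (Mat2 a b c d) = Mat2 (a y) (b y) (c y) (d y)"
  by (simp add: comp_at_def)

lemma comp_at_adelic_mat [simp]: "comp_at y (adelic_mat m) = m y"
  by (simp add: comp_at_def adelic_mat_def)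

lemma comp_at_eqI: "(\<And>y. comp_at y g = comp_at y h) \<Longrightarrow> g = h"
  by (cases g; cases h) (auto simp: comp_at_def)

lemma comp_at_mult: "comp_at y (g \<otimes>\<^bsub>GL2 adele_ring\<^esub> h) = comp_at y g \<otimes>\<^bsub>GL2 (\<F> y)\<^esub> comp_at y h"
  by (cases g; cases h) (simp add: comp_at_def GL2_mult)

lemma comp_at_one: "comp_at y \<one>\<^bsub>G_A\<^esub> = \<one>\<^bsub>GL2 (\<F> y)\<^esub>"
  by (simp add: comp_at_def GL2_one)

lemma GL2_local_integers_carrier:
  "m \<in> carrier (GL2 (local_integers y)) \<longleftrightarrow> small y 0 (e11 m) \<and> small y 0 (e12 m) \<and> small y 0 (e21 m) \<and> small y 0 (e22 m) \<and>
     (\<exists>w. small y 0 w \<and> det2 (\<F> y) m \<otimes>\<^bsub>\<F> y\<^esub> w = \<one>\<^bsub>\<F> y\<^esub>)"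
proof -
  interpret O: cring "local_integers y" by (rule local_integers_cring)
  have "det2 (local_integers y) m = det2 (\<F> y) m" "small y 0 (det2 (\<F> y) m)"
    if "small y 0 (e11 m)" "small y 0 (e12 m)" "small y 0 (e21 m)" "small y 0 (e22 m)"
    using that by (simp_all add: det2_def a_minus_def a_inv_local_integers small0_mult small_add small_minus)
  then show ?thesis by (auto simp: GL2_carrier O.Units_iff local_integers_carrier Bex_def)
qed

lemma GL2_completion_carrier:
  "m \<in> carrier (GL2 (\<F> y)) \<longleftrightarrow> e11 m \<in> carrier (\<F> y) \<and> e12 m \<in> carrier (\<F> y) \<and>
     e21 m \<in> carrier (\<F> y) \<and> e22 m \<in> carrier (\<F> y) \<and>
     (\<exists>w\<in>carrier (\<F> y). det2 (\<F> y) m \<otimes>\<^bsub>\<F> y\<^esub> w = \<one>\<^bsub>\<F> y\<^esub>)"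
proof -
  interpret C: cring "\<F> y" by (rule completion_cring)
  show ?thesis by (auto simp: GL2_carrier C.Units_iff C.det2_closed)
qed

lemma GL2_local_integers_subset: "m \<in> carrier (GL2 (local_integers y)) \<Longrightarrow> m \<in> carrier (GL2 (\<F> y))"
  by (auto simp: GL2_local_integers_carrier GL2_completion_carrier small_carrier)

lemma GL2_local_integers_mult: "monoid.mult (GL2 (local_integers y)) = monoid.mult (GL2 (\<F> y))"
  by (simp add: GL2_def)

lemma GL2_local_integers_one: "\<one>\<^bsub>GL2 (local_integers y)\<^esub> = \<one>\<^bsub>GL2 (\<F> y)\<^esub>"
  by (simp add: GL2_def)

text \<open>Integrality is a condition at each place separately, since the inverse of the determinant can be
assembled from its components.\<close>

lemma K_A_iff: "k \<in> K_A \<longleftrightarrow> (\<forall>y. comp_at y k \<in> carrier (GL2 (local_integers y)))"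
proof -
  interpret A: cring integral_adeles by (rule integral_adeles_cring)
  interpret C: cring "\<F> y" for y by (rule completion_cring)
  obtain a b c d where k: "k = Mat2 a b c d" by (cases k) auto
  let ?int = "\<forall>y. small y 0 (a y) \<and> small y 0 (b y) \<and> small y 0 (c y) \<and> small y 0 (d y)"
  have det: "det2 integral_adeles k = (\<lambda>y. det2 (\<F> y) (comp_at y k))" if ?int
  proof -
    have "(\<lambda>y. b y \<otimes>\<^bsub>\<F> y\<^esub> c y) \<in> carrier integral_adeles"
      using that by (simp add: integral_adele_carrier small0_mult)
    then show ?thesis by (simp add: k det2_Mat2 comp_at_Mat2 a_minus_def integral_adele_minus)
  qed
  have deti: "(\<lambda>y. det2 (\<F> y) (comp_at y k)) \<in> carrier integral_adeles" if ?int
    using that by (simp add: k integral_adele_carrier det2_Mat2 comp_at_Mat2 small_diff small0_mult)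
  show ?thesis
  proof
    assume "k \<in> K_A"
    then have i: ?int and u: "det2 integral_adeles k \<in> Units integral_adeles"
      by (auto simp: K_A_def GL2_carrier k integral_adele_carrier)
    then obtain w where w: "w \<in> carrier integral_adeles"
      "\<And>y. det2 (\<F> y) (comp_at y k) \<otimes>\<^bsub>\<F> y\<^esub> w y = \<one>\<^bsub>\<F> y\<^esub>"
      by (auto simp: A.Units_iff det[OF i] dest: fun_cong)
    show "\<forall>y. comp_at y k \<in> carrier (GL2 (local_integers y))"
    proof
      fix y
      have e: "e11 (comp_at y k) = a y" "e12 (comp_at y k) = b y" "e21 (comp_at y k) = c y" "e22 (comp_at y k) = d y"
        by (simp_all add: k comp_at_Mat2)
      have "small y 0 (w y)" using w(1) by (simp add: integral_adele_carrier)
      then show "comp_at y k \<in> carrier (GL2 (local_integers y))"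
        unfolding GL2_local_integers_carrier e using i w(2)[of y] by auto
    qed
  next
    assume r: "\<forall>y. comp_at y k \<in> carrier (GL2 (local_integers y))"
    then have i: ?int by (simp add: GL2_local_integers_carrier k comp_at_Mat2)
    have "\<forall>y. \<exists>w. small y 0 w \<and> det2 (\<F> y) (comp_at y k) \<otimes>\<^bsub>\<F> y\<^esub> w = \<one>\<^bsub>\<F> y\<^esub>"
      using r by (simp add: GL2_local_integers_carrier)
    then obtain w where w: "\<And>y. small y 0 (w y)" "\<And>y. det2 (\<F> y) (comp_at y k) \<otimes>\<^bsub>\<F> y\<^esub> w y = \<one>\<^bsub>\<F> y\<^esub>"
      by metis
    have "w \<in> carrier integral_adeles" using w(1) by (simp add: integral_adele_carrier)
    then have "det2 integral_adeles k \<in> Units integral_adeles"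
      using w(2) deti[OF i] by (auto simp: A.Units_iff det[OF i] intro!: bexI[of _ w])
    then show "k \<in> K_A" using i by (simp add: K_A_def GL2_carrier k integral_adele_carrier)
  qed
qed

lemma G_A_iff: "g \<in> carrier G_A \<longleftrightarrow> (\<forall>y. comp_at y g \<in> carrier (GL2 (\<F> y))) \<and>
    finite {y. comp_at y g \<notin> carrier (GL2 (local_integers y))}"
proof -
  interpret A: cring adele_ring by (rule adele_cring)
  interpret C: cring "\<F> y" for y by (rule completion_cring)
  obtain a b c d where k: "g = Mat2 a b c d" by (cases g) auto
  let ?int = "a \<in> carrier adele_ring \<and> b \<in> carrier adele_ring \<and> c \<in> carrier adele_ring \<and> d \<in> carrier adele_ring"
  have det: "det2 adele_ring g = (\<lambda>y. det2 (\<F> y) (comp_at y g))" if ?int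
  proof -
    have "(\<lambda>y. b y \<otimes>\<^bsub>\<F> y\<^esub> c y) \<in> carrier adele_ring"
      using that by (simp add: adele_mult)
    then show ?thesis by (simp add: k det2_Mat2 comp_at_Mat2 a_minus_def adele_minus)
  qed
  show ?thesis
  proof
    assume "g \<in> carrier G_A"
    then have i: ?int and u: "det2 adele_ring g \<in> Units adele_ring"
      by (auto simp: GL2_carrier k)
    then obtain w where w: "w \<in> carrier adele_ring"
      "\<And>y. det2 (\<F> y) (comp_at y g) \<otimes>\<^bsub>\<F> y\<^esub> w y = \<one>\<^bsub>\<F> y\<^esub>"
      by (auto simp: A.Units_iff det[OF i] dest: fun_cong)
    have e: "e11 (comp_at y g) = a y" "e12 (comp_at y g) = b y" "e21 (comp_at y g) = c y" "e22 (comp_at y g) = d y" for y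
      by (simp_all add: k comp_at_Mat2)
    have "\<forall>y. comp_at y g \<in> carrier (GL2 (\<F> y))"
    proof
      fix y
      have "w y \<in> carrier (\<F> y)" using w(1) by (simp add: adele_carrier)
      then show "comp_at y g \<in> carrier (GL2 (\<F> y))"
        unfolding GL2_completion_carrier e using i w(2)[of y] by (auto simp: adele_carrier)
    qed
    moreover have "{y. comp_at y g \<notin> carrier (GL2 (local_integers y))} \<subseteq>
      {y. \<not> small y 0 (a y)} \<union> {y. \<not> small y 0 (b y)} \<union> {y. \<not> small y 0 (c y)} \<union> {y. \<not> small y 0 (d y)} \<union> {y. \<not> small y 0 (w y)}"
      using w(2) by (auto simp: GL2_local_integers_carrier e)
    then have "finite {y. comp_at y g \<notin> carrier (GL2 (local_integers y))}"
      by (rule finite_subset) (use i w in \<open>simp add: adele_carrier\<close>)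
    ultimately show "(\<forall>y. comp_at y g \<in> carrier (GL2 (\<F> y))) \<and>
      finite {y. comp_at y g \<notin> carrier (GL2 (local_integers y))}" by blast
  next
    assume r: "(\<forall>y. comp_at y g \<in> carrier (GL2 (\<F> y))) \<and>
      finite {y. comp_at y g \<notin> carrier (GL2 (local_integers y))}"
    let ?S = "{y. comp_at y g \<notin> carrier (GL2 (local_integers y))}"
    have S: "finite ?S" using r by blast
    have "finite {y. \<not> small y 0 (a y)}" "finite {y. \<not> small y 0 (b y)}" "finite {y. \<not> small y 0 (c y)}" "finite {y. \<not> small y 0 (d y)}"
      by (rule finite_subset[OF _ S]; auto simp: GL2_local_integers_carrier k comp_at_Mat2)+
    moreover have "\<forall>y. a y \<in> carrier (\<F> y) \<and> b y \<in> carrier (\<F> y) \<and> c y \<in> carrier (\<F> y) \<and> d y \<in> carrier (\<F> y)"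
      using r by (simp add: GL2_completion_carrier k comp_at_Mat2)
    ultimately have i: ?int by (simp add: adele_carrier)
    let ?P = "\<lambda>y w. w \<in> carrier (\<F> y) \<and> det2 (\<F> y) (comp_at y g) \<otimes>\<^bsub>\<F> y\<^esub> w = \<one>\<^bsub>\<F> y\<^esub>
       \<and> (y \<notin> ?S \<longrightarrow> small y 0 w)"
    have "\<forall>y. \<exists>w. ?P y w"
    proof
      fix y show "\<exists>w. ?P y w"
      proof (cases "y \<in> ?S")
        case True
        have "comp_at y g \<in> carrier (GL2 (\<F> y))" using r by blast
        then show ?thesis using True unfolding GL2_completion_carrier by blast
      next
        case False
        then have "comp_at y g \<in> carrier (GL2 (local_integers y))" by blast
        then show ?thesis using small_carrier[of y 0] unfolding GL2_local_integers_carrier by blast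
      qed
    qed
    from choice[OF this] obtain w where "\<forall>y. ?P y (w y)" by (elim exE)
    then have w: "?P y (w y)" for y by (rule spec)
    have "finite {y. \<not> small y 0 (w y)}" by (rule finite_subset[OF _ S]) (use w in auto)
    then have "w \<in> carrier adele_ring" using w by (simp add: adele_carrier)
    moreover have "det2 adele_ring g \<in> carrier adele_ring" using i by (intro A.det2_closed) (auto simp: k)
    ultimately have "det2 adele_ring g \<in> Units adele_ring"
      using w by (auto simp: A.Units_iff det[OF i] intro!: bexI[of _ w] ext)
    then show "g \<in> carrier G_A" using i by (simp add: GL2_carrier k)
  qed
qed

section \<open>Adelic matrices with rational components\<close>

abbreviation GA_mult :: "'k::field GA \<Rightarrow> 'k GA \<Rightarrow> 'k GA" (infixl "\<star>" 70) where
  "g \<star> h \<equiv> g \<otimes>\<^bsub>G_A\<^esub> h"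

text \<open>Matrices over $F$ itself are handled with the operations of the type rather than with a ring structure
on a carrier.\<close>

definition mmul :: "'a::comm_ring_1 mat2 \<Rightarrow> 'a mat2 \<Rightarrow> 'a mat2" where
  "mmul g h = Mat2 (e11 g * e11 h + e12 g * e21 h) (e11 g * e12 h + e12 g * e22 h)
                   (e21 g * e11 h + e22 g * e21 h) (e21 g * e12 h + e22 g * e22 h)"

definition mdet :: "'a::comm_ring_1 mat2 \<Rightarrow> 'a" where
  "mdet g = e11 g * e22 g - e12 g * e21 g"

definition mone :: "'a::comm_ring_1 mat2" where
  "mone = Mat2 1 0 0 1"

definition minv :: "'a::field mat2 \<Rightarrow> 'a mat2" where
  "minv g = Mat2 (e22 g / mdet g) (- (e12 g / mdet g)) (- (e21 g / mdet g)) (e11 g / mdet g)"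

lemma mdet_mmul: "mdet (mmul g h) = mdet g * mdet h"
  by (simp add: mdet_def mmul_def algebra_simps)

lemma mmul_assoc: "mmul (mmul g h) k = mmul g (mmul h k)"
  by (simp add: mmul_def algebra_simps)

lemma mmul_mone [simp]: "mmul mone g = g" "mmul g mone = g"
  by (cases g; simp add: mmul_def mone_def)+

lemma mdet_mone [simp]: "mdet mone = 1"
  by (simp add: mdet_def mone_def)

lemma minv_left: "mdet g \<noteq> 0 \<Longrightarrow> mmul (minv g) g = mone"
proof -
  assume d: "mdet g \<noteq> 0"
  have e: "e11 g * e22 g - e12 g * e21 g = mdet g" by (simp add: mdet_def)
  have "(e22 g * e11 g - e12 g * e21 g) / mdet g = 1" using d e by (simp add: mult.commute)
  then have "e22 g / mdet g * e11 g + - (e12 g / mdet g) * e21 g = 1" by (simp add: diff_divide_distrib)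
  moreover have "- (e21 g / mdet g) * e12 g + e11 g / mdet g * e22 g = 1"
  proof -
    have "(e11 g * e22 g - e12 g * e21 g) / mdet g = 1" using d e by simp
    then show ?thesis by (simp add: diff_divide_distrib mult.commute)
  qed
  ultimately show ?thesis by (simp add: mmul_def minv_def mone_def mult.commute)
qed

lemma minv_right: "mdet g \<noteq> 0 \<Longrightarrow> mmul g (minv g) = mone"
proof -
  assume d: "mdet g \<noteq> 0"
  have e: "e11 g * e22 g - e12 g * e21 g = mdet g" by (simp add: mdet_def)
  have "(e11 g * e22 g - e12 g * e21 g) / mdet g = 1" using d e by simp
  then show ?thesis by (simp add: mmul_def minv_def mone_def diff_divide_distrib mult.commute)
qed

lemma mdet_minv: "mdet g \<noteq> 0 \<Longrightarrow> mdet (minv g) = inverse (mdet g)"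
  using mdet_mmul[of "minv g" g] minv_left[of g] by (simp add: field_simps)

definition embm :: "'k::field place \<Rightarrow> 'k ratfun mat2 \<Rightarrow> 'k local mat2" where
  "embm y g = map_mat2 (emb_local y) g"

lemma embm_sel [simp]:
  "e11 (embm y g) = emb_local y (e11 g)" "e12 (embm y g) = emb_local y (e12 g)"
  "e21 (embm y g) = emb_local y (e21 g)" "e22 (embm y g) = emb_local y (e22 g)"
  by (cases g; simp add: embm_def)+

lemma embm_mmul: "embm y (mmul g h) = embm y g \<otimes>\<^bsub>GL2 (\<F> y)\<^esub> embm y h"
  by (cases g; cases h) (simp add: embm_def mmul_def GL2_mult emb_local_add emb_local_mult)

lemma embm_mone: "embm y mone = \<one>\<^bsub>GL2 (\<F> y)\<^esub>"
  by (simp add: embm_def mone_def GL2_one emb_local_0 emb_local_1)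

lemma det2_embm: "det2 (\<F> y) (embm y g) = emb_local y (mdet g)"
  by (simp add: det2_def mdet_def emb_local_mult emb_local_diff)

lemma embm_carrier: "mdet g \<noteq> 0 \<Longrightarrow> embm y g \<in> carrier (GL2 (\<F> y))"
  by (auto simp: GL2_completion_carrier det2_embm emb_local_mult[symmetric] emb_local_1[symmetric] emb_local_eq_iff
      intro!: bexI[of _ "emb_local y (inverse (mdet g))"])

text \<open>$g \in \mathrm{GL}_2(\mathcal{O}_y \cap F)$.\<close>

definition gl2_integral :: "'k::field place \<Rightarrow> 'k ratfun mat2 \<Rightarrow> bool" where
  "gl2_integral y g \<longleftrightarrow> e11 g \<in> val_ring y \<and> e12 g \<in> val_ring y \<and> e21 g \<in> val_ring y \<and> e22 g \<in> val_ring y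
     \<and> unit_at y (mdet g)"

lemma gl2_integral_mone [simp]: "gl2_integral y mone"
  by (simp add: gl2_integral_def mone_def mdet_def)

lemma gl2_integral_mmul: "gl2_integral y g \<Longrightarrow> gl2_integral y h \<Longrightarrow> gl2_integral y (mmul g h)"
  unfolding gl2_integral_def mdet_mmul
  by (simp add: mmul_def val_ring_add val_ring_mult unit_at_mult)

lemma gl2_integral_minv: "gl2_integral y g \<Longrightarrow> gl2_integral y (minv g)"
proof -
  assume g: "gl2_integral y g"
  then have d: "mdet g \<noteq> 0" "inverse (mdet g) \<in> val_ring y" "unit_at y (inverse (mdet g))"
    by (auto simp: gl2_integral_def unit_at_def)
  show ?thesis unfolding gl2_integral_def mdet_minv[OF d(1)]
    using g d by (auto simp: gl2_integral_def minv_def divide_inverse intro!: val_ring_mult val_ring_minus)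
qed

lemma embm_integral: "embm y g \<in> carrier (GL2 (local_integers y)) \<longleftrightarrow> gl2_integral y g"
proof -
  interpret C: cring "\<F> y" by (rule completion_cring)
  have "(\<exists>w. small y 0 w \<and> det2 (\<F> y) (embm y g) \<otimes>\<^bsub>\<F> y\<^esub> w = \<one>\<^bsub>\<F> y\<^esub>)
    \<longleftrightarrow> unit_at y (mdet g)" if i: "mdet g \<in> val_ring y"
  proof
    assume "\<exists>w. small y 0 w \<and> det2 (\<F> y) (embm y g) \<otimes>\<^bsub>\<F> y\<^esub> w = \<one>\<^bsub>\<F> y\<^esub>"
    then obtain w where w: "small y 0 w" "emb_local y (mdet g) \<otimes>\<^bsub>\<F> y\<^esub> w = \<one>\<^bsub>\<F> y\<^esub>"
      by (auto simp: det2_embm)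
    have d: "mdet g \<noteq> 0"
    proof
      assume "mdet g = 0"
      then have "emb_local y 0 = emb_local y 1" using w small_carrier[OF w(1)] by (simp add: emb_local_0 emb_local_1)
      then show False by (simp add: emb_local_eq_iff)
    qed
    have "w = (emb_local y (inverse (mdet g)) \<otimes>\<^bsub>\<F> y\<^esub> emb_local y (mdet g)) \<otimes>\<^bsub>\<F> y\<^esub> w"
      using d small_carrier[OF w(1)] by (simp add: emb_local_mult[symmetric] emb_local_1)
    also have "\<dots> = emb_local y (inverse (mdet g))" using w small_carrier[OF w(1)] by (simp add: C.m_assoc)
    finally have "small y 0 (emb_local y (inverse (mdet g)))" using w(1) by simp
    then show "unit_at y (mdet g)" using d i by (simp add: unit_at_def small_emb near_zero_val_ring)
  next
    assume u: "unit_at y (mdet g)"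
    then have "small y 0 (emb_local y (inverse (mdet g)))" by (simp add: unit_at_def small_emb near_zero_val_ring)
    moreover have "det2 (\<F> y) (embm y g) \<otimes>\<^bsub>\<F> y\<^esub> emb_local y (inverse (mdet g)) = \<one>\<^bsub>\<F> y\<^esub>"
      using u by (simp add: det2_embm emb_local_mult[symmetric] emb_local_1 unit_at_def)
    ultimately show "\<exists>w. small y 0 w \<and> det2 (\<F> y) (embm y g) \<otimes>\<^bsub>\<F> y\<^esub> w = \<one>\<^bsub>\<F> y\<^esub>" by blast
  qed
  moreover have "mdet g \<in> val_ring y" if "e11 g \<in> val_ring y" "e12 g \<in> val_ring y" "e21 g \<in> val_ring y" "e22 g \<in> val_ring y"
    using that val_ring_add[OF val_ring_mult val_ring_minus[OF val_ring_mult]] by (simp add: mdet_def)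
  ultimately show ?thesis
    by (auto simp: GL2_local_integers_carrier gl2_integral_def small_emb near_zero_val_ring)
qed

text \<open>A family of matrices over $F$ indexed by the places that defines an element of $G(\mathbb{A})$.\<close>

definition family :: "('k::field place \<Rightarrow> 'k ratfun mat2) \<Rightarrow> bool" where
  "family \<gamma> \<longleftrightarrow> (\<forall>y. mdet (\<gamma> y) \<noteq> 0) \<and> finite {y. \<not> gl2_integral y (\<gamma> y)}"

text \<open>The element of $G(\mathbb{A})$ with the given rational components. Constant families give $G(F)$.\<close>

definition J :: "('k::field place \<Rightarrow> 'k ratfun mat2) \<Rightarrow> 'k GA" where
  "J \<gamma> = adelic_mat (\<lambda>y. embm y (\<gamma> y))"

lemma comp_at_J [simp]: "comp_at y (J \<gamma>) = embm y (\<gamma> y)"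
  by (simp add: J_def)

lemma J_carrier: "family \<gamma> \<Longrightarrow> J \<gamma> \<in> carrier G_A"
  by (simp add: G_A_iff family_def embm_carrier embm_integral)

lemma J_mmul: "J (\<lambda>y. mmul (\<gamma> y) (\<delta> y)) = J \<gamma> \<star> J \<delta>"
  by (rule comp_at_eqI) (simp add: comp_at_mult embm_mmul)

lemma J_mone: "J (\<lambda>y. mone) = \<one>\<^bsub>G_A\<^esub>"
  by (rule comp_at_eqI) (simp only: comp_at_J comp_at_one embm_mone)

lemma J_K: "J \<gamma> \<in> K_A \<longleftrightarrow> (\<forall>y. gl2_integral y (\<gamma> y))"
  by (simp add: K_A_iff embm_integral)

lemma family_integral: "\<forall>y. gl2_integral y (\<gamma> y) \<Longrightarrow> family \<gamma>"
  by (auto simp: family_def gl2_integral_def unit_at_def)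

lemma family_mmul:
  assumes "family \<gamma>" "family \<delta>"
  shows "family (\<lambda>y. mmul (\<gamma> y) (\<delta> y))"
proof -
  have "finite {y. \<not> gl2_integral y (mmul (\<gamma> y) (\<delta> y))}"
    by (rule finite_subset[of _ "{y. \<not> gl2_integral y (\<gamma> y)} \<union> {y. \<not> gl2_integral y (\<delta> y)}"])
      (use assms gl2_integral_mmul in \<open>auto simp: family_def\<close>)
  then show ?thesis using assms by (simp add: family_def mdet_mmul)
qed

lemma family_minv:
  assumes "family \<gamma>"
  shows "family (\<lambda>y. minv (\<gamma> y))"
proof -
  have "finite {y. \<not> gl2_integral y (minv (\<gamma> y))}"
    by (rule finite_subset[of _ "{y. \<not> gl2_integral y (\<gamma> y)}"])
      (use assms gl2_integral_minv in \<open>auto simp: family_def\<close>)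
  then show ?thesis using assms by (simp add: family_def mdet_minv)
qed

lemma G_A_group: "Group.group (G_A :: 'k::field GA monoid)"
  by (rule cring.GL2_group[OF adele_cring])

lemma K_A_subset: "K_A \<subseteq> carrier G_A"
  by (auto simp: G_A_iff K_A_iff GL2_local_integers_subset)

lemma K_A_subgroup: "subgroup K_A (G_A :: 'k::field GA monoid)"
proof -
  interpret G: Group.group "G_A :: 'k GA monoid" by (rule G_A_group)
  interpret I: cring "integral_adeles :: 'k adele ring" by (rule integral_adeles_cring)
  interpret K: Group.group "GL2 (integral_adeles :: 'k adele ring)" by (rule I.GL2_group)
  have m: "monoid.mult (GL2 (integral_adeles :: 'k adele ring)) = monoid.mult G_A"
    "\<one>\<^bsub>GL2 (integral_adeles :: 'k adele ring)\<^esub> = \<one>\<^bsub>G_A\<^esub>"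
    by (simp_all add: GL2_def)
  show ?thesis
  proof (rule G.subgroupI)
    show "K_A \<subseteq> carrier (G_A :: 'k GA monoid)" by (rule K_A_subset)
    show "K_A \<noteq> ({} :: 'k GA set)" using K.one_closed by (auto simp: K_A_def)
    fix a b :: "'k GA" assume a: "a \<in> K_A" and b: "b \<in> K_A"
    show "a \<star> b \<in> K_A" using K.m_closed[of a b] a b by (simp add: K_A_def m)
  next
    fix a :: "'k GA" assume a: "a \<in> K_A"
    obtain b where b: "b \<in> K_A" "b \<star> a = \<one>\<^bsub>G_A\<^esub>"
      using K.l_inv_ex[of a] a by (auto simp: K_A_def m)
    then have "inv\<^bsub>G_A\<^esub> a = b" using a K_A_subset by (intro G.inv_equality) auto
    then show "inv\<^bsub>G_A\<^esub> a \<in> K_A" using b by simp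
  qed
qed

text \<open>If $uw = 1$ then $w = 1 - (u-1)w$. As $u - 1$ has positive valuation, each use of this identity
improves a lower bound for the valuation of $w$ until it reaches 0.\<close>

lemma local_unit_inverse:
  assumes u: "small y 1 (u \<ominus>\<^bsub>\<F> y\<^esub> \<one>\<^bsub>\<F> y\<^esub>)" "u \<in> carrier (\<F> y)"
    and w: "w \<in> carrier (\<F> y)" "u \<otimes>\<^bsub>\<F> y\<^esub> w = \<one>\<^bsub>\<F> y\<^esub>"
  shows "small y 0 w"
proof -
  interpret C: cring "\<F> y" by (rule completion_cring)
  have e: "w = \<one>\<^bsub>\<F> y\<^esub> \<ominus>\<^bsub>\<F> y\<^esub> ((u \<ominus>\<^bsub>\<F> y\<^esub> \<one>\<^bsub>\<F> y\<^esub>) \<otimes>\<^bsub>\<F> y\<^esub> w)"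
  proof -
    have "(u \<ominus>\<^bsub>\<F> y\<^esub> \<one>\<^bsub>\<F> y\<^esub>) \<otimes>\<^bsub>\<F> y\<^esub> w = u \<otimes>\<^bsub>\<F> y\<^esub> w \<ominus>\<^bsub>\<F> y\<^esub> w"
      using u(2) w(1) by (simp add: a_minus_def C.l_distr C.l_minus)
    then have "\<one>\<^bsub>\<F> y\<^esub> \<ominus>\<^bsub>\<F> y\<^esub> ((u \<ominus>\<^bsub>\<F> y\<^esub> \<one>\<^bsub>\<F> y\<^esub>) \<otimes>\<^bsub>\<F> y\<^esub> w)
      = \<one>\<^bsub>\<F> y\<^esub> \<ominus>\<^bsub>\<F> y\<^esub> (\<one>\<^bsub>\<F> y\<^esub> \<ominus>\<^bsub>\<F> y\<^esub> w)" using w(2) by simp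
    also have "\<dots> = w" using w(1) by algebra
    finally show ?thesis by simp
  qed
  have one: "small y 0 \<one>\<^bsub>\<F> y\<^esub>" by (simp add: small_one)
  have *: "small y (- int n) w \<Longrightarrow> small y 0 w" for n
  proof (induction n)
    case (Suc n)
    have "small y (1 + - int (Suc n)) ((u \<ominus>\<^bsub>\<F> y\<^esub> \<one>\<^bsub>\<F> y\<^esub>) \<otimes>\<^bsub>\<F> y\<^esub> w)"
      by (rule small_mult[OF u(1) Suc.prems])
    moreover have "1 + - int (Suc n) = - int n" by simp
    ultimately have "small y (- int n) ((u \<ominus>\<^bsub>\<F> y\<^esub> \<one>\<^bsub>\<F> y\<^esub>) \<otimes>\<^bsub>\<F> y\<^esub> w)" by metis
    then have "small y (- int n) w" by (subst e) (intro small_diff small_mono[OF one], simp)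
    then show ?case by (rule Suc.IH)
  qed simp
  obtain N where N: "small y N w" using small_exists[OF w(1)] by blast
  have "small y (- int (nat (- N))) w" by (rule small_mono[OF N]) simp
  then show ?thesis by (rule *)
qed

lemma small_exists5:
  assumes "a \<in> carrier (\<F> y)" "b \<in> carrier (\<F> y)" "c \<in> carrier (\<F> y)"
    "d \<in> carrier (\<F> y)" "e \<in> carrier (\<F> y)"
  shows "\<exists>B\<ge>0. small y (-B) a \<and> small y (-B) b \<and> small y (-B) c \<and> small y (-B) d \<and> small y (-B) e"
proof -
  obtain A1 A2 A3 A4 A5 where *: "small y A1 a" "small y A2 b" "small y A3 c" "small y A4 d" "small y A5 e"
    using assms small_exists by meson
  define B where "B = max (max (max (- A1) (- A2)) (max (- A3) (- A4))) (max (- A5) 0)"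
  have B: "B \<ge> 0" "- B \<le> A1" "- B \<le> A2" "- B \<le> A3" "- B \<le> A4" "- B \<le> A5" by (auto simp: B_def)
  then show ?thesis using small_mono[OF *(1) B(2)] small_mono[OF *(2) B(3)] small_mono[OF *(3) B(4)]
      small_mono[OF *(4) B(5)] small_mono[OF *(5) B(6)] by blast
qed

text \<open>Density of $F$ in its completion, for invertible matrices: $k = g^{-1}m$ is close to 1 when $g$ is
close to $m$. The entry of $k$ in the upper right corner is made divisible by the uniformizer because this is the
congruence that survives conjugation by $\mathrm{diag}(\pi_y, 1)$.\<close>

lemma GL2_approximation:
  assumes m: "m \<in> carrier (GL2 (\<F> y))"
  shows "\<exists>g k. mdet g \<noteq> 0 \<and> k \<in> carrier (GL2 (local_integers y)) \<and> m = embm y g \<otimes>\<^bsub>GL2 (\<F> y)\<^esub> k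
     \<and> small y 1 (e12 k)"
proof -
  interpret C: cring "\<F> y" by (rule completion_cring)
  interpret G: Group.group "GL2 (\<F> y)" by (rule C.GL2_group)
  obtain a b c d where mm: "m = Mat2 a b c d" by (cases m) auto
  note [simp] = emb_local_closed
  let ?D = "a \<otimes>\<^bsub>\<F> y\<^esub> d \<ominus>\<^bsub>\<F> y\<^esub> b \<otimes>\<^bsub>\<F> y\<^esub> c"
  obtain w where cr: "a \<in> carrier (\<F> y)" "b \<in> carrier (\<F> y)" "c \<in> carrier (\<F> y)" "d \<in> carrier (\<F> y)"
    and w: "w \<in> carrier (\<F> y)" "?D \<otimes>\<^bsub>\<F> y\<^esub> w = \<one>\<^bsub>\<F> y\<^esub>"
    using m by (auto simp: GL2_completion_carrier mm det2_def)
  obtain B where B: "B \<ge> 0" "small y (-B) a" "small y (-B) b" "small y (-B) c" "small y (-B) d" "small y (-B) w"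
    using small_exists5[OF cr w(1)] by blast
  \<comment> \<open>all entries and the inverse determinant have valuation at least $-B$; then the entries of $g^{-1}$ have valuation at least $-2B$\<close>
  define L where "L = 2 * B + 1"
  obtain \<alpha> \<beta> \<gamma> \<delta> where ap:
    "small y L (a \<ominus>\<^bsub>\<F> y\<^esub> emb_local y \<alpha>)" "small y L (b \<ominus>\<^bsub>\<F> y\<^esub> emb_local y \<beta>)"
    "small y L (c \<ominus>\<^bsub>\<F> y\<^esub> emb_local y \<gamma>)" "small y L (d \<ominus>\<^bsub>\<F> y\<^esub> emb_local y \<delta>)"
    using small_approx cr by meson
  have LB: "- B \<le> L" using B(1) by (simp add: L_def)
  have flip: "emb_local y z = v \<ominus>\<^bsub>\<F> y\<^esub> (v \<ominus>\<^bsub>\<F> y\<^esub> emb_local y z)" if "v \<in> carrier (\<F> y)" for v z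
    using that emb_local_closed[of y z] by algebra
  have sm: "small y (-B) (emb_local y z)" if "small y (-B) v" "small y L (v \<ominus>\<^bsub>\<F> y\<^esub> emb_local y z)" for v z
    using small_diff[OF that(1) small_mono[OF that(2) LB]] flip[OF small_carrier[OF that(1)], of z] by simp
  have apB: "small y (-B) (emb_local y \<beta>)" "small y (-B) (emb_local y \<delta>)" "small y (-B) (emb_local y \<alpha>)" "small y (-B) (emb_local y \<gamma>)"
    using sm ap B by blast+
  define g where "g = Mat2 \<alpha> \<beta> \<gamma> \<delta>"
  let ?e = "emb_local y (mdet g)"
  have e: "?e = emb_local y \<alpha> \<otimes>\<^bsub>\<F> y\<^esub> emb_local y \<delta> \<ominus>\<^bsub>\<F> y\<^esub> emb_local y \<beta> \<otimes>\<^bsub>\<F> y\<^esub> emb_local y \<gamma>"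
    by (simp add: g_def mdet_def emb_local_diff emb_local_mult)
  have De: "?D \<ominus>\<^bsub>\<F> y\<^esub> ?e =
     (a \<otimes>\<^bsub>\<F> y\<^esub> (d \<ominus>\<^bsub>\<F> y\<^esub> emb_local y \<delta>) \<oplus>\<^bsub>\<F> y\<^esub> (a \<ominus>\<^bsub>\<F> y\<^esub> emb_local y \<alpha>) \<otimes>\<^bsub>\<F> y\<^esub> emb_local y \<delta>)
     \<ominus>\<^bsub>\<F> y\<^esub> (b \<otimes>\<^bsub>\<F> y\<^esub> (c \<ominus>\<^bsub>\<F> y\<^esub> emb_local y \<gamma>) \<oplus>\<^bsub>\<F> y\<^esub> (b \<ominus>\<^bsub>\<F> y\<^esub> emb_local y \<beta>) \<otimes>\<^bsub>\<F> y\<^esub> emb_local y \<gamma>)"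
    unfolding e using cr emb_local_closed[of y \<alpha>] emb_local_closed[of y \<beta>] emb_local_closed[of y \<gamma>] emb_local_closed[of y \<delta>] by algebra
  have "small y (-B + L) (?D \<ominus>\<^bsub>\<F> y\<^esub> ?e)"
    unfolding De
    using small_mult[OF B(2) ap(4)] small_mult[OF ap(1) apB(2)] small_mult[OF B(3) ap(3)] small_mult[OF ap(2) apB(4)]
    by (intro small_diff small_add) (simp_all add: add.commute)
  from small_mult[OF this B(6)] have "small y 1 ((?D \<ominus>\<^bsub>\<F> y\<^esub> ?e) \<otimes>\<^bsub>\<F> y\<^esub> w)"
    by (rule small_mono) (simp add: L_def)
  moreover have "?e \<otimes>\<^bsub>\<F> y\<^esub> w \<ominus>\<^bsub>\<F> y\<^esub> \<one>\<^bsub>\<F> y\<^esub> = \<ominus>\<^bsub>\<F> y\<^esub> ((?D \<ominus>\<^bsub>\<F> y\<^esub> ?e) \<otimes>\<^bsub>\<F> y\<^esub> w)"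
  proof -
    have "?e \<otimes>\<^bsub>\<F> y\<^esub> w \<ominus>\<^bsub>\<F> y\<^esub> ?D \<otimes>\<^bsub>\<F> y\<^esub> w = \<ominus>\<^bsub>\<F> y\<^esub> ((?D \<ominus>\<^bsub>\<F> y\<^esub> ?e) \<otimes>\<^bsub>\<F> y\<^esub> w)"
      using cr w(1) emb_local_closed[of y "mdet g"] by algebra
    then show ?thesis using w(2) by simp
  qed
  ultimately have u1: "small y 1 (?e \<otimes>\<^bsub>\<F> y\<^esub> w \<ominus>\<^bsub>\<F> y\<^esub> \<one>\<^bsub>\<F> y\<^esub>)" by (simp add: small_minus)
  have g0: "mdet g \<noteq> 0"
  proof
    assume "mdet g = 0"
    then have "small y 1 (\<ominus>\<^bsub>\<F> y\<^esub> \<one>\<^bsub>\<F> y\<^esub>)" using u1 w(1) by (simp add: emb_local_0 a_minus_def)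
    from small_minus[OF this] show False by (simp add: small_one)
  qed
  let ?f = "emb_local y (inverse (mdet g))"
  have ef: "?e \<otimes>\<^bsub>\<F> y\<^esub> ?f = \<one>\<^bsub>\<F> y\<^esub>" using g0 by (simp add: emb_local_mult[symmetric] emb_local_1)
  have Dc: "?D \<in> carrier (\<F> y)" using cr by simp
  let ?u = "?e \<otimes>\<^bsub>\<F> y\<^esub> w"
  have uinv: "?u \<otimes>\<^bsub>\<F> y\<^esub> (?f \<otimes>\<^bsub>\<F> y\<^esub> ?D) = \<one>\<^bsub>\<F> y\<^esub>"
  proof -
    have "?u \<otimes>\<^bsub>\<F> y\<^esub> (?f \<otimes>\<^bsub>\<F> y\<^esub> ?D) = (?e \<otimes>\<^bsub>\<F> y\<^esub> ?f) \<otimes>\<^bsub>\<F> y\<^esub> (?D \<otimes>\<^bsub>\<F> y\<^esub> w)"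
      using w(1) Dc by (simp add: C.m_ac)
    then show ?thesis using ef w(2) by simp
  qed
  have fD: "small y 0 (?f \<otimes>\<^bsub>\<F> y\<^esub> ?D)" by (rule local_unit_inverse[OF u1 _ _ uinv]) (use w(1) Dc in simp_all)
  have ub: "small y 0 ?u"
  proof -
    have "?u = (?u \<ominus>\<^bsub>\<F> y\<^esub> \<one>\<^bsub>\<F> y\<^esub>) \<oplus>\<^bsub>\<F> y\<^esub> \<one>\<^bsub>\<F> y\<^esub>"
      using w(1) by (simp add: a_minus_def C.a_assoc C.l_neg)
    then show ?thesis using small_add[OF small_mono[OF u1, of 0], of "\<one>\<^bsub>\<F> y\<^esub>"] by (simp add: small_one)
  qed
  have "?f = (?f \<otimes>\<^bsub>\<F> y\<^esub> ?D) \<otimes>\<^bsub>\<F> y\<^esub> w" using w Dc by (simp add: C.m_assoc)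
  then have fB: "small y (-B) ?f" using small_mult[OF fD B(6)] by simp
  define k where "k = embm y (minv g) \<otimes>\<^bsub>GL2 (\<F> y)\<^esub> m"
  have kc: "k \<in> carrier (GL2 (\<F> y))" unfolding k_def using m embm_carrier[of "minv g" y] g0 by (simp add: mdet_minv)
  have mk: "m = embm y g \<otimes>\<^bsub>GL2 (\<F> y)\<^esub> k"
  proof -
    have "embm y g \<otimes>\<^bsub>GL2 (\<F> y)\<^esub> k = (embm y g \<otimes>\<^bsub>GL2 (\<F> y)\<^esub> embm y (minv g)) \<otimes>\<^bsub>GL2 (\<F> y)\<^esub> m"
      unfolding k_def using m embm_carrier[of "minv g" y] embm_carrier[OF g0] g0 by (simp add: mdet_minv G.m_assoc)
    also have "\<dots> = m" using m g0 by (simp add: embm_mmul[symmetric] minv_right embm_mone)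
    finally show ?thesis by simp
  qed
  have mi: "minv g = Mat2 (inverse (mdet g) * \<delta>) (- (inverse (mdet g) * \<beta>)) (- (inverse (mdet g) * \<gamma>)) (inverse (mdet g) * \<alpha>)"
    by (simp add: minv_def g_def field_simps)
  let ?a = "emb_local y \<alpha>" and ?b = "emb_local y \<beta>" and ?c = "emb_local y \<gamma>" and ?d = "emb_local y \<delta>"
  have cl: "?a \<in> carrier (\<F> y)" "?b \<in> carrier (\<F> y)" "?c \<in> carrier (\<F> y)" "?d \<in> carrier (\<F> y)" "?f \<in> carrier (\<F> y)"
    by simp_all
  have ks: "k = Mat2 (?f \<otimes>\<^bsub>\<F> y\<^esub> ?d \<otimes>\<^bsub>\<F> y\<^esub> a \<oplus>\<^bsub>\<F> y\<^esub> (\<ominus>\<^bsub>\<F> y\<^esub> (?f \<otimes>\<^bsub>\<F> y\<^esub> ?b)) \<otimes>\<^bsub>\<F> y\<^esub> c)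
     (?f \<otimes>\<^bsub>\<F> y\<^esub> ?d \<otimes>\<^bsub>\<F> y\<^esub> b \<oplus>\<^bsub>\<F> y\<^esub> (\<ominus>\<^bsub>\<F> y\<^esub> (?f \<otimes>\<^bsub>\<F> y\<^esub> ?b)) \<otimes>\<^bsub>\<F> y\<^esub> d)
     ((\<ominus>\<^bsub>\<F> y\<^esub> (?f \<otimes>\<^bsub>\<F> y\<^esub> ?c)) \<otimes>\<^bsub>\<F> y\<^esub> a \<oplus>\<^bsub>\<F> y\<^esub> ?f \<otimes>\<^bsub>\<F> y\<^esub> ?a \<otimes>\<^bsub>\<F> y\<^esub> c)
     ((\<ominus>\<^bsub>\<F> y\<^esub> (?f \<otimes>\<^bsub>\<F> y\<^esub> ?c)) \<otimes>\<^bsub>\<F> y\<^esub> b \<oplus>\<^bsub>\<F> y\<^esub> ?f \<otimes>\<^bsub>\<F> y\<^esub> ?a \<otimes>\<^bsub>\<F> y\<^esub> d)"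
    unfolding k_def mi mm by (simp add: embm_def GL2_mult emb_local_mult emb_local_minus)
  have key: "small y 1 (?f \<otimes>\<^bsub>\<F> y\<^esub> p \<otimes>\<^bsub>\<F> y\<^esub> r)" if "small y (-B) p" "small y L r" for p r
    by (rule small_mono[OF small_mult[OF small_mult[OF fB that(1)] that(2)]]) (simp add: L_def)
  have one: "\<one>\<^bsub>\<F> y\<^esub> = (?a \<otimes>\<^bsub>\<F> y\<^esub> ?d \<ominus>\<^bsub>\<F> y\<^esub> ?b \<otimes>\<^bsub>\<F> y\<^esub> ?c) \<otimes>\<^bsub>\<F> y\<^esub> ?f" using ef e by simp
  have k12: "small y 1 (e12 k)"
  proof -
    have "e12 k = ?f \<otimes>\<^bsub>\<F> y\<^esub> ?d \<otimes>\<^bsub>\<F> y\<^esub> (b \<ominus>\<^bsub>\<F> y\<^esub> ?b) \<ominus>\<^bsub>\<F> y\<^esub> ?f \<otimes>\<^bsub>\<F> y\<^esub> ?b \<otimes>\<^bsub>\<F> y\<^esub> (d \<ominus>\<^bsub>\<F> y\<^esub> ?d)"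
      unfolding ks mat2.sel using cl cr by algebra
    then show ?thesis using small_diff[OF key[OF apB(2) ap(2)] key[OF apB(1) ap(4)]] by simp
  qed
  have k21: "small y 0 (e21 k)"
  proof -
    have "e21 k = ?f \<otimes>\<^bsub>\<F> y\<^esub> ?a \<otimes>\<^bsub>\<F> y\<^esub> (c \<ominus>\<^bsub>\<F> y\<^esub> ?c) \<ominus>\<^bsub>\<F> y\<^esub> ?f \<otimes>\<^bsub>\<F> y\<^esub> ?c \<otimes>\<^bsub>\<F> y\<^esub> (a \<ominus>\<^bsub>\<F> y\<^esub> ?a)"
      unfolding ks mat2.sel using cl cr by algebra
    then show ?thesis using small_mono[OF small_diff[OF key[OF apB(3) ap(3)] key[OF apB(4) ap(1)]], of 0] by simp
  qed
  have b1: "small y 0 \<one>\<^bsub>\<F> y\<^esub>" by (simp add: small_one)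
  have k11: "small y 0 (e11 k)"
  proof -
    have "e11 k = (?f \<otimes>\<^bsub>\<F> y\<^esub> ?d \<otimes>\<^bsub>\<F> y\<^esub> (a \<ominus>\<^bsub>\<F> y\<^esub> ?a) \<ominus>\<^bsub>\<F> y\<^esub> ?f \<otimes>\<^bsub>\<F> y\<^esub> ?b \<otimes>\<^bsub>\<F> y\<^esub> (c \<ominus>\<^bsub>\<F> y\<^esub> ?c))
      \<oplus>\<^bsub>\<F> y\<^esub> (?a \<otimes>\<^bsub>\<F> y\<^esub> ?d \<ominus>\<^bsub>\<F> y\<^esub> ?b \<otimes>\<^bsub>\<F> y\<^esub> ?c) \<otimes>\<^bsub>\<F> y\<^esub> ?f"
      unfolding ks mat2.sel using cl cr by algebra
    then show ?thesis unfolding one[symmetric] using small_add[OF small_mono[OF small_diff[OF key[OF apB(2) ap(1)] key[OF apB(1) ap(3)]], of 0] b1] by simp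
  qed
  have k22: "small y 0 (e22 k)"
  proof -
    have "e22 k = (?f \<otimes>\<^bsub>\<F> y\<^esub> ?a \<otimes>\<^bsub>\<F> y\<^esub> (d \<ominus>\<^bsub>\<F> y\<^esub> ?d) \<ominus>\<^bsub>\<F> y\<^esub> ?f \<otimes>\<^bsub>\<F> y\<^esub> ?c \<otimes>\<^bsub>\<F> y\<^esub> (b \<ominus>\<^bsub>\<F> y\<^esub> ?b))
      \<oplus>\<^bsub>\<F> y\<^esub> (?a \<otimes>\<^bsub>\<F> y\<^esub> ?d \<ominus>\<^bsub>\<F> y\<^esub> ?b \<otimes>\<^bsub>\<F> y\<^esub> ?c) \<otimes>\<^bsub>\<F> y\<^esub> ?f"
      unfolding ks mat2.sel using cl cr by algebra
    then show ?thesis unfolding one[symmetric] using small_add[OF small_mono[OF small_diff[OF key[OF apB(3) ap(4)] key[OF apB(4) ap(2)]], of 0] b1] by simp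
  qed
  have "det2 (\<F> y) k = ?f \<otimes>\<^bsub>\<F> y\<^esub> ?D"
  proof -
    have "det2 (\<F> y) k = det2 (\<F> y) (embm y (minv g)) \<otimes>\<^bsub>\<F> y\<^esub> det2 (\<F> y) m"
      unfolding k_def by (rule C.det2_mult) (use cr in \<open>simp_all add: mm\<close>)
    then show ?thesis using g0 by (simp add: det2_embm mdet_minv mm det2_Mat2)
  qed
  then have "det2 (\<F> y) k \<otimes>\<^bsub>\<F> y\<^esub> ?u = \<one>\<^bsub>\<F> y\<^esub>" using uinv w(1) Dc by (simp add: C.m_comm)
  then have "k \<in> carrier (GL2 (local_integers y))"
    using k11 small_mono[OF k12, of 0] k21 k22 ub by (auto simp: GL2_local_integers_carrier)
  then show ?thesis using g0 mk k12 by blast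
qed

lemma scalar_approximation:
  assumes c: "c \<in> carrier (\<F> y)" and w: "w \<in> carrier (\<F> y)" "c \<otimes>\<^bsub>\<F> y\<^esub> w = \<one>\<^bsub>\<F> y\<^esub>"
  shows "\<exists>z. z \<noteq> 0 \<and> small y 0 (emb_local y (inverse z) \<otimes>\<^bsub>\<F> y\<^esub> c) \<and> small y 0 (emb_local y z \<otimes>\<^bsub>\<F> y\<^esub> w)"
proof -
  interpret C: cring "\<F> y" by (rule completion_cring)
  obtain N where N: "small y N w" using small_exists[OF w(1)] by blast
  obtain z where z: "small y (1 - N) (c \<ominus>\<^bsub>\<F> y\<^esub> emb_local y z)" using small_approx[OF c] by blast
  have zc: "emb_local y z \<in> carrier (\<F> y)" by simp
  let ?u = "emb_local y z \<otimes>\<^bsub>\<F> y\<^esub> w"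
  have "?u \<ominus>\<^bsub>\<F> y\<^esub> c \<otimes>\<^bsub>\<F> y\<^esub> w = \<ominus>\<^bsub>\<F> y\<^esub> ((c \<ominus>\<^bsub>\<F> y\<^esub> emb_local y z) \<otimes>\<^bsub>\<F> y\<^esub> w)"
    using c w(1) zc by algebra
  moreover have "small y 1 ((c \<ominus>\<^bsub>\<F> y\<^esub> emb_local y z) \<otimes>\<^bsub>\<F> y\<^esub> w)"
    using small_mult[OF z N] by simp
  ultimately have u1: "small y 1 (?u \<ominus>\<^bsub>\<F> y\<^esub> \<one>\<^bsub>\<F> y\<^esub>)" using w(2) by (simp add: small_minus)
  have z0: "z \<noteq> 0"
  proof
    assume "z = 0"
    then have "small y 1 (\<ominus>\<^bsub>\<F> y\<^esub> \<one>\<^bsub>\<F> y\<^esub>)" using u1 w(1) by (simp add: emb_local_0 a_minus_def)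
    from small_minus[OF this] show False by (simp add: small_one)
  qed
  have "?u \<otimes>\<^bsub>\<F> y\<^esub> (emb_local y (inverse z) \<otimes>\<^bsub>\<F> y\<^esub> c)
    = (emb_local y z \<otimes>\<^bsub>\<F> y\<^esub> emb_local y (inverse z)) \<otimes>\<^bsub>\<F> y\<^esub> (c \<otimes>\<^bsub>\<F> y\<^esub> w)"
    using c w(1) by (simp add: C.m_ac)
  also have "\<dots> = \<one>\<^bsub>\<F> y\<^esub>" using z0 w(2) by (simp add: emb_local_mult[symmetric] emb_local_1)
  finally have "small y 0 (emb_local y (inverse z) \<otimes>\<^bsub>\<F> y\<^esub> c)"
    by (intro local_unit_inverse[OF u1]) (use c w(1) in simp_all)
  moreover have "small y 0 ?u"
  proof -
    have "?u = (?u \<ominus>\<^bsub>\<F> y\<^esub> \<one>\<^bsub>\<F> y\<^esub>) \<oplus>\<^bsub>\<F> y\<^esub> \<one>\<^bsub>\<F> y\<^esub>"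
      using w(1) by (simp add: a_minus_def C.a_assoc C.l_neg)
    then show ?thesis using small_add[OF small_mono[OF u1, of 0], of "\<one>\<^bsub>\<F> y\<^esub>"] by (simp add: small_one)
  qed
  ultimately show ?thesis using z0 by blast
qed

text \<open>At almost all places $g_y$ is integral, and then so is the rational component, because the two
differ by an integral matrix. Hence the local approximations form a family.\<close>

lemma adelic_approximation:
  assumes g: "g \<in> carrier G_A"
  shows "\<exists>\<gamma> k. family \<gamma> \<and> k \<in> K_A \<and> g = J \<gamma> \<star> k \<and> (\<forall>y. small y 1 (e12 (comp_at y k)))"
proof -
  let ?P = "\<lambda>y gk. mdet (fst gk) \<noteq> 0 \<and> snd gk \<in> carrier (GL2 (local_integers y)) \<and>
     comp_at y g = embm y (fst gk) \<otimes>\<^bsub>GL2 (\<F> y)\<^esub> snd gk \<and> small y 1 (e12 (snd gk))"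
  have "\<forall>y. \<exists>gk. ?P y gk"
  proof
    fix y
    have "comp_at y g \<in> carrier (GL2 (\<F> y))" using g by (simp add: G_A_iff)
    from GL2_approximation[OF this] show "\<exists>gk. ?P y gk" by simp
  qed
  from choice[OF this] obtain f where "\<forall>y. ?P y (f y)" by (elim exE)
  then have f: "?P y (f y)" for y by (rule spec)
  define \<gamma> where "\<gamma> = (\<lambda>y. fst (f y))"
  define k where "k = adelic_mat (\<lambda>y. snd (f y))"
  have gk: "g = J \<gamma> \<star> k"
    by (rule comp_at_eqI) (use f in \<open>simp add: comp_at_mult \<gamma>_def k_def\<close>)
  have kK: "k \<in> K_A" using f by (simp add: K_A_iff k_def)
  have "gl2_integral y (\<gamma> y)" if y: "comp_at y g \<in> carrier (GL2 (local_integers y))" for y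
  proof -
    interpret O: cring "local_integers y" by (rule local_integers_cring)
    interpret OG: Group.group "GL2 (local_integers y)" by (rule O.GL2_group)
    interpret C: cring "\<F> y" by (rule completion_cring)
    interpret CG: Group.group "GL2 (\<F> y)" by (rule C.GL2_group)
    let ?k = "snd (f y)" and ?e = "embm y (\<gamma> y)"
    have e: "?e \<in> carrier (GL2 (\<F> y))" using f[of y] by (simp add: \<gamma>_def embm_carrier)
    have k: "?k \<in> carrier (GL2 (local_integers y))" using f by blast
    obtain k' where k': "k' \<in> carrier (GL2 (local_integers y))" "?k \<otimes>\<^bsub>GL2 (\<F> y)\<^esub> k' = \<one>\<^bsub>GL2 (\<F> y)\<^esub>"
      using OG.r_inv_ex[OF k] by (auto simp: GL2_local_integers_mult GL2_local_integers_one)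
    have "?e = ?e \<otimes>\<^bsub>GL2 (\<F> y)\<^esub> (?k \<otimes>\<^bsub>GL2 (\<F> y)\<^esub> k')" using k' e by simp
    also have "\<dots> = comp_at y g \<otimes>\<^bsub>GL2 (\<F> y)\<^esub> k'"
      using f[of y] e GL2_local_integers_subset[OF k] GL2_local_integers_subset[OF k'(1)]
      by (simp add: CG.m_assoc \<gamma>_def)
    also have "\<dots> \<in> carrier (GL2 (local_integers y))" using OG.m_closed[OF y k'(1)] by (simp add: GL2_local_integers_mult)
    finally show ?thesis by (simp add: embm_integral)
  qed
  then have "{y. \<not> gl2_integral y (\<gamma> y)} \<subseteq> {y. comp_at y g \<notin> carrier (GL2 (local_integers y))}" by blast
  moreover have "finite {y. comp_at y g \<notin> carrier (GL2 (local_integers y))}" using g by (simp add: G_A_iff)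
  ultimately have "finite {y. \<not> gl2_integral y (\<gamma> y)}" by (rule finite_subset)
  then have "family \<gamma>" using f by (simp add: family_def \<gamma>_def)
  moreover have "\<forall>y. small y 1 (e12 (comp_at y k))" using f by (simp add: k_def)
  ultimately show ?thesis using gk kK by blast
qed

section \<open>Slopes of adelic lattices\<close>

text \<open>Lattices are described through row vectors, on which matrices act from the right: $v \mapsto vg$
is compatible with left multiplication by $G(F)$ and with right multiplication by $K$.\<close>

definition vmul :: "'a::comm_ring_1 \<times> 'a \<Rightarrow> 'a mat2 \<Rightarrow> 'a \<times> 'a" where
  "vmul v g = (fst v * e11 g + snd v * e21 g, fst v * e12 g + snd v * e22 g)"

lemma vmul_mmul: "vmul v (mmul g h) = vmul (vmul v g) h"
  by (simp add: vmul_def mmul_def algebra_simps)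

lemma vmul_mone [simp]: "vmul v mone = v"
  by (simp add: vmul_def mone_def)

lemma vmul_zero: "vmul (0, 0) g = (0, 0)"
  by (simp add: vmul_def)

lemma vmul_nonzero: "mdet g \<noteq> 0 \<Longrightarrow> v \<noteq> (0, 0) \<Longrightarrow> vmul v g \<noteq> (0, 0)" for g :: "'a::field mat2"
proof
  assume d: "mdet g \<noteq> 0" and v: "v \<noteq> (0, 0)" and z: "vmul v g = (0, 0)"
  have "vmul (vmul v g) (minv g) = v" using d by (simp add: vmul_mmul[symmetric] minv_right)
  then show False using v by (simp add: z vmul_zero)
qed

text \<open>The exponent of the $y$-adic norm of a nonzero vector, that is, the minimum of the valuations of the nonzero
entries.\<close>

definition vord :: "'k::field place \<Rightarrow> 'k ratfun \<times> 'k ratfun \<Rightarrow> int" where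
  "vord y v = (if fst v = 0 then ord_at y (snd v) else if snd v = 0 then ord_at y (fst v)
     else min (ord_at y (fst v)) (ord_at y (snd v)))"

lemma vord_ge_iff: "v \<noteq> (0, 0) \<Longrightarrow> N \<le> vord y v \<longleftrightarrow> near_zero y N (fst v) \<and> near_zero y N (snd v)"
  by (cases v) (auto simp: vord_def near_zero_def)

lemma vord_vmul_ge:
  assumes v: "v \<noteq> (0, 0)" and g: "mdet g \<noteq> 0"
    and n: "near_zero y N (e11 g)" "near_zero y N (e12 g)" "near_zero y N (e21 g)" "near_zero y N (e22 g)"
  shows "vord y v + N \<le> vord y (vmul v g)"
proof -
  have "near_zero y (vord y v) (fst v)" "near_zero y (vord y v) (snd v)" using vord_ge_iff[OF v] by blast+
  then show ?thesis
    unfolding vord_ge_iff[OF vmul_nonzero[OF g v]] using n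
    by (simp add: vmul_def near_zero_add near_zero_mult)
qed

text \<open>An integral matrix cannot decrease the exponent, and neither can its inverse.\<close>

lemma vord_vmul_integral:
  assumes v: "v \<noteq> (0, 0)" and g: "gl2_integral y g"
  shows "vord y (vmul v g) = vord y v"
proof -
  have *: "vord y v \<le> vord y (vmul v g)" if "v \<noteq> (0, 0)" "gl2_integral y g" for v g
    using vord_vmul_ge[of v g y 0] that by (auto simp: gl2_integral_def unit_at_def near_zero_val_ring)
  have d: "mdet g \<noteq> 0" using g by (auto simp: gl2_integral_def unit_at_def)
  have "vord y (vmul v g) \<le> vord y (vmul (vmul v g) (minv g))"
    by (rule *[OF vmul_nonzero[OF d v] gl2_integral_minv[OF g]])
  also have "vmul (vmul v g) (minv g) = v" using d by (simp add: vmul_mmul[symmetric] minv_right)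
  finally show ?thesis using *[OF v g] by simp
qed

definition msc :: "'a::comm_ring_1 \<Rightarrow> 'a mat2 \<Rightarrow> 'a mat2" where
  "msc z g = Mat2 (z * e11 g) (z * e12 g) (z * e21 g) (z * e22 g)"

lemma msc_mmul: "mmul (msc z g) h = msc z (mmul g h)" "mmul g (msc z h) = msc z (mmul g h)"
  by (simp_all add: msc_def mmul_def algebra_simps)

lemma msc_msc: "msc z (msc w g) = msc (z * w) g"
  by (simp add: msc_def algebra_simps)

lemma msc_one [simp]: "msc 1 g = g"
  by (cases g) (simp add: msc_def)

lemma mdet_msc: "mdet (msc z g) = z ^ 2 * mdet g"
  by (simp add: msc_def mdet_def power2_eq_square algebra_simps)

lemma vord_msc:
  assumes "z \<noteq> 0" "vmul v g \<noteq> (0, 0)"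
  shows "vord y (vmul v (msc z g)) = ord_at y z + vord y (vmul v g)"
proof -
  have "vmul v (msc z g) = (z * fst (vmul v g), z * snd (vmul v g))"
    by (simp add: vmul_def msc_def algebra_simps)
  moreover have "vord y (z * fst w, z * snd w) = ord_at y z + vord y w" if "w \<noteq> (0, 0)" for w
    using that assms(1) by (cases w) (auto simp: vord_def ord_at_mult)
  ultimately show ?thesis using assms(2) by metis
qed

definition mswap :: "'a::comm_ring_1 mat2" where "mswap = Mat2 0 1 1 0"

lemma gl2_integral_mswap: "gl2_integral y mswap"
proof -
  have "unit_at y (- 1)" by (simp add: unit_at_iff_ord)
  then show ?thesis by (simp add: gl2_integral_def mdet_def mswap_def)
qed

lemma gl2_integral_unipotent: "b \<in> val_ring y \<Longrightarrow> gl2_integral y (Mat2 1 b 0 1)"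
  by (simp add: gl2_integral_def mdet_def)

context rational_place
begin

text \<open>The degree of the divisor $\sum_y f(y)\,y$.\<close>

definition sdeg :: "('k place \<Rightarrow> int) \<Rightarrow> int" where
  "sdeg f = (\<Sum>y | f y \<noteq> 0. int (deg_at y) * f y)"

abbreviation fin :: "('k place \<Rightarrow> int) \<Rightarrow> bool" where "fin f \<equiv> finite {y. f y \<noteq> 0}"

lemma sdeg_superset: "finite S \<Longrightarrow> {y. f y \<noteq> 0} \<subseteq> S \<Longrightarrow> sdeg f = (\<Sum>y\<in>S. int (deg_at y) * f y)"
  unfolding sdeg_def by (intro sum.mono_neutral_left) auto

lemma fin_add: "fin f \<Longrightarrow> fin g \<Longrightarrow> fin (\<lambda>y. f y + g y)"
proof -
  assume f: "fin f" and g: "fin g"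
  have "f y \<noteq> 0 \<or> g y \<noteq> 0" if "f y + g y \<noteq> 0" for y using that by linarith
  then have "{y. f y + g y \<noteq> 0} \<subseteq> {y. f y \<noteq> 0} \<union> {y. g y \<noteq> 0}" by blast
  then show ?thesis by (rule finite_subset) (simp add: f g)
qed

lemma sdeg_add:
  assumes "fin f" "fin g"
  shows "sdeg (\<lambda>y. f y + g y) = sdeg f + sdeg g"
proof -
  let ?S = "{y. f y \<noteq> 0} \<union> {y. g y \<noteq> 0}"
  have S: "finite ?S" using assms by simp
  have "sdeg (\<lambda>y. f y + g y) = (\<Sum>y\<in>?S. int (deg_at y) * (f y + g y))" by (rule sdeg_superset[OF S]) auto
  also have "\<dots> = (\<Sum>y\<in>?S. int (deg_at y) * f y) + (\<Sum>y\<in>?S. int (deg_at y) * g y)"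
    by (simp add: distrib_left sum.distrib)
  also have "\<dots> = sdeg f + sdeg g" using sdeg_superset[OF S, of f] sdeg_superset[OF S, of g] by auto
  finally show ?thesis .
qed

lemma sdeg_mono:
  assumes "fin f" "fin g" "\<And>y. f y \<le> g y"
  shows "sdeg f \<le> sdeg g"
proof -
  let ?S = "{y. f y \<noteq> 0} \<union> {y. g y \<noteq> 0}"
  have S: "finite ?S" using assms by simp
  have "(\<Sum>y\<in>?S. int (deg_at y) * f y) \<le> (\<Sum>y\<in>?S. int (deg_at y) * g y)"
    by (intro sum_mono mult_left_mono assms(3)) simp
  then show ?thesis using sdeg_superset[OF S, of f] sdeg_superset[OF S, of g] by auto
qed

lemma sdeg_single: "sdeg (\<lambda>z. if z = y then n else 0) = int (deg_at y) * n"
proof -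
  have "sdeg (\<lambda>z. if z = y then n else 0) = (\<Sum>z\<in>{y}. int (deg_at z) * (if z = y then n else 0))"
    by (rule sdeg_superset) auto
  then show ?thesis by simp
qed

lemma fin_single: "fin (\<lambda>z. if z = y then n else 0)"
  by (rule finite_subset[of _ "{y}"]) auto

lemma sdeg_ord: "z \<noteq> 0 \<Longrightarrow> sdeg (\<lambda>y. ord_at y z) = 0"
  unfolding sdeg_def using product_formula[of z] by simp

lemma fin_vord:
  assumes "v \<noteq> (0, 0)"
  shows "fin (\<lambda>y. vord y v)"
proof -
  obtain a b where v: "v = (a, b)" by (cases v) auto
  have "{y. vord y v \<noteq> 0} \<subseteq> (if a = 0 then {} else {y. ord_at y a \<noteq> 0}) \<union> (if b = 0 then {} else {y. ord_at y b \<noteq> 0})"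
  proof
    fix y assume "y \<in> {y. vord y v \<noteq> 0}"
    then show "y \<in> (if a = 0 then {} else {y. ord_at y a \<noteq> 0}) \<union> (if b = 0 then {} else {y. ord_at y b \<noteq> 0})"
      using assms by (cases "a = 0"; cases "b = 0") (simp_all add: v vord_def min_def split: if_splits)
  qed
  then show ?thesis by (rule finite_subset) (auto simp: finite_ord)
qed

lemma fin_vord_family:
  assumes g: "family \<gamma>" and v: "v \<noteq> (0, 0)"
  shows "fin (\<lambda>y. vord y (vmul v (\<gamma> y)))"
proof -
  have "{y. vord y (vmul v (\<gamma> y)) \<noteq> 0} \<subseteq> {y. \<not> gl2_integral y (\<gamma> y)} \<union> {y. vord y v \<noteq> 0}"
    using vord_vmul_integral[OF v] by auto
  then show ?thesis by (rule finite_subset) (use g fin_vord[OF v] in \<open>simp add: family_def\<close>)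
qed

lemma fin_det_family:
  assumes g: "family \<gamma>"
  shows "fin (\<lambda>y. ord_at y (mdet (\<gamma> y)))"
proof -
  have "{y. ord_at y (mdet (\<gamma> y)) \<noteq> 0} \<subseteq> {y. \<not> gl2_integral y (\<gamma> y)}"
    by (auto simp: gl2_integral_def ord_at_unit)
  then show ?thesis by (rule finite_subset) (use g in \<open>simp add: family_def\<close>)
qed

text \<open>The degree of the line subbundle spanned by $v$, with the lattice at $y$ being the set of $w \in F^2$ such that $wg_y$ is integral.\<close>

definition vdeg :: "('k place \<Rightarrow> 'k ratfun mat2) \<Rightarrow> 'k ratfun \<times> 'k ratfun \<Rightarrow> int" where
  "vdeg \<gamma> v = sdeg (\<lambda>y. vord y (vmul v (\<gamma> y)))"

definition ddeg :: "('k place \<Rightarrow> 'k ratfun mat2) \<Rightarrow> int" where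
  "ddeg \<gamma> = sdeg (\<lambda>y. ord_at y (mdet (\<gamma> y)))"

text \<open>If the bundle has degree \<open>ddeg\<close> and its line subbundles have degree at most $a$, with equality for
one of them, then it splits into line bundles of degrees $a$ and $\mathit{ddeg} - a$. The number
$n = 2a - \mathit{ddeg}$ is their difference.\<close>

definition slope :: "('k place \<Rightarrow> 'k ratfun mat2) \<Rightarrow> int \<Rightarrow> bool" where
  "slope \<gamma> n \<longleftrightarrow> (\<forall>v. v \<noteq> (0, 0) \<longrightarrow> 2 * vdeg \<gamma> v \<le> n + ddeg \<gamma>) \<and>
     (\<exists>v. v \<noteq> (0, 0) \<and> 2 * vdeg \<gamma> v = n + ddeg \<gamma>)"

lemma slopeD: "slope \<gamma> n \<Longrightarrow> v \<noteq> (0, 0) \<Longrightarrow> 2 * vdeg \<gamma> v \<le> n + ddeg \<gamma>"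
  unfolding slope_def by blast

lemma slope_unique:
  assumes "slope \<gamma> n" "slope \<gamma> m"
  shows "n = m"
proof -
  obtain v where v: "v \<noteq> (0, 0)" "2 * vdeg \<gamma> v = n + ddeg \<gamma>" using assms(1) unfolding slope_def by blast
  obtain w where w: "w \<noteq> (0, 0)" "2 * vdeg \<gamma> w = m + ddeg \<gamma>" using assms(2) unfolding slope_def by blast
  have "2 * vdeg \<gamma> v \<le> m + ddeg \<gamma>" using assms(2) v(1) unfolding slope_def by blast
  moreover have "2 * vdeg \<gamma> w \<le> n + ddeg \<gamma>" using assms(1) w(1) unfolding slope_def by blast
  ultimately show ?thesis using v(2) w(2) by linarith
qed

lemma family_const: "mdet A \<noteq> 0 \<Longrightarrow> family (\<lambda>y :: 'k place. A)"
proof -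
  assume A: "mdet A \<noteq> 0"
  have e: "finite {y :: 'k place. z \<notin> val_ring y}" for z
  proof (cases "z = 0")
    case False
    have "ord_at y z \<noteq> 0" if "z \<notin> val_ring y" for y :: "'k place"
      using val_ring_iff_ord[OF False, of y] that by linarith
    then have "{y :: 'k place. z \<notin> val_ring y} \<subseteq> {y. ord_at y z \<noteq> 0}" by blast
    then show ?thesis by (rule finite_subset) (rule finite_ord[OF False])
  qed simp
  have "{y :: 'k place. \<not> gl2_integral y A} \<subseteq> {y. e11 A \<notin> val_ring y} \<union> {y. e12 A \<notin> val_ring y} \<union> {y. e21 A \<notin> val_ring y}
     \<union> {y. e22 A \<notin> val_ring y} \<union> {y. ord_at y (mdet A) \<noteq> 0}"
    unfolding gl2_integral_def unit_at_iff_ord using A by blast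
  then have "finite {y :: 'k place. \<not> gl2_integral y A}"
    by (rule finite_subset) (use e finite_ord[OF A] in simp)
  then show ?thesis using A by (simp add: family_def)
qed

text \<open>Replacing $v$ by $vA$ permutes the nonzero vectors, and the determinant of $A$ contributes nothing by
the product formula.\<close>

lemma slope_left:
  assumes A: "mdet A \<noteq> 0" and g: "family \<gamma>" and s: "slope \<gamma> n"
  shows "slope (\<lambda>y. mmul A (\<gamma> y)) n"
proof -
  have d: "ddeg (\<lambda>y. mmul A (\<gamma> y)) = ddeg \<gamma>"
  proof -
    have "ddeg (\<lambda>y. mmul A (\<gamma> y)) = sdeg (\<lambda>y. ord_at y (mdet A) + ord_at y (mdet (\<gamma> y)))"
      using A g by (simp add: ddeg_def mdet_mmul ord_at_mult family_def)
    also have "\<dots> = ddeg \<gamma>"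
      using sdeg_add[OF finite_ord[OF A] fin_det_family[OF g]] sdeg_ord[OF A] by (simp add: ddeg_def)
    finally show ?thesis .
  qed
  have v: "vdeg (\<lambda>y. mmul A (\<gamma> y)) v = vdeg \<gamma> (vmul v A)" for v by (simp add: vdeg_def vmul_mmul)
  obtain v where v0: "v \<noteq> (0, 0)" "2 * vdeg \<gamma> v = n + ddeg \<gamma>" using s unfolding slope_def by blast
  have i: "mdet (minv A) \<noteq> 0" using A by (simp add: mdet_minv)
  have "vmul (vmul v (minv A)) A = v" using A by (simp add: vmul_mmul[symmetric] minv_left)
  then have "vmul v (minv A) \<noteq> (0, 0) \<and> 2 * vdeg (\<lambda>y. mmul A (\<gamma> y)) (vmul v (minv A)) = n + ddeg \<gamma>"
    using vmul_nonzero[OF i v0(1)] v0(2) v by simp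
  moreover have "2 * vdeg (\<lambda>y. mmul A (\<gamma> y)) v \<le> n + ddeg \<gamma>" if "v \<noteq> (0, 0)" for v
    unfolding v by (rule slopeD[OF s vmul_nonzero[OF A that]])
  ultimately show ?thesis unfolding slope_def d by blast
qed

lemma vdeg_right:
  assumes g: "family \<gamma>" and k: "\<And>y. gl2_integral y (\<kappa> y)" and v: "v \<noteq> (0, 0)"
  shows "vdeg (\<lambda>y. mmul (\<gamma> y) (\<kappa> y)) v = vdeg \<gamma> v"
  unfolding vdeg_def using g vord_vmul_integral[OF vmul_nonzero[OF _ v] k] by (simp add: vmul_mmul family_def)

lemma ddeg_right:
  assumes g: "family \<gamma>" and k: "\<And>y. gl2_integral y (\<kappa> y)"
  shows "ddeg (\<lambda>y. mmul (\<gamma> y) (\<kappa> y)) = ddeg \<gamma>"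
proof -
  have "ord_at y (mdet (\<kappa> y)) = 0" "mdet (\<kappa> y) \<noteq> 0" for y
    using k[of y] by (simp_all add: gl2_integral_def unit_at_iff_ord)
  then show ?thesis using g by (simp add: ddeg_def mdet_mmul ord_at_mult family_def)
qed

lemma slope_right:
  assumes g: "family \<gamma>" and k: "\<And>y. gl2_integral y (\<kappa> y)" and s: "slope \<gamma> n"
  shows "slope (\<lambda>y. mmul (\<gamma> y) (\<kappa> y)) n"
proof -
  obtain v where v: "v \<noteq> (0, 0)" "2 * vdeg \<gamma> v = n + ddeg \<gamma>" using s unfolding slope_def by blast
  have "2 * vdeg (\<lambda>y. mmul (\<gamma> y) (\<kappa> y)) w \<le> n + ddeg \<gamma>" if w: "w \<noteq> (0, 0)" for w
    using s w unfolding slope_def vdeg_right[OF g k w] by blast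
  moreover have "2 * vdeg (\<lambda>y. mmul (\<gamma> y) (\<kappa> y)) v = n + ddeg \<gamma>"
    unfolding vdeg_right[OF g k v(1)] by (rule v(2))
  ultimately show ?thesis unfolding slope_def ddeg_right[OF g k] using v(1) by blast
qed

text \<open>A scalar shifts the degree of every line by the same amount and the degree of the determinant by
twice that amount.\<close>

lemma slope_scalar:
  assumes g: "family \<gamma>" and z: "\<And>y. \<zeta> y \<noteq> 0" "fin (\<lambda>y. ord_at y (\<zeta> y))" and s: "slope \<gamma> n"
  shows "slope (\<lambda>y. msc (\<zeta> y) (\<gamma> y)) n"
proof -
  let ?z = "\<lambda>y. ord_at y (\<zeta> y)"
  have "ddeg (\<lambda>y. msc (\<zeta> y) (\<gamma> y)) = sdeg (\<lambda>y. (?z y + ?z y) + ord_at y (mdet (\<gamma> y)))"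
    using g z(1) by (simp add: ddeg_def mdet_msc ord_at_mult ord_at_power family_def)
  also have "\<dots> = sdeg (\<lambda>y. ?z y + ?z y) + ddeg \<gamma>"
    unfolding ddeg_def by (rule sdeg_add[OF fin_add[OF z(2) z(2)] fin_det_family[OF g]])
  also have "sdeg (\<lambda>y. ?z y + ?z y) = 2 * sdeg ?z" using sdeg_add[OF z(2) z(2)] by linarith
  finally have d: "ddeg (\<lambda>y. msc (\<zeta> y) (\<gamma> y)) = 2 * sdeg ?z + ddeg \<gamma>" .
  have v: "vdeg (\<lambda>y. msc (\<zeta> y) (\<gamma> y)) v = sdeg ?z + vdeg \<gamma> v" if v: "v \<noteq> (0, 0)" for v
  proof -
    have "vmul v (\<gamma> y) \<noteq> (0, 0)" for y using g vmul_nonzero[OF _ v] by (simp add: family_def)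
    then have "vdeg (\<lambda>y. msc (\<zeta> y) (\<gamma> y)) v = sdeg (\<lambda>y. ?z y + vord y (vmul v (\<gamma> y)))"
      by (simp add: vdeg_def vord_msc[OF z(1)])
    also have "\<dots> = sdeg ?z + vdeg \<gamma> v"
      unfolding vdeg_def by (rule sdeg_add[OF z(2) fin_vord_family[OF g v]])
    finally show ?thesis .
  qed
  obtain v where v0: "v \<noteq> (0, 0)" "2 * vdeg \<gamma> v = n + ddeg \<gamma>" using s unfolding slope_def by blast
  have "2 * vdeg (\<lambda>y. msc (\<zeta> y) (\<gamma> y)) v = n + ddeg (\<lambda>y. msc (\<zeta> y) (\<gamma> y))" using v[OF v0(1)] d v0(2) by simp
  moreover have "2 * vdeg (\<lambda>y. msc (\<zeta> y) (\<gamma> y)) v \<le> n + ddeg (\<lambda>y. msc (\<zeta> y) (\<gamma> y))" if v': "v \<noteq> (0, 0)" for v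
  proof -
    have "2 * vdeg \<gamma> v \<le> n + ddeg \<gamma>" using s v' unfolding slope_def by blast
    then show ?thesis using v[OF v'] d by simp
  qed
  ultimately show ?thesis using v0(1) unfolding slope_def by blast
qed

definition diag_family :: "'k place \<Rightarrow> 'k ratfun \<Rightarrow> 'k place \<Rightarrow> 'k ratfun mat2" where
  "diag_family y z = (\<lambda>y'. if y' = y then Mat2 z 0 0 1 else mone)"

text \<open>The matrix of $c_{nx}$.\<close>

definition standard_family :: "nat \<Rightarrow> 'k place \<Rightarrow> 'k ratfun mat2" where
  "standard_family n = diag_family x (t_rf powi (- int n))"

lemma family_local:
  assumes "\<And>y'. y' \<noteq> y \<Longrightarrow> \<gamma> y' = mone" "mdet (\<gamma> y) \<noteq> 0"
  shows "family \<gamma>"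
proof -
  have "{y'. \<not> gl2_integral y' (\<gamma> y')} \<subseteq> {y}" using assms(1) by force
  then have "finite {y'. \<not> gl2_integral y' (\<gamma> y')}" by (rule finite_subset) simp
  moreover have "mdet (\<gamma> y') \<noteq> 0" for y' using assms by (cases "y' = y") auto
  ultimately show ?thesis by (simp add: family_def)
qed

lemma family_diag: "z \<noteq> 0 \<Longrightarrow> family (diag_family y z)"
  by (rule family_local[of y]) (simp_all add: diag_family_def mdet_def)

lemma family_standard: "family (standard_family n)"
  unfolding standard_family_def by (rule family_diag) simp

lemma ddeg_local:
  assumes "\<And>y'. y' \<noteq> y \<Longrightarrow> \<gamma> y' = mone"
  shows "ddeg \<gamma> = int (deg_at y) * ord_at y (mdet (\<gamma> y))"
proof -
  have "(\<lambda>y'. ord_at y' (mdet (\<gamma> y'))) = (\<lambda>z. if z = y then ord_at y (mdet (\<gamma> y)) else 0)"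
    using assms by auto
  then show ?thesis unfolding ddeg_def by (simp add: sdeg_single)
qed

lemma deg_at_x [simp]: "deg_at x = 1"
  by (simp add: deg_at_def)

lemma ddeg_standard: "ddeg (standard_family n) = - int n"
  using ddeg_local[of x "standard_family n"]
  by (simp add: standard_family_def diag_family_def mdet_def ord_at_power_int)

lemma vdeg_standard_01: "vdeg (standard_family n) (0, 1) = 0"
proof -
  have "vord y (vmul (0, 1) (standard_family n y)) = 0" for y
    by (simp add: vmul_def standard_family_def diag_family_def mone_def vord_def)
  then show ?thesis by (simp add: vdeg_def sdeg_def)
qed

text \<open>A vector $(a,b)$ with $b \ne 0$ has degree at most that of the principal divisor of $b$, which is 0; for
$b = 0$ the degree is $-n$. The maximum 0 is attained at $(0,1)$.\<close>

lemma slope_standard: "slope (standard_family n) (int n)"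
  unfolding slope_def ddeg_standard
proof (intro conjI allI impI)
  show "\<exists>v. v \<noteq> (0, 0) \<and> 2 * vdeg (standard_family n) v = int n + - int n"
    using vdeg_standard_01 by (intro exI[of _ "(0, 1)"]) simp
  fix v :: "'k ratfun \<times> 'k ratfun" assume v: "v \<noteq> (0, 0)"
  obtain a b where ab: "v = (a, b)" by (cases v) auto
  have vm: "vmul v (standard_family n y) = (if y = x then t_rf powi (- int n) * a else a, b)" for y
    by (simp add: ab vmul_def standard_family_def diag_family_def mone_def mult.commute)
  show "2 * vdeg (standard_family n) v \<le> int n + - int n"
  proof (cases "b = 0")
    case False
    have "vord y (vmul v (standard_family n y)) \<le> ord_at y b" for y
      using False by (simp add: vm vord_def)
    then have "vdeg (standard_family n) v \<le> sdeg (\<lambda>y. ord_at y b)"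
      unfolding vdeg_def by (rule sdeg_mono[OF fin_vord_family[OF family_standard v] finite_ord[OF False]])
    then show ?thesis by (simp add: sdeg_ord[OF False])
  next
    case True
    then have a: "a \<noteq> 0" using v ab by simp
    have "vord y (vmul v (standard_family n y)) = ord_at y a + (if y = x then - int n else 0)" for y
      using True a by (simp add: vm vord_def ord_at_mult ord_at_power_int)
    then have "vdeg (standard_family n) v = sdeg (\<lambda>y. ord_at y a + (if y = x then - int n else 0))"
      by (simp add: vdeg_def)
    also have "\<dots> = - int n"
      using sdeg_add[OF finite_ord[OF a] fin_single[of x "- int n"]] by (simp add: sdeg_ord[OF a] sdeg_single)
    finally show ?thesis by simp
  qed
qed

lemma vord_diag_le:
  assumes p: "p \<noteq> 0" "ord_at y p = 1" and v: "v \<noteq> (0, 0)"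
  shows "vord y (vmul v (Mat2 p 0 0 1)) \<le> vord y v + 1"
proof -
  let ?g = "Mat2 p 0 0 1" and ?h = "Mat2 (inverse p) 0 0 1"
  have gh: "mmul ?g ?h = mone" using p by (simp add: mmul_def mone_def)
  have nz: "vmul v ?g \<noteq> (0, 0)" by (rule vmul_nonzero[OF _ v]) (simp add: mdet_def p)
  have "vord y (vmul v ?g) + (- 1) \<le> vord y (vmul (vmul v ?g) ?h)"
    by (rule vord_vmul_ge[OF nz]) (simp_all add: mdet_def near_zero_def ord_at_inverse p)
  then show ?thesis by (simp add: vmul_mmul[symmetric] gh)
qed

text \<open>The modification raises the degree of a line by at most $\deg y$, hence twice the maximum by at most
$2\deg y$, and it raises the degree of the determinant by exactly $\deg y$.\<close>

lemma slope_hecke_le: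
  assumes p: "p \<noteq> 0" "ord_at y p = 1" and g: "family \<gamma>"
    and s: "slope \<gamma> n" "slope (\<lambda>y'. mmul (\<gamma> y') (diag_family y p y')) m"
  shows "m \<le> n + int (deg_at y)"
proof -
  let ?h = "\<lambda>y'. mmul (\<gamma> y') (diag_family y p y')"
  have h: "family ?h" by (rule family_mmul[OF g family_diag[OF p(1)]])
  have dd: "ddeg ?h = ddeg \<gamma> + int (deg_at y)"
  proof -
    have "ord_at y' (mdet (?h y')) = ord_at y' (mdet (\<gamma> y')) + (if y' = y then 1 else 0)" for y'
    proof -
      have "mdet (Mat2 p 0 0 1) = p" by (simp add: mdet_def)
      then show ?thesis using g p by (simp add: mdet_mmul family_def diag_family_def ord_at_mult)
    qed
    then show ?thesis using sdeg_add[OF fin_det_family[OF g] fin_single[of y 1]]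
      by (simp add: ddeg_def sdeg_single)
  qed
  obtain v where v: "v \<noteq> (0, 0)" "2 * vdeg ?h v = m + ddeg ?h" using s(2) unfolding slope_def by blast
  have "vord y' (vmul v (?h y')) \<le> vord y' (vmul v (\<gamma> y')) + (if y' = y then 1 else 0)" for y'
    using vord_diag_le[OF p, of "vmul v (\<gamma> y)"] vmul_nonzero[OF _ v(1), of "\<gamma> y"] g
    by (simp add: diag_family_def vmul_mmul family_def)
  then have "vdeg ?h v \<le> sdeg (\<lambda>y'. vord y' (vmul v (\<gamma> y')) + (if y' = y then 1 else 0))"
    unfolding vdeg_def by (rule sdeg_mono[OF fin_vord_family[OF h v(1)] fin_add[OF fin_vord_family[OF g v(1)] fin_single]])
  also have "\<dots> = vdeg \<gamma> v + int (deg_at y)"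
    using sdeg_add[OF fin_vord_family[OF g v(1)] fin_single[of y 1]] by (simp add: vdeg_def sdeg_single)
  finally have "vdeg ?h v \<le> vdeg \<gamma> v + int (deg_at y)" .
  moreover have "2 * vdeg \<gamma> v \<le> n + ddeg \<gamma>" using s(1) v(1) unfolding slope_def by blast
  ultimately show ?thesis using v(2) dd by linarith
qed

text \<open>The representative $\mathrm{diag}(1,\pi_y)$ raises the degree of the line $(0,1)$, which has
maximal degree for the standard family, by the full amount $\deg y$.\<close>

lemma slope_hecke_ge:
  assumes p: "p \<noteq> 0" "ord_at y p = 1"
    and s: "slope (\<lambda>y'. mmul (standard_family n y') (if y' = y then Mat2 1 0 0 p else mone)) m"
  shows "int n + int (deg_at y) \<le> m"
proof -
  let ?q = "\<lambda>y'. if y' = y then Mat2 1 0 0 p else mone"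
  let ?h = "\<lambda>y'. mmul (standard_family n y') (?q y')"
  have q: "family ?q" by (rule family_local[of y]) (use p in \<open>simp_all add: mdet_def\<close>)
  have nz: "mdet (standard_family n y') \<noteq> 0" for y' using family_standard by (simp add: family_def)
  have dd: "ddeg ?h = - int n + int (deg_at y)"
  proof -
    have "ord_at y' (mdet (?h y')) = ord_at y' (mdet (standard_family n y')) + (if y' = y then 1 else 0)" for y'
    proof -
      have "mdet (Mat2 1 0 0 p) = p" by (simp add: mdet_def)
      then show ?thesis using p nz by (simp add: mdet_mmul ord_at_mult)
    qed
    then show ?thesis using sdeg_add[OF fin_det_family[OF family_standard[of n]] fin_single[of y 1]] ddeg_standard[of n]
      by (simp add: ddeg_def sdeg_single)
  qed
  have "vord y' (vmul (0, 1) (?h y')) = (if y' = y then 1 else 0)" for y'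
    using p by (simp add: vmul_def mmul_def standard_family_def diag_family_def mone_def vord_def)
  then have "vdeg ?h (0, 1) = int (deg_at y)" by (simp add: vdeg_def sdeg_single)
  moreover have "2 * vdeg ?h (0, 1) \<le> m + ddeg ?h" by (rule slopeD[OF s]) simp
  ultimately show ?thesis using dd by linarith
qed

text \<open>Writing $v = (vg)g^{-1}$ bounds the degree of the line of $v$ from above: the divisor of $v$ itself has
degree at most 0, by the product formula applied to a nonzero entry, and $g^{-1}$ distorts norms by
at most the entries of $g$ and the inverse of its determinant. Here $h(y)$ is the logarithm of the
local height.\<close>

lemma slope_le_height:
  assumes g: "family \<gamma>" and s: "slope \<gamma> n" and h: "fin h"
    and e: "\<And>y. near_zero y (- h y) (e11 (\<gamma> y))" "\<And>y. near_zero y (- h y) (e12 (\<gamma> y))"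
      "\<And>y. near_zero y (- h y) (e21 (\<gamma> y))" "\<And>y. near_zero y (- h y) (e22 (\<gamma> y))"
    and d: "\<And>y. ord_at y (mdet (\<gamma> y)) \<le> h y"
  shows "n \<le> 3 * sdeg h"
proof -
  obtain v where v: "v \<noteq> (0, 0)" "2 * vdeg \<gamma> v = n + ddeg \<gamma>" using s unfolding slope_def by blast
  let ?D = "\<lambda>y. ord_at y (mdet (\<gamma> y))"
  have nz: "mdet (\<gamma> y) \<noteq> 0" for y using g by (simp add: family_def)
  have inv: "vord y (vmul v (\<gamma> y)) \<le> vord y v + (h y + ?D y)" for y
  proof -
    have sc: "near_zero y (- h y + - ?D y) (z / mdet (\<gamma> y))" if "near_zero y (- h y) z" for z
    proof -
      have "near_zero y (- ?D y) (inverse (mdet (\<gamma> y)))" using nz by (simp add: near_zero_def ord_at_inverse)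
      from near_zero_mult[OF that this] show ?thesis by (simp add: divide_inverse)
    qed
    have i: "mdet (minv (\<gamma> y)) \<noteq> 0" using nz by (simp add: mdet_minv)
    have "vord y (vmul v (\<gamma> y)) + (- h y + - ?D y) \<le> vord y (vmul (vmul v (\<gamma> y)) (minv (\<gamma> y)))"
      by (rule vord_vmul_ge[OF vmul_nonzero[OF nz v(1)] i]) (use sc e in \<open>simp_all add: minv_def\<close>)
    moreover have "vmul (vmul v (\<gamma> y)) (minv (\<gamma> y)) = v" using nz by (simp add: vmul_mmul[symmetric] minv_right)
    ultimately show ?thesis by simp
  qed
  have v0: "sdeg (\<lambda>y. vord y v) \<le> 0"
  proof -
    obtain z where z: "z \<noteq> 0" "\<And>y. vord y v \<le> ord_at y z"
      using v(1) by (cases v; cases "fst v = 0") (auto simp: vord_def)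
    then show ?thesis using sdeg_mono[OF fin_vord[OF v(1)] finite_ord[OF z(1)]] sdeg_ord[OF z(1)] by simp
  qed
  have "vdeg \<gamma> v \<le> sdeg (\<lambda>y. vord y v + (h y + ?D y))"
    unfolding vdeg_def using inv
    by (rule sdeg_mono[OF fin_vord_family[OF g v(1)] fin_add[OF fin_vord[OF v(1)] fin_add[OF h fin_det_family[OF g]]]])
  also have "\<dots> = sdeg (\<lambda>y. vord y v) + (sdeg h + ddeg \<gamma>)"
    using sdeg_add[OF fin_vord[OF v(1)] fin_add[OF h fin_det_family[OF g]]] sdeg_add[OF h fin_det_family[OF g]]
    by (simp add: ddeg_def)
  finally have "vdeg \<gamma> v \<le> sdeg h + ddeg \<gamma>" using v0 by simp
  moreover have "ddeg \<gamma> \<le> sdeg h" unfolding ddeg_def by (rule sdeg_mono[OF fin_det_family[OF g] h d])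
  ultimately show ?thesis using v(2) by linarith
qed


section \<open>Every adelic lattice splits\<close>

text \<open>Equivalence under $G(F)$ from the left, $K$ from the right and the centre, directed since only the
passage from a family to its normal form is required.\<close>

definition equivF :: "('k place \<Rightarrow> 'k ratfun mat2) \<Rightarrow> ('k place \<Rightarrow> 'k ratfun mat2) \<Rightarrow> bool" where
  "equivF \<gamma> \<delta> \<longleftrightarrow> (\<exists>A \<zeta> \<kappa>. mdet A \<noteq> 0 \<and> (\<forall>y. \<zeta> y \<noteq> 0) \<and> fin (\<lambda>y. ord_at y (\<zeta> y)) \<and> (\<forall>y. gl2_integral y (\<kappa> y)) \<and>
     (\<forall>y. \<delta> y = msc (\<zeta> y) (mmul A (mmul (\<gamma> y) (\<kappa> y)))))"

lemma equivFI:
  assumes "mdet A \<noteq> 0" "\<And>y. \<zeta> y \<noteq> 0" "fin (\<lambda>y. ord_at y (\<zeta> y))" "\<And>y. gl2_integral y (\<kappa> y)"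
    "\<And>y. \<delta> y = msc (\<zeta> y) (mmul A (mmul (\<gamma> y) (\<kappa> y)))"
  shows "equivF \<gamma> \<delta>"
  using assms unfolding equivF_def by blast

lemma equivFE:
  assumes "equivF \<gamma> \<delta>"
  obtains A \<zeta> \<kappa> where "mdet A \<noteq> 0" "\<And>y. \<zeta> y \<noteq> 0" "fin (\<lambda>y. ord_at y (\<zeta> y))" "\<And>y. gl2_integral y (\<kappa> y)"
    "\<And>y. \<delta> y = msc (\<zeta> y) (mmul A (mmul (\<gamma> y) (\<kappa> y)))"
  using assms unfolding equivF_def by (elim exE conjE) (rule that, simp_all)

lemma equivF_trans:
  assumes "equivF \<alpha> \<beta>" "equivF \<beta> \<gamma>"
  shows "equivF \<alpha> \<gamma>"
proof -
  obtain A \<zeta> \<kappa> where 1: "mdet A \<noteq> 0" "\<And>y. \<zeta> y \<noteq> 0" "fin (\<lambda>y. ord_at y (\<zeta> y))" "\<And>y. gl2_integral y (\<kappa> y)"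
    "\<And>y. \<beta> y = msc (\<zeta> y) (mmul A (mmul (\<alpha> y) (\<kappa> y)))" by (rule equivFE[OF assms(1)]) (rule that)
  obtain A' \<zeta>' \<kappa>' where 2: "mdet A' \<noteq> 0" "\<And>y. \<zeta>' y \<noteq> 0" "fin (\<lambda>y. ord_at y (\<zeta>' y))" "\<And>y. gl2_integral y (\<kappa>' y)"
    "\<And>y. \<gamma> y = msc (\<zeta>' y) (mmul A' (mmul (\<beta> y) (\<kappa>' y)))" by (rule equivFE[OF assms(2)]) (rule that)
  show ?thesis
  proof (rule equivFI)
    show "mdet (mmul A' A) \<noteq> 0" using 1(1) 2(1) by (simp add: mdet_mmul)
    show "\<zeta>' y * \<zeta> y \<noteq> 0" for y using 1(2) 2(2) by simp
    show "fin (\<lambda>y. ord_at y (\<zeta>' y * \<zeta> y))" using fin_add[OF 2(3) 1(3)] 1(2) 2(2) by (simp add: ord_at_mult)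
    show "gl2_integral y (mmul (\<kappa> y) (\<kappa>' y))" for y using 1(4) 2(4) by (rule gl2_integral_mmul)
    show "\<gamma> y = msc (\<zeta>' y * \<zeta> y) (mmul (mmul A' A) (mmul (\<alpha> y) (mmul (\<kappa> y) (\<kappa>' y))))" for y
      by (simp add: 2(5) 1(5) msc_mmul msc_msc mmul_assoc)
  qed
qed

lemma equivF_right:
  assumes "\<And>y. gl2_integral y (\<kappa> y)"
  shows "equivF \<gamma> (\<lambda>y. mmul (\<gamma> y) (\<kappa> y))"
  by (rule equivFI[of mone "\<lambda>y. 1" \<kappa>]) (use assms in simp_all)

lemma equivF_scalar:
  assumes "\<And>y. \<zeta> y \<noteq> 0" "fin (\<lambda>y. ord_at y (\<zeta> y))"
  shows "equivF \<gamma> (\<lambda>y. msc (\<zeta> y) (\<gamma> y))"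
  by (rule equivFI[of mone \<zeta> "\<lambda>y. mone"]) (use assms in simp_all)

definition upper_family :: "int \<Rightarrow> ('k place \<Rightarrow> 'k ratfun) \<Rightarrow> 'k place \<Rightarrow> 'k ratfun mat2" where
  "upper_family m b = (\<lambda>y. Mat2 (if y = x then t_rf powi m else 1) (b y) 0 1)"

text \<open>One entry of the bottom row divides the other, so a column operation over the valuation ring, possibly after exchanging the columns,
clears the left one.\<close>

lemma iwasawa:
  assumes d: "mdet g \<noteq> 0"
  shows "\<exists>k. gl2_integral y k \<and> e21 (mmul g k) = 0"
proof -
  let ?r = "e21 g" and ?s = "e22 g"
  have nz: "?r \<noteq> 0 \<or> ?s \<noteq> 0" using d by (auto simp: mdet_def)
  show ?thesis
  proof (cases "?s \<noteq> 0 \<and> ?r / ?s \<in> val_ring y")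
    case True
    then have "gl2_integral y (Mat2 1 0 (- (?r / ?s)) 1)"
      by (simp add: gl2_integral_def mdet_def val_ring_minus del: minus_divide_left minus_divide_right)
    moreover have "e21 (mmul g (Mat2 1 0 (- (?r / ?s)) 1)) = 0" using True by (simp add: mmul_def)
    ultimately show ?thesis by blast
  next
    case False
    have r: "?r \<noteq> 0" using False nz by (cases "?s = 0") auto
    have "?s / ?r \<in> val_ring y"
      using False val_ring_total[of "?r / ?s" y] by (cases "?s = 0") auto
    then have "gl2_integral y (Mat2 (- (?s / ?r)) 1 1 0)"
      using unit_at_const[of "- 1" y] by (simp add: gl2_integral_def mdet_def val_ring_minus const_rf_minus)
    moreover have "e21 (mmul g (Mat2 (- (?s / ?r)) 1 1 0)) = 0" using r by (simp add: mmul_def)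
    ultimately show ?thesis by blast
  qed
qed

text \<open>After triangularisation the centre makes the lower diagonal entry 1. The upper one is an idele, which
becomes a power of $t$ at $x$ and 1 elsewhere since the class number is one.\<close>

lemma equivF_upper_family:
  assumes g: "family \<gamma>"
  shows "\<exists>m b. finite {y. b y \<notin> val_ring y} \<and> equivF \<gamma> (upper_family m b)"
proof -
  have "\<forall>y. \<exists>k. gl2_integral y k \<and> e21 (mmul (\<gamma> y) k) = 0"
  proof
    fix y
    have "mdet (\<gamma> y) \<noteq> 0" using g by (simp add: family_def)
    then show "\<exists>k. gl2_integral y k \<and> e21 (mmul (\<gamma> y) k) = 0" by (rule iwasawa)
  qed
  from choice[OF this] obtain \<kappa> where k: "\<And>y. gl2_integral y (\<kappa> y)" "\<And>y. e21 (mmul (\<gamma> y) (\<kappa> y)) = 0" by blast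
  define \<delta> where "\<delta> = (\<lambda>y. mmul (\<gamma> y) (\<kappa> y))"
  have e1: "equivF \<gamma> \<delta>" unfolding \<delta>_def by (rule equivF_right[OF k(1)])
  have fd: "family \<delta>" unfolding \<delta>_def by (rule family_mmul[OF g family_integral]) (use k in blast)
  define a where "a = (\<lambda>y. e11 (\<delta> y))"
  define b where "b = (\<lambda>y. e12 (\<delta> y))"
  define c where "c = (\<lambda>y. e22 (\<delta> y))"
  have \<delta>: "\<delta> y = Mat2 (a y) (b y) 0 (c y)" for y
    using k(2)[of y] by (simp add: a_def b_def c_def \<delta>_def[symmetric]) (metis \<delta>_def mat2.collapse)
  have det: "mdet (\<delta> y) = a y * c y" for y by (simp add: \<delta> mdet_def)
  have nz: "a y \<noteq> 0" "c y \<noteq> 0" for y using fd det[of y] by (auto simp: family_def)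
  have good: "ord_at y (a y) = 0 \<and> ord_at y (c y) = 0 \<and> b y \<in> val_ring y" if i: "gl2_integral y (\<delta> y)" for y
  proof -
    have "a y \<in> val_ring y" "b y \<in> val_ring y" "c y \<in> val_ring y" "unit_at y (a y * c y)"
      using i det[of y] by (simp_all add: gl2_integral_def \<delta>)
    then have "ord_at y (a y) \<ge> 0" "ord_at y (c y) \<ge> 0" "ord_at y (a y) + ord_at y (c y) = 0" "b y \<in> val_ring y"
      using nz[of y] by (simp_all add: val_ring_iff_ord unit_at_iff_ord ord_at_mult)
    then show ?thesis by linarith
  qed
  let ?bad = "{y. \<not> gl2_integral y (\<delta> y)}"
  have bad: "finite ?bad" using fd by (simp add: family_def)
  have "{y. ord_at y (a y / c y) \<noteq> 0} \<subseteq> ?bad" using good nz by (force simp: ord_at_divide)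
  then have fa: "finite {y. ord_at y (a y / c y) \<noteq> 0}" by (rule finite_subset[OF _ bad])
  have "{y. ord_at y (inverse (c y)) \<noteq> 0} \<subseteq> ?bad" using good nz by (force simp: ord_at_inverse)
  then have fc: "fin (\<lambda>y. ord_at y (inverse (c y)))" by (rule finite_subset[OF _ bad])
  have "b y / c y \<in> val_ring y" if "y \<notin> ?bad" for y
    using good[of y] that nz[of y] by (cases "b y = 0") (simp_all add: val_ring_iff_ord ord_at_divide)
  then have fb: "finite {y. b y / c y \<notin> val_ring y}" by (intro finite_subset[OF _ bad]) blast
  have e2: "equivF \<delta> (\<lambda>y. msc (inverse (c y)) (\<delta> y))" by (rule equivF_scalar[OF _ fc]) (simp add: nz)
  have e2': "msc (inverse (c y)) (\<delta> y) = Mat2 (a y / c y) (b y / c y) 0 1" for y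
    using nz[of y] by (simp add: msc_def \<delta> field_simps)
  obtain z where z: "z \<noteq> 0" "\<And>y. y \<noteq> x \<Longrightarrow> ord_at y z = ord_at y (a y / c y)"
    using ideles_class_number_one[OF _ fa] nz by auto
  define m where "m = ord_at x (a x / c x) - ord_at x z"
  define u where "u = (\<lambda>y. (a y / c y) / (z * (if y = x then t_rf powi m else 1)))"
  have u0: "u y \<noteq> 0" for y using nz z by (simp add: u_def)
  have uu: "unit_at y (u y)" for y
  proof -
    have n: "z * (if y = x then t_rf powi m else 1) \<noteq> 0" "a y / c y \<noteq> 0" using z nz by simp_all
    have "ord_at y (z * (if y = x then t_rf powi m else 1)) = ord_at y (a y / c y)"
      using z by (auto simp: ord_at_mult ord_at_power_int m_def)
    then have "ord_at y (u y) = 0" unfolding u_def using ord_at_divide[OF n(2) n(1), of y] by simp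
    then show ?thesis using u0 by (simp add: unit_at_iff_ord)
  qed
  define b' where "b' = (\<lambda>y. b y / c y / z)"
  let ?A = "Mat2 (inverse z) 0 0 1" and ?k = "\<lambda>y. Mat2 (inverse (u y)) 0 0 1"
  have e3: "equivF (\<lambda>y. msc (inverse (c y)) (\<delta> y)) (upper_family m b')"
  proof (rule equivFI[of ?A "\<lambda>y. 1" ?k])
    show "mdet ?A \<noteq> 0" using z by (simp add: mdet_def)
    show "gl2_integral y (?k y)" for y using unit_at_inverse[OF uu[of y]] by (simp add: gl2_integral_def mdet_def unit_at_def)
    show "upper_family m b' y = msc 1 (mmul ?A (mmul (msc (inverse (c y)) (\<delta> y)) (?k y)))" for y
    proof -
      have "inverse z * (a y / c y * inverse (u y)) = (if y = x then t_rf powi m else 1)"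
        using nz[of y] z by (simp add: u_def field_simps)
      then show ?thesis unfolding e2' by (simp add: upper_family_def mmul_def b'_def divide_inverse mult.commute)
    qed
  qed simp_all
  have "{y. b' y \<notin> val_ring y} \<subseteq> {y. b y / c y \<notin> val_ring y} \<union> {y. ord_at y z \<noteq> 0}"
  proof
    fix y assume y: "y \<in> {y. b' y \<notin> val_ring y}"
    show "y \<in> {y. b y / c y \<notin> val_ring y} \<union> {y. ord_at y z \<noteq> 0}"
    proof (rule ccontr)
      assume n: "\<not> ?thesis"
      then have "unit_at y z" using z by (simp add: unit_at_iff_ord)
      then have "b y / c y * inverse z \<in> val_ring y" using n by (intro val_ring_mult) (simp_all add: unit_at_def)
      then show False using y by (simp add: b'_def divide_inverse)
    qed
  qed
  then have "finite {y. b' y \<notin> val_ring y}" by (rule finite_subset) (use fb finite_ord[OF z(1)] in simp)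
  then show ?thesis using equivF_trans[OF e1 equivF_trans[OF e2 e3]] by blast
qed

text \<open>Strong approximation moves the unipotent part to the place $x$.\<close>

lemma equivF_upper_family_x:
  assumes "finite {y. b y \<notin> val_ring y}"
  shows "\<exists>c. near_zero x 1 c \<and> equivF (upper_family m b) (upper_family m (\<lambda>y. if y = x then c else 0))"
proof -
  obtain \<beta> where \<beta>: "\<And>y. y \<noteq> x \<Longrightarrow> b y - \<beta> \<in> val_ring y" "near_zero x 1 (b x - \<beta>)"
    using strong_approximation[OF assms] by blast
  let ?A = "Mat2 1 (- \<beta>) 0 1" and ?k = "\<lambda>y. if y = x then mone else Mat2 1 (- (b y - \<beta>)) 0 1"
  have "equivF (upper_family m b) (upper_family m (\<lambda>y. if y = x then b x - \<beta> else 0))"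
  proof (rule equivFI[of ?A "\<lambda>y. 1" ?k])
    show "mdet ?A \<noteq> 0" by (simp add: mdet_def)
    show "gl2_integral y (?k y)" for y
      using gl2_integral_unipotent[OF val_ring_minus[OF \<beta>(1)[of y]]] by (cases "y = x") simp_all
    show "upper_family m (\<lambda>y. if y = x then b x - \<beta> else 0) y = msc 1 (mmul ?A (mmul (upper_family m b y) (?k y)))" for y
      by (simp add: upper_family_def mmul_def mone_def)
  qed simp_all
  then show ?thesis using \<beta>(2) by blast
qed

text \<open>A negative exponent is standard already; a positive one becomes negative by exchanging the two basis
vectors and rescaling at $x$.\<close>

lemma equivF_diagonal: "\<exists>n. equivF (diag_family x (t_rf powi m)) (standard_family n)"
proof (cases "m \<le> 0")
  case True
  have "equivF (diag_family x (t_rf powi m)) (\<lambda>y. mmul (diag_family x (t_rf powi m) y) mone)" by (rule equivF_right) simp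
  moreover have "standard_family (nat (- m)) = diag_family x (t_rf powi m)" using True by (simp add: standard_family_def)
  ultimately show ?thesis by (intro exI[of _ "nat (- m)"]) simp
next
  case False
  let ?z = "\<lambda>y. if y = x then t_rf powi (- m) else 1"
  have "equivF (diag_family x (t_rf powi m)) (standard_family (nat m))"
  proof (rule equivFI[of mswap ?z "\<lambda>y. mswap"])
    show "mdet (mswap :: 'k ratfun mat2) \<noteq> 0" by (simp add: mdet_def mswap_def)
    show "fin (\<lambda>y. ord_at y (?z y))" by (rule finite_subset[of _ "{x}"]) auto
    show "standard_family (nat m) y = msc (?z y) (mmul mswap (mmul (diag_family x (t_rf powi m) y) mswap))" for y
      using False by (simp add: standard_family_def diag_family_def mmul_def mswap_def msc_def mone_def power_int_minus)
  qed (simp_all add: gl2_integral_mswap)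
  then show ?thesis by blast
qed

text \<open>Exchanging the rows and clearing the lower left entry again is a step of the Euclidean algorithm at
$x$. It lowers the exponent from $m$ to $m - 2\,\mathrm{ord}_x(c)$.\<close>

lemma equivF_upper_step:
  assumes c: "c \<noteq> 0" "1 \<le> ord_at x c" "ord_at x c < m"
  shows "equivF (upper_family m (\<lambda>y. if y = x then c else 0))
    (upper_family (m - 2 * ord_at x c) (\<lambda>y. if y = x then inverse c else 0))"
proof -
  let ?j = "ord_at x c"
  let ?v = "t_rf powi (2 * ?j) / (c * c)"
  have tj: "t_rf powi k \<noteq> (0 :: 'k ratfun)" for k by simp
  have v0: "?v \<noteq> 0" using c by simp
  have "ord_at x ?v = 0" using ord_at_divide[OF tj[of "2 * ?j"], of "c * c" x] c
    by (simp add: ord_at_power_int ord_at_mult)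
  then have v: "unit_at x ?v" using v0 unit_at_iff_ord by blast
  have "ord_at x (t_rf powi m / c) = m - ?j" using c ord_at_divide[OF tj[of m] c(1), of x] by (simp add: ord_at_power_int)
  then have w: "t_rf powi m / c \<in> val_ring x" using c by (simp add: val_ring_iff_ord)
  let ?z = "\<lambda>y. if y = x then inverse c else 1"
  let ?k1 = "Mat2 1 0 (- (t_rf powi m / c)) 1" and ?k2 = "Mat2 (- inverse ?v) 0 0 1"
  let ?k = "\<lambda>y. if y = x then mmul ?k1 ?k2 else mswap"
  show ?thesis
  proof (rule equivFI[of mswap ?z ?k])
    show "mdet (mswap :: 'k ratfun mat2) \<noteq> 0" by (simp add: mdet_def mswap_def)
    show "?z y \<noteq> 0" for y using c by simp
    show "fin (\<lambda>y. ord_at y (?z y))" by (rule finite_subset[of _ "{x}"]) auto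
    have "gl2_integral x ?k1" using val_ring_minus[OF w] by (simp add: gl2_integral_def mdet_def)
    moreover have "gl2_integral x ?k2"
    proof -
      have i: "unit_at x (inverse ?v)" by (rule unit_at_inverse[OF v])
      have "unit_at x (- inverse ?v)" using i by (simp only: unit_at_iff_ord ord_at_minus neg_equal_0_iff_equal simp_thms)
      then show ?thesis by (simp add: gl2_integral_def mdet_def unit_at_def)
    qed
    ultimately show "gl2_integral y (?k y)" for y
      using gl2_integral_mmul[of x ?k1 ?k2] gl2_integral_mswap[of y] by (cases "y = x") simp_all
    show "upper_family (m - 2 * ?j) (\<lambda>y. if y = x then inverse c else 0) y
      = msc (?z y) (mmul mswap (mmul (upper_family m (\<lambda>y. if y = x then c else 0) y) (?k y)))" for y
    proof (cases "y = x")
      case True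
      have 1: "mmul (Mat2 (t_rf powi m) c 0 1) ?k1 = Mat2 0 c (- (t_rf powi m / c)) 1"
        using c by (simp add: mmul_def)
      have 2: "mmul (Mat2 0 c (- (t_rf powi m / c)) 1) ?k2 = Mat2 0 c (t_rf powi m / c * inverse ?v) 1"
        by (simp add: mmul_def)
      have 3: "inverse c * (t_rf powi m / c * inverse ?v) = t_rf powi (m - 2 * ?j)"
        using c by (simp add: power_int_diff field_simps)
      show ?thesis using True c 3
        by (simp add: upper_family_def mmul_assoc[symmetric] 1 2) (simp add: mmul_def mswap_def msc_def)
    next
      case False
      then show ?thesis by (simp add: upper_family_def mmul_def mswap_def)
    qed
  qed
qed

text \<open>If $t^m$ divides the off-diagonal entry at $x$, a column operation removes it and the family is
diagonal. Otherwise the exponent drops, which can happen only finitely often as the off-diagonal entry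
is always arranged to vanish at $x$.\<close>

lemma upper_family_standard:
  assumes "finite {y. b y \<notin> val_ring y}"
  shows "\<exists>n. equivF (upper_family m b) (standard_family n)"
  using assms
proof (induction "nat m" arbitrary: m b rule: less_induct)
  case less
  obtain c where c: "near_zero x 1 c" "equivF (upper_family m b) (upper_family m (\<lambda>y. if y = x then c else 0))"
    using equivF_upper_family_x[OF less.prems] by blast
  show ?case
  proof (cases "near_zero x m c")
    case True
    let ?k = "\<lambda>y. if y = x then Mat2 1 (- (c * t_rf powi (- m))) 0 1 else mone"
    have "near_zero x (m + - m) (c * t_rf powi (- m))"
      by (rule near_zero_mult[OF True]) (simp add: near_zero_def ord_at_power_int)
    then have i: "c * t_rf powi (- m) \<in> val_ring x" by (simp add: near_zero_val_ring)
    have "equivF (upper_family m (\<lambda>y. if y = x then c else 0))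
      (\<lambda>y. mmul (upper_family m (\<lambda>y. if y = x then c else 0) y) (?k y))"
      by (rule equivF_right) (simp add: gl2_integral_unipotent[OF val_ring_minus[OF i]])
    moreover have "(\<lambda>y. mmul (upper_family m (\<lambda>y. if y = x then c else 0) y) (?k y)) = diag_family x (t_rf powi m)"
      by (rule ext) (simp add: upper_family_def diag_family_def mmul_def mone_def power_int_minus)
    ultimately show ?thesis using c(2) equivF_diagonal equivF_trans by metis
  next
    case False
    then have c': "c \<noteq> 0" "1 \<le> ord_at x c" "ord_at x c < m" using c(1) by (auto simp: near_zero_def)
    have lt: "nat (m - 2 * ord_at x c) < nat m" using c' by simp
    have fi: "finite {y. (if y = x then inverse c else 0) \<notin> val_ring y}"
      by (rule finite_subset[of _ "{x}"]) auto
    from less.hyps[OF lt fi]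
    obtain n where "equivF (upper_family (m - 2 * ord_at x c) (\<lambda>y. if y = x then inverse c else 0)) (standard_family n)"
      by (elim exE)
    from equivF_trans[OF c(2) equivF_trans[OF equivF_upper_step[OF c'] this]] show ?thesis by (rule exI)
  qed
qed

theorem family_standard_form: "family \<gamma> \<Longrightarrow> \<exists>n. equivF \<gamma> (standard_family n)"
proof -
  assume "family \<gamma>"
  from equivF_upper_family[OF this] obtain m b where b: "finite {y. b y \<notin> val_ring y}" "equivF \<gamma> (upper_family m b)"
    by (elim exE conjE)
  from upper_family_standard[OF b(1), of m] obtain n where "equivF (upper_family m b) (standard_family n)" by (elim exE)
  from equivF_trans[OF b(2) this] show ?thesis by (rule exI)
qed

end

section \<open>Double cosets of GL2 of the adeles\<close>

lemma K_A_inv: "k \<in> K_A \<Longrightarrow> inv\<^bsub>G_A\<^esub> k \<in> K_A"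
  using subgroup.m_inv_closed[OF K_A_subgroup] .

lemma K_A_mult: "k \<in> K_A \<Longrightarrow> k' \<in> K_A \<Longrightarrow> k \<star> k' \<in> K_A"
  using subgroup.m_closed[OF K_A_subgroup] .

lemma K_A_carrier: "k \<in> K_A \<Longrightarrow> k \<in> carrier G_A"
  using K_A_subset by blast

lemma Z_A_carrier: "z \<in> Z_A \<Longrightarrow> z \<in> carrier G_A"
  by (simp add: Z_A_def)

lemma Z_A_comm: "z \<in> Z_A \<Longrightarrow> g \<in> carrier G_A \<Longrightarrow> z \<star> g = g \<star> z"
  by (simp add: Z_A_def)

lemma Z_A_mult: "z \<in> Z_A \<Longrightarrow> w \<in> Z_A \<Longrightarrow> z \<star> w \<in> Z_A"
  and Z_A_inv: "z \<in> Z_A \<Longrightarrow> inv\<^bsub>G_A\<^esub> z \<in> Z_A" for z :: "'k::field GA"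
proof -
  interpret G: Group.group "G_A :: 'k GA monoid" by (rule G_A_group)
  show "z \<star> w \<in> Z_A" if z: "z \<in> Z_A" and w: "w \<in> Z_A"
  proof -
    note c = Z_A_carrier[OF z] Z_A_carrier[OF w]
    have "z \<star> w \<star> g = g \<star> (z \<star> w)" if g: "g \<in> carrier G_A" for g
    proof -
      have "z \<star> w \<star> g = z \<star> (g \<star> w)" using c g Z_A_comm[OF w g] by (simp add: G.m_assoc)
      also have "\<dots> = (g \<star> z) \<star> w" using c g Z_A_comm[OF z g] by (simp add: G.m_assoc[symmetric])
      finally show ?thesis using c g by (simp add: G.m_assoc)
    qed
    then show ?thesis using c by (simp add: Z_A_def)
  qed
  assume z: "z \<in> Z_A"
  then have zc: "z \<in> carrier G_A" by (rule Z_A_carrier)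
  have "inv\<^bsub>G_A\<^esub> z \<star> g = g \<star> inv\<^bsub>G_A\<^esub> z" if g: "g \<in> carrier G_A" for g
  proof -
    have "inv\<^bsub>G_A\<^esub> z \<star> g = inv\<^bsub>G_A\<^esub> z \<star> (g \<star> z) \<star> inv\<^bsub>G_A\<^esub> z"
      using zc g by (simp add: G.m_assoc)
    also have "\<dots> = inv\<^bsub>G_A\<^esub> z \<star> (z \<star> g) \<star> inv\<^bsub>G_A\<^esub> z" using Z_A_comm[OF z g] by simp
    also have "\<dots> = g \<star> inv\<^bsub>G_A\<^esub> z" using zc g by (simp add: G.m_assoc[symmetric])
    finally show ?thesis .
  qed
  then show "inv\<^bsub>G_A\<^esub> z \<in> Z_A" using zc by (simp add: Z_A_def)
qed

lemma Z_A_scalarI: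
  fixes z :: "'k::field GA"
  assumes z: "z \<in> carrier G_A" and c: "\<And>y. comp_at y z = Mat2 (c y) \<zero>\<^bsub>\<F> y\<^esub> \<zero>\<^bsub>\<F> y\<^esub> (c y)"
  shows "z \<in> Z_A"
  unfolding Z_A_def
proof (intro CollectI conjI ballI z)
  fix g :: "'k GA" assume g: "g \<in> carrier G_A"
  show "z \<star> g = g \<star> z"
  proof (rule comp_at_eqI)
    fix y :: "'k place"
    interpret C: cring "\<F> y" by (rule completion_cring)
    have "comp_at y z \<in> carrier (GL2 (\<F> y))" "comp_at y g \<in> carrier (GL2 (\<F> y))"
      using z g by (simp_all add: G_A_iff)
    then show "comp_at y (z \<star> g) = comp_at y (g \<star> z)"
      unfolding comp_at_mult c
      by (cases "comp_at y g") (simp add: GL2_mult GL2_carrier C.m_comm)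
  qed
qed

lemma J_scalar_Z:
  assumes "\<And>y. \<zeta> y \<noteq> 0" "finite {y. ord_at y (\<zeta> y) \<noteq> 0}"
  shows "family (\<lambda>y. msc (\<zeta> y) mone)" "J (\<lambda>y. msc (\<zeta> y) mone) \<in> Z_A"
proof -
  have "gl2_integral y (msc (\<zeta> y) mone)" if "ord_at y (\<zeta> y) = 0" for y
  proof -
    have "unit_at y (\<zeta> y)" using that assms(1) by (simp add: unit_at_iff_ord)
    then show ?thesis by (simp add: gl2_integral_def mdet_def msc_def mone_def unit_at_def val_ring_mult)
  qed
  then have "{y. \<not> gl2_integral y (msc (\<zeta> y) mone)} \<subseteq> {y. ord_at y (\<zeta> y) \<noteq> 0}" by blast
  then have "finite {y. \<not> gl2_integral y (msc (\<zeta> y) mone)}" by (rule finite_subset[OF _ assms(2)])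
  then show f: "family (\<lambda>y. msc (\<zeta> y) mone)" using assms(1) by (simp add: family_def mdet_msc)
  show "J (\<lambda>y. msc (\<zeta> y) mone) \<in> Z_A"
    by (rule Z_A_scalarI[OF J_carrier[OF f], of "\<lambda>y. emb_local y (\<zeta> y)"])
      (simp add: embm_def msc_def mone_def emb_local_0)
qed

context rational_place
begin

text \<open>Commuting with the two elementary unipotent matrices forces a matrix to be scalar.\<close>

lemma Z_A_scalar:
  assumes z: "z \<in> (Z_A :: 'k GA set)"
  shows "\<exists>c. \<forall>y. comp_at y z = Mat2 (c y) \<zero>\<^bsub>\<F> y\<^esub> \<zero>\<^bsub>\<F> y\<^esub> (c y)"
proof -
  let ?U = "\<lambda>y :: 'k place. Mat2 1 1 0 1 :: 'k ratfun mat2" and ?L = "\<lambda>y :: 'k place. Mat2 1 0 1 1 :: 'k ratfun mat2"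
  have U: "J ?U \<in> carrier G_A" and L: "J ?L \<in> carrier G_A"
    by (rule J_carrier, rule family_const, simp add: mdet_def)+
  have "\<forall>y. \<exists>c. comp_at y z = Mat2 c \<zero>\<^bsub>\<F> y\<^esub> \<zero>\<^bsub>\<F> y\<^esub> c"
  proof
    fix y :: "'k place"
    interpret C: cring "\<F> y" by (rule completion_cring)
    obtain p q r s where m: "comp_at y z = Mat2 p q r s" by (cases "comp_at y z") auto
    have "comp_at y z \<in> carrier (GL2 (\<F> y))" using Z_A_carrier[OF z] by (simp add: G_A_iff)
    then have cr: "p \<in> carrier (\<F> y)" "q \<in> carrier (\<F> y)" "r \<in> carrier (\<F> y)" "s \<in> carrier (\<F> y)"
      by (simp_all add: GL2_carrier m)
    have "comp_at y z \<otimes>\<^bsub>GL2 (\<F> y)\<^esub> embm y (Mat2 1 1 0 1) = embm y (Mat2 1 1 0 1) \<otimes>\<^bsub>GL2 (\<F> y)\<^esub> comp_at y z"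
      using arg_cong[OF Z_A_comm[OF z U], of "comp_at y"] by (simp add: comp_at_mult)
    then have u: "p = p \<oplus>\<^bsub>\<F> y\<^esub> r" "p \<oplus>\<^bsub>\<F> y\<^esub> q = q \<oplus>\<^bsub>\<F> y\<^esub> s"
      using cr by (simp_all add: m embm_def GL2_mult emb_local_0 emb_local_1)
    have "comp_at y z \<otimes>\<^bsub>GL2 (\<F> y)\<^esub> embm y (Mat2 1 0 1 1) = embm y (Mat2 1 0 1 1) \<otimes>\<^bsub>GL2 (\<F> y)\<^esub> comp_at y z"
      using arg_cong[OF Z_A_comm[OF z L], of "comp_at y"] by (simp add: comp_at_mult)
    then have l: "p \<oplus>\<^bsub>\<F> y\<^esub> q = p"
      using cr by (simp add: m embm_def GL2_mult emb_local_0 emb_local_1)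
    have "r = \<zero>\<^bsub>\<F> y\<^esub>" using u(1) cr C.add.r_cancel_one'[of p r] C.add.l_cancel_one'[of p r] by simp
    moreover have q: "q = \<zero>\<^bsub>\<F> y\<^esub>" using l cr C.add.r_cancel_one[of p q] C.add.l_cancel_one[of p q] by simp
    moreover have "p = s" using u(2) q cr by simp
    ultimately show "\<exists>c. comp_at y z = Mat2 c \<zero>\<^bsub>\<F> y\<^esub> \<zero>\<^bsub>\<F> y\<^esub> c" by (simp add: m)
  qed
  then show ?thesis by (rule choice)
qed

text \<open>An idele is a family of elements of $F^\times$ times a unit idele.\<close>

lemma Z_A_approximation:
  assumes z: "z \<in> (Z_A :: 'k GA set)"
  shows "\<exists>\<zeta> k. (\<forall>y. \<zeta> y \<noteq> 0) \<and> fin (\<lambda>y. ord_at y (\<zeta> y)) \<and> k \<in> K_A \<and> k \<in> Z_A \<and> z = J (\<lambda>y. msc (\<zeta> y) mone) \<star> k"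
proof -
  obtain c where c: "\<And>y. comp_at y z = Mat2 (c y) \<zero>\<^bsub>\<F> y\<^esub> \<zero>\<^bsub>\<F> y\<^esub> (c y)" using Z_A_scalar[OF z] by blast
  let ?P = "\<lambda>y \<zeta>. \<zeta> \<noteq> 0 \<and> c y \<in> carrier (\<F> y) \<and> (\<exists>w. w \<in> carrier (\<F> y) \<and> c y \<otimes>\<^bsub>\<F> y\<^esub> w = \<one>\<^bsub>\<F> y\<^esub> \<and>
     small y 0 (emb_local y (inverse \<zeta>) \<otimes>\<^bsub>\<F> y\<^esub> c y) \<and> small y 0 (emb_local y \<zeta> \<otimes>\<^bsub>\<F> y\<^esub> w) \<and>
     (comp_at y z \<in> carrier (GL2 (local_integers y)) \<longrightarrow> small y 0 (c y) \<and> small y 0 w))"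
  have "\<forall>y. \<exists>\<zeta>. ?P y \<zeta>"
  proof
    fix y :: "'k place"
    interpret C: cring "\<F> y" by (rule completion_cring)
    have mc: "comp_at y z \<in> carrier (GL2 (\<F> y))" using Z_A_carrier[OF z] by (simp add: G_A_iff)
    then have cc: "c y \<in> carrier (\<F> y)" by (simp add: GL2_carrier c)
    have det: "det2 (\<F> y) (comp_at y z) = c y \<otimes>\<^bsub>\<F> y\<^esub> c y"
      using cc by (simp add: c det2_def a_minus_def)
    have "\<exists>v. v \<in> carrier (\<F> y) \<and> c y \<otimes>\<^bsub>\<F> y\<^esub> c y \<otimes>\<^bsub>\<F> y\<^esub> v = \<one>\<^bsub>\<F> y\<^esub> \<and>
       (comp_at y z \<in> carrier (GL2 (local_integers y)) \<longrightarrow> small y 0 (c y) \<and> small y 0 v)"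
    proof (cases "comp_at y z \<in> carrier (GL2 (local_integers y))")
      case True
      then obtain v where v: "small y 0 v" "c y \<otimes>\<^bsub>\<F> y\<^esub> c y \<otimes>\<^bsub>\<F> y\<^esub> v = \<one>\<^bsub>\<F> y\<^esub>" "small y 0 (c y)"
        unfolding GL2_local_integers_carrier det by (auto simp: c)
      then show ?thesis using small_carrier[OF v(1)] by blast
    next
      case False
      then show ?thesis using mc unfolding GL2_completion_carrier det by blast
    qed
    then obtain v where v: "v \<in> carrier (\<F> y)" "c y \<otimes>\<^bsub>\<F> y\<^esub> c y \<otimes>\<^bsub>\<F> y\<^esub> v = \<one>\<^bsub>\<F> y\<^esub>"
      "comp_at y z \<in> carrier (GL2 (local_integers y)) \<longrightarrow> small y 0 (c y) \<and> small y 0 v" by blast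
    let ?w = "c y \<otimes>\<^bsub>\<F> y\<^esub> v"
    have w: "?w \<in> carrier (\<F> y)" "c y \<otimes>\<^bsub>\<F> y\<^esub> ?w = \<one>\<^bsub>\<F> y\<^esub>"
      using cc v by (simp_all add: C.m_assoc)
    obtain \<zeta> where \<zeta>: "\<zeta> \<noteq> 0" "small y 0 (emb_local y (inverse \<zeta>) \<otimes>\<^bsub>\<F> y\<^esub> c y)" "small y 0 (emb_local y \<zeta> \<otimes>\<^bsub>\<F> y\<^esub> ?w)"
      using scalar_approximation[OF cc w] by blast
    have "comp_at y z \<in> carrier (GL2 (local_integers y)) \<longrightarrow> small y 0 (c y) \<and> small y 0 ?w" using v(3) small0_mult by blast
    then show "\<exists>\<zeta>. ?P y \<zeta>" using \<zeta> w cc by (intro exI[of _ \<zeta>] conjI exI[of _ ?w])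
  qed
  from choice[OF this] obtain \<zeta> where "\<forall>y. ?P y (\<zeta> y)" by (elim exE)
  then have \<zeta>: "?P y (\<zeta> y)" for y by (rule spec)
  have \<zeta>0: "\<zeta> y \<noteq> 0" for y using \<zeta>[of y] by (elim conjE)
  have cc: "c y \<in> carrier (\<F> y)" for y using \<zeta>[of y] by (elim conjE)
  have ord: "ord_at y (\<zeta> y) = 0" if i: "comp_at y z \<in> carrier (GL2 (local_integers y))" for y
  proof -
    interpret C: cring "\<F> y" by (rule completion_cring)
    obtain w where w: "w \<in> carrier (\<F> y)" "c y \<otimes>\<^bsub>\<F> y\<^esub> w = \<one>\<^bsub>\<F> y\<^esub>"
      "small y 0 (emb_local y (inverse (\<zeta> y)) \<otimes>\<^bsub>\<F> y\<^esub> c y)" "small y 0 (emb_local y (\<zeta> y) \<otimes>\<^bsub>\<F> y\<^esub> w)"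
      "small y 0 (c y)" "small y 0 w" using \<zeta>[of y] i by blast
    have "emb_local y (inverse (\<zeta> y)) = emb_local y (inverse (\<zeta> y)) \<otimes>\<^bsub>\<F> y\<^esub> c y \<otimes>\<^bsub>\<F> y\<^esub> w"
      using w(1,2) cc[of y] by (simp add: C.m_assoc)
    then have "small y 0 (emb_local y (inverse (\<zeta> y)))" using small0_mult[OF w(3) w(6)] by simp
    moreover have "emb_local y (\<zeta> y) = emb_local y (\<zeta> y) \<otimes>\<^bsub>\<F> y\<^esub> w \<otimes>\<^bsub>\<F> y\<^esub> c y"
      using w(1,2) cc[of y] by (simp add: C.m_assoc C.m_comm[of w "c y"])
    then have "small y 0 (emb_local y (\<zeta> y))" using small0_mult[OF w(4) w(5)] by simp
    ultimately have "near_zero y 0 (\<zeta> y)" "near_zero y 0 (inverse (\<zeta> y))" by (simp_all add: small_emb)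
    then show ?thesis using \<zeta>0[of y] by (simp add: near_zero_def ord_at_inverse)
  qed
  then have "{y. ord_at y (\<zeta> y) \<noteq> 0} \<subseteq> {y. comp_at y z \<notin> carrier (GL2 (local_integers y))}" by blast
  moreover have "finite {y. comp_at y z \<notin> carrier (GL2 (local_integers y))}" using Z_A_carrier[OF z] by (simp add: G_A_iff)
  ultimately have fz: "fin (\<lambda>y. ord_at y (\<zeta> y))" by (rule finite_subset)
  define k where "k = adelic_mat (\<lambda>y. Mat2 (emb_local y (inverse (\<zeta> y)) \<otimes>\<^bsub>\<F> y\<^esub> c y) \<zero>\<^bsub>\<F> y\<^esub>
    \<zero>\<^bsub>\<F> y\<^esub> (emb_local y (inverse (\<zeta> y)) \<otimes>\<^bsub>\<F> y\<^esub> c y))"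
  have "comp_at y k \<in> carrier (GL2 (local_integers y))" for y
  proof -
    interpret C: cring "\<F> y" by (rule completion_cring)
    obtain w where w: "w \<in> carrier (\<F> y)" "c y \<otimes>\<^bsub>\<F> y\<^esub> w = \<one>\<^bsub>\<F> y\<^esub>"
      "small y 0 (emb_local y (inverse (\<zeta> y)) \<otimes>\<^bsub>\<F> y\<^esub> c y)" "small y 0 (emb_local y (\<zeta> y) \<otimes>\<^bsub>\<F> y\<^esub> w)"
      using \<zeta>[of y] by blast
    let ?u = "emb_local y (inverse (\<zeta> y)) \<otimes>\<^bsub>\<F> y\<^esub> c y" and ?v = "emb_local y (\<zeta> y) \<otimes>\<^bsub>\<F> y\<^esub> w"
    have "?u \<otimes>\<^bsub>\<F> y\<^esub> ?v = (emb_local y (inverse (\<zeta> y)) \<otimes>\<^bsub>\<F> y\<^esub> emb_local y (\<zeta> y)) \<otimes>\<^bsub>\<F> y\<^esub> (c y \<otimes>\<^bsub>\<F> y\<^esub> w)"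
      using w(1) cc[of y] by (simp add: C.m_ac)
    also have "\<dots> = \<one>\<^bsub>\<F> y\<^esub>" using w(2) \<zeta>0[of y] by (simp add: emb_local_mult[symmetric] emb_local_1)
    finally have uv: "?u \<otimes>\<^bsub>\<F> y\<^esub> ?v = \<one>\<^bsub>\<F> y\<^esub>" .
    have cl: "?u \<in> carrier (\<F> y)" "?v \<in> carrier (\<F> y)" using w cc[of y] by simp_all
    have "?u \<otimes>\<^bsub>\<F> y\<^esub> ?u \<otimes>\<^bsub>\<F> y\<^esub> (?v \<otimes>\<^bsub>\<F> y\<^esub> ?v) = (?u \<otimes>\<^bsub>\<F> y\<^esub> ?v) \<otimes>\<^bsub>\<F> y\<^esub> (?u \<otimes>\<^bsub>\<F> y\<^esub> ?v)"
    proof -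
      have "a \<otimes>\<^bsub>\<F> y\<^esub> a \<otimes>\<^bsub>\<F> y\<^esub> (b \<otimes>\<^bsub>\<F> y\<^esub> b) = (a \<otimes>\<^bsub>\<F> y\<^esub> b) \<otimes>\<^bsub>\<F> y\<^esub> (a \<otimes>\<^bsub>\<F> y\<^esub> b)"
        if "a \<in> carrier (\<F> y)" "b \<in> carrier (\<F> y)" for a b using that by (simp add: C.m_ac)
      then show ?thesis using cl by blast
    qed
    then have "?u \<otimes>\<^bsub>\<F> y\<^esub> ?u \<otimes>\<^bsub>\<F> y\<^esub> (?v \<otimes>\<^bsub>\<F> y\<^esub> ?v) = \<one>\<^bsub>\<F> y\<^esub>" using uv by simp
    moreover have "small y 0 (?v \<otimes>\<^bsub>\<F> y\<^esub> ?v)" by (rule small0_mult[OF w(4) w(4)])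
    moreover have "det2 (\<F> y) (comp_at y k) = ?u \<otimes>\<^bsub>\<F> y\<^esub> ?u" using cl(1) by (simp add: k_def det2_def a_minus_def)
    ultimately show ?thesis using w(3) unfolding GL2_local_integers_carrier by (auto simp: k_def)
  qed
  then have kK: "k \<in> K_A" by (simp add: K_A_iff)
  have "k \<in> Z_A" by (rule Z_A_scalarI[OF K_A_carrier[OF kK]]) (simp add: k_def)
  moreover have "z = J (\<lambda>y. msc (\<zeta> y) mone) \<star> k"
  proof (rule comp_at_eqI)
    fix y :: "'k place"
    interpret C: cring "\<F> y" by (rule completion_cring)
    have "emb_local y (\<zeta> y) \<otimes>\<^bsub>\<F> y\<^esub> (emb_local y (inverse (\<zeta> y)) \<otimes>\<^bsub>\<F> y\<^esub> c y) = c y"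
      using cc[of y] \<zeta>0[of y] by (simp add: C.m_assoc[symmetric] emb_local_mult[symmetric] emb_local_1)
    then show "comp_at y z = comp_at y (J (\<lambda>y. msc (\<zeta> y) mone) \<star> k)"
      using cc[of y] by (simp add: c comp_at_mult k_def embm_def msc_def mone_def GL2_mult emb_local_0)
  qed
  ultimately show ?thesis using \<zeta>0 fz kK by blast
qed

lemma G_F_eq: "(G_F :: 'k GA set) = {J (\<lambda>y. A) | A. mdet A \<noteq> 0}"
proof -
  have "carrier (GL2 (F_ring :: 'k ratfun ring)) = {A. mdet A \<noteq> 0}"
  proof -
    interpret F: field "F_ring :: 'k ratfun ring" by (rule field_from_type_algebra)
    have "det2 (F_ring :: 'k ratfun ring) A = mdet A" for A
      by (simp add: det2_def mdet_def a_minus_def a_inv_F_ring) (simp add: ring_of_type_algebra_def)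
    then show ?thesis
      by (auto simp: GL2_carrier F.field_Units) (simp_all add: ring_of_type_algebra_def)
  qed
  moreover have "map_mat2 emb_adele A = J (\<lambda>y. A)" for A :: "'k ratfun mat2"
    by (rule comp_at_eqI) (cases A; simp add: comp_at_def emb_adele_def embm_def J_def adelic_mat_def)
  ultimately show ?thesis unfolding G_F_def by auto
qed

lemma G_F_mult: "a \<in> (G_F :: 'k GA set) \<Longrightarrow> b \<in> G_F \<Longrightarrow> a \<star> b \<in> G_F"
  unfolding G_F_eq
proof clarify
  fix A B :: "'k ratfun mat2" assume "mdet A \<noteq> 0" "mdet B \<noteq> 0"
  then show "\<exists>C. J (\<lambda>y. A) \<star> J (\<lambda>y. B) = J (\<lambda>y. C) \<and> mdet C \<noteq> 0"
    by (intro exI[of _ "mmul A B"]) (simp add: J_mmul[symmetric] mdet_mmul)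
qed

lemma G_F_carrier: "a \<in> (G_F :: 'k GA set) \<Longrightarrow> a \<in> carrier G_A"
  unfolding G_F_eq using J_carrier[OF family_const] by blast

lemma G_F_inv: "a \<in> (G_F :: 'k GA set) \<Longrightarrow> inv\<^bsub>G_A\<^esub> a \<in> G_F"
proof -
  interpret G: Group.group "G_A :: 'k GA monoid" by (rule G_A_group)
  assume a: "a \<in> G_F"
  then obtain A where A: "a = J (\<lambda>y. A)" "mdet A \<noteq> 0" unfolding G_F_eq by blast
  have i: "J (\<lambda>y. minv A) \<in> G_F" unfolding G_F_eq using A(2) by (auto simp: mdet_minv)
  have "J (\<lambda>y. minv A) \<star> a = \<one>\<^bsub>G_A\<^esub>" unfolding A(1) J_mmul[symmetric] using A(2) by (simp add: minv_left J_mone)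
  then have "inv\<^bsub>G_A\<^esub> a = J (\<lambda>y. minv A)" using G_F_carrier[OF a] G_F_carrier[OF i] by (rule G.inv_equality)
  then show ?thesis using i by simp
qed

lemma dclass_iff:
  "g' \<in> dclass g \<longleftrightarrow> (\<exists>a\<in>G_F. \<exists>z\<in>Z_A. \<exists>k\<in>K_A. g' = a \<star> g \<star> (z \<star> k))"
  unfolding dclass_def set_mult_def r_coset_def by blast

lemma dclassI:
  assumes "a \<in> G_F" "z \<in> Z_A" "k \<in> K_A" "g' = a \<star> g \<star> (z \<star> k)"
  shows "g' \<in> dclass g"
  using assms unfolding dclass_iff by blast

lemma one_G_F: "\<one>\<^bsub>G_A\<^esub> \<in> (G_F :: 'k GA set)"
proof -
  have "mdet (mone :: 'k ratfun mat2) \<noteq> 0" by simp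
  then show ?thesis unfolding G_F_eq J_mone[symmetric] by blast
qed

lemma one_Z_A: "\<one>\<^bsub>G_A\<^esub> \<in> (Z_A :: 'k GA set)"
proof -
  interpret G: Group.group "G_A :: 'k GA monoid" by (rule G_A_group)
  show ?thesis by (simp add: Z_A_def)
qed

lemma one_K_A: "\<one>\<^bsub>G_A\<^esub> \<in> (K_A :: 'k GA set)"
  using subgroup.one_closed[OF K_A_subgroup] .

lemma dclass_carrier: "g \<in> carrier G_A \<Longrightarrow> g' \<in> dclass g \<Longrightarrow> g' \<in> carrier (G_A :: 'k GA monoid)"
proof -
  interpret G: Group.group "G_A :: 'k GA monoid" by (rule G_A_group)
  assume "g \<in> carrier G_A" "g' \<in> dclass g"
  then show ?thesis unfolding dclass_iff by (auto intro!: G.m_closed intro: G_F_carrier Z_A_carrier K_A_carrier)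
qed

lemma dclass_self: "g \<in> carrier G_A \<Longrightarrow> g \<in> dclass (g :: 'k GA)"
proof -
  interpret G: Group.group "G_A :: 'k GA monoid" by (rule G_A_group)
  assume "g \<in> carrier G_A"
  then show ?thesis by (intro dclassI[OF one_G_F one_Z_A one_K_A]) simp
qed

lemma dclass_sym:
  assumes g: "g \<in> carrier (G_A :: 'k GA monoid)" and g': "g' \<in> dclass g"
  shows "g \<in> dclass g'"
proof -
  interpret G: Group.group "G_A :: 'k GA monoid" by (rule G_A_group)
  obtain a z k where *: "a \<in> G_F" "z \<in> Z_A" "k \<in> K_A" "g' = a \<star> g \<star> (z \<star> k)"
    using g' unfolding dclass_iff by blast
  have c: "a \<in> carrier G_A" "z \<in> carrier G_A" "k \<in> carrier G_A" using * G_F_carrier Z_A_carrier K_A_carrier by blast+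
  have "z \<star> k \<star> (inv\<^bsub>G_A\<^esub> z \<star> inv\<^bsub>G_A\<^esub> k) = \<one>\<^bsub>G_A\<^esub>"
    using c Z_A_comm[OF *(2) c(3)] by (simp add: G.m_assoc G.inv_mult_group[symmetric])
  then have "g = inv\<^bsub>G_A\<^esub> a \<star> g' \<star> (inv\<^bsub>G_A\<^esub> z \<star> inv\<^bsub>G_A\<^esub> k)"
  proof -
    assume e: "z \<star> k \<star> (inv\<^bsub>G_A\<^esub> z \<star> inv\<^bsub>G_A\<^esub> k) = \<one>\<^bsub>G_A\<^esub>"
    have "inv\<^bsub>G_A\<^esub> a \<star> g' \<star> (inv\<^bsub>G_A\<^esub> z \<star> inv\<^bsub>G_A\<^esub> k)
      = (inv\<^bsub>G_A\<^esub> a \<star> a) \<star> g \<star> (z \<star> k \<star> (inv\<^bsub>G_A\<^esub> z \<star> inv\<^bsub>G_A\<^esub> k))"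
      unfolding *(4) using c g by (simp only: G.m_assoc G.m_closed G.inv_closed)
    then show ?thesis using e c g by simp
  qed
  then show ?thesis by (rule dclassI[OF G_F_inv[OF *(1)] Z_A_inv[OF *(2)] K_A_inv[OF *(3)]])
qed

lemma dclass_trans:
  assumes g: "g \<in> carrier (G_A :: 'k GA monoid)" and 1: "g' \<in> dclass g" and 2: "g'' \<in> dclass g'"
  shows "g'' \<in> dclass g"
proof -
  interpret G: Group.group "G_A :: 'k GA monoid" by (rule G_A_group)
  obtain a z k where *: "a \<in> G_F" "z \<in> Z_A" "k \<in> K_A" "g' = a \<star> g \<star> (z \<star> k)"
    using 1 unfolding dclass_iff by blast
  obtain b w l where **: "b \<in> G_F" "w \<in> Z_A" "l \<in> K_A" "g'' = b \<star> g' \<star> (w \<star> l)"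
    using 2 unfolding dclass_iff by blast
  have c: "a \<in> carrier G_A" "z \<in> carrier G_A" "k \<in> carrier G_A" "b \<in> carrier G_A" "w \<in> carrier G_A" "l \<in> carrier G_A"
    using * ** G_F_carrier Z_A_carrier K_A_carrier by blast+
  have "k \<star> (w \<star> l) = w \<star> (k \<star> l)"
    using Z_A_comm[OF **(2) c(3)] c by (simp add: G.m_assoc[symmetric])
  then have "g'' = (b \<star> a) \<star> g \<star> ((z \<star> w) \<star> (k \<star> l))"
    unfolding *(4) **(4) using c g by (simp add: G.m_assoc)
  then show ?thesis by (rule dclassI[OF G_F_mult[OF **(1) *(1)] Z_A_mult[OF *(2) **(2)] K_A_mult[OF *(3) **(3)]])
qed

definition std :: "nat \<Rightarrow> 'k GA" where "std n = J (standard_family n)"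

lemma std_carrier: "std n \<in> carrier G_A"
  unfolding std_def by (rule J_carrier[OF family_standard])

lemma diag_at_J: "z \<noteq> 0 \<Longrightarrow> diag_at y z = J (diag_family y z)"
proof (rule comp_at_eqI)
  fix y' :: "'k place"
  show "comp_at y' (diag_at y z) = comp_at y' (J (diag_family y z))"
    by (cases "y' = y")
      (simp_all add: diag_at_def at_place_def Let_def comp_at_Mat2 diag_family_def embm_def mone_def emb_local_0 emb_local_1)
qed

lemma c_class_std: "c_class x t_rf n = dclass (std n)"
  unfolding c_class_def std_def standard_family_def by (subst diag_at_J) simp_all

definition adelic_slope :: "'k GA \<Rightarrow> int \<Rightarrow> bool" where
  "adelic_slope g n \<longleftrightarrow> (\<exists>\<gamma> k. family \<gamma> \<and> k \<in> K_A \<and> g = J \<gamma> \<star> k \<and> slope \<gamma> n)"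

lemma adelic_slopeI: "family \<gamma> \<Longrightarrow> slope \<gamma> n \<Longrightarrow> k \<in> K_A \<Longrightarrow> adelic_slope (J \<gamma> \<star> k) n"
  unfolding adelic_slope_def by blast

text \<open>Two rational families representing the same coset of $K$ differ by an integral family, so the slope
does not depend on the representative.\<close>

lemma adelic_slopeD:
  assumes g: "family \<gamma>" and k: "k \<in> K_A" and s: "adelic_slope (J \<gamma> \<star> k) n"
  shows "slope \<gamma> n"
proof -
  interpret G: Group.group "G_A :: 'k GA monoid" by (rule G_A_group)
  obtain \<delta> l where d: "family \<delta>" "l \<in> K_A" "J \<gamma> \<star> k = J \<delta> \<star> l" "slope \<delta> n"
    using s unfolding adelic_slope_def by blast
  have c: "J \<gamma> \<in> carrier G_A" "J \<delta> \<in> carrier G_A" "k \<in> carrier G_A" "l \<in> carrier G_A"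
    using J_carrier g d k K_A_carrier by blast+
  let ?i = "\<lambda>y. minv (\<delta> y)" and ?\<kappa> = "\<lambda>y. mmul (minv (\<delta> y)) (\<gamma> y)"
  have i: "J ?i \<in> carrier G_A" "J ?i \<star> J \<delta> = \<one>\<^bsub>G_A\<^esub>"
    using J_carrier[OF family_minv[OF d(1)]] d(1) by (simp_all add: J_mmul[symmetric] minv_left family_def J_mone)
  have "J \<gamma> = J \<gamma> \<star> k \<star> inv\<^bsub>G_A\<^esub> k" using c by (simp add: G.m_assoc)
  then have "J ?\<kappa> = J ?i \<star> (J \<delta> \<star> l \<star> inv\<^bsub>G_A\<^esub> k)" using d(3) by (simp add: J_mmul)
  also have "\<dots> = (J ?i \<star> J \<delta>) \<star> (l \<star> inv\<^bsub>G_A\<^esub> k)" using c i(1) by (simp add: G.m_assoc del: J_mmul)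
  also have "\<dots> = l \<star> inv\<^bsub>G_A\<^esub> k" using i(2) c by simp
  finally have "J ?\<kappa> \<in> K_A" using K_A_mult[OF d(2) K_A_inv[OF k]] by simp
  then have "gl2_integral y (?\<kappa> y)" for y by (simp add: J_K)
  from slope_right[OF d(1) this d(4)] have "slope (\<lambda>y. mmul (\<delta> y) (?\<kappa> y)) n" .
  moreover have "mmul (\<delta> y) (?\<kappa> y) = \<gamma> y" for y using d(1) by (simp add: mmul_assoc[symmetric] minv_right family_def)
  ultimately show ?thesis by simp
qed

lemma adelic_slope_unique:
  assumes "adelic_slope g n" "adelic_slope g m"
  shows "n = m"
proof -
  obtain \<gamma> k where g: "family \<gamma>" "k \<in> K_A" "g = J \<gamma> \<star> k" "slope \<gamma> n" using assms(1) unfolding adelic_slope_def by blast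
  have "slope \<gamma> m" using adelic_slopeD[OF g(1,2)] assms(2) g(3) by blast
  then show ?thesis using slope_unique g(4) by blast
qed

lemma adelic_slope_right:
  assumes "adelic_slope g n" "l \<in> K_A"
  shows "adelic_slope (g \<star> l) n"
proof -
  interpret G: Group.group "G_A :: 'k GA monoid" by (rule G_A_group)
  obtain \<gamma> k where g: "family \<gamma>" "k \<in> K_A" "g = J \<gamma> \<star> k" "slope \<gamma> n" using assms(1) unfolding adelic_slope_def by blast
  have "g \<star> l = J \<gamma> \<star> (k \<star> l)"
    using g(3) J_carrier[OF g(1)] K_A_carrier[OF g(2)] K_A_carrier[OF assms(2)] by (simp add: G.m_assoc)
  then show ?thesis using adelic_slopeI[OF g(1,4) K_A_mult[OF g(2) assms(2)]] by simp
qed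

lemma adelic_slope_left:
  assumes "adelic_slope g n" "a \<in> G_F"
  shows "adelic_slope (a \<star> g) n"
proof -
  interpret G: Group.group "G_A :: 'k GA monoid" by (rule G_A_group)
  obtain \<gamma> k where g: "family \<gamma>" "k \<in> K_A" "g = J \<gamma> \<star> k" "slope \<gamma> n" using assms(1) unfolding adelic_slope_def by blast
  obtain A where A: "a = J (\<lambda>y. A)" "mdet A \<noteq> 0" using assms(2) unfolding G_F_eq by blast
  have "a \<star> g = J (\<lambda>y. mmul A (\<gamma> y)) \<star> k"
    using g(3) J_carrier[OF g(1)] K_A_carrier[OF g(2)] G_F_carrier[OF assms(2)] by (simp add: J_mmul G.m_assoc A(1))
  then show ?thesis
    using adelic_slopeI[OF family_mmul[OF family_const[OF A(2)] g(1)] slope_left[OF A(2) g(1,4)] g(2)] by simp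
qed

lemma adelic_slope_center:
  assumes "adelic_slope g n" "z \<in> Z_A"
  shows "adelic_slope (z \<star> g) n"
proof -
  interpret G: Group.group "G_A :: 'k GA monoid" by (rule G_A_group)
  obtain \<gamma> k where g: "family \<gamma>" "k \<in> K_A" "g = J \<gamma> \<star> k" "slope \<gamma> n" using assms(1) unfolding adelic_slope_def by blast
  obtain \<zeta> l where \<zeta>: "\<And>y. \<zeta> y \<noteq> 0" "fin (\<lambda>y. ord_at y (\<zeta> y))" and l: "l \<in> K_A" "l \<in> Z_A"
    and zl: "z = J (\<lambda>y. msc (\<zeta> y) mone) \<star> l" using Z_A_approximation[OF assms(2)] by blast
  note f = J_scalar_Z(1)[OF \<zeta>]
  have c: "J \<gamma> \<in> carrier G_A" "J (\<lambda>y. msc (\<zeta> y) mone) \<in> carrier G_A" "k \<in> carrier G_A" "l \<in> carrier G_A"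
    using J_carrier[OF g(1)] J_carrier[OF f] K_A_carrier g(2) l(1) by blast+
  have m: "J (\<lambda>y. msc (\<zeta> y) (\<gamma> y)) = J (\<lambda>y. msc (\<zeta> y) mone) \<star> J \<gamma>"
    by (simp add: J_mmul[symmetric] msc_mmul)
  have "z \<star> g = J (\<lambda>y. msc (\<zeta> y) mone) \<star> (l \<star> J \<gamma>) \<star> k"
    unfolding zl g(3) using c by (simp add: G.m_assoc)
  also have "\<dots> = J (\<lambda>y. msc (\<zeta> y) (\<gamma> y)) \<star> (l \<star> k)"
    unfolding Z_A_comm[OF l(2) c(1)] m using c by (simp add: G.m_assoc)
  finally have e: "z \<star> g = J (\<lambda>y. msc (\<zeta> y) (\<gamma> y)) \<star> (l \<star> k)" .
  have "family (\<lambda>y. msc (\<zeta> y) (\<gamma> y))" using family_mmul[OF f g(1)] by (simp add: msc_mmul)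
  from adelic_slopeI[OF this slope_scalar[OF g(1) \<zeta> g(4)] K_A_mult[OF l(1) g(2)]] show ?thesis unfolding e .
qed

lemma adelic_slope_dclass:
  assumes g: "g \<in> carrier G_A" and s: "adelic_slope g n" and g': "g' \<in> dclass g"
  shows "adelic_slope g' n"
proof -
  interpret G: Group.group "G_A :: 'k GA monoid" by (rule G_A_group)
  obtain a z k where *: "a \<in> G_F" "z \<in> Z_A" "k \<in> K_A" "g' = a \<star> g \<star> (z \<star> k)"
    using g' unfolding dclass_iff by blast
  have c: "a \<in> carrier G_A" "z \<in> carrier G_A" "k \<in> carrier G_A" using * G_F_carrier Z_A_carrier K_A_carrier by blast+
  have "g' = z \<star> (a \<star> g) \<star> k"
    using *(4) Z_A_comm[OF *(2) G.m_closed[OF c(1) g]] c g by (simp add: G.m_assoc)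
  then show ?thesis
    using adelic_slope_right[OF adelic_slope_center[OF adelic_slope_left[OF s *(1)] *(2)] *(3)] by simp
qed

lemma adelic_slope_std: "adelic_slope (std n) (int n)"
proof -
  interpret G: Group.group "G_A :: 'k GA monoid" by (rule G_A_group)
  have "std n = J (standard_family n) \<star> \<one>\<^bsub>G_A\<^esub>" using std_carrier[of n] by (simp add: std_def)
  then show ?thesis using adelic_slopeI[OF family_standard slope_standard one_K_A] by metis
qed

text \<open>Each double coset contains some $c_{nx}$, as every family has a standard form.\<close>

lemma dclass_std_exists:
  assumes g: "g \<in> carrier (G_A :: 'k GA monoid)"
  shows "\<exists>n. g \<in> dclass (std n)"
proof -
  interpret G: Group.group "G_A :: 'k GA monoid" by (rule G_A_group)
  obtain \<gamma> k where gk: "family \<gamma>" "k \<in> K_A" "g = J \<gamma> \<star> k" using adelic_approximation[OF g] by blast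
  have Jc: "J \<gamma> \<in> carrier G_A" by (rule J_carrier[OF gk(1)])
  have 1: "g \<in> dclass (J \<gamma>)"
    by (rule dclassI[OF one_G_F one_Z_A gk(2)]) (use Jc K_A_carrier[OF gk(2)] gk(3) in simp)
  obtain n where "equivF \<gamma> (standard_family n)" using family_standard_form[OF gk(1)] by blast
  then obtain A \<zeta> \<kappa> where e: "mdet A \<noteq> 0" "\<And>y. \<zeta> y \<noteq> 0" "fin (\<lambda>y. ord_at y (\<zeta> y))" "\<And>y. gl2_integral y (\<kappa> y)"
    "\<And>y. standard_family n y = msc (\<zeta> y) (mmul A (mmul (\<gamma> y) (\<kappa> y)))" by (rule equivFE) (rule that)
  let ?z = "J (\<lambda>y. msc (\<zeta> y) mone)"
  have A: "J (\<lambda>y. A) \<in> G_F" unfolding G_F_eq using e(1) by blast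
  have z: "?z \<in> Z_A" by (rule J_scalar_Z(2)[OF e(2,3)])
  have k: "J \<kappa> \<in> K_A" using e(4) by (simp add: J_K)
  note c = G_F_carrier[OF A] Z_A_carrier[OF z] K_A_carrier[OF k] Jc
  have "std n = ?z \<star> (J (\<lambda>y. A) \<star> (J \<gamma> \<star> J \<kappa>))"
    unfolding std_def J_mmul[symmetric] by (rule arg_cong[of _ _ J]) (simp add: e(5) msc_mmul fun_eq_iff)
  also have "\<dots> = (?z \<star> (J (\<lambda>y. A) \<star> J \<gamma>)) \<star> J \<kappa>" using c by (simp add: G.m_assoc)
  also have "\<dots> = J (\<lambda>y. A) \<star> J \<gamma> \<star> (?z \<star> J \<kappa>)"
    unfolding Z_A_comm[OF z G.m_closed[OF c(1,4)]] using c by (simp add: G.m_assoc)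
  finally have 2: "std n \<in> dclass (J \<gamma>)" by (rule dclassI[OF A z k])
  have "J \<gamma> \<in> dclass (std n)" by (rule dclass_sym[OF Jc 2])
  from dclass_trans[OF std_carrier this 1] show ?thesis by (rule exI)
qed

definition index :: "'k GA \<Rightarrow> nat" where
  "index g = (THE n. adelic_slope g (int n))"

lemma index_eqI: "adelic_slope g (int n) \<Longrightarrow> index g = n"
  unfolding index_def using adelic_slope_unique by (intro the_equality) force+

lemma index_dclass: "g \<in> dclass (std n) \<Longrightarrow> index g = n"
  by (rule index_eqI[OF adelic_slope_dclass[OF std_carrier adelic_slope_std]])

lemma index_std [simp]: "index (std n) = n"
  by (rule index_eqI[OF adelic_slope_std])

lemma dclass_index: "g \<in> carrier G_A \<Longrightarrow> g \<in> dclass (std (index g))"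
  using dclass_std_exists index_dclass by blast

lemma adelic_slope_index: "g \<in> carrier G_A \<Longrightarrow> adelic_slope g (int (index g))"
  using adelic_slope_dclass[OF std_carrier adelic_slope_std dclass_index] .

end

section \<open>The Hecke operator as a finite sum\<close>

lemma finite_residues: "\<exists>R. finite R \<and> (\<forall>z\<in>val_ring y. \<exists>r\<in>R. near_zero y 1 (z - r))" for y :: "'k::{field,finite} place"
proof -
  obtain \<tau> P where P: "place_poly y \<tau> P" using generator_in_val_ring place_poly_exists by blast
  let ?R = "ev \<tau> ` {C. Polynomial.degree C < Polynomial.degree P}"
  have "finite ?R" using finite_polys by blast
  moreover have "\<exists>r\<in>?R. near_zero y 1 (z - r)" if "z \<in> val_ring y" for z
    using place_poly_residue[OF P that] by blast
  ultimately show ?thesis by blast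
qed

definition K_coset :: "'k::field GA \<Rightarrow> 'k GA set" where
  "K_coset g = g <#\<^bsub>G_A\<^esub> K_A"

lemma K_coset_iff: "h \<in> K_coset g \<longleftrightarrow> (\<exists>k\<in>K_A. h = g \<star> k)"
  by (auto simp: K_coset_def l_coset_def)

lemma K_coset_eq:
  fixes g :: "'k::field GA"
  assumes g: "g \<in> carrier G_A" and h: "h \<in> K_coset g"
  shows "K_coset h = K_coset g"
proof -
  interpret G: Group.group "G_A :: 'k GA monoid" by (rule G_A_group)
  obtain k where k: "k \<in> K_A" "h = g \<star> k" using h K_coset_iff by blast
  have kc: "k \<in> carrier G_A" by (rule K_A_carrier[OF k(1)])
  have "h \<star> l \<in> K_coset g" if "l \<in> K_A" for l
  proof -
    have "h \<star> l = g \<star> (k \<star> l)" unfolding k(2) using K_A_carrier[OF that] kc g by (simp add: G.m_assoc)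
    then show ?thesis using K_A_mult[OF k(1) that] K_coset_iff by blast
  qed
  moreover have "g \<star> l \<in> K_coset h" if l: "l \<in> K_A" for l
  proof -
    have "g \<star> l = h \<star> (inv\<^bsub>G_A\<^esub> k \<star> l)"
    proof -
      have "h \<star> (inv\<^bsub>G_A\<^esub> k \<star> l) = g \<star> (k \<star> inv\<^bsub>G_A\<^esub> k) \<star> l"
        unfolding k(2) using kc g K_A_carrier[OF l] by (simp only: G.m_assoc G.m_closed G.inv_closed)
      then show ?thesis using kc g by simp
    qed
    then show ?thesis using K_A_mult[OF K_A_inv[OF k(1)] l] K_coset_iff by blast
  qed
  ultimately show ?thesis by (intro equalityI subsetI) (auto simp: K_coset_iff[of _ h] K_coset_iff[of _ g])
qed

definition hecke_cosets :: "'k::field place \<Rightarrow> 'k ratfun \<Rightarrow> 'k GA set set" where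
  "hecke_cosets y p = (\<lambda>k. K_coset (k \<star> diag_at y p)) ` K_A"

definition rep :: "'k GA set \<Rightarrow> 'k GA" where
  "rep C = (SOME h. h \<in> C)"

context rational_place
begin

lemma diag_at_carrier:
  fixes y :: "'k place"
  assumes p: "p \<noteq> 0"
  shows "diag_at y p \<in> carrier G_A"
  unfolding diag_at_J[OF p] by (rule J_carrier[OF family_diag[OF p]])

text \<open>Conjugation by $\mathrm{diag}(\pi_y, 1)$ divides the upper right entry by $\pi_y$ and multiplies the
lower left one.\<close>

lemma conjugate_diag:
  fixes y :: "'k place"
  assumes p: "p \<noteq> 0" "ord_at y p = 1" and m: "m \<in> K_A" "small y 1 (e12 (comp_at y m))"
  shows "\<exists>m'\<in>K_A. m \<star> diag_at y p = diag_at y p \<star> m'"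
proof -
  interpret C: cring "\<F> y'" for y' :: "'k place" by (rule completion_cring)
  obtain a b c d where abcd: "comp_at y m = Mat2 a b c d" by (cases "comp_at y m") auto
  let ?e = "emb_local y p" and ?f = "emb_local y (inverse p)"
  let ?N = "Mat2 a (?f \<otimes>\<^bsub>\<F> y\<^esub> b) (c \<otimes>\<^bsub>\<F> y\<^esub> ?e) d"
  define m' where "m' = adelic_mat (\<lambda>y'. if y' = y then ?N else comp_at y' m)"
  have my: "comp_at y' m \<in> carrier (GL2 (local_integers y'))" for y' using m(1) by (simp add: K_A_iff)
  obtain w where bl: "small y 0 a" "small y 0 b" "small y 0 c" "small y 0 d" "small y 0 w"
    and w: "(a \<otimes>\<^bsub>\<F> y\<^esub> d \<ominus>\<^bsub>\<F> y\<^esub> b \<otimes>\<^bsub>\<F> y\<^esub> c) \<otimes>\<^bsub>\<F> y\<^esub> w = \<one>\<^bsub>\<F> y\<^esub>"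
    using my[of y] by (auto simp: GL2_local_integers_carrier abcd det2_def)
  note cr = small_carrier[OF bl(1)] small_carrier[OF bl(2)] small_carrier[OF bl(3)] small_carrier[OF bl(4)]
  have ef: "?f \<otimes>\<^bsub>\<F> y\<^esub> ?e = \<one>\<^bsub>\<F> y\<^esub>" "?e \<otimes>\<^bsub>\<F> y\<^esub> ?f = \<one>\<^bsub>\<F> y\<^esub>"
    using p(1) by (simp_all add: emb_local_mult[symmetric] emb_local_1)
  have "small y (-1) ?f" using p by (simp add: small_emb near_zero_def ord_at_inverse)
  from small_mult[OF this, of 1 b] have b': "small y 0 (?f \<otimes>\<^bsub>\<F> y\<^esub> b)" using m(2) by (simp add: abcd)
  have "small y 0 ?e" using p by (simp add: small_emb near_zero_def)
  then have c': "small y 0 (c \<otimes>\<^bsub>\<F> y\<^esub> ?e)" by (rule small0_mult[OF bl(3)])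
  have "(?f \<otimes>\<^bsub>\<F> y\<^esub> b) \<otimes>\<^bsub>\<F> y\<^esub> (c \<otimes>\<^bsub>\<F> y\<^esub> ?e) = (?f \<otimes>\<^bsub>\<F> y\<^esub> ?e) \<otimes>\<^bsub>\<F> y\<^esub> (b \<otimes>\<^bsub>\<F> y\<^esub> c)"
    using cr by (simp add: C.m_ac)
  then have "det2 (\<F> y) ?N = a \<otimes>\<^bsub>\<F> y\<^esub> d \<ominus>\<^bsub>\<F> y\<^esub> b \<otimes>\<^bsub>\<F> y\<^esub> c"
    using ef cr by (simp add: det2_def)
  then have "?N \<in> carrier (GL2 (local_integers y))"
    using w bl b' c' by (auto simp: GL2_local_integers_carrier)
  then have mK: "m' \<in> K_A" using my by (simp add: K_A_iff m'_def)
  have "m \<star> diag_at y p = diag_at y p \<star> m'"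
  proof (rule comp_at_eqI)
    fix y' :: "'k place"
    interpret G: Group.group "GL2 (\<F> y')" by (rule C.GL2_group)
    show "comp_at y' (m \<star> diag_at y p) = comp_at y' (diag_at y p \<star> m')"
    proof (cases "y' = y")
      case True
      have "b = ?e \<otimes>\<^bsub>\<F> y\<^esub> (?f \<otimes>\<^bsub>\<F> y\<^esub> b)" using ef cr by (simp add: C.m_assoc[symmetric])
      then show ?thesis using True p(1) cr
        by (simp add: comp_at_mult diag_at_J diag_family_def m'_def abcd embm_def GL2_mult emb_local_0 emb_local_1 C.m_comm)
    next
      case False
      then show ?thesis using p(1) GL2_local_integers_subset[OF my[of y']]
        by (simp add: comp_at_mult diag_at_J diag_family_def m'_def embm_mone)
    qed
  qed
  then show ?thesis using mK by blast
qed

lemma coset_eq: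
  fixes y :: "'k place"
  assumes p: "p \<noteq> 0" "ord_at y p = 1" and k: "k \<in> K_A" "k' \<in> K_A"
    and b: "small y 1 (e12 (comp_at y (inv\<^bsub>G_A\<^esub> k \<star> k')))"
  shows "K_coset (k \<star> diag_at y p) = K_coset (k' \<star> diag_at y p)"
proof -
  interpret G: Group.group "G_A :: 'k GA monoid" by (rule G_A_group)
  let ?m = "inv\<^bsub>G_A\<^esub> k \<star> k'" and ?P = "diag_at y p"
  have m: "?m \<in> K_A" by (rule K_A_mult[OF K_A_inv[OF k(1)] k(2)])
  obtain m' where m': "m' \<in> K_A" "?m \<star> ?P = ?P \<star> m'" using conjugate_diag[OF p m b] by blast
  note c = K_A_carrier[OF k(1)] K_A_carrier[OF k(2)] diag_at_carrier[OF p(1), of y] K_A_carrier[OF m'(1)] K_A_carrier[OF m]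
  have "k' \<star> ?P = k \<star> (?m \<star> ?P)" using c by (simp add: G.m_assoc[symmetric])
  also have "\<dots> = (k \<star> ?P) \<star> m'" unfolding m'(2) using c by (simp add: G.m_assoc)
  finally have "k' \<star> ?P \<in> K_coset (k \<star> ?P)" using m'(1) K_coset_iff by blast
  then show ?thesis using K_coset_eq[of "k \<star> ?P"] c by simp
qed

lemma e12_quotient:
  fixes y :: "'k place"
  assumes k: "k \<in> (K_A :: 'k GA set)" "k' \<in> K_A"
    and b: "small y 1 (e12 (comp_at y k) \<ominus>\<^bsub>\<F> y\<^esub> e12 (comp_at y k'))"
    and d: "small y 1 (e22 (comp_at y k) \<ominus>\<^bsub>\<F> y\<^esub> e22 (comp_at y k'))"
  shows "small y 1 (e12 (comp_at y (inv\<^bsub>G_A\<^esub> k \<star> k')))"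
proof -
  interpret G: Group.group "G_A :: 'k GA monoid" by (rule G_A_group)
  interpret C: cring "\<F> y" by (rule completion_cring)
  interpret L: Group.group "GL2 (\<F> y)" by (rule C.GL2_group)
  obtain p q r s where m: "comp_at y k = Mat2 p q r s" by (cases "comp_at y k") auto
  obtain p' q' r' s' where m': "comp_at y k' = Mat2 p' q' r' s'" by (cases "comp_at y k'") auto
  have i: "comp_at y k \<in> carrier (GL2 (local_integers y))" "comp_at y k' \<in> carrier (GL2 (local_integers y))"
    using k by (simp_all add: K_A_iff)
  obtain w where w: "small y 0 w" "det2 (\<F> y) (comp_at y k) \<otimes>\<^bsub>\<F> y\<^esub> w = \<one>\<^bsub>\<F> y\<^esub>"
    and bl: "small y 0 q" "small y 0 s" using i(1) by (auto simp: GL2_local_integers_carrier m)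
  have bl': "small y 0 q'" "small y 0 s'" using i(2) by (auto simp: GL2_local_integers_carrier m')
  note cr = small_carrier[OF w(1)] small_carrier[OF bl(1)] small_carrier[OF bl(2)] small_carrier[OF bl'(1)] small_carrier[OF bl'(2)]
  let ?A = "GL2_adj (\<F> y) w (comp_at y k)"
  note kc = GL2_local_integers_subset[OF i(1)]
  have A: "?A \<in> carrier (GL2 (\<F> y))" "?A \<otimes>\<^bsub>GL2 (\<F> y)\<^esub> comp_at y k = \<one>\<^bsub>GL2 (\<F> y)\<^esub>"
    using C.GL2_adj[OF kc cr(1) w(2)] by blast+
  have ik: "comp_at y (inv\<^bsub>G_A\<^esub> k) \<in> carrier (GL2 (\<F> y))" using K_A_inv[OF k(1)] K_A_subset by (auto simp: G_A_iff)
  have "comp_at y (inv\<^bsub>G_A\<^esub> k) \<otimes>\<^bsub>GL2 (\<F> y)\<^esub> comp_at y k = \<one>\<^bsub>GL2 (\<F> y)\<^esub>"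
    using K_A_carrier[OF k(1)] by (simp add: comp_at_mult[symmetric] comp_at_one)
  then have "comp_at y (inv\<^bsub>G_A\<^esub> k) = ?A" using A ik kc L.inv_equality by metis
  then have "e12 (comp_at y (inv\<^bsub>G_A\<^esub> k \<star> k')) = w \<otimes>\<^bsub>\<F> y\<^esub> s \<otimes>\<^bsub>\<F> y\<^esub> q' \<oplus>\<^bsub>\<F> y\<^esub> (\<ominus>\<^bsub>\<F> y\<^esub> (w \<otimes>\<^bsub>\<F> y\<^esub> q)) \<otimes>\<^bsub>\<F> y\<^esub> s'"
    by (simp add: comp_at_mult m m' GL2_adj_def GL2_mult)
  also have "\<dots> = w \<otimes>\<^bsub>\<F> y\<^esub> (q \<otimes>\<^bsub>\<F> y\<^esub> (s \<ominus>\<^bsub>\<F> y\<^esub> s') \<ominus>\<^bsub>\<F> y\<^esub> s \<otimes>\<^bsub>\<F> y\<^esub> (q \<ominus>\<^bsub>\<F> y\<^esub> q'))"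
    using cr by algebra
  finally have e: "e12 (comp_at y (inv\<^bsub>G_A\<^esub> k \<star> k')) = \<dots>" .
  have "small y (0 + (0 + 1)) (w \<otimes>\<^bsub>\<F> y\<^esub> (q \<otimes>\<^bsub>\<F> y\<^esub> (s \<ominus>\<^bsub>\<F> y\<^esub> s') \<ominus>\<^bsub>\<F> y\<^esub> s \<otimes>\<^bsub>\<F> y\<^esub> (q \<ominus>\<^bsub>\<F> y\<^esub> q')))"
  proof -
    have "small y 1 (q \<ominus>\<^bsub>\<F> y\<^esub> q')" "small y 1 (s \<ominus>\<^bsub>\<F> y\<^esub> s')" using b d by (simp_all add: m m')
    then show ?thesis using small_mult[OF w(1) small_diff[OF small_mult[OF bl(1)] small_mult[OF bl(2)]]] by blast
  qed
  then show ?thesis unfolding e by simp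
qed

text \<open>The coset of $k\,\mathrm{diag}(\pi_y,1)$ depends only on the second column of $k_y$ modulo
$\pi_y$.\<close>

lemma finite_hecke_cosets:
  fixes y :: "'k place"
  assumes p: "p \<noteq> 0" "ord_at y p = 1"
  shows "finite (hecke_cosets y p)"
proof -
  obtain R where R: "finite R" "\<And>z. z \<in> val_ring y \<Longrightarrow> \<exists>r\<in>R. near_zero y 1 (z - r)"
    using finite_residues[of y] by blast
  have approx: "\<exists>r\<in>R. small y 1 (a \<ominus>\<^bsub>\<F> y\<^esub> emb_local y r)" if a: "small y 0 a" for a
  proof -
    interpret C: cring "\<F> y" by (rule completion_cring)
    note ac = small_carrier[OF a]
    obtain z where z: "small y 1 (a \<ominus>\<^bsub>\<F> y\<^esub> emb_local y z)" using small_approx[OF ac] by blast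
    have zc: "emb_local y z \<in> carrier (\<F> y)" by simp
    have "emb_local y z = a \<ominus>\<^bsub>\<F> y\<^esub> (a \<ominus>\<^bsub>\<F> y\<^esub> emb_local y z)" using ac zc by algebra
    then have "small y 0 (emb_local y z)" using small_diff[OF a small_mono[OF z]] by simp
    then obtain r where r: "r \<in> R" "near_zero y 1 (z - r)" using R(2) by (auto simp: small_emb near_zero_val_ring)
    have rc: "emb_local y r \<in> carrier (\<F> y)" by simp
    have "a \<ominus>\<^bsub>\<F> y\<^esub> emb_local y r = (a \<ominus>\<^bsub>\<F> y\<^esub> emb_local y z) \<oplus>\<^bsub>\<F> y\<^esub> (emb_local y z \<ominus>\<^bsub>\<F> y\<^esub> emb_local y r)"
      using ac zc rc by algebra
    moreover have "small y 1 (emb_local y z \<ominus>\<^bsub>\<F> y\<^esub> emb_local y r)" using r(2) by (simp add: emb_local_diff[symmetric] small_emb)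
    ultimately have "small y 1 (a \<ominus>\<^bsub>\<F> y\<^esub> emb_local y r)" using small_add[OF z] by simp
    then show ?thesis using r(1) by blast
  qed
  let ?near = "\<lambda>k r. small y 1 (e12 (comp_at y k) \<ominus>\<^bsub>\<F> y\<^esub> emb_local y (fst r)) \<and>
     small y 1 (e22 (comp_at y k) \<ominus>\<^bsub>\<F> y\<^esub> emb_local y (snd r))"
  let ?Q = "\<lambda>k. K_coset (k \<star> diag_at y p)"
  let ?h = "\<lambda>r. ?Q (SOME k. k \<in> K_A \<and> ?near k r)"
  have "hecke_cosets y p \<subseteq> ?h ` (R \<times> R)"
  proof
    fix C assume "C \<in> hecke_cosets y p"
    then obtain k where k: "k \<in> K_A" "C = ?Q k" by (auto simp: hecke_cosets_def)
    have i: "comp_at y k \<in> carrier (GL2 (local_integers y))" using k(1) by (simp add: K_A_iff)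
    then have "small y 0 (e12 (comp_at y k))" "small y 0 (e22 (comp_at y k))" by (auto simp: GL2_local_integers_carrier)
    from approx[OF this(1)] approx[OF this(2)]
    obtain r1 r2 where r: "r1 \<in> R" "r2 \<in> R" "?near k (r1, r2)" by auto
    define k' where "k' = (SOME k. k \<in> K_A \<and> ?near k (r1, r2))"
    have k': "k' \<in> K_A \<and> ?near k' (r1, r2)" unfolding k'_def by (rule someI[of _ k]) (use k r in blast)
    interpret C: cring "\<F> y" by (rule completion_cring)
    have cl: "e12 (comp_at y k) \<in> carrier (\<F> y)" "e22 (comp_at y k) \<in> carrier (\<F> y)"
      "e12 (comp_at y k') \<in> carrier (\<F> y)" "e22 (comp_at y k') \<in> carrier (\<F> y)"
      using k(1) k' K_A_carrier by (auto simp: G_A_iff GL2_completion_carrier)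
    have sub: "small y 1 (a \<ominus>\<^bsub>\<F> y\<^esub> b)" if "a \<in> carrier (\<F> y)" "b \<in> carrier (\<F> y)"
      "small y 1 (a \<ominus>\<^bsub>\<F> y\<^esub> emb_local y r)" "small y 1 (b \<ominus>\<^bsub>\<F> y\<^esub> emb_local y r)" for a b r
    proof -
      have rc: "emb_local y r \<in> carrier (\<F> y)" by simp
      have "a \<ominus>\<^bsub>\<F> y\<^esub> b = (a \<ominus>\<^bsub>\<F> y\<^esub> emb_local y r) \<ominus>\<^bsub>\<F> y\<^esub> (b \<ominus>\<^bsub>\<F> y\<^esub> emb_local y r)"
        using that(1,2) rc by algebra
      then show ?thesis using small_diff[OF that(3,4)] by simp
    qed
    have "?Q k = ?Q k'"
      using r(3) k' by (intro coset_eq[OF p] e12_quotient sub[OF cl(1,3)] sub[OF cl(2,4)] k(1)) auto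
    then show "C \<in> ?h ` (R \<times> R)" using k(2) r(1,2) unfolding k'_def by blast
  qed
  then show ?thesis by (rule finite_subset) (use R(1) in blast)
qed

lemma hecke_cosets_union:
  fixes y :: "'k place"
  assumes p: "p \<noteq> 0"
  shows "K_A <#>\<^bsub>G_A\<^esub> (diag_at y p <#\<^bsub>G_A\<^esub> K_A) = \<Union> (hecke_cosets y p)"
proof -
  interpret G: Group.group "G_A :: 'k GA monoid" by (rule G_A_group)
  have "k \<star> (diag_at y p \<star> l) = (k \<star> diag_at y p) \<star> l" if "k \<in> K_A" "l \<in> K_A" for k l
    using K_A_carrier[OF that(1)] K_A_carrier[OF that(2)] diag_at_carrier[OF p, of y] by (simp add: G.m_assoc)
  then show ?thesis
    by (auto simp: set_mult_def l_coset_def hecke_cosets_def K_coset_iff Bex_def) metis+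
qed

lemma hecke_coset_rep:
  fixes y :: "'k place"
  assumes p: "p \<noteq> 0" and C: "C \<in> hecke_cosets y p"
  shows "rep C \<in> C" "h \<in> C \<Longrightarrow> h \<in> carrier G_A" "h \<in> C \<Longrightarrow> K_coset h = C"
    "h \<in> C \<Longrightarrow> \<exists>k\<in>K_A. h = rep C \<star> k"
proof -
  interpret G: Group.group "G_A :: 'k GA monoid" by (rule G_A_group)
  obtain k where k: "k \<in> K_A" "C = K_coset (k \<star> diag_at y p)" using C by (auto simp: hecke_cosets_def)
  have kP: "k \<star> diag_at y p \<in> carrier G_A" using K_A_carrier[OF k(1)] diag_at_carrier[OF p] by simp
  have c: "\<And>h. h \<in> C \<Longrightarrow> h \<in> carrier G_A" unfolding k(2) K_coset_iff using kP K_A_carrier by auto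
  have e: "\<And>h. h \<in> C \<Longrightarrow> K_coset h = C" unfolding k(2) by (rule K_coset_eq[OF kP])
  have "k \<star> diag_at y p \<star> \<one>\<^bsub>G_A\<^esub> \<in> C" unfolding k(2) K_coset_iff using one_K_A by blast
  then show r: "rep C \<in> C" unfolding rep_def by (rule someI)
  show "h \<in> C \<Longrightarrow> h \<in> carrier G_A" "h \<in> C \<Longrightarrow> K_coset h = C" using c e by blast+
  show "h \<in> C \<Longrightarrow> \<exists>k\<in>K_A. h = rep C \<star> k" using e[OF r] K_coset_iff by blast
qed

text \<open>The function $h \mapsto f(gh)$ is constant on each coset $hK$. Left invariance of the measure gives
all cosets the volume of $K$.\<close>

lemma hecke_operator_sum:
  fixes y :: "'k place"
  assumes p: "p \<noteq> 0" "ord_at y p = 1"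
    and \<mu>: "haar_measure G_A (GL2_topology adele_ring adele_topology) \<mu>" "emeasure \<mu> K_A = 1"
    and f: "\<And>k g. k \<in> K_A \<Longrightarrow> g \<in> carrier G_A \<Longrightarrow> f (g \<star> k) = f g"
    and g: "g \<in> carrier G_A"
  shows "hecke_operator \<mu> y p f g = (\<Sum>C\<in>hecke_cosets y p. f (g \<star> rep C))"
proof -
  interpret G: Group.group "G_A :: 'k GA monoid" by (rule G_A_group)
  let ?Q = "hecke_cosets y p"
  have fin: "finite ?Q" by (rule finite_hecke_cosets[OF p])
  \<comment> \<open>nonmeasurable sets are assigned measure 0\<close>
  have K: "K_A \<in> sets \<mu>" using \<mu>(2) emeasure_notin_sets[of K_A \<mu>] by auto
  have C: "C \<in> sets \<mu> \<and> emeasure \<mu> C = 1" if C: "C \<in> ?Q" for C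
  proof -
    obtain k where k: "k \<in> K_A" "C = K_coset (k \<star> diag_at y p)" using C by (auto simp: hecke_cosets_def)
    have "k \<star> diag_at y p \<in> carrier G_A" using K_A_carrier[OF k(1)] diag_at_carrier[OF p(1)] by simp
    then have e: "emeasure \<mu> C = 1" using \<mu> K unfolding haar_measure_def k(2) K_coset_def by simp
    then show ?thesis using emeasure_notin_sets[of C \<mu>] by auto
  qed
  have pt: "indicator (\<Union>?Q) h * f (g \<star> h) = (\<Sum>C\<in>?Q. indicator C h *\<^sub>R f (g \<star> rep C))" for h
  proof (cases "h \<in> \<Union>?Q")
    case True
    then obtain D where D: "D \<in> ?Q" "h \<in> D" by blast
    have "indicator C h *\<^sub>R f (g \<star> rep C) = (if C = D then f (g \<star> rep D) else 0)" if "C \<in> ?Q" for C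
    proof (cases "h \<in> C")
      case True
      then have "C = D" using hecke_coset_rep(3)[OF p(1)] that D by metis
      then show ?thesis using True by simp
    next
      case False
      then show ?thesis using D by auto
    qed
    then have "(\<Sum>C\<in>?Q. indicator C h *\<^sub>R f (g \<star> rep C)) = (\<Sum>C\<in>?Q. if C = D then f (g \<star> rep D) else 0)"
      by (rule sum.cong[OF refl])
    also have "\<dots> = f (g \<star> rep D)" using fin D(1) by simp
    also have "\<dots> = f (g \<star> h)"
    proof -
      obtain k where k: "k \<in> K_A" "h = rep D \<star> k" using hecke_coset_rep(4)[OF p(1) D] by blast
      have r: "rep D \<in> carrier G_A" using hecke_coset_rep(1,2)[OF p(1) D(1)] by blast
      have "g \<star> h = (g \<star> rep D) \<star> k" using k r g K_A_carrier[OF k(1)] by (simp add: G.m_assoc)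
      then show ?thesis using f[OF k(1)] g r by simp
    qed
    finally show ?thesis using True by simp
  next
    case False
    then have "indicator C h *\<^sub>R f (g \<star> rep C) = 0" if "C \<in> ?Q" for C using that by auto
    then show ?thesis using False by simp
  qed
  have "has_bochner_integral \<mu> (\<lambda>h. \<Sum>C\<in>?Q. indicator C h *\<^sub>R f (g \<star> rep C))
     (\<Sum>C\<in>?Q. measure \<mu> C *\<^sub>R f (g \<star> rep C))"
    by (intro has_bochner_integral_sum has_bochner_integral_indicator) (use C in auto)
  moreover have "measure \<mu> C = 1" if "C \<in> ?Q" for C using C[OF that] by (simp add: measure_def)
  ultimately have "(LINT h|\<mu>. indicator (\<Union>?Q) h * f (g \<star> h)) = (\<Sum>C\<in>?Q. f (g \<star> rep C))"
    unfolding pt by (simp add: has_bochner_integral_integral_eq)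
  then show ?thesis using g by (simp add: hecke_operator_def hecke_cosets_union[OF p(1)])
qed

text \<open>Write $g$ as a rational family times $k_0 \in K$ and let $k\,\mathrm{diag}(\pi_y,1)K$ be the coset.
Approximating $k_0k$ by a rational family moves the remaining factor past the diagonal matrix into
$K$, which leaves a statement about families.\<close>

lemma index_coset_le:
  fixes y :: "'k place"
  assumes p: "p \<noteq> 0" "ord_at y p = 1" and g: "g \<in> carrier G_A" and C: "C \<in> hecke_cosets y p"
  shows "index (g \<star> rep C) \<le> index g + deg_at y"
proof -
  interpret G: Group.group "G_A :: 'k GA monoid" by (rule G_A_group)
  let ?P = "diag_at y p"
  obtain k where k: "k \<in> K_A" "C = K_coset (k \<star> ?P)" using C by (auto simp: hecke_cosets_def)
  obtain l where l: "l \<in> K_A" "rep C = k \<star> ?P \<star> l"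
    using hecke_coset_rep(1)[OF p(1) C] unfolding k(2) K_coset_iff by blast
  obtain \<gamma> k0 where g0: "family \<gamma>" "k0 \<in> K_A" "g = J \<gamma> \<star> k0" "slope \<gamma> (int (index g))"
    using adelic_slope_index[OF g] unfolding adelic_slope_def by blast
  have k0k: "k0 \<star> k \<in> K_A" by (rule K_A_mult[OF g0(2) k(1)])
  obtain \<kappa> k1 where a: "family \<kappa>" "k1 \<in> K_A" "k0 \<star> k = J \<kappa> \<star> k1" "small y 1 (e12 (comp_at y k1))"
    using adelic_approximation[OF K_A_carrier[OF k0k]] by blast
  obtain k2 where k2: "k2 \<in> K_A" "k1 \<star> ?P = ?P \<star> k2" using conjugate_diag[OF p a(2,4)] by blast
  have c: "J \<gamma> \<in> carrier G_A" "J \<kappa> \<in> carrier G_A" "?P \<in> carrier G_A" "k \<in> carrier G_A" "k0 \<in> carrier G_A"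
    "k1 \<in> carrier G_A" "k2 \<in> carrier G_A" "l \<in> carrier G_A"
    using J_carrier g0(1,2) a(1,2) diag_at_carrier[OF p(1)] K_A_carrier k(1) k2(1) l(1) by blast+
  have "J \<kappa> = k0 \<star> k \<star> inv\<^bsub>G_A\<^esub> k1" unfolding a(3) using c by (simp add: G.m_assoc)
  then have "J \<kappa> \<in> K_A" using K_A_mult[OF k0k K_A_inv[OF a(2)]] by simp
  then have \<kappa>: "gl2_integral y' (\<kappa> y')" for y' by (simp add: J_K)
  let ?\<delta> = "\<lambda>y'. mmul (\<gamma> y') (\<kappa> y')"
  let ?\<epsilon> = "\<lambda>y'. mmul (?\<delta> y') (diag_family y p y')"
  have \<delta>: "family ?\<delta>" "slope ?\<delta> (int (index g))" using family_mmul[OF g0(1) a(1)] slope_right[OF g0(1) \<kappa> g0(4)] by blast+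
  have \<epsilon>: "family ?\<epsilon>" by (rule family_mmul[OF \<delta>(1) family_diag[OF p(1)]])
  have "g \<star> rep C = J \<gamma> \<star> (k0 \<star> k) \<star> ?P \<star> l"
    unfolding g0(3) l(2) using c by (simp add: G.m_assoc)
  also have "\<dots> = J \<gamma> \<star> J \<kappa> \<star> (k1 \<star> ?P) \<star> l" unfolding a(3) using c by (simp add: G.m_assoc)
  also have "\<dots> = (J \<gamma> \<star> J \<kappa> \<star> ?P) \<star> (k2 \<star> l)" unfolding k2(2) using c by (simp add: G.m_assoc)
  also have "J \<gamma> \<star> J \<kappa> \<star> ?P = J ?\<epsilon>" by (simp add: J_mmul diag_at_J[OF p(1)])
  finally have e: "g \<star> rep C = J ?\<epsilon> \<star> (k2 \<star> l)" .
  have "g \<star> rep C \<in> carrier G_A" using g hecke_coset_rep(1,2)[OF p(1) C] by simp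
  from adelic_slope_index[OF this] have "slope ?\<epsilon> (int (index (g \<star> rep C)))"
    using adelic_slopeD[OF \<epsilon> K_A_mult[OF k2(1) l(1)]] e by simp
  from slope_hecke_le[OF p \<delta> this] show ?thesis by linarith
qed

text \<open>Conjugation by the permutation matrix, which lies in $K$, turns $\mathrm{diag}(\pi_y,1)$ into
$\mathrm{diag}(1,\pi_y)$.\<close>

lemma index_coset_ge:
  fixes y :: "'k place"
  assumes p: "p \<noteq> 0" "ord_at y p = 1"
  shows "\<exists>C\<in>hecke_cosets y p. \<forall>n. n + deg_at y \<le> index (std n \<star> rep C)"
proof -
  interpret G: Group.group "G_A :: 'k GA monoid" by (rule G_A_group)
  let ?P = "diag_at y p"
  let ?W = "J (\<lambda>y. mswap) :: 'k GA" and ?q = "\<lambda>y'. if y' = y then Mat2 1 0 0 p else mone"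
  have W: "?W \<in> K_A" by (simp add: J_K gl2_integral_mswap)
  let ?C = "K_coset (?W \<star> ?P)"
  have C: "?C \<in> hecke_cosets y p" using W by (auto simp: hecke_cosets_def)
  obtain l where l: "l \<in> K_A" "rep ?C = ?W \<star> ?P \<star> l"
    using hecke_coset_rep(1)[OF p(1) C] unfolding K_coset_iff by blast
  note c = K_A_carrier[OF W] diag_at_carrier[OF p(1), of y] K_A_carrier[OF l(1)]
  have WW: "?W \<star> ?W = \<one>\<^bsub>G_A\<^esub>"
    unfolding J_mmul[symmetric] J_mone[symmetric] by (rule arg_cong[of _ _ J]) (simp add: mmul_def mswap_def mone_def)
  have q: "?W \<star> ?P \<star> ?W = J ?q"
    unfolding diag_at_J[OF p(1)] J_mmul[symmetric] by (rule arg_cong[of _ _ J]) (auto simp: fun_eq_iff diag_family_def mmul_def mswap_def mone_def)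
  have "rep ?C = ?W \<star> ?P \<star> (?W \<star> ?W) \<star> l" using WW l(2) c by simp
  also have "\<dots> = J ?q \<star> (?W \<star> l)" unfolding q[symmetric] using c by (simp add: G.m_assoc)
  finally have r: "rep ?C = J ?q \<star> (?W \<star> l)" .
  have fq: "family ?q" by (rule family_local[of y]) (use p in \<open>simp_all add: mdet_def\<close>)
  have "n + deg_at y \<le> index (std n \<star> rep ?C)" for n
  proof -
    let ?\<epsilon> = "\<lambda>y'. mmul (standard_family n y') (?q y')"
    have \<epsilon>: "family ?\<epsilon>" by (rule family_mmul[OF family_standard fq])
    have e: "std n \<star> rep ?C = J ?\<epsilon> \<star> (?W \<star> l)"
      unfolding r std_def using J_carrier[OF family_standard, of n] J_carrier[OF fq] c by (simp only: J_mmul G.m_assoc G.m_closed)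
    have "std n \<star> rep ?C \<in> carrier G_A" using std_carrier hecke_coset_rep(1,2)[OF p(1) C] by simp
    from adelic_slope_index[OF this] have "slope ?\<epsilon> (int (index (std n \<star> rep ?C)))"
      using adelic_slopeD[OF \<epsilon> K_A_mult[OF W l(1)]] e by simp
    from slope_hecke_ge[OF p this] show ?thesis by linarith
  qed
  then show ?thesis using C by blast
qed

end

section \<open>Heights bound slopes\<close>

lemma power_int_le_cancel: "1 < (Q :: real) \<Longrightarrow> Q powi a \<le> Q powi b \<Longrightarrow> a \<le> b"
  using power_int_strict_increasing[of b a Q] by force

lemma prod_power_int: "(q :: real) \<noteq> 0 \<Longrightarrow> (\<Prod>y\<in>S. q powi f y) = q powi (\<Sum>y\<in>S. f y)"
  by (induction S rule: infinite_finite_induct) (simp_all add: power_int_add)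

lemma abs_local_le_small:
  fixes y :: "'k::{field,finite} place"
  assumes a: "a \<in> carrier (\<F> y)" and Q: "1 < real CARD('k) ^ place_degree y"
    and le: "abs_local y a \<le> (real CARD('k) ^ place_degree y) powi h"
  shows "small y (- h) a"
proof (cases "a = \<zero>\<^bsub>\<F> y\<^esub>")
  case False
  then have "(real CARD('k) ^ place_degree y) powi (- ord_local y a) \<le> (real CARD('k) ^ place_degree y) powi h"
    using le by (simp add: abs_local_def)
  then have "- ord_local y a \<le> h" by (rule power_int_le_cancel[OF Q])
  then show ?thesis using small_ord_local[OF a False] by simp
qed simp

text \<open>The local height is the value of one of the five quantities, hence an integral power of
$q^{\deg y}$. For an integral matrix it is 1, since the determinant is then a unit.\<close>

lemma local_height_form:
  fixes y :: "'k::{field,finite} place"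
  assumes m: "m \<in> carrier (GL2 (\<F> y))" and Q: "1 < real CARD('k) ^ place_degree y"
  shows "\<exists>h w. local_height y m = (real CARD('k) ^ place_degree y) powi h \<and>
     small y (- h) (e11 m) \<and> small y (- h) (e12 m) \<and> small y (- h) (e21 m) \<and> small y (- h) (e22 m) \<and> small y (- h) w \<and>
     det2 (\<F> y) m \<otimes>\<^bsub>\<F> y\<^esub> w = \<one>\<^bsub>\<F> y\<^esub> \<and>
     (m \<in> carrier (GL2 (local_integers y)) \<longrightarrow> h = 0)"
proof -
  interpret C: cring "\<F> y" by (rule completion_cring)
  let ?Q = "real CARD('k) ^ place_degree y"
  let ?D = "det2 (\<F> y) m"
  let ?w = "inv\<^bsub>\<F> y\<^esub> ?D"
  let ?S = "{e11 m, e12 m, e21 m, e22 m, ?w}"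
  have U: "?D \<in> Units (\<F> y)" using m by (simp add: GL2_carrier)
  have wc: "?w \<in> carrier (\<F> y)" and Dw: "?D \<otimes>\<^bsub>\<F> y\<^esub> ?w = \<one>\<^bsub>\<F> y\<^esub>" using U by simp_all
  have Dc: "?D \<in> carrier (\<F> y)" using U by blast
  have Sc: "?S \<subseteq> carrier (\<F> y)" using m wc by (simp add: GL2_carrier)
  have w0: "?w \<noteq> \<zero>\<^bsub>\<F> y\<^esub>"
  proof
    assume "?w = \<zero>\<^bsub>\<F> y\<^esub>"
    then have "\<one>\<^bsub>\<F> y\<^esub> = \<zero>\<^bsub>\<F> y\<^esub>" using Dw Dc by simp
    then show False using small_one[of y 1] by simp
  qed
  have pos: "0 < ?Q powi n" for n using Q by simp
  have lh: "local_height y m = Max (abs_local y ` ?S)" by (simp add: local_height_def)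
  have "local_height y m \<in> abs_local y ` ?S" unfolding lh by (rule Max_in) auto
  then obtain a where a: "a \<in> ?S" "local_height y m = abs_local y a" by blast
  have ge: "abs_local y b \<le> local_height y m" if "b \<in> ?S" for b
    unfolding lh by (rule Max_ge) (use that in auto)
  have "0 < abs_local y ?w" using w0 pos by (simp add: abs_local_def)
  then have "abs_local y a \<noteq> 0" using ge[of ?w] a(2) by auto
  then have "a \<noteq> \<zero>\<^bsub>\<F> y\<^esub>" by (auto simp: abs_local_def)
  then have h: "local_height y m = ?Q powi (- ord_local y a)" using a(2) by (simp add: abs_local_def)
  have bl: "small y (- (- ord_local y a)) b" if "b \<in> ?S" for b
    by (rule abs_local_le_small[OF subsetD[OF Sc that] Q]) (use ge[OF that] h in simp)
  have z: "- ord_local y a = 0" if i: "m \<in> carrier (GL2 (local_integers y))"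
  proof -
    obtain v where v: "small y 0 v" "?D \<otimes>\<^bsub>\<F> y\<^esub> v = \<one>\<^bsub>\<F> y\<^esub>"
      and e: "small y 0 (e11 m)" "small y 0 (e12 m)" "small y 0 (e21 m)" "small y 0 (e22 m)"
      using i unfolding GL2_local_integers_carrier by blast
    have "v = ?w" using v(2) Dw C.inv_unique'[of ?D v] C.m_comm[of ?D v] small_carrier[OF v(1)] Dc by simp
    then have w: "small y 0 ?w" using v(1) by simp
    then have all: "small y 0 b" if "b \<in> ?S" for b using e that by auto
    have "\<not> small y 1 ?w"
    proof
      assume "small y 1 ?w"
      moreover have "small y 0 ?D" using e by (simp add: det2_def small_diff small0_mult)
      ultimately have "small y (0 + 1) (?D \<otimes>\<^bsub>\<F> y\<^esub> ?w)" by (rule small_mult[rotated])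
      then show False using Dw by (simp add: small_one)
    qed
    then have "ord_local y ?w = 0" using w small_ord_local[OF wc w0] by fastforce
    then have "abs_local y ?w = 1" using w0 by (simp add: abs_local_def)
    then have "?Q powi 0 \<le> ?Q powi (- ord_local y a)" using ge[of ?w] h by simp
    then have "0 \<le> - ord_local y a" by (rule power_int_le_cancel[OF Q])
    moreover have "0 \<le> ord_local y a" using all[OF a(1)] small_ord_local[OF subsetD[OF Sc a(1)] \<open>a \<noteq> \<zero>\<^bsub>\<F> y\<^esub>\<close>] by simp
    ultimately show ?thesis by simp
  qed
  show ?thesis using h bl z Dw by (intro exI[of _ "- ord_local y a"] exI[of _ ?w]) auto
qed

context rational_place
begin

lemma card_k: "1 < real CARD('k)"
  using card_mono[of "UNIV :: 'k set" "{0, 1}"] by simp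

text \<open>The logarithm of the height is the degree of the divisor of local exponents.\<close>

lemma slope_height_bound:
  assumes g: "g \<in> carrier (G_A :: 'k GA monoid)" and s: "adelic_slope g n"
  shows "\<exists>r. height g = real CARD('k) powi r \<and> n \<le> 3 * r"
proof -
  interpret G: Group.group "G_A :: 'k GA monoid" by (rule G_A_group)
  let ?q = "real CARD('k)"
  have Q: "1 < ?q ^ place_degree y" for y :: "'k place"
    using card_k deg_at_pos[of y] by (simp add: deg_at_eq)
  let ?P = "\<lambda>y h. \<exists>w. local_height y (comp_at y g) = (?q ^ place_degree y) powi h \<and>
     small y (- h) (e11 (comp_at y g)) \<and> small y (- h) (e12 (comp_at y g)) \<and> small y (- h) (e21 (comp_at y g)) \<and>
     small y (- h) (e22 (comp_at y g)) \<and> small y (- h) w \<and>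
     det2 (\<F> y) (comp_at y g) \<otimes>\<^bsub>\<F> y\<^esub> w = \<one>\<^bsub>\<F> y\<^esub> \<and>
     (comp_at y g \<in> carrier (GL2 (local_integers y)) \<longrightarrow> h = 0)"
  have "\<forall>y. \<exists>h. ?P y h"
    using local_height_form[OF _ Q] g by (simp add: G_A_iff)
  from choice[OF this] obtain h where "\<forall>y. ?P y (h y)" by (elim exE)
  then have h: "?P y (h y)" for y by (rule spec)
  have "{y. h y \<noteq> 0} \<subseteq> {y. comp_at y g \<notin> carrier (GL2 (local_integers y))}" using h by blast
  then have fh: "fin h" by (rule finite_subset) (use g in \<open>simp add: G_A_iff\<close>)
  have lh: "local_height y (comp_at y g) = ?q powi (int (deg_at y) * h y)" for y
    using h[of y] by (auto simp: deg_at_eq power_int_mult)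
  have "height g = (\<Prod>y | h y \<noteq> 0. local_height y (comp_at y g))"
    unfolding height_def comp_at_def[symmetric]
    by (rule Prod_any.expand_superset[OF fh]) (auto simp: lh)
  also have "\<dots> = ?q powi (\<Sum>y | h y \<noteq> 0. int (deg_at y) * h y)"
    unfolding lh by (rule prod_power_int) (use card_k in simp)
  finally have ht: "height g = ?q powi sdeg h" by (simp add: sdeg_def)
  obtain \<gamma> k where gk: "family \<gamma>" "k \<in> K_A" "g = J \<gamma> \<star> k" "slope \<gamma> n" using s unfolding adelic_slope_def by blast
  note c = J_carrier[OF gk(1)] K_A_carrier[OF gk(2)]
  let ?k = "inv\<^bsub>G_A\<^esub> k"
  have Jg: "J \<gamma> = g \<star> ?k" unfolding gk(3) using c by (simp add: G.m_assoc)
  have near: "near_zero y (- h y) (e11 (\<gamma> y)) \<and> near_zero y (- h y) (e12 (\<gamma> y)) \<and> near_zero y (- h y) (e21 (\<gamma> y)) \<and>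
     near_zero y (- h y) (e22 (\<gamma> y)) \<and> ord_at y (mdet (\<gamma> y)) \<le> h y" for y
  proof -
    interpret C: cring "\<F> y" by (rule completion_cring)
    obtain w where w: "small y (- h y) (e11 (comp_at y g))" "small y (- h y) (e12 (comp_at y g))" "small y (- h y) (e21 (comp_at y g))"
      "small y (- h y) (e22 (comp_at y g))" "small y (- h y) w"
      "det2 (\<F> y) (comp_at y g) \<otimes>\<^bsub>\<F> y\<^esub> w = \<one>\<^bsub>\<F> y\<^esub>" using h[of y] by blast
    obtain a b a' b' where gm: "comp_at y g = Mat2 a b a' b'" by (cases "comp_at y g") auto
    obtain p q r s where km: "comp_at y ?k = Mat2 p q r s" by (cases "comp_at y ?k") auto
    have ki: "comp_at y ?k \<in> carrier (GL2 (local_integers y))" "comp_at y k \<in> carrier (GL2 (local_integers y))"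
      using K_A_inv[OF gk(2)] gk(2) by (simp_all add: K_A_iff)
    have kb: "small y 0 p" "small y 0 q" "small y 0 r" "small y 0 s" using ki(1) by (simp_all add: GL2_local_integers_carrier km)
    have mul: "small y (- h y) (u \<otimes>\<^bsub>\<F> y\<^esub> v)" if "small y (- h y) u" "small y 0 v" for u v
      using small_mult[OF that] by simp
    have e: "embm y (\<gamma> y) = comp_at y g \<otimes>\<^bsub>GL2 (\<F> y)\<^esub> comp_at y ?k"
      using arg_cong[OF Jg, of "comp_at y"] by (simp add: comp_at_mult)
    have "small y (- h y) (e11 (embm y (\<gamma> y)))" "small y (- h y) (e12 (embm y (\<gamma> y)))"
      "small y (- h y) (e21 (embm y (\<gamma> y)))" "small y (- h y) (e22 (embm y (\<gamma> y)))"
      unfolding e gm km GL2_mult mat2.sel using w(1-4) kb by (auto simp: gm intro!: small_add mul)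
    then have 1: "near_zero y (- h y) (e11 (\<gamma> y))" "near_zero y (- h y) (e12 (\<gamma> y))" "near_zero y (- h y) (e21 (\<gamma> y))"
      "near_zero y (- h y) (e22 (\<gamma> y))" by (simp_all add: small_emb)
    have nz: "mdet (\<gamma> y) \<noteq> 0" using gk(1) by (simp add: family_def)
    let ?e = "emb_local y (mdet (\<gamma> y))" and ?f = "emb_local y (inverse (mdet (\<gamma> y)))" and ?u = "det2 (\<F> y) (comp_at y k)"
    have kb': "small y 0 (e11 (comp_at y k))" "small y 0 (e12 (comp_at y k))" "small y 0 (e21 (comp_at y k))" "small y 0 (e22 (comp_at y k))"
      using ki(2) by (simp_all add: GL2_local_integers_carrier)
    have ub: "small y 0 ?u" using kb' by (simp add: det2_def small_diff small0_mult)
    have D: "det2 (\<F> y) (comp_at y g) = ?e \<otimes>\<^bsub>\<F> y\<^esub> ?u"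
      unfolding gk(3) comp_at_mult comp_at_J det2_embm[symmetric]
      by (rule C.det2_mult) (use kb' small_carrier in auto)
    have cl: "w \<in> carrier (\<F> y)" "?u \<in> carrier (\<F> y)" using small_carrier[OF w(5)] small_carrier[OF ub] by blast+
    have "?f = ?f \<otimes>\<^bsub>\<F> y\<^esub> (?e \<otimes>\<^bsub>\<F> y\<^esub> ?u \<otimes>\<^bsub>\<F> y\<^esub> w)" using w(6) D by simp
    also have "\<dots> = (?f \<otimes>\<^bsub>\<F> y\<^esub> ?e) \<otimes>\<^bsub>\<F> y\<^esub> (?u \<otimes>\<^bsub>\<F> y\<^esub> w)" using cl by (simp add: C.m_assoc)
    also have "\<dots> = ?u \<otimes>\<^bsub>\<F> y\<^esub> w" using nz cl by (simp add: emb_local_mult[symmetric] emb_local_1)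
    finally have "small y (0 + - h y) ?f" using small_mult[OF ub w(5)] by simp
    then have "ord_at y (mdet (\<gamma> y)) \<le> h y" using nz by (simp add: small_emb near_zero_def ord_at_inverse)
    then show ?thesis using 1 by blast
  qed
  have "n \<le> 3 * sdeg h" by (rule slope_le_height[OF gk(1,4) fh]) (use near in blast)+
  then show ?thesis using ht by blast
qed

end


section \<open>The eigenvalue equation as a recursion\<close>

text \<open>The eigenvalue equation at $n - d$ solved for the value at $n$. For the neighbours $C$ of a class $m$, the number
$a(m, C)$ is the index of the class of that neighbour.\<close>

function hecke_rec :: "nat \<Rightarrow> complex \<Rightarrow> 'c set \<Rightarrow> (nat \<Rightarrow> 'c \<Rightarrow> nat) \<Rightarrow> (nat \<Rightarrow> complex) \<Rightarrow> nat \<Rightarrow> complex" where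
  "hecke_rec d l Q a v n = (if n < d \<or> d = 0 then v n else
     (l * hecke_rec d l Q a v (n - d) - (\<Sum>C\<in>{C \<in> Q. a (n - d) C < n}. hecke_rec d l Q a v (a (n - d) C)))
     / of_nat (card {C \<in> Q. a (n - d) C = n}))"
  by pat_completeness auto
termination by (relation "Wellfounded.measure (\<lambda>(d, l, Q, a, v, n). n)") auto

declare hecke_rec.simps [simp del]

locale hecke_recursion =
  fixes d :: nat and l :: complex and Q :: "'c set" and a :: "nat \<Rightarrow> 'c \<Rightarrow> nat"
  assumes d: "d > 0" and Q: "finite Q" and le: "\<And>n C. C \<in> Q \<Longrightarrow> a n C \<le> n + d"
    and top: "\<And>n. \<exists>C\<in>Q. a n C = n + d"
begin

definition solution :: "(nat \<Rightarrow> complex) \<Rightarrow> bool" where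
  "solution \<phi> \<longleftrightarrow> (\<forall>n. (\<Sum>C\<in>Q. \<phi> (a n C)) = l * \<phi> n)"

lemma split_sum:
  "(\<Sum>C\<in>Q. \<phi> (a n C)) = of_nat (card {C \<in> Q. a n C = n + d}) * \<phi> (n + d) + (\<Sum>C\<in>{C \<in> Q. a n C < n + d}. \<phi> (a n C))"
  for \<phi> :: "nat \<Rightarrow> complex"
proof -
  have e: "Q = {C \<in> Q. a n C = n + d} \<union> {C \<in> Q. a n C < n + d}" using le[of _ n] by force
  have "(\<Sum>C\<in>Q. \<phi> (a n C)) = (\<Sum>C\<in>{C \<in> Q. a n C = n + d} \<union> {C \<in> Q. a n C < n + d}. \<phi> (a n C))"
    by (rule arg_cong[OF e])
  also have "\<dots> = (\<Sum>C\<in>{C \<in> Q. a n C = n + d}. \<phi> (a n C)) + (\<Sum>C\<in>{C \<in> Q. a n C < n + d}. \<phi> (a n C))"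
  proof (rule sum.union_disjoint)
    show "finite {C \<in> Q. a n C = n + d}" "finite {C \<in> Q. a n C < n + d}"
      by (rule finite_subset[OF _ Q], blast)+
  qed fastforce
  also have "(\<Sum>C\<in>{C \<in> Q. a n C = n + d}. \<phi> (a n C)) = of_nat (card {C \<in> Q. a n C = n + d}) * \<phi> (n + d)" by simp
  finally show ?thesis .
qed

lemma multiplicity_pos: "card {C \<in> Q. a n C = n + d} > 0"
  using top[of n] Q by (auto simp: card_gt_0_iff)

lemma solution_unique:
  assumes "solution \<phi>" "solution \<psi>" "\<And>n. n < d \<Longrightarrow> \<phi> n = \<psi> n"
  shows "\<phi> = \<psi>"
proof
  fix n show "\<phi> n = \<psi> n"
  proof (induction n rule: less_induct)
    case (less n)
    show ?case
    proof (cases "n < d")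
      case False
      define m where "m = n - d"
      have n: "n = m + d" using False by (simp add: m_def)
      have low: "(\<Sum>C\<in>{C \<in> Q. a m C < m + d}. \<phi> (a m C)) = (\<Sum>C\<in>{C \<in> Q. a m C < m + d}. \<psi> (a m C))"
        by (rule sum.cong) (use less n in auto)
      have "\<phi> m = \<psi> m" using less d n by simp
      then have "(\<Sum>C\<in>Q. \<phi> (a m C)) = (\<Sum>C\<in>Q. \<psi> (a m C))" using assms(1,2) by (simp add: solution_def)
      then have "of_nat (card {C \<in> Q. a m C = m + d}) * \<phi> (m + d) = of_nat (card {C \<in> Q. a m C = m + d}) * \<psi> (m + d)"
        unfolding split_sum low by simp
      then show ?thesis using multiplicity_pos[of m] n by simp
    qed (use assms(3) in simp)
  qed
qed

lemma solution_hecke_rec: "solution (hecke_rec d l Q a v)"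
  unfolding solution_def
proof
  fix n
  let ?\<phi> = "hecke_rec d l Q a v"
  have "of_nat (card {C \<in> Q. a n C = n + d}) * ?\<phi> (n + d) = l * ?\<phi> n - (\<Sum>C\<in>{C \<in> Q. a n C < n + d}. ?\<phi> (a n C))"
    using multiplicity_pos[of n] d by (subst hecke_rec.simps) simp
  then show "(\<Sum>C\<in>Q. ?\<phi> (a n C)) = l * ?\<phi> n" unfolding split_sum by simp
qed

lemma hecke_rec_initial: "n < d \<Longrightarrow> hecke_rec d l Q a v n = v n"
  by (subst hecke_rec.simps) simp

text \<open>The leading coefficient is a positive integer, so dividing by it does not increase absolute values;
each value is then at most the sum of $|l|$ and the number of neighbours, times a bound for the
earlier values.\<close>

lemma hecke_rec_bound:
  "cmod (hecke_rec d l Q a v n) \<le> (\<Sum>i<d. cmod (v i)) * (cmod l + real (card Q) + 1) ^ n"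
proof (induction n rule: less_induct)
  case (less n)
  let ?\<phi> = "hecke_rec d l Q a v" and ?V = "\<Sum>i<d. cmod (v i)" and ?B = "cmod l + real (card Q) + 1"
  have B: "?B \<ge> 1" by simp
  have V: "?V \<ge> 0" by (simp add: sum_nonneg)
  show ?case
  proof (cases "n < d")
    case True
    have "cmod (v n) \<le> ?V" using True by (intro member_le_sum) auto
    also have "\<dots> \<le> ?V * ?B ^ n" using V one_le_power[OF B, of n] by (simp add: mult_le_cancel_left1 mult_left_mono[of 1, simplified])
    finally show ?thesis using True by (simp add: hecke_rec_initial)
  next
    case False
    define m where "m = n - d"
    have n: "n = m + d" using False by (simp add: m_def)
    let ?c = "card {C \<in> Q. a m C = m + d}" and ?T = "{C \<in> Q. a m C < m + d}"
    have bd: "cmod (?\<phi> i) \<le> ?V * ?B ^ (n - 1)" if "i < n" for i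
    proof -
      have "cmod (?\<phi> i) \<le> ?V * ?B ^ i" by (rule less[OF that])
      also have "\<dots> \<le> ?V * ?B ^ (n - 1)" using that by (intro mult_left_mono V power_increasing B) simp
      finally show ?thesis .
    qed
    have eq: "?\<phi> n = (l * ?\<phi> m - (\<Sum>C\<in>?T. ?\<phi> (a m C))) / of_nat ?c"
      using n d by (subst hecke_rec.simps) simp
    have "cmod (?\<phi> n) = cmod (l * ?\<phi> m - (\<Sum>C\<in>?T. ?\<phi> (a m C))) / real ?c" by (simp only: eq norm_divide norm_of_nat)
    also have "\<dots> \<le> cmod (l * ?\<phi> m - (\<Sum>C\<in>?T. ?\<phi> (a m C)))"
    proof -
      have "1 \<le> real ?c" using multiplicity_pos[of m] by linarith
      then show ?thesis by (simp add: divide_le_eq mult_le_cancel_left1)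
    qed
    also have "\<dots> \<le> cmod l * cmod (?\<phi> m) + (\<Sum>C\<in>?T. cmod (?\<phi> (a m C)))"
      using norm_triangle_ineq4[of "l * ?\<phi> m" "\<Sum>C\<in>?T. ?\<phi> (a m C)"] norm_sum[of "\<lambda>C. ?\<phi> (a m C)" ?T] by (simp add: norm_mult)
    also have "\<dots> \<le> cmod l * (?V * ?B ^ (n - 1)) + (\<Sum>C\<in>?T. ?V * ?B ^ (n - 1))"
      by (intro add_mono mult_left_mono bd sum_mono) (use n d in auto)
    also have "\<dots> = (cmod l + real (card ?T)) * (?V * ?B ^ (n - 1))" by (simp add: distrib_right)
    also have "\<dots> \<le> ?B * (?V * ?B ^ (n - 1))"
    proof (rule mult_right_mono)
      have "card ?T \<le> card Q" by (rule card_mono[OF Q]) auto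
      then show "cmod l + real (card ?T) \<le> ?B" by simp
      show "0 \<le> ?V * ?B ^ (n - 1)" using V by simp
    qed
    also have "\<dots> = ?V * ?B ^ n" using n d by (simp add: power_eq_if mult.left_commute)
    finally show ?thesis .
  qed
qed

end

section \<open>Eigenfunctions\<close>

lemma sum_fun_apply: "(\<Sum>i\<in>S. F i) x = (\<Sum>i\<in>S. F i x)" for F :: "'i \<Rightarrow> 'a \<Rightarrow> complex"
  by (induction S rule: infinite_finite_induct) simp_all

lemma fun_scale_vector_space: "vector_space fun_scale"
  by unfold_locales (auto simp: fun_scale_def fun_eq_iff algebra_simps)

context rational_place
begin

text \<open>The function on $G(\mathbb{A})$ with prescribed values on the classes $c_{nx}$.\<close>

definition lift :: "(nat \<Rightarrow> complex) \<Rightarrow> 'k GA \<Rightarrow> complex" where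
  "lift \<phi> g = (if g \<in> carrier G_A then \<phi> (index g) else 0)"

lemma automorphic_lift:
  assumes f: "f \<in> (automorphic_functions :: ('k GA \<Rightarrow> complex) set)"
  shows "f = lift (\<lambda>n. f (std n))"
proof
  interpret G: Group.group "G_A :: 'k GA monoid" by (rule G_A_group)
  fix g show "f g = lift (\<lambda>n. f (std n)) g"
  proof (cases "g \<in> carrier G_A")
    case True
    obtain a z k where *: "a \<in> G_F" "z \<in> Z_A" "k \<in> K_A" "g = a \<star> std (index g) \<star> (z \<star> k)"
      using dclass_index[OF True] unfolding dclass_iff by blast
    note c = G_F_carrier[OF *(1)] Z_A_carrier[OF *(2)] K_A_carrier[OF *(3)] std_carrier[of "index g"]
    have e: "g = z \<star> (a \<star> std (index g)) \<star> k"
      using *(4) Z_A_comm[OF *(2) G.m_closed[OF c(1,4)]] c by (simp add: G.m_assoc)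
    have "f (z \<star> (a \<star> std (index g)) \<star> k) = f (z \<star> (a \<star> std (index g)))"
      using f *(3) c unfolding automorphic_functions_def by simp
    also have "\<dots> = f (a \<star> std (index g))" using f *(2) c unfolding automorphic_functions_def by simp
    also have "\<dots> = f (std (index g))" using f *(1) c unfolding automorphic_functions_def by simp
    finally show ?thesis using True e by (simp add: lift_def)
  next
    case False
    then show ?thesis using f unfolding automorphic_functions_def lift_def by simp
  qed
qed

lemma lift_invariant:
  assumes g: "g \<in> carrier (G_A :: 'k GA monoid)"
  shows "a \<in> G_F \<Longrightarrow> lift \<phi> (a \<star> g) = lift \<phi> g" "z \<in> Z_A \<Longrightarrow> lift \<phi> (z \<star> g) = lift \<phi> g"
    "k \<in> K_A \<Longrightarrow> lift \<phi> (g \<star> k) = lift \<phi> g"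
proof -
  interpret G: Group.group "G_A :: 'k GA monoid" by (rule G_A_group)
  note s = adelic_slope_index[OF g]
  show "a \<in> G_F \<Longrightarrow> lift \<phi> (a \<star> g) = lift \<phi> g"
    using index_eqI[OF adelic_slope_left[OF s]] G_F_carrier[of a] g by (simp add: lift_def)
  show "z \<in> Z_A \<Longrightarrow> lift \<phi> (z \<star> g) = lift \<phi> g"
    using index_eqI[OF adelic_slope_center[OF s]] Z_A_carrier[of z] g by (simp add: lift_def)
  show "k \<in> K_A \<Longrightarrow> lift \<phi> (g \<star> k) = lift \<phi> g"
    using index_eqI[OF adelic_slope_right[OF s]] K_A_carrier[of k] g by (simp add: lift_def)
qed

lemma lift_std [simp]: "lift \<phi> (std n) = \<phi> n"
  by (simp add: lift_def std_carrier)

text \<open>Exponential growth in $n$ is polynomial growth in the height: $B^n = (q^n)^{\log_q B}$ and $q^n$ is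
at most the cube of the height.\<close>

lemma lift_automorphic:
  assumes B: "B \<ge> 1" and V: "V \<ge> 0" and \<phi>: "\<And>n. cmod (\<phi> n) \<le> V * B ^ n"
  shows "lift \<phi> \<in> automorphic_functions"
proof -
  let ?q = "real CARD('k)"
  let ?N = "3 * log ?q B"
  have q: "1 < ?q" by (rule card_k)
  have "cmod (lift \<phi> g) \<le> V * height g powr ?N" if g: "g \<in> carrier G_A" for g :: "'k GA"
  proof -
    obtain r where r: "height g = ?q powi r" "int (index g) \<le> 3 * r"
      using slope_height_bound[OF g adelic_slope_index[OF g]] by blast
    have "B ^ index g = ?q powr (log ?q B * real (index g))"
      using q B by (simp add: powr_powr[symmetric] powr_realpow)
    also have "\<dots> \<le> ?q powr (log ?q B * (3 * real_of_int r))"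
    proof -
      have "real (index g) \<le> 3 * real_of_int r" using r(2) by linarith
      moreover have "0 \<le> log ?q B" using q B by simp
      ultimately show ?thesis using q by (intro powr_mono mult_left_mono) simp_all
    qed
    also have "\<dots> = height g powr ?N"
      using q by (simp add: r(1) powr_real_of_int'[symmetric] powr_powr mult.commute mult.left_commute)
    finally have "B ^ index g \<le> height g powr ?N" .
    then have "V * B ^ index g \<le> V * height g powr ?N" using V by (rule mult_left_mono)
    then show ?thesis using \<phi>[of "index g"] g by (simp add: lift_def)
  qed
  then have "\<exists>C N. \<forall>g\<in>carrier G_A. cmod (lift \<phi> g) \<le> C * height g powr N" by blast
  then show ?thesis unfolding automorphic_functions_def using lift_invariant by (auto simp: lift_def)
qed

end

locale hecke_setup = rational_place x for x :: "'k::{field,finite} place" +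
  fixes \<mu> :: "'k GA measure" and y :: "'k place" and p :: "'k ratfun" and l :: complex
  assumes haar: "haar_measure G_A (GL2_topology adele_ring adele_topology) \<mu>" and volume: "emeasure \<mu> K_A = 1"
    and uniformizer_p: "uniformizer y p"
begin

lemma ord_p: "p \<noteq> 0" "ord_at y p = 1"
  using ord_at_uniformizer[OF uniformizer_p] by auto

abbreviation neighbour :: "nat \<Rightarrow> 'k GA set \<Rightarrow> nat" where
  "neighbour n C \<equiv> index (std n \<star> rep C)"

lemma rep_carrier: "C \<in> hecke_cosets y p \<Longrightarrow> rep C \<in> carrier G_A"
  using hecke_coset_rep(1,2)[OF ord_p(1)] by blast

sublocale recursion: hecke_recursion "place_degree y" l "hecke_cosets y p" neighbour
proof
  show "place_degree y > 0" using deg_at_pos[of y] by (simp add: deg_at_eq)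
  show "finite (hecke_cosets y p)" by (rule finite_hecke_cosets[OF ord_p])
  show le: "neighbour n C \<le> n + place_degree y" if "C \<in> hecke_cosets y p" for n C
    using index_coset_le[OF ord_p std_carrier that, of n] by (simp add: deg_at_eq)
  show "\<exists>C\<in>hecke_cosets y p. neighbour n C = n + place_degree y" for n
    using index_coset_ge[OF ord_p] le by (metis deg_at_eq order_antisym)
qed

text \<open>The sum depends only on the class of $g$: the factors from $G(F)$ and $Z$ drop out, and a factor
$k \in K$ on the right of $g$ merely permutes the cosets.\<close>

lemma lift_coset_sum:
  assumes g: "g \<in> carrier G_A"
  shows "(\<Sum>C\<in>hecke_cosets y p. lift \<phi> (g \<star> rep C)) = (\<Sum>C\<in>hecke_cosets y p. \<phi> (neighbour (index g) C))"
proof -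
  interpret G: Group.group "G_A :: 'k GA monoid" by (rule G_A_group)
  let ?Q = "hecke_cosets y p" and ?s = "std (index g)"
  obtain a z k where *: "a \<in> G_F" "z \<in> Z_A" "k \<in> K_A" "g = a \<star> ?s \<star> (z \<star> k)"
    using dclass_index[OF g] unfolding dclass_iff by blast
  note c = G_F_carrier[OF *(1)] Z_A_carrier[OF *(2)] K_A_carrier[OF *(3)] std_carrier[of "index g"]
  have e: "lift \<phi> (g \<star> h) = lift \<phi> (?s \<star> (k \<star> h))" if h: "h \<in> carrier G_A" for h
  proof -
    have "g \<star> h = a \<star> (?s \<star> z) \<star> (k \<star> h)"
      by (subst *(4)) (use c h in \<open>simp add: G.m_assoc\<close>)
    also have "\<dots> = a \<star> (z \<star> (?s \<star> (k \<star> h)))"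
      unfolding Z_A_comm[OF *(2) c(4), symmetric] using c h by (simp add: G.m_assoc)
    finally show ?thesis using lift_invariant(1,2) *(1,2) c h by simp
  qed
  have shift: "K_coset (m \<star> rep C) \<in> ?Q" "m \<star> rep C \<in> K_coset (m \<star> rep C)"
    if C: "C \<in> ?Q" and m: "m \<in> K_A" for C m
  proof -
    obtain j where j: "j \<in> K_A" "C = K_coset (j \<star> diag_at y p)" using C by (auto simp: hecke_cosets_def)
    note cs = K_A_carrier[OF j(1)] K_A_carrier[OF m] diag_at_carrier[OF ord_p(1), of y]
    obtain i where i: "i \<in> K_A" "rep C = j \<star> diag_at y p \<star> i"
      using hecke_coset_rep(1)[OF ord_p(1) C] unfolding j(2) K_coset_iff by blast
    have "m \<star> rep C = (m \<star> j) \<star> diag_at y p \<star> i"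
      unfolding i(2) using cs K_A_carrier[OF i(1)] by (simp add: G.m_assoc)
    then have "m \<star> rep C \<in> K_coset ((m \<star> j) \<star> diag_at y p)" using i(1) K_coset_iff by blast
    then have "K_coset (m \<star> rep C) = K_coset ((m \<star> j) \<star> diag_at y p)"
      using cs by (intro K_coset_eq) simp_all
    then show "K_coset (m \<star> rep C) \<in> ?Q" using K_A_mult[OF m j(1)] by (simp add: hecke_cosets_def)
    have "m \<star> rep C = m \<star> rep C \<star> \<one>\<^bsub>G_A\<^esub>" using cs rep_carrier[OF C] by simp
    then show "m \<star> rep C \<in> K_coset (m \<star> rep C)" using one_K_A K_coset_iff by blast
  qed
  let ?t = "\<lambda>m C. K_coset (m \<star> rep C)"
  have unshift: "?t n (?t m C) = C" if C: "C \<in> ?Q" and m: "m \<in> K_A" "n \<in> K_A" "n \<star> m = \<one>\<^bsub>G_A\<^esub>" for C m n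
  proof -
    note cs = K_A_carrier[OF m(1)] K_A_carrier[OF m(2)] rep_carrier[OF C]
    define D where "D = ?t m C"
    obtain i where i: "i \<in> K_A" "m \<star> rep C = rep D \<star> i"
      using hecke_coset_rep(4)[OF ord_p(1) shift[OF C m(1)]] unfolding D_def by blast
    have rc: "rep D \<in> carrier G_A" unfolding D_def by (rule rep_carrier[OF shift(1)[OF C m(1)]])
    have "rep C = n \<star> (m \<star> rep C)" using m(3) cs by (simp add: G.m_assoc[symmetric])
    also have "\<dots> = n \<star> rep D \<star> i" unfolding i(2) using cs rc K_A_carrier[OF i(1)] by (simp add: G.m_assoc)
    finally have "rep C \<in> ?t n D" using i(1) K_coset_iff by blast
    then have "K_coset (rep C) = ?t n D" using cs rc by (intro K_coset_eq) simp_all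
    then show ?thesis using hecke_coset_rep(3)[OF ord_p(1) C hecke_coset_rep(1)[OF ord_p(1) C]] unfolding D_def by simp
  qed
  have "(\<Sum>C\<in>?Q. lift \<phi> (g \<star> rep C)) = (\<Sum>C\<in>?Q. lift \<phi> (?s \<star> (k \<star> rep C)))"
    by (rule sum.cong[OF refl e[OF rep_carrier]])
  also have "\<dots> = (\<Sum>C\<in>?Q. lift \<phi> (?s \<star> rep C))"
  proof (rule sum.reindex_bij_witness[of _ "?t (inv\<^bsub>G_A\<^esub> k)" "?t k"])
    fix C assume C: "C \<in> ?Q"
    show "?t (inv\<^bsub>G_A\<^esub> k) (?t k C) = C" by (rule unshift[OF C *(3) K_A_inv[OF *(3)]]) (use c in simp)
    show "?t k C \<in> ?Q" by (rule shift(1)[OF C *(3)])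
    show "?t k (?t (inv\<^bsub>G_A\<^esub> k) C) = C" by (rule unshift[OF C K_A_inv[OF *(3)] *(3)]) (use c in simp)
    show "?t (inv\<^bsub>G_A\<^esub> k) C \<in> ?Q" by (rule shift(1)[OF C K_A_inv[OF *(3)]])
    define D where "D = ?t k C"
    obtain i where i: "i \<in> K_A" "k \<star> rep C = rep D \<star> i"
      using hecke_coset_rep(4)[OF ord_p(1) shift[OF C *(3)]] unfolding D_def by blast
    have rc: "rep D \<in> carrier G_A" unfolding D_def by (rule rep_carrier[OF shift(1)[OF C *(3)]])
    have "?s \<star> (k \<star> rep C) = (?s \<star> rep D) \<star> i"
      unfolding i(2) using c rc K_A_carrier[OF i(1)] by (simp add: G.m_assoc)
    then show "lift \<phi> (?s \<star> rep (?t k C)) = lift \<phi> (?s \<star> (k \<star> rep C))"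
      unfolding D_def[symmetric] using lift_invariant(3)[OF _ i(1)] c rc by simp
  qed
  also have "\<dots> = (\<Sum>C\<in>?Q. \<phi> (neighbour (index g) C))"
    by (rule sum.cong[OF refl]) (use c rep_carrier in \<open>simp add: lift_def\<close>)
  finally show ?thesis .
qed

lemma hecke_lift:
  "hecke_operator \<mu> y p (lift \<phi>) = lift (\<lambda>n. \<Sum>C\<in>hecke_cosets y p. \<phi> (neighbour n C))"
proof
  fix g show "hecke_operator \<mu> y p (lift \<phi>) g = lift (\<lambda>n. \<Sum>C\<in>hecke_cosets y p. \<phi> (neighbour n C)) g"
  proof (cases "g \<in> carrier G_A")
    case True
    have "hecke_operator \<mu> y p (lift \<phi>) g = (\<Sum>C\<in>hecke_cosets y p. lift \<phi> (g \<star> rep C))"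
      by (rule hecke_operator_sum[OF ord_p haar volume lift_invariant(3) True])
    then show ?thesis using lift_coset_sum[OF True] True by (simp add: lift_def)
  qed (simp add: hecke_operator_def lift_def)
qed

lemma solution_automorphic:
  assumes "recursion.solution \<phi>"
  shows "lift \<phi> \<in> automorphic_functions"
proof -
  let ?\<psi> = "hecke_rec (place_degree y) l (hecke_cosets y p) neighbour \<phi>"
  have "\<phi> = ?\<psi>"
    by (rule recursion.solution_unique[OF assms recursion.solution_hecke_rec]) (simp add: recursion.hecke_rec_initial)
  moreover have "lift ?\<psi> \<in> automorphic_functions"
    by (rule lift_automorphic[OF _ _ recursion.hecke_rec_bound]) (simp_all add: sum_nonneg)
  ultimately show ?thesis by metis
qed

text \<open>Every eigenfunction is determined by its values on the classes, and for these the eigenvalue equation is the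
recursion; conversely solutions have moderate growth.\<close>

lemma eigenspace_eq: "hecke_eigenspace \<mu> y p l = lift ` {\<phi>. recursion.solution \<phi>}"
proof (intro equalityI subsetI)
  fix f assume f: "f \<in> hecke_eigenspace \<mu> y p l"
  define \<phi> where "\<phi> = (\<lambda>n. f (std n))"
  have fl: "f = lift \<phi>" unfolding \<phi>_def by (rule automorphic_lift) (use f in \<open>simp add: hecke_eigenspace_def\<close>)
  have "lift (\<lambda>n. \<Sum>C\<in>hecke_cosets y p. \<phi> (neighbour n C)) = fun_scale l (lift \<phi>)"
    using f unfolding hecke_eigenspace_def by (simp add: fl hecke_lift)
  then have "lift (\<lambda>n. \<Sum>C\<in>hecke_cosets y p. \<phi> (neighbour n C)) (std n) = fun_scale l (lift \<phi>) (std n)" for n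
    by simp
  then have "recursion.solution \<phi>" by (simp add: recursion.solution_def fun_scale_def)
  then show "f \<in> lift ` {\<phi>. recursion.solution \<phi>}" using fl by blast
next
  fix f assume "f \<in> lift ` {\<phi>. recursion.solution \<phi>}"
  then obtain \<phi> where \<phi>: "recursion.solution \<phi>" "f = lift \<phi>" by blast
  have "hecke_operator \<mu> y p (lift \<phi>) = fun_scale l (lift \<phi>)"
    using \<phi>(1) unfolding hecke_lift recursion.solution_def by (auto simp: fun_scale_def lift_def)
  then show "f \<in> hecke_eigenspace \<mu> y p l" using solution_automorphic[OF \<phi>(1)] \<phi>(2) by (simp add: hecke_eigenspace_def)
qed

lemma eigenspace_subspace: "module.subspace fun_scale (hecke_eigenspace \<mu> y p l)"
proof -
  interpret V: vector_space "fun_scale :: complex \<Rightarrow> ('k GA \<Rightarrow> complex) \<Rightarrow> _" by (rule fun_scale_vector_space)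
  have add: "lift \<phi> + lift \<psi> = lift (\<lambda>n. \<phi> n + \<psi> n)" for \<phi> \<psi> by (rule ext) (simp add: lift_def)
  have sc: "fun_scale c (lift \<phi>) = lift (\<lambda>n. c * \<phi> n)" for c \<phi> by (rule ext) (simp add: lift_def fun_scale_def)
  show ?thesis unfolding eigenspace_eq
  proof (rule V.subspaceI)
    show "0 \<in> lift ` {\<phi>. recursion.solution \<phi>}"
      by (rule image_eqI[of _ lift "\<lambda>n. 0"]) (auto simp: recursion.solution_def lift_def)
    fix f h assume "f \<in> lift ` {\<phi>. recursion.solution \<phi>}" "h \<in> lift ` {\<phi>. recursion.solution \<phi>}"
    then obtain \<phi> \<psi> where "recursion.solution \<phi>" "recursion.solution \<psi>" "f = lift \<phi>" "h = lift \<psi>" by blast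
    then show "f + h \<in> lift ` {\<phi>. recursion.solution \<phi>}"
      by (intro image_eqI[of _ _ "\<lambda>n. \<phi> n + \<psi> n"]) (simp_all add: add recursion.solution_def sum.distrib distrib_left)
  next
    fix c f assume "f \<in> lift ` {\<phi>. recursion.solution \<phi>}"
    then obtain \<phi> where "recursion.solution \<phi>" "f = lift \<phi>" by blast
    then show "fun_scale c f \<in> lift ` {\<phi>. recursion.solution \<phi>}"
      by (intro image_eqI[of _ _ "\<lambda>n. c * \<phi> n"])
        (simp_all add: sc recursion.solution_def sum_distrib_left[symmetric] mult.left_commute)
  qed
qed

abbreviation initial_classes :: "'k GA set set" where
  "initial_classes \<equiv> N_classes x t_rf (place_degree y)"

lemma eval_classes_lift: "n < place_degree y \<Longrightarrow> eval_classes initial_classes (lift \<phi>) (c_class x t_rf n) = \<phi> n"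
proof -
  assume n: "n < place_degree y"
  have c: "c_class x t_rf n = dclass (std n)" by (rule c_class_std)
  have s: "(SOME g. g \<in> dclass (std n)) \<in> dclass (std n)" by (rule someI[where P = "\<lambda>g. g \<in> dclass (std n)", OF dclass_self[OF std_carrier]])
  have "lift \<phi> (SOME g. g \<in> dclass (std n)) = \<phi> n"
    using index_dclass[OF s] dclass_carrier[OF std_carrier s] by (simp add: lift_def)
  then show ?thesis using n by (simp add: eval_classes_def N_classes_def c[symmetric])
qed

lemma eval_classes_bij: "bij_betw (eval_classes initial_classes) (hecke_eigenspace \<mu> y p l) (coord_space initial_classes)"
  unfolding bij_betw_def eigenspace_eq
proof
  show "inj_on (eval_classes initial_classes) (lift ` {\<phi>. recursion.solution \<phi>})"
  proof (rule inj_onI, clarify)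
    fix \<phi> \<psi> assume s: "recursion.solution \<phi>" "recursion.solution \<psi>"
      and e: "eval_classes initial_classes (lift \<phi>) = eval_classes initial_classes (lift \<psi>)"
    have "\<phi> = \<psi>"
      by (rule recursion.solution_unique[OF s]) (use eval_classes_lift e in metis)
    then show "lift \<phi> = lift \<psi>" by simp
  qed
  show "eval_classes initial_classes ` lift ` {\<phi>. recursion.solution \<phi>} = coord_space initial_classes"
  proof (intro equalityI subsetI)
    fix v assume v: "v \<in> coord_space initial_classes"
    let ?\<phi> = "hecke_rec (place_degree y) l (hecke_cosets y p) neighbour (\<lambda>n. v (c_class x t_rf n))"
    have "eval_classes initial_classes (lift ?\<phi>) = v"
    proof
      fix c show "eval_classes initial_classes (lift ?\<phi>) c = v c"
      proof (cases "c \<in> initial_classes")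
        case True
        then obtain n where n: "n < place_degree y" "c = c_class x t_rf n" by (auto simp: N_classes_def)
        then show ?thesis using eval_classes_lift[OF n(1)] recursion.hecke_rec_initial[OF n(1)] by simp
      next
        case False
        then show ?thesis using v by (simp add: eval_classes_def coord_space_def)
      qed
    qed
    then show "v \<in> eval_classes initial_classes ` lift ` {\<phi>. recursion.solution \<phi>}"
      using recursion.solution_hecke_rec by (metis (mono_tags, lifting) image_eqI mem_Collect_eq)
  qed (auto simp: coord_space_def eval_classes_def)
qed

text \<open>A basis is given by the eigenfunctions dual to the evaluations at $c_0,\dots,c_{(d-1)x}$.\<close>

lemma eigenspace_dim: "vector_space.dim fun_scale (hecke_eigenspace \<mu> y p l) = place_degree y"
proof -
  interpret V: vector_space "fun_scale :: complex \<Rightarrow> ('k GA \<Rightarrow> complex) \<Rightarrow> _" by (rule fun_scale_vector_space)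
  let ?E = "hecke_eigenspace \<mu> y p l" and ?d = "place_degree y"
  define e where "e = (\<lambda>n. lift (hecke_rec ?d l (hecke_cosets y p) neighbour (\<lambda>i. if i = n then 1 else 0)))"
  have eE: "e n \<in> ?E" for n unfolding e_def eigenspace_eq using recursion.solution_hecke_rec by blast
  have ev: "e n (std m) = (if m = n then 1 else 0)" if "m < ?d" for m n
    using that by (simp add: e_def recursion.hecke_rec_initial)
  have inj: "inj_on e {..<?d}"
  proof (rule inj_onI)
    fix n m assume "n \<in> {..<?d}" "m \<in> {..<?d}" "e n = e m"
    then show "n = m" using ev[of n n] ev[of n m] by (auto split: if_splits)
  qed
  have eq: "f = h" if fh: "f \<in> ?E" "h \<in> ?E" "\<And>n. n < ?d \<Longrightarrow> f (std n) = h (std n)" for f h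
  proof -
    obtain \<phi> \<psi> where "recursion.solution \<phi>" "recursion.solution \<psi>" "f = lift \<phi>" "h = lift \<psi>"
      using fh(1,2) unfolding eigenspace_eq by blast
    then show ?thesis using recursion.solution_unique[of \<phi> \<psi>] fh(3) by simp
  qed
  show ?thesis
  proof (rule V.dim_unique)
    show "e ` {..<?d} \<subseteq> ?E" using eE by blast
    show "card (e ` {..<?d}) = ?d" using card_image[OF inj] by simp
    show "V.independent (e ` {..<?d})"
    proof (rule V.independent_if_scalars_zero)
      show "finite (e ` {..<?d})" by simp
      fix u b assume z: "(\<Sum>b\<in>e ` {..<?d}. fun_scale (u b) b) = 0" and b: "b \<in> e ` {..<?d}"
      obtain n where n: "n < ?d" "b = e n" using b by blast
      have "0 = (\<Sum>b\<in>e ` {..<?d}. fun_scale (u b) b) (std n)" using z by simp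
      also have "\<dots> = (\<Sum>m<?d. u (e m) * e m (std n))"
        by (simp add: sum_fun_apply sum.reindex[OF inj] fun_scale_def)
      also have "\<dots> = (\<Sum>m<?d. if m = n then u (e n) else 0)"
        by (rule sum.cong) (use n ev in auto)
      also have "\<dots> = u b" using n by simp
      finally show "u b = 0" by simp
    qed
    show "?E \<subseteq> V.span (e ` {..<?d})"
    proof
      fix f assume f: "f \<in> ?E"
      let ?h = "\<Sum>m<?d. fun_scale (f (std m)) (e m)"
      have sp: "?h \<in> V.span (e ` {..<?d})"
        by (intro V.span_sum V.span_scale V.span_base) blast
      have "?h \<in> ?E"
        by (intro V.subspace_sum[OF eigenspace_subspace] V.subspace_scale[OF eigenspace_subspace] eE)
      moreover have "f (std n) = ?h (std n)" if n: "n < ?d" for n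
      proof -
        have "?h (std n) = (\<Sum>m<?d. f (std m) * e m (std n))" by (simp add: sum_fun_apply fun_scale_def)
        also have "\<dots> = (\<Sum>m<?d. if m = n then f (std n) else 0)" by (rule sum.cong) (use n ev in auto)
        also have "\<dots> = f (std n)" using n by simp
        finally show ?thesis by simp
      qed
      ultimately have "f = ?h" using eq[OF f] by blast
      then show "f \<in> V.span (e ` {..<?d})" using sp by simp
    qed
  qed
qed

end

lemma eval_classes_linear: "Vector_Spaces.linear fun_scale fun_scale (eval_classes S)"
  unfolding Vector_Spaces.linear_iff
  by (intro conjI fun_scale_vector_space) (auto simp: eval_classes_def fun_scale_def fun_eq_iff)

theorem theorem3p6:
  fixes \<mu> :: "'k::{field,finite} GA measure"
    and x y :: "'k place" and p :: "'k ratfun" and d :: nat and l :: complex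
  assumes "haar_measure G_A (GL2_topology adele_ring adele_topology) \<mu>"
    and "emeasure \<mu> K_A = 1"
    and "place_degree x = 1" and "uniformizer x t_rf"
    and "uniformizer y p" and "place_degree y = d" and "l \<noteq> 0"
  shows "module.subspace fun_scale (hecke_eigenspace \<mu> y p l)
    \<and> Vector_Spaces.linear fun_scale fun_scale (eval_classes (N_classes x t_rf d))
    \<and> bij_betw (eval_classes (N_classes x t_rf d)) (hecke_eigenspace \<mu> y p l) (coord_space (N_classes x t_rf d))
    \<and> vector_space.dim fun_scale (hecke_eigenspace \<mu> y p l) = d"
proof -
  interpret hecke_setup x \<mu> y p l
    by unfold_locales (fact assms)+
  show ?thesis
    unfolding assms(6)[symmetric]
    using eigenspace_subspace eval_classes_linear eval_classes_bij eigenspace_dim by blast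
qed

end
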